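(* Let $S$ be a one-cusped torus, i.e. a once punctured torus with a complete finite-area hyperbolic metric $g$. Then there exists a choice of waists $(p_\alpha)_{\alpha\in\overline{X}^{(0)}}$ (one point $p_\alpha$ on the geodesic representative of each arc $\alpha$) such that the associated infinitesimal strip map $\boldsymbol{f}$, valued in the tangent space $T_{[g]}$ (of dimension $3$) at the class of the holonomy of $g$ to the representation variety of $\pi_1(S)$, has as image of $\boldsymbol{f}|_X$ a convex hypersurface with codimension-1 edges looking salient from the origin, in the following sense: for any two distinct top-dimensional simplices of the arc complex $\overline{X}$ sharing a codimension-1 face, with vertex lists $(\alpha,\beta_1,\beta_2)$ and $(\alpha',\beta_1,\beta_2)$, the vectors $\boldsymbol{f}(\alpha),\boldsymbol{f}(\beta_1),\boldsymbol{f}(\beta_2)$ form a basis of $T_{[g]}$, and there exist real numbers $A,A',B_1,B_2$ (unique up to common scaling) with $$A\,\boldsymbol{f}(\alpha)+A'\,\boldsymbol{f}(\alpha')=B_1\,\boldsymbol{f}(\beta_1)+B_2\,\boldsymbol{f}(\beta_2),\qquad A>0,\quad A'>0,\quad B_1+B_2>0,$$ and these numbers satisfy $$A+A'<B_1+B_2 .$$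
   Context: Arc complex. The arc complex $\overline{X}$ of the once punctured torus $S$ is the 2-dimensional simplicial complex whose vertices (set $\overline{X}^{(0)}$) are the isotopy classes of essential (non-boundary-parallel) embedded arcs from the puncture to itself, and whose 1-cells (resp. 2-cells) correspond to pairs (resp. triples) of mutually nonisotopic arcs that can be embedded disjointly. Top-dimensional cells are triples of arcs forming an (ideal) triangulation of $S$; two distinct ones share a codimension-1 face exactly when the triangulations differ by a diagonal flip. Points of $\overline{X}$ are written $\sum_{i=1}^3\lambda_i\alpha_i$ with $\lambda_i\ge0$, $\sum\lambda_i=1$. A cell is small if the arcs corresponding to its vertices fail to cut $S$ into disks; $X\subset\overline{X}$ is the complement of the union of all small cells. Metric. The holonomy representation $\rho:\pi_1(S)\to\mathrm{PSL}_2(\mathbb{R})$ of $g$ takes two free generators of $\pi_1(S)$ to loxodromics with parabolic commutator. Every $\alpha\in\overline{X}^{(0)}$ is realized as an embedded bi-infinite geodesic in $(S,g)$ going from the cusp to itself, still denoted $\alpha$. A choice of waists is a choice, for each $\alpha\in\overline{X}^{(0)}$, of a point $p_\alpha\in\alpha$. Strip map. The class of $\rho$ is a smooth point of the space of representations $\pi_1(S)\to\mathrm{PSL}_2(\mathbb{R})$ up to conjugation, with tangent space $T_{[g]}\simeq H^1(\pi_1(S),\mathfrak{psl}_2(\mathbb{R})_{\mathrm{Ad}\rho})$ of dimension $3$. For an arc $\alpha$, the vector $\boldsymbol{f}(\alpha)\in T_{[g]}$ is the derivative at $t=0$ of the holonomy of the surface obtained by cutting along $\alpha$ and inserting a strip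 of $\mathbb{H}^2$ of width $t$ (the region bounded by two geodesics perpendicular to a segment of length $t$ at its endpoints), these endpoints being glued to the two copies of $p_\alpha$; and $\boldsymbol{f}(\sum\lambda_i\alpha_i):=\sum\lambda_i\boldsymbol{f}(\alpha_i)$. Equivalently, identify $\mathfrak{psl}_2(\mathbb{R})$ with the Killing fields on $\mathbb{H}^2$. The lifts of $\alpha$ cut the universal cover $\mathbb{H}^2$ of $S$ into tiles; choose Killing fields $\psi(e)$, one for each tile $e$, such that whenever a lift $\widetilde\alpha$ of $\alpha$ separates adjacent tiles $e,e'$, the difference $\psi(e')-\psi(e)$ is the infinitesimal translation of velocity $1$, directed towards $e'$, along the geodesic perpendicular to $\widetilde\alpha$ through the lifted waist. Then $\boldsymbol{f}(\alpha)$ is the class of the cocycle $u$ defined by $\psi(\eta\cdot e)=\mathrm{Ad}(\rho(\eta))\psi(e)+u(\eta)$ for $\eta\in\pi_1(S)$, corresponding to the deformation $\rho_t(\eta)=\exp(t\,u(\eta)+o(t))\rho(\eta)$. *)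

theory Defs
  imports "HOL-Analysis.Analysis"
begin

section \<open>The hyperbolic plane and its isometries\<close>

text \<open>
  The hyperbolic plane is the upper half-plane with the metric $|dz|/\mathrm{Im}\,z$. An element of
  \<open>PSL\<^sub>2(\<real>)\<close> is given by either of its two representatives in \<open>SL\<^sub>2(\<real>)\<close>, and a subgroup
  of \<open>PSL\<^sub>2(\<real>)\<close> by its full preimage in \<open>SL\<^sub>2(\<real>)\<close>, which contains \<open>- mat 1\<close>.
\<close>

definition half_plane :: "complex set" where
  "half_plane = {z. Im z > 0}"

definition mat2 :: "real \<Rightarrow> real \<Rightarrow> real \<Rightarrow> real \<Rightarrow> real^2^2" where
  "mat2 a b c d = vector [vector [a, b], vector [c, d]]"

definition SL2 :: "(real^2^2) set" where
  "SL2 = {M. det M = 1}"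

definition moeb :: "real^2^2 \<Rightarrow> complex \<Rightarrow> complex" where
  "moeb M z = (of_real (M $ 1 $ 1) * z + of_real (M $ 1 $ 2)) /
              (of_real (M $ 2 $ 1) * z + of_real (M $ 2 $ 2))"

definition loxodromic :: "real^2^2 \<Rightarrow> bool" where
  "loxodromic M \<longleftrightarrow> M \<in> SL2 \<and> \<bar>trace M\<bar> > 2"

definition parabolic :: "real^2^2 \<Rightarrow> bool" where
  "parabolic M \<longleftrightarrow> M \<in> SL2 \<and> \<bar>trace M\<bar> = 2 \<and> M \<noteq> mat 1 \<and> M \<noteq> - mat 1"

text \<open>
  For \<open>M \<in> SL2\<close>, \<open>geod M\<close> is the image under \<open>M\<close> of the unit speed parametrisation
  $t \mapsto e^t i$ of the imaginary axis. These are exactly the unit speed bi-infinite geodesics.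
\<close>

definition geod :: "real^2^2 \<Rightarrow> real \<Rightarrow> complex" where
  "geod M t = moeb M (\<i> * of_real (exp t))"

definition geod_line :: "real^2^2 \<Rightarrow> complex set" where
  "geod_line M = range (geod M)"

text \<open>\<open>transl M t\<close> is the translation of length \<open>t\<close> along the oriented geodesic \<open>geod M\<close>.\<close>

definition transl :: "real^2^2 \<Rightarrow> real \<Rightarrow> real^2^2" where
  "transl M t = M ** mat2 (exp (t / 2)) 0 0 (exp (- t / 2)) ** matrix_inv M"

text \<open>
  Killing fields are identified with trace zero matrices, the derivatives at the identity of paths
  in \<open>SL\<^sub>2(\<real>)\<close>.
\<close>

definition unit_translation :: "real^2^2 \<Rightarrow> real^2^2" where
  "unit_translation M = vector_derivative (transl M) (at 0)"

definition Ad :: "real^2^2 \<Rightarrow> real^2^2 \<Rightarrow> real^2^2" where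
  "Ad M X = M ** X ** matrix_inv M"


section \<open>One-cusped tori\<close>

text \<open>
  The once punctured torus is $S^1 \times S^1$ minus the point \<open>puncture\<close>.
\<close>

definition torus :: "(complex \<times> complex) set" where
  "torus = sphere 0 1 \<times> sphere 0 1"

definition puncture :: "complex \<times> complex" where
  "puncture = (1, 1)"

definition punctured_torus :: "(complex \<times> complex) set" where
  "punctured_torus = torus - {puncture}"

text \<open>
  A representation of the free group $\pi_1(S)$ on two generators into \<open>PSL\<^sub>2(\<real>)\<close> is given by
  (lifts of) the images \<open>A\<close>, \<open>B\<close> of the generators. Group elements are written as words: a letter
  \<open>(g, s)\<close> is the first (\<open>g = True\<close>) or second generator, inverted if \<open>s = False\<close>.
\<close>

fun letter_image :: "real^2^2 \<Rightarrow> real^2^2 \<Rightarrow> bool \<times> bool \<Rightarrow> real^2^2" where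
  "letter_image A B (g, s) =
     (let C = (if g then A else B) in if s then C else matrix_inv C)"

definition word_image :: "real^2^2 \<Rightarrow> real^2^2 \<Rightarrow> (bool \<times> bool) list \<Rightarrow> real^2^2" where
  "word_image A B w = foldr (\<lambda>x P. letter_image A B x ** P) w (mat 1)"

definition reduced_word :: "(bool \<times> bool) list \<Rightarrow> bool" where
  "reduced_word w \<longleftrightarrow> successively (\<lambda>x y. \<not> (fst x = fst y \<and> snd x \<noteq> snd y)) w"

definition holonomy_group :: "real^2^2 \<Rightarrow> real^2^2 \<Rightarrow> (real^2^2) set" where
  "holonomy_group A B = {M. \<exists>w. M = word_image A B w \<or> M = - word_image A B w}"

text \<open>
  A complete hyperbolic metric \<open>g\<close> on the punctured torus \<open>S\<close> is given by its Riemannian universal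
  covering \<open>q\<close>, whose source is the hyperbolic plane and whose deck group is the image of the
  (faithful) holonomy representation; the metric is the one which makes \<open>q\<close> a local isometry.
  The area of \<open>g\<close> is the hyperbolic area of any Borel set mapped bijectively to \<open>S\<close> by \<open>q\<close>.
  That generators with the stated loxodromic and parabolic images exist is a property of every
  such metric; it is recorded here as part of the description of the holonomy.
\<close>

definition one_cusped_torus ::
    "real^2^2 \<Rightarrow> real^2^2 \<Rightarrow> (complex \<Rightarrow> complex \<times> complex) \<Rightarrow> bool" where
  "one_cusped_torus A B q \<longleftrightarrow>
     loxodromic A \<and> loxodromic B \<and> parabolic (A ** B ** matrix_inv A ** matrix_inv B) \<and>
     (\<forall>w. reduced_word w \<and> w \<noteq> [] \<longrightarrow> word_image A B w \<noteq> mat 1 \<and> word_image A B w \<noteq> - mat 1) \<and>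
     covering_space half_plane q punctured_torus \<and>
     (\<forall>z\<in>half_plane. \<forall>w\<in>half_plane. q z = q w \<longleftrightarrow> (\<exists>M\<in>holonomy_group A B. w = moeb M z)) \<and>
     (\<exists>D. D \<in> sets borel \<and> D \<subseteq> half_plane \<and> bij_betw q D punctured_torus \<and>
        (\<integral>\<^sup>+ z\<in>D. ennreal (1 / (Im z)\<^sup>2) \<partial>lborel) < \<infinity>)"


section \<open>The arc complex\<close>

text \<open>
  An embedded arc in \<open>S\<close> from the puncture to itself is completed by the puncture to a simple loop
  in the torus. Arcs are unoriented.
\<close>

type_synonym loop = "real \<Rightarrow> complex \<times> complex"

definition embedded_arc :: "loop \<Rightarrow> bool" where
  "embedded_arc c \<longleftrightarrow> simple_path c \<and> path_image c \<subseteq> torus \<and>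
     pathstart c = puncture \<and> pathfinish c = puncture"

definition isotopic :: "loop \<Rightarrow> loop \<Rightarrow> bool" where
  "isotopic c c' \<longleftrightarrow> homotopic_with_canon embedded_arc {0..1} torus c c' \<or>
                    homotopic_with_canon embedded_arc {0..1} torus c (reversepath c')"

definition boundary_parallel :: "loop \<Rightarrow> bool" where
  "boundary_parallel c \<longleftrightarrow>
     (\<forall>U. open U \<and> puncture \<in> U \<longrightarrow> (\<exists>c'. isotopic c c' \<and> path_image c' \<subseteq> U))"

definition isotopy_class :: "loop \<Rightarrow> loop set" where
  "isotopy_class c = {c'. embedded_arc c' \<and> isotopic c c'}"

text \<open>
  \<open>G \<subseteq> S\<close> is a geodesic representative of the isotopy class \<open>\<alpha>\<close>: the covering \<open>q\<close> maps a geodesic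
  line bijectively to \<open>G\<close>, and \<open>G\<close>, completed by the puncture, is an arc in the class \<open>\<alpha>\<close>.
\<close>

definition geodesic_rep ::
    "(complex \<Rightarrow> complex \<times> complex) \<Rightarrow> loop set \<Rightarrow> (complex \<times> complex) set \<Rightarrow> bool" where
  "geodesic_rep q \<alpha> G \<longleftrightarrow>
     (\<exists>c\<in>\<alpha>. G = path_image c - {puncture} \<and> (\<exists>N\<in>SL2. bij_betw q (geod_line N) G))"

definition geodesic_of ::
    "(complex \<Rightarrow> complex \<times> complex) \<Rightarrow> loop set \<Rightarrow> (complex \<times> complex) set" where
  "geodesic_of q \<alpha> = (THE G. geodesic_rep q \<alpha> G)"

text \<open>
  Every isotopy class of essential arcs has one and only one geodesic representative for the
  metric given by \<open>q\<close>. Hence the last condition below excludes no class, and \<open>arc_vertices q\<close>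
  does not depend on the metric; the condition records the classical realisation of arcs by
  geodesics.
\<close>

definition arc_vertices :: "(complex \<Rightarrow> complex \<times> complex) \<Rightarrow> loop set set" where
  "arc_vertices q =
     {isotopy_class c | c. embedded_arc c \<and> \<not> boundary_parallel c \<and>
                           (\<exists>G. geodesic_rep q (isotopy_class c) G)}"

definition arc_complex :: "(complex \<Rightarrow> complex \<times> complex) \<Rightarrow> loop set set set" where
  "arc_complex q =
     {\<sigma>. \<sigma> \<subseteq> arc_vertices q \<and> card \<sigma> \<in> {1, 2, 3} \<and>
         (\<exists>r. (\<forall>\<alpha>\<in>\<sigma>. r \<alpha> \<in> \<alpha>) \<and>
              pairwise (\<lambda>\<alpha> \<beta>. path_image (r \<alpha>) \<inter> path_image (r \<beta>) = {puncture}) \<sigma>)}"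

definition waist_choice ::
    "(complex \<Rightarrow> complex \<times> complex) \<Rightarrow> (loop set \<Rightarrow> complex \<times> complex) \<Rightarrow> bool" where
  "waist_choice q p \<longleftrightarrow> (\<forall>\<alpha>\<in>arc_vertices q. p \<alpha> \<in> geodesic_of q \<alpha>)"


section \<open>The tangent space\<close>

text \<open>
  The tangent space at \<open>[g]\<close> is $H^1(\Gamma, \mathfrak{psl}_2(\mathbb{R})_{\mathrm{Ad}})$, cocycles
  modulo coboundaries. Here \<open>\<Gamma>\<close> is the preimage in \<open>SL\<^sub>2(\<real>)\<close> of the holonomy group; since a
  cocycle vanishes at \<open>- mat 1\<close>, this is the cohomology of the group itself. Elements of the
  tangent space are represented by cocycles, and relations between them are relations between
  cocycles up to coboundaries.
\<close>

definition cocycle :: "(real^2^2) set \<Rightarrow> (real^2^2 \<Rightarrow> real^2^2) \<Rightarrow> bool" where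
  "cocycle \<Gamma> u \<longleftrightarrow> (\<forall>M\<in>\<Gamma>. trace (u M) = 0) \<and>
     (\<forall>M\<in>\<Gamma>. \<forall>N\<in>\<Gamma>. u (M ** N) = u M + Ad M (u N))"

definition coboundary :: "(real^2^2) set \<Rightarrow> (real^2^2 \<Rightarrow> real^2^2) \<Rightarrow> bool" where
  "coboundary \<Gamma> u \<longleftrightarrow> (\<exists>X. trace X = 0 \<and> (\<forall>M\<in>\<Gamma>. u M = X - Ad M X))"

definition H1_eq ::
    "(real^2^2) set \<Rightarrow> (real^2^2 \<Rightarrow> real^2^2) \<Rightarrow> (real^2^2 \<Rightarrow> real^2^2) \<Rightarrow> bool" where
  "H1_eq \<Gamma> u v \<longleftrightarrow> coboundary \<Gamma> (\<lambda>M. u M - v M)"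

definition H1_basis ::
    "(real^2^2) set \<Rightarrow> (real^2^2 \<Rightarrow> real^2^2) \<Rightarrow> (real^2^2 \<Rightarrow> real^2^2) \<Rightarrow>
     (real^2^2 \<Rightarrow> real^2^2) \<Rightarrow> bool" where
  "H1_basis \<Gamma> u v w \<longleftrightarrow>
     cocycle \<Gamma> u \<and> cocycle \<Gamma> v \<and> cocycle \<Gamma> w \<and>
     (\<forall>a b c. H1_eq \<Gamma> (\<lambda>M. a *\<^sub>R u M + b *\<^sub>R v M + c *\<^sub>R w M) (\<lambda>M. 0) \<longrightarrow>
        a = 0 \<and> b = 0 \<and> c = 0) \<and>
     (\<forall>x. cocycle \<Gamma> x \<longrightarrow>
        (\<exists>a b c. H1_eq \<Gamma> x (\<lambda>M. a *\<^sub>R u M + b *\<^sub>R v M + c *\<^sub>R w M)))"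


section \<open>The infinitesimal strip map\<close>

definition tiles ::
    "(complex \<Rightarrow> complex \<times> complex) \<Rightarrow> (complex \<times> complex) set \<Rightarrow> complex set set" where
  "tiles q G = components {z \<in> half_plane. q z \<notin> G}"

text \<open>
  \<open>strip_jump q G p e e' M\<close>: the tiles \<open>e\<close>, \<open>e'\<close> are adjacent along a lift \<open>geod_line N\<close> of the
  geodesic arc \<open>G\<close>, and \<open>geod M\<close> is the geodesic which crosses this lift orthogonally at the lift of
  the waist \<open>p\<close>, directed towards \<open>e'\<close>.
\<close>

definition strip_jump ::
    "(complex \<Rightarrow> complex \<times> complex) \<Rightarrow> (complex \<times> complex) set \<Rightarrow> complex \<times> complex \<Rightarrow>
     complex set \<Rightarrow> complex set \<Rightarrow> real^2^2 \<Rightarrow> bool" where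
  "strip_jump q G p e e' M \<longleftrightarrow>
     e \<in> tiles q G \<and> e' \<in> tiles q G \<and> e \<noteq> e' \<and> M \<in> SL2 \<and>
     (\<exists>N\<in>SL2. \<exists>s. q ` geod_line N = G \<and> geod_line N \<subseteq> closure e \<inter> closure e' \<and>
        geod M 0 = geod N s \<and> q (geod M 0) = p \<and>
        orthogonal (vector_derivative (geod M) (at 0)) (vector_derivative (geod N) (at s)) \<and>
        (\<forall>\<^sub>F t in at_right 0. geod M t \<in> e'))"

definition strip_cocycle ::
    "(real^2^2) set \<Rightarrow> (complex \<Rightarrow> complex \<times> complex) \<Rightarrow> (complex \<times> complex) set \<Rightarrow>
     complex \<times> complex \<Rightarrow> (real^2^2 \<Rightarrow> real^2^2) \<Rightarrow> bool" where
  "strip_cocycle \<Gamma> q G p u \<longleftrightarrow>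
     (\<exists>\<psi> :: complex set \<Rightarrow> real^2^2.
        (\<forall>e\<in>tiles q G. trace (\<psi> e) = 0) \<and>
        (\<forall>e e' M. strip_jump q G p e e' M \<longrightarrow> \<psi> e' - \<psi> e = unit_translation M) \<and>
        (\<forall>M\<in>\<Gamma>. \<forall>e\<in>tiles q G. \<psi> (moeb M ` e) = Ad M (\<psi> e) + u M))"

text \<open>
  A cocycle representing the vector \<open>f(\<alpha>)\<close>. The class of \<open>u\<close> does not depend on the choice, since
  \<open>\<psi>\<close> is determined up to the addition of a constant.
\<close>

definition strip_map ::
    "(real^2^2) set \<Rightarrow> (complex \<Rightarrow> complex \<times> complex) \<Rightarrow> (loop set \<Rightarrow> complex \<times> complex) \<Rightarrow>
     loop set \<Rightarrow> real^2^2 \<Rightarrow> real^2^2" where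
  "strip_map \<Gamma> q p \<alpha> = (SOME u. strip_cocycle \<Gamma> q (geodesic_of q \<alpha>) (p \<alpha>) u)"

text \<open>
  \<open>a f\<^sub>1 + a' f\<^sub>1' = b\<^sub>1 f\<^sub>2 + b\<^sub>2 f\<^sub>3\<close> in the tangent space, with the normalisation of the signs of
  the coefficients.
\<close>

definition flip_relation ::
    "(real^2^2) set \<Rightarrow> (real^2^2 \<Rightarrow> real^2^2) \<Rightarrow> (real^2^2 \<Rightarrow> real^2^2) \<Rightarrow>
     (real^2^2 \<Rightarrow> real^2^2) \<Rightarrow> (real^2^2 \<Rightarrow> real^2^2) \<Rightarrow> real \<Rightarrow> real \<Rightarrow> real \<Rightarrow> real \<Rightarrow> bool" where
  "flip_relation \<Gamma> f1 f1' f2 f3 a a' b1 b2 \<longleftrightarrow>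
     H1_eq \<Gamma> (\<lambda>M. a *\<^sub>R f1 M + a' *\<^sub>R f1' M) (\<lambda>M. b1 *\<^sub>R f2 M + b2 *\<^sub>R f3 M) \<and>
     a > 0 \<and> a' > 0 \<and> b1 + b2 > 0"

end

theory Submission
  imports Defs
begin

text \<open>
  Decorated cusps are the vectors \<open>\<plusminus>g v0\<close>, \<open>g \<in> \<Gamma>\<close>, where \<open>v0\<close> is fixed by a parabolic element; they
  encode horoballs which are disjoint by the Shimizu--Leutbecher inequality, so that every lift of an
  arc runs between two cusps. The waist of an arc is the point at equal distance from the two
  horoballs at its ends. It is preserved by the hyperelliptic involution, which lifts to
  \<open>(AB - BA) / 2\<close> because the commutator has trace \<open>-2\<close>. Disjoint arcs have unlinked ends (Fashoda
  theorem), and by counting crossings every triangulation is reached from one explicit triangle by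
  flips; hence \<open>\<alpha>\<close>, \<open>\<alpha>'\<close>, \<open>\<beta>1\<close>, \<open>\<beta>2\<close> come from a triangle \<open>a b c\<close> whose sides are folded by
  elliptic involutions in the extended group. Evaluated at these three involutions, the cocycle of
  each side is one infinitesimal translation and zero otherwise. With \<open>\<lambda>1, \<lambda>2, \<lambda>3\<close> the determinants
  of the pairs of vertices this gives
  \<open>\<lambda>1 (f(\<alpha>) + f(\<alpha>')) = (1 + \<lambda>1\<^sup>2 / (\<lambda>2\<^sup>2 + \<lambda>3\<^sup>2)) (\<lambda>2 f(\<beta>1) + \<lambda>3 f(\<beta>2))\<close>, and the inequality
  follows from \<open>\<lambda>2 + \<lambda>3 > sqrt (\<lambda>2\<^sup>2 + \<lambda>3\<^sup>2)\<close> and the inequality of the two means.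
\<close>

section \<open>Plane vectors and Moebius transformations\<close>

text \<open>Two groups act: \<Gamma>, on which the cocycles are defined, and its extension by the
  half turns of the sides. Because the waists are fixed by those half turns, every strip cocycle
  extends to the larger group, and its restriction to \<Gamma> is determined by the values at three
  elements of order four. A statement about infinitely many tiles thus becomes a finite identity
  between squares of vectors. The determinants \<lambda> are lambda lengths. Opposite sides of the
  quadrilateral of a flip are equal, so Ptolemy's relation for the new diagonal reads \<lambda>1
  \<lambda>1' = \<lambda>2^2 + \<lambda>3^2, and the relation has the symmetric form f(\<alpha>) +
  f(\<alpha>') = (1/\<lambda>1 + 1/\<lambda>1') (\<lambda>2 f(\<beta>1) + \<lambda>3 f(\<beta>2)).
  The obstacle is that arcs are topological objects, and nothing says beforehand that two cells with
  a common face differ by a geometric flip. Isotopy is seen only through the cusps at the ends of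
  lifts, and all further combinatorics takes place on the boundary circle, through signs of
  \<open>dt\<close>.\<close>

definition dt :: "real^2 => real^2 => real" where
 "dt u v = u$1 * v$2 - u$2 * v$1"

lemma mat2_nth [simp]:
 "mat2 a b c d $ 1 $ 1 = a" "mat2 a b c d $ 1 $ 2 = b"
 "mat2 a b c d $ 2 $ 1 = c" "mat2 a b c d $ 2 $ 2 = d"
 by(simp_all add: mat2_def)

lemma mat_eq2: "(M::real^2^2) = N \<longleftrightarrow>
  M$1$1 = N$1$1 \<and> M$1$2 = N$1$2 \<and> M$2$1 = N$2$1 \<and> M$2$2 = N$2$2"
 by(auto simp: vec_eq_iff forall_2)

lemma vec_eq2: "(u::real^2) = v \<longleftrightarrow> u$1 = v$1 \<and> u$2 = v$2"
 by(auto simp: vec_eq_iff forall_2)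

lemma mat_mult2 [simp]: "((M::real^2^2) ** N)$i$j = M$i$1 * N$1$j + M$i$2 * N$2$j"
 by(simp add: matrix_matrix_mult_def sum_2)

lemma mat_vec2 [simp]: "((M::real^2^2) *v u)$i = M$i$1 * u$1 + M$i$2 * u$2"
 by(simp add: matrix_vector_mult_def sum_2)

lemma mat1_nth [simp]:
 "(mat x :: real^2^2) $ 1 $ 1 = x" "(mat x :: real^2^2) $ 1 $ 2 = 0"
 "(mat x :: real^2^2) $ 2 $ 1 = 0" "(mat x :: real^2^2) $ 2 $ 2 = x"
 by(simp_all add: mat_def)

lemma trace2: "trace (M::real^2^2) = M$1$1 + M$2$2"
 by(simp add: trace_def sum_2)

lemma SL2_iff: "M \<in> SL2 \<longleftrightarrow> M$1$1 * M$2$2 - M$1$2 * M$2$1 = 1"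
 by(simp add: SL2_def det_2)

lemma SL2D: "M \<in> SL2 ==> M$1$1 * M$2$2 = 1 + M$1$2 * M$2$1"
 by(simp add: SL2_iff)

lemma mult_SL2 [simp, intro]: "M \<in> SL2 ==> N \<in> SL2 ==> M ** N \<in> SL2"
 by(simp add: SL2_def det_mul)

lemma mat1_SL2 [simp]: "mat 1 \<in> SL2"
 by(simp add: SL2_def)

lemma uminus_SL2 [simp]: "- M \<in> SL2 \<longleftrightarrow> M \<in> SL2"
 by(simp add: SL2_iff)

lemma mat_uminus_left: "(- M) ** N = - (M ** N)"
 and mat_uminus_right: "M ** (- N) = - (M ** N)" for M N :: "real^2^2"
 by(simp_all add: mat_eq2)

lemma mat_vec_uminus_left [simp]: "(- (M::real^2^2)) *v u = - (M *v u)"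
 and mat_vec_uminus_right [simp]: "(M::real^2^2) *v (- u) = - (M *v u)"
 by(simp_all add: vec_eq2)

lemma mat_vec_lin: "(M::real^2^2) *v (x *\<^sub>R u + y *\<^sub>R v) = x *\<^sub>R (M *v u) + y *\<^sub>R (M *v v)"
 by(simp add: vec_eq2 algebra_simps)

lemma mat_vec_scale: "(M::real^2^2) *v (x *\<^sub>R u) = x *\<^sub>R (M *v u)"
 by(simp add: vec_eq2 algebra_simps)

lemma mat_vec_assoc: "(M::real^2^2) *v (N *v u) = (M ** N) *v u"
 by(rule matrix_vector_mul_assoc)

text \<open>On \<open>SL2\<close> this is the inverse. It is polynomial in the entries, so
  identities between inverses can be checked coordinatewise.\<close>

definition adj :: "real^2^2 => real^2^2" where
 "adj M = mat2 (M$2$2) (- M$1$2) (- M$2$1) (M$1$1)"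

lemma adj_nth [simp]:
 "adj M $ 1 $ 1 = M$2$2" "adj M $ 1 $ 2 = - M$1$2"
 "adj M $ 2 $ 1 = - M$2$1" "adj M $ 2 $ 2 = M$1$1"
 by(simp_all add: adj_def)

lemma adj_mult: "M \<in> SL2 ==> adj M ** M = mat 1" "M \<in> SL2 ==> M ** adj M = mat 1"
 by(auto simp: mat_eq2 SL2_iff algebra_simps)

lemma adj_SL2 [simp]: "adj M \<in> SL2 \<longleftrightarrow> M \<in> SL2"
 by(auto simp: SL2_iff algebra_simps)

lemma matrix_inv_SL2: "M \<in> SL2 ==> matrix_inv M = adj M"
proof -
 assume M: "M \<in> SL2"
 hence "invertible M" by(metis adj_mult invertible_def)
 hence i: "M ** matrix_inv M = mat 1 \<and> matrix_inv M ** M = mat 1"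
  unfolding matrix_inv_def invertible_def by(rule someI_ex)
 have "matrix_inv M = adj M ** (M ** matrix_inv M)"
  using M by(metis adj_mult(1) matrix_mul_assoc matrix_mul_lid)
 thus ?thesis using i by simp
qed

lemma adj_mult_distrib: "adj (M ** N) = adj N ** adj M"
 by(simp add: mat_eq2 algebra_simps)

lemma adj_adj [simp]: "adj (adj M) = M"
 by(simp add: mat_eq2)

lemma adj_uminus: "adj (- M) = - adj M"
 by(simp add: mat_eq2)

lemma adj_cancel_left: "M \<in> SL2 ==> adj M ** (M ** N) = N" "M \<in> SL2 ==> M ** (adj M ** N) = N"
 by(simp_all add: matrix_mul_assoc adj_mult)

lemma adj_cancel_vec: "M \<in> SL2 ==> adj M *v (M *v u) = u" "M \<in> SL2 ==> M *v (adj M *v u) = u"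
 by(simp_all add: mat_vec_assoc adj_mult)

lemma dt_self [simp]: "dt u u = 0"
 by(simp add: dt_def)

lemma dt_swap: "dt u v = - dt v u"
 by(simp add: dt_def)

lemma dt_lin: "dt (x *\<^sub>R u) v = x * dt u v" "dt u (x *\<^sub>R v) = x * dt u v"
 "dt (u + u') v = dt u v + dt u' v" "dt u (v + v') = dt u v + dt u v'"
 "dt (u - u') v = dt u v - dt u' v" "dt u (v - v') = dt u v - dt u v'"
 "dt (- u) v = - dt u v" "dt u (- v) = - dt u v" "dt 0 v = 0" "dt u 0 = 0"
 by(simp_all add: dt_def algebra_simps)

lemma dt_mat: "M \<in> SL2 ==> dt (M *v u) (M *v v) = dt u v"
proof -
 have "dt (M *v u) (M *v v) = (M$1$1 * M$2$2 - M$1$2 * M$2$1) * dt u v"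
  by(simp add: dt_def algebra_simps)
 thus "M \<in> SL2 ==> ?thesis" by(simp add: SL2_iff)
qed

lemma dt_plucker: "dt u v * dt w x = dt u w * dt v x - dt u x * dt v w"
 by(simp add: dt_def algebra_simps)

text \<open>Cramer's rule, kept free of division: it writes any vector in the basis
  \<open>u\<close>, \<open>v\<close> when \<open>dt u v\<close> is nonzero.\<close>

lemma dt_expand: "dt u v *\<^sub>R w = dt w v *\<^sub>R u + dt u w *\<^sub>R v"
 by(simp add: dt_def vec_eq2 algebra_simps)

lemma dt_zero_parallel:
 assumes "dt u v = 0" "u \<noteq> 0"
 shows "\<exists>x. v = x *\<^sub>R u"
proof (cases "u$1 = 0")
 case False
 hence "v = (v$1/u$1) *\<^sub>R u" using assms(1) by(simp add: vec_eq2 dt_def field_simps)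
 thus ?thesis by blast
next
 case True
 hence "u$2 \<noteq> 0" using assms(2) by(simp add: vec_eq2)
 hence "v = (v$2/u$2) *\<^sub>R u" using assms(1) True by(simp add: vec_eq2 dt_def)
 thus ?thesis by blast
qed

lemma dt_basis_eq:
 assumes "dt a b \<noteq> 0" "dt a u = dt a v" "dt b u = dt b v"
 shows "u = v"
proof -
 have "dt u b = dt v b" using assms(3) dt_swap[of u b] dt_swap[of v b] by linarith
 hence "dt a b *\<^sub>R u = dt a b *\<^sub>R v" by(simp only: dt_expand[of a b] assms(2))
 thus ?thesis using assms(1) by simp
qed

lemma mat_basis_eq:
 fixes M N :: "real^2^2"
 assumes "dt a b \<noteq> 0" "M *v a = N *v a" "M *v b = N *v b"
 shows "M = N"
proof -
 have h: "M *v w = N *v w" for w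
 proof -
  have "dt a b *\<^sub>R (M *v w) = M *v (dt a b *\<^sub>R w)" by(simp only: mat_vec_scale)
  also have "\<dots> = N *v (dt a b *\<^sub>R w)" by(simp only: dt_expand[of a b w] mat_vec_lin assms(2,3))
  also have "\<dots> = dt a b *\<^sub>R (N *v w)" by(simp only: mat_vec_scale)
  finally show ?thesis using assms(1) by simp
 qed
 thus ?thesis by(simp add: matrix_eq)
qed

lemma matrix_add_mult_distrib2: "(X + Y) ** Z = X ** Z + Y ** (Z::real^2^2)"
 "Z ** (X + Y) = Z ** X + Z ** (Y::real^2^2)"
 "(X - Y) ** Z = X ** Z - Y ** (Z::real^2^2)"
 "Z ** (X - Y) = Z ** X - Z ** (Y::real^2^2)"
 "(x *\<^sub>R X) ** Z = x *\<^sub>R (X ** Z)" "Z ** (x *\<^sub>R X) = x *\<^sub>R (Z ** X)" for X Y Z :: "real^2^2"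
 by(simp_all add: mat_eq2 algebra_simps)

section \<open>Sides of lines and heights over cusps\<close>

definition ev :: "real^2 => complex => complex" where
 "ev u z = of_real (u$1) - of_real (u$2) * z"

definition jac :: "real^2^2 => complex => complex" where
 "jac M z = of_real (M$2$1) * z + of_real (M$2$2)"

lemma half_plane_iff: "z \<in> half_plane \<longleftrightarrow> Im z > 0"
 by(simp add: half_plane_def)

lemma lin_nonzero:
 assumes "Im z > 0" "c \<noteq> 0 \<or> d \<noteq> 0"
 shows "of_real c * z + of_real d \<noteq> 0"
proof
 assume e: "of_real c * z + of_real d = 0"
 have "Im (of_real c * z + of_real d) = c * Im z" "Re (of_real c * z + of_real d) = c * Re z + d" by simp_all
 with e assms show False by simp
qed

lemma jac_nonzero:
 assumes "M \<in> SL2" "Im z > 0"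
 shows "jac M z \<noteq> 0"
proof -
 have "M$2$1 \<noteq> 0 \<or> M$2$2 \<noteq> 0" using assms(1) by(auto simp: SL2_iff)
 thus ?thesis unfolding jac_def by(rule lin_nonzero[OF assms(2)])
qed

lemma ev_nonzero:
 assumes "u \<noteq> 0" "Im z > 0"
 shows "ev u z \<noteq> 0"
proof -
 have "- u$2 \<noteq> 0 \<or> u$1 \<noteq> 0" using assms(1) by(auto simp: vec_eq2)
 from lin_nonzero[OF assms(2) this] show ?thesis by(simp add: ev_def)
qed

lemma moeb_jac: "moeb M z = (of_real (M$1$1) * z + of_real (M$1$2)) / jac M z"
 by(simp add: moeb_def jac_def)

text \<open>\<open>ev u z\<close> is the determinant of \<open>u\<close> with the column (z, 1), and
  \<open>M\<close> sends this column to \<open>jac M z\<close> times the column of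
  \<open>moeb M z\<close>. The law is the invariance of determinants under
  \<open>SL2\<close>.\<close>

lemma ev_moeb:
 assumes M: "M \<in> SL2" "Im z > 0"
 shows "ev (M *v u) (moeb M z) = ev u z / jac M z"
proof -
 have d: "of_real (M$1$1) * of_real (M$2$2) - of_real (M$1$2) * of_real (M$2$1) = (1 :: complex)"
  using M(1) unfolding SL2_iff by(metis of_real_1 of_real_diff of_real_mult)
 have j: "moeb M z * jac M z = of_real (M$1$1) * z + of_real (M$1$2)"
  using jac_nonzero[OF M] by(simp add: moeb_jac)
 have "ev (M *v u) (moeb M z) * jac M z =
   of_real (M$1$1*u$1 + M$1$2*u$2) * jac M z - of_real (M$2$1*u$1 + M$2$2*u$2) * (moeb M z * jac M z)"
  by(simp only: ev_def mat_vec2 left_diff_distrib mult.assoc)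
 also have "\<dots> = ev u z * (of_real (M$1$1) * of_real (M$2$2) - of_real (M$1$2) * of_real (M$2$1))"
  unfolding j by(simp add: jac_def ev_def algebra_simps)
 finally show ?thesis using jac_nonzero[OF M] d by(simp add: eq_divide_eq)
qed

lemma Im_moeb: "M \<in> SL2 ==> Im z > 0 ==> Im (moeb M z) = Im z / (norm (jac M z))\<^sup>2"
proof -
 assume M: "M \<in> SL2" "Im z > 0"
 have "Im (moeb M z) = (M$1$1 * M$2$2 - M$1$2 * M$2$1) * Im z / (norm (jac M z))\<^sup>2"
  unfolding moeb_jac Im_divide cmod_power2[symmetric]
  by(simp add: jac_def cmod_power2 algebra_simps)
 thus ?thesis using M(1) by(simp add: SL2_iff)
qed

lemma moeb_half_plane: "M \<in> SL2 ==> z \<in> half_plane ==> moeb M z \<in> half_plane"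
 using jac_nonzero[of M z] by(simp add: half_plane_iff Im_moeb)

lemma moeb_mult: "M \<in> SL2 ==> N \<in> SL2 ==> Im z > 0 ==> moeb (M ** N) z = moeb M (moeb N z)"
proof -
 assume a: "M \<in> SL2" "N \<in> SL2" "Im z > 0"
 have n: "jac N z \<noteq> 0" "jac (M ** N) z \<noteq> 0" using a jac_nonzero mult_SL2 by blast+
 have "jac M (moeb N z) * jac N z = jac (M ** N) z"
  using n by(simp add: jac_def moeb_jac field_simps)
 moreover have "(of_real (M$1$1) * moeb N z + of_real (M$1$2)) * jac N z
   = of_real ((M**N)$1$1) * z + of_real ((M**N)$1$2)"
  using n by(simp add: moeb_jac jac_def field_simps)
 moreover have "moeb M (moeb N z) = ((of_real (M$1$1) * moeb N z + of_real (M$1$2)) * jac N z) / (jac M (moeb N z) * jac N z)"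
  using n(1) by(simp add: moeb_jac[of M "moeb N z"])
 ultimately show ?thesis by(simp only: moeb_jac[of "M**N" z])
qed

lemma moeb_mat1 [simp]: "moeb (mat 1) z = z"
 by(simp add: moeb_def)

lemma moeb_uminus [simp]: "moeb (- M) z = moeb M z"
proof -
 have "moeb (- M) z = (- (of_real (M$1$1) * z + of_real (M$1$2))) / (- (of_real (M$2$1) * z + of_real (M$2$2)))"
  by(simp add: moeb_def)
 thus ?thesis by(simp only: minus_divide_divide moeb_def)
qed

lemma moeb_adj: "M \<in> SL2 ==> Im z > 0 ==> moeb (adj M) (moeb M z) = z"
 "M \<in> SL2 ==> Im z > 0 ==> moeb M (moeb (adj M) z) = z"
 using moeb_mult[of "adj M" M z] moeb_mult[of M "adj M" z] by(simp_all add: adj_mult)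

lemma continuous_on_moeb: "M \<in> SL2 ==> continuous_on half_plane (moeb M)"
 unfolding moeb_def
 by(intro continuous_intros) (use jac_nonzero[of M] in \<open>auto simp: jac_def half_plane_iff\<close>)

text \<open>For \<open>e1\<close>, \<open>e2\<close> the value is \<open>- Re z\<close>. By
  equivariance the zero set is the geodesic joining the boundary points \<open>u$1 / u$2\<close> and
  \<open>v$1 / v$2\<close>, and the sign distinguishes its two sides; negating one vector exchanges
  them.\<close>

definition side :: "real^2 => real^2 => complex => real" where
 "side u v z = Re (ev u z * cnj (ev v z))"

text \<open>The level sets are horocycles at the boundary point of \<open>u\<close>. Rescaling
  \<open>u\<close> shifts the levels, which is how a vector encodes a horoball.\<close>

definition ht :: "real^2 => complex => real" where
 "ht u z = Im z / (norm (ev u z))\<^sup>2"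

definition line :: "real^2 => real^2 => complex set" where
 "line u v = {z. Im z > 0 \<and> side u v z = 0}"

lemma side_explicit: "side u v z = u$1 * v$1 - (u$1 * v$2 + u$2 * v$1) * Re z + u$2 * v$2 * ((Re z)\<^sup>2 + (Im z)\<^sup>2)"
 by(simp add: side_def ev_def power2_eq_square algebra_simps)

lemma continuous_side: "continuous_on S (side u v)"
 unfolding side_explicit[abs_def] by(intro continuous_intros)

lemma side_swap: "side u v z = side v u z"
 by(simp add: side_explicit algebra_simps)

lemma side_uminus [simp]: "side (- u) v z = - side u v z" "side u (- v) z = - side u v z"
 by(simp_all add: side_explicit algebra_simps)

lemma ht_uminus [simp]: "ht (- u) z = ht u z"
 by(simp add: ht_def ev_def norm_minus_commute)

lemma side_moeb: "M \<in> SL2 ==> Im z > 0 ==>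
  side (M *v u) (M *v v) (moeb M z) = side u v z / (norm (jac M z))\<^sup>2"
proof -
 assume M: "M \<in> SL2" "Im z > 0"
 have "ev u z / jac M z * cnj (ev v z / jac M z) = (ev u z * cnj (ev v z)) / of_real ((norm (jac M z))\<^sup>2)"
  by(simp only: complex_norm_square complex_cnj_divide times_divide_times_eq)
 thus ?thesis unfolding side_def ev_moeb[OF M] by(simp only: Re_divide_of_real)
qed

lemma sgn_side_moeb: "M \<in> SL2 ==> Im z > 0 ==>
  sgn (side (M *v u) (M *v v) (moeb M z)) = sgn (side u v z)"
 using jac_nonzero[of M z] by(simp add: side_moeb sgn_divide)

lemma ht_moeb: "M \<in> SL2 ==> Im z > 0 ==> ht (M *v u) (moeb M z) = ht u z"
 using jac_nonzero[of M z]
 by(simp add: ht_def ev_moeb Im_moeb norm_divide power_divide)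

lemma line_moeb: "M \<in> SL2 ==> moeb M ` line u v = line (M *v u) (M *v v)"
proof (intro equalityI subsetI)
 assume M: "M \<in> SL2"
 fix z assume "z \<in> moeb M ` line u v"
 then obtain w where w: "z = moeb M w" "Im w > 0" "side u v w = 0" by(auto simp: line_def)
 thus "z \<in> line (M *v u) (M *v v)"
  using moeb_half_plane[OF M, of w] M by(simp add: line_def side_moeb half_plane_iff)
next
 assume M: "M \<in> SL2"
 fix z assume z: "z \<in> line (M *v u) (M *v v)"
 let ?w = "moeb (adj M) z"
 have i: "Im z > 0" using z by(simp add: line_def)
 hence w: "Im ?w > 0" "moeb M ?w = z"
  using M moeb_half_plane[of "adj M" z] moeb_adj(2)[of M z] by(auto simp: half_plane_iff)
 have "side u v ?w = 0"
  using side_moeb[OF M w(1), of u v] z w jac_nonzero[OF M w(1)] by(simp add: line_def)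
 thus "z \<in> moeb M ` line u v" using w by(auto simp: line_def image_iff intro!: bexI[of _ ?w])
qed

lemma side_sq_bound: "(Im z)\<^sup>2 * (dt u v)\<^sup>2 \<le> (norm (ev u z))\<^sup>2 * (norm (ev v z))\<^sup>2"
proof -
 have "Im (ev u z * cnj (ev v z)) = - dt v u * Im z \<or> Im (ev u z * cnj (ev v z)) = dt v u * Im z"
  by(simp add: ev_def dt_def algebra_simps)
 hence "(Im z)\<^sup>2 * (dt u v)\<^sup>2 = (Im (ev u z * cnj (ev v z)))\<^sup>2"
  by(auto simp: power_mult_distrib dt_swap[of v u])
 also have "\<dots> \<le> (norm (ev u z * cnj (ev v z)))\<^sup>2"
  unfolding cmod_power2 by(simp only: le_add_same_cancel2 zero_le_power2)
 finally show ?thesis by(simp add: norm_mult power_mult_distrib)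
qed

text \<open>The squared modulus of \<open>ev u z * cnj (ev v z)\<close> is the sum of the squares of
  \<open>side u v z\<close> and of \<open>dt u v * Im z\<close>; dropping the first term gives the
  bound, with equality on \<open>line u v\<close>. A lower bound on \<open>dt\<close> therefore
  separates horoballs.\<close>

lemma ht_prod: "u \<noteq> 0 ==> v \<noteq> 0 ==> Im z > 0 ==> ht u z * ht v z * (dt u v)\<^sup>2 \<le> 1"
 using side_sq_bound[of z u v] ev_nonzero[of u z] ev_nonzero[of v z]
 by(simp add: ht_def power2_eq_square divide_simps mult_ac)

section \<open>Infinitesimal isometries and geodesics\<close>

lemma Ad_SL2: "M \<in> SL2 ==> Ad M X = M ** X ** adj M"
 by(simp add: Ad_def matrix_inv_SL2)

lemma Ad_lin: "M \<in> SL2 ==> Ad M (x *\<^sub>R X) = x *\<^sub>R Ad M X"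
 "M \<in> SL2 ==> Ad M (X + Y) = Ad M X + Ad M Y"
 "M \<in> SL2 ==> Ad M (X - Y) = Ad M X - Ad M Y"
 "M \<in> SL2 ==> Ad M (- X) = - Ad M X"
 "M \<in> SL2 ==> Ad M 0 = 0"
 by(simp_all add: Ad_SL2 mat_eq2 algebra_simps)

lemma Ad_sum: "M \<in> SL2 ==> Ad M (sum f F) = (\<Sum>x\<in>F. Ad M (f x))"
 by(induction F rule: infinite_finite_induct) (simp_all add: Ad_lin)

lemma Ad_mult: "M \<in> SL2 ==> N \<in> SL2 ==> Ad (M ** N) X = Ad M (Ad N X)"
 by(simp add: Ad_SL2 adj_mult_distrib matrix_mul_assoc)

lemma Ad_mat1 [simp]: "Ad (mat 1) X = X"
proof -
 have "adj (mat 1) = mat 1" by(simp add: mat_eq2)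
 thus ?thesis by(simp add: Ad_SL2)
qed

lemma Ad_uminus: "M \<in> SL2 ==> Ad (- M) X = Ad M X"
 by(simp add: Ad_SL2 adj_uminus mat_uminus_left mat_uminus_right)

lemma trace_Ad: "M \<in> SL2 ==> trace (Ad M X) = trace X"
proof -
 assume M: "M \<in> SL2"
 have "trace (Ad M X) = trace (adj M ** (M ** X))" using M trace_mul_sym[of "M ** X" "adj M"] by(simp add: Ad_SL2)
 thus ?thesis using M by(simp add: adj_cancel_left)
qed

text \<open>The rank one map \<open>w \<mapsto> dt u w *\<^sub>R u\<close>, quadratic in
  \<open>u\<close>. The matrices \<open>mat 1 + k *\<^sub>R nil u\<close> are the parabolics at the
  boundary point of \<open>u\<close>.\<close>

definition nil :: "real^2 => real^2^2" where
 "nil u = mat2 (- (u$1 * u$2)) (u$1 * u$1) (- (u$2 * u$2)) (u$1 * u$2)"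

lemma nil_vec: "nil u *v w = dt u w *\<^sub>R u"
 by(simp add: nil_def vec_eq2 dt_def algebra_simps)

lemma trace_nil [simp]: "trace (nil u) = 0"
 by(simp add: trace2 nil_def)

lemma nil_uminus [simp]: "nil (- u) = nil u"
 by(simp add: nil_def)

lemma nil_scale: "nil (x *\<^sub>R u) = x\<^sup>2 *\<^sub>R nil u"
 by(simp add: nil_def mat_eq2 power2_eq_square algebra_simps)

lemma Ad_nil: "M \<in> SL2 ==> Ad M (nil u) = nil (M *v u)"
 unfolding Ad_SL2 by(simp add: nil_def mat_eq2 algebra_simps)

text \<open>For \<open>e1\<close>, \<open>e2\<close> this is half the matrix exchanging them, the
  unit translation along the geodesic from -1 to 1 through i. In general it translates across
  \<open>line u v\<close> at \<open>mid u v\<close>; it is symmetric in the pair and odd in each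
  vector.\<close>

definition tv :: "real^2 => real^2 => real^2^2" where
 "tv u v = (1 / (2 * dt u v)) *\<^sub>R (nil u - nil v)"

lemma trace_lin: "trace (X + Y) = trace X + trace Y" "trace (X - Y) = trace X - trace Y"
 "trace (- X) = - trace X" "trace (x *\<^sub>R X) = x * trace X" "trace (0::real^2^2) = 0" for X Y :: "real^2^2"
 by(simp_all add: trace2 algebra_simps)

lemma trace_tv [simp]: "trace (tv u v) = 0"
 by(simp add: tv_def trace_lin)

lemma tv_sym: "tv v u = tv u v"
 by(simp add: tv_def mat_eq2 dt_swap[of v u] diff_divide_distrib)

lemma tv_uminus [simp]: "tv (- u) v = - tv u v" "tv u (- v) = - tv u v"
 by(simp_all add: tv_def dt_lin)

lemma Ad_tv: "M \<in> SL2 ==> Ad M (tv u v) = tv (M *v u) (M *v v)"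
 by(simp add: tv_def Ad_lin Ad_nil dt_mat)

text \<open>Passing from the positive to the negative side contributes \<open>tv p r\<close>, the
  opposite passage its negative. Negating \<open>p\<close> or \<open>r\<close> changes the sign of
  both factors, so the signs of the decorations do not matter.\<close>

definition jump :: "real^2 => real^2 => complex => complex => real^2^2" where
 "jump p r z w = ((sgn (side p r z) - sgn (side p r w)) / 2) *\<^sub>R tv p r"

lemma jump_uminus [simp]: "jump (- p) r z w = jump p r z w" "jump p (- r) z w = jump p r z w"
 by(simp_all add: jump_def sgn_minus mat_eq2 diff_divide_distrib algebra_simps)

lemma jump_add: "jump p r x z = jump p r x y + jump p r y z"
 by(simp add: jump_def scaleR_left_distrib[symmetric] diff_divide_distrib)

lemma jump_same: "sgn (side p r z) = sgn (side p r w) ==> jump p r z w = 0"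
 by(simp add: jump_def)

lemma trace_jump [simp]: "trace (jump p r z w) = 0"
 by(simp add: jump_def trace_lin)

text \<open>The half turn about \<open>mid a b\<close>, that is, the map \<open>w \<mapsto> (1 / dt
  a b) *\<^sub>R (dt w b *\<^sub>R b - dt a w *\<^sub>R a)\<close>. In \<open>SL2\<close> it has
  order four.\<close>

definition Jm :: "real^2 => real^2 => real^2^2" where
 "Jm a b = (1 / dt a b) *\<^sub>R mat2 (a$1*a$2 + b$1*b$2) (- (a$1*a$1 + b$1*b$1))
                   (a$2*a$2 + b$2*b$2) (- (a$1*a$2 + b$1*b$2))"

lemma Jm_vec: "dt a b \<noteq> 0 ==> Jm a b *v w = (1 / dt a b) *\<^sub>R (dt w b *\<^sub>R b - dt a w *\<^sub>R a)"
 by(simp add: Jm_def vec_eq2 dt_def add_divide_distrib[symmetric] diff_divide_distrib[symmetric] algebra_simps)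

lemma Jm_left: "dt a b \<noteq> 0 ==> Jm a b *v a = b"
 by(simp add: Jm_vec)

lemma Jm_right: "dt a b \<noteq> 0 ==> Jm a b *v b = - a"
 by(simp add: Jm_vec)

lemma Jm_SL2: "dt a b \<noteq> 0 ==> Jm a b \<in> SL2"
proof -
 assume d: "dt a b \<noteq> 0"
 have "(a$1*a$2 + b$1*b$2) * (- (a$1*a$2 + b$1*b$2)) - (- (a$1*a$1 + b$1*b$1)) * (a$2*a$2 + b$2*b$2)
   = dt a b * dt a b"
  by(simp add: dt_def algebra_simps)
 thus ?thesis using d by(simp add: SL2_iff Jm_def field_simps)
qed

lemma Jm_square: "dt a b \<noteq> 0 ==> Jm a b ** Jm a b = - mat 1"
 by(rule mat_basis_eq[of a b]) (simp_all add: mat_vec_assoc[symmetric] Jm_left Jm_right)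

lemma adj_Jm: "adj (Jm a b) = - Jm a b"
 unfolding mat_eq2 adj_nth by(simp add: Jm_def minus_divide_left)

lemma Jm_conj: "dt a b \<noteq> 0 ==> M \<in> SL2 ==> M ** Jm a b ** adj M = Jm (M *v a) (M *v b)"
proof -
 assume a: "dt a b \<noteq> 0" "M \<in> SL2"
 show ?thesis
  by(rule mat_basis_eq[of "M *v a" "M *v b"])
   (use a in \<open>simp_all add: dt_mat Jm_left Jm_right mat_vec_assoc[symmetric] adj_cancel_vec\<close>)
qed

lemma Jm_flips: "dt a b \<noteq> 0 ==> Jm b (- a) = Jm a b" "dt a b \<noteq> 0 ==> Jm (-a) b = - Jm a b"
 "dt a b \<noteq> 0 ==> Jm a (-b) = - Jm a b" "dt a b \<noteq> 0 ==> Jm b a = - Jm a b"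
 by(auto simp: mat_eq2 Jm_def dt_lin dt_swap[of b a])

section \<open>Geodesic lines with prescribed ends and their midpoints\<close>

abbreviation "e1 \<equiv> (vector [1, 0] :: real^2)"
abbreviation "e2 \<equiv> (vector [0, 1] :: real^2)"

lemma mat_e [simp]: "((M::real^2^2) *v e1)$i = M$i$1" "((M::real^2^2) *v e2)$i = M$i$2"
 by(simp_all add: matrix_vector_mult_def sum_2)

lemma side_e: "side e1 e2 z = - Re z"
 by(simp add: side_explicit)

lemma dt_e [simp]: "dt e1 e2 = 1"
 by(simp add: dt_def)

lemma Im_iexp: "Im (\<i> * of_real (exp t)) > 0"
 by simp

lemma geod_line_eq:
 assumes "N \<in> SL2"
 shows "geod_line N = line (N *v e1) (N *v e2)"
proof -
 have "range (\<lambda>t. \<i> * complex_of_real (exp t)) = line e1 e2"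
 proof (intro equalityI subsetI)
  fix z assume z: "z \<in> line e1 e2"
  hence "z = \<i> * of_real (exp (ln (Im z)))"
   by(simp add: line_def side_e complex_eq_iff)
  thus "z \<in> range (\<lambda>t. \<i> * complex_of_real (exp t))" by blast
 qed (auto simp: line_def side_e)
 moreover have "geod_line N = moeb N ` range (\<lambda>t. \<i> * complex_of_real (exp t))"
  by(auto simp: geod_line_def geod_def image_iff)
 ultimately show ?thesis using line_moeb[OF assms] by simp
qed

definition colmat :: "real^2 => real^2 => real^2^2" where
 "colmat u v = mat2 (u$1) (v$1) (u$2) (v$2)"

lemma colmat_e [simp]: "colmat u v *v e1 = u" "colmat u v *v e2 = v"
 by(simp_all add: vec_eq2 colmat_def)

lemma colmat_SL2: "dt u v = 1 ==> colmat u v \<in> SL2"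
 by(simp add: colmat_def SL2_iff dt_def algebra_simps)

text \<open>The scaling makes the midpoint of the geodesic from \<open>v\<close> to \<open>u\<close> the image of \<open>\<i>\<close>.\<close>

lemma frame:
 assumes "dt u v > 0"
 obtains N where "N \<in> SL2" "u = sqrt (dt u v) *\<^sub>R (N *v e1)" "v = sqrt (dt u v) *\<^sub>R (N *v e2)"
proof -
 let ?s = "sqrt (dt u v)"
 let ?N = "colmat ((1/?s) *\<^sub>R u) ((1/?s) *\<^sub>R v)"
 have s: "?s > 0" "?s * ?s = dt u v" using assms by simp_all
 have "dt ((1/?s) *\<^sub>R u) ((1/?s) *\<^sub>R v) = (1/(?s*?s)) * dt u v"
  by(simp only: dt_lin) simp
 hence "dt ((1/?s) *\<^sub>R u) ((1/?s) *\<^sub>R v) = 1" using assms s by simp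
 hence "?N \<in> SL2" by(rule colmat_SL2)
 thus thesis by(rule that) (use s(1) in simp_all)
qed

lemma side_scale: "side (x *\<^sub>R u) (y *\<^sub>R v) z = x * y * side u v z"
 by(simp add: side_explicit algebra_simps)

lemma ht_scale: "ht (x *\<^sub>R u) z = ht u z / x\<^sup>2"
proof -
 have "ev (x *\<^sub>R u) z = of_real x * ev u z" by(simp add: ev_def algebra_simps)
 thus ?thesis by(simp add: ht_def norm_mult power_mult_distrib)
qed

lemma line_scale: "x \<noteq> 0 ==> y \<noteq> 0 ==> line (x *\<^sub>R u) (y *\<^sub>R v) = line u v"
 by(simp add: line_def side_scale)

lemma line_uminus [simp]: "line (- u) v = line u v" "line u (- v) = line u v"
 by(simp_all add: line_def)

lemma line_swap: "line u v = line v u"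
 by(simp add: line_def side_swap)

lemma line_geod:
 assumes "dt u v \<noteq> 0"
 obtains N where "N \<in> SL2" "line u v = geod_line N"
proof (cases "dt u v > 0")
 case True
 then obtain N where N: "N \<in> SL2" "u = sqrt (dt u v) *\<^sub>R (N *v e1)" "v = sqrt (dt u v) *\<^sub>R (N *v e2)"
  by(rule frame)
 have "line u v = geod_line N"
  unfolding geod_line_eq[OF N(1)] by(subst N(2), subst N(3), rule line_scale) (use True in auto)
 thus thesis using N(1) that by blast
next
 case False
 hence d: "dt v u > 0" using assms dt_swap[of v u] by simp
 then obtain N where N: "N \<in> SL2" "v = sqrt (dt v u) *\<^sub>R (N *v e1)" "u = sqrt (dt v u) *\<^sub>R (N *v e2)"
  by(rule frame)
 have "line v u = geod_line N"
  unfolding geod_line_eq[OF N(1)] by(subst N(2), subst N(3), rule line_scale) (use d in auto)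
 thus thesis using N(1) that line_swap by blast
qed

lemma line_subset_axis:
 assumes "line e1 e2 \<subseteq> line u v"
 shows "u$1 * v$1 = 0" "u$2 * v$2 = 0"
proof -
 have *: "u$1 * v$1 + u$2 * v$2 * y\<^sup>2 = 0" if "y > 0" for y
 proof -
  have "\<i> * of_real y \<in> line e1 e2" using that by(simp add: line_def side_e)
  hence "\<i> * of_real y \<in> line u v" using assms by blast
  hence "side u v (\<i> * of_real y) = 0" by(simp add: line_def)
  thus ?thesis by(simp add: side_explicit)
 qed
 \<comment> \<open>Two points of the axis, at heights 1 and 2, determine both coefficients.\<close>
 have "u$1 * v$1 + u$2 * v$2 = 0" "u$1 * v$1 + u$2 * v$2 * 4 = 0" using *[of 1] *[of 2] by simp_all
 thus "u$1 * v$1 = 0" "u$2 * v$2 = 0" by linarith+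
qed

lemma line_subset_ends:
 assumes "dt u v \<noteq> 0" "dt u' v' \<noteq> 0" "line u v \<subseteq> line u' v'"
 shows "(dt u u' = 0 \<and> dt v v' = 0) \<or> (dt u v' = 0 \<and> dt v u' = 0)"
proof -
 let ?N = "colmat ((1 / dt u v) *\<^sub>R u) v"
 have N: "?N \<in> SL2" using assms(1) by(intro colmat_SL2) (simp add: dt_lin)
 have l: "line e1 e2 \<subseteq> line (adj ?N *v u') (adj ?N *v v')"
 proof -
  have "line e1 e2 = line ((dt u v) *\<^sub>R e1) e2" using line_scale[of "dt u v" 1 e1 e2] assms(1) by simp
  also have "\<dots> = line (adj ?N *v u) (adj ?N *v v)"
  proof -
   have "adj ?N *v u = dt u v *\<^sub>R (adj ?N *v (?N *v e1))"
    using assms(1) by(simp only: colmat_e mat_vec_scale[symmetric]) simp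
   moreover have "adj ?N *v v = adj ?N *v (?N *v e2)" by(simp only: colmat_e)
   ultimately show ?thesis by(simp only: adj_cancel_vec[OF N])
  qed
  also have "\<dots> = moeb (adj ?N) ` line u v" using line_moeb[of "adj ?N" u v] N by simp
  also have "\<dots> \<subseteq> moeb (adj ?N) ` line u' v'" using assms(3) by blast
  also have "\<dots> = line (adj ?N *v u') (adj ?N *v v')" using line_moeb[of "adj ?N"] N by simp
  finally show ?thesis .
 qed
 have c: "(adj ?N *v w)$1 = dt w v" "(adj ?N *v w)$2 = (1/dt u v) * dt u w" for w
  by(simp_all add: adj_def colmat_def dt_def[of w v] dt_def[of u w] algebra_simps diff_divide_distrib)
 have "dt u' v * dt v' v = 0" "dt u u' * dt u v' = 0"
  using line_subset_axis[OF l] assms(1) unfolding c by simp_all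
 moreover have "\<not> (dt u' v = 0 \<and> dt u u' = 0)" "\<not> (dt v' v = 0 \<and> dt u v' = 0)"
  using assms(2) dt_plucker[of u v u' v'] assms(1) dt_swap[of v u'] dt_swap[of v v'] by auto
 ultimately show ?thesis using dt_swap[of v u'] dt_swap[of v v'] by auto
qed

text \<open>Equal height over both ends: the waist for the chosen horoballs. It is stable under a
  common rescaling of \<open>u\<close> and \<open>v\<close> only, which is why the cusps have to be
  decorated.\<close>

definition is_mid :: "real^2 => real^2 => complex => bool" where
 "is_mid u v z \<longleftrightarrow> Im z > 0 \<and> side u v z = 0 \<and> ht u z = ht v z"

definition mid :: "real^2 => real^2 => complex" where
 "mid u v = (THE z. is_mid u v z)"

lemma is_mid_moeb:
 assumes M: "M \<in> SL2" and z: "Im z > 0"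
 shows "is_mid (M *v u) (M *v v) (moeb M z) \<longleftrightarrow> is_mid u v z"
proof -
 have "Im (moeb M z) > 0" using moeb_half_plane[OF M] z by(simp add: half_plane_iff)
 moreover have "side (M *v u) (M *v v) (moeb M z) = 0 \<longleftrightarrow> side u v z = 0"
  using jac_nonzero[OF M z] by(simp add: side_moeb[OF M z])
 ultimately show ?thesis using z by(simp add: is_mid_def ht_moeb[OF M z])
qed

lemma is_mid_scale: "x \<noteq> 0 ==> is_mid (x *\<^sub>R u) (x *\<^sub>R v) z \<longleftrightarrow> is_mid u v z"
 by(simp add: is_mid_def side_scale ht_scale)

lemma is_mid_uminus [simp]: "is_mid (- u) v z = is_mid u v z" "is_mid u (- v) z = is_mid u v z"
 by(simp_all add: is_mid_def)

lemma is_mid_swap: "is_mid u v z = is_mid v u z"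
 by(auto simp: is_mid_def side_swap)

lemma is_mid_e: "is_mid e1 e2 z \<longleftrightarrow> z = \<i>"
proof
 assume a: "is_mid e1 e2 z"
 hence r: "Im z > 0" "Re z = 0" "ht e1 z = ht e2 z" by(auto simp: is_mid_def side_e)
 hence "Im z = Im z / (Im z)\<^sup>2" by(simp add: ht_def ev_def cmod_power2)
 hence "(Im z)\<^sup>2 = 1" using r(1) by(simp add: field_simps)
 hence "Im z = 1" using r(1) by(simp add: power2_eq_1_iff)
 thus "z = \<i>" using r(2) by(simp add: complex_eq_iff)
qed (simp add: is_mid_def side_e ht_def ev_def)

lemma is_mid_frame:
 assumes "N \<in> SL2" "s \<noteq> 0" "u = s *\<^sub>R (N *v e1)" "v = s *\<^sub>R (N *v e2)"
 shows "is_mid u v z \<longleftrightarrow> z = moeb N \<i>"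
proof
 assume a: "is_mid u v z"
 hence z: "Im z > 0" by(simp add: is_mid_def)
 have w: "Im (moeb (adj N) z) > 0" "moeb N (moeb (adj N) z) = z"
  using moeb_half_plane[of "adj N" z] moeb_adj(2)[OF assms(1) z] z assms(1) by(simp_all add: half_plane_iff)
 hence "is_mid e1 e2 (moeb (adj N) z)"
  using a is_mid_moeb[OF assms(1) w(1), of e1 e2] is_mid_scale[OF assms(2)] assms(3,4) by simp
 hence "moeb (adj N) z = \<i>" using is_mid_e by blast
 thus "z = moeb N \<i>" using w(2) by simp
next
 assume "z = moeb N \<i>"
 moreover have "is_mid e1 e2 \<i>" by(simp add: is_mid_e)
 ultimately show "is_mid u v z"
  using is_mid_moeb[OF assms(1), of \<i> e1 e2] is_mid_scale[OF assms(2)] assms(3,4) by simp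
qed

lemma is_mid_ex1:
 assumes "dt u v \<noteq> 0"
 shows "\<exists>!z. is_mid u v z"
proof (cases "dt u v > 0")
 case True
 then obtain N where N: "N \<in> SL2" "u = sqrt (dt u v) *\<^sub>R (N *v e1)" "v = sqrt (dt u v) *\<^sub>R (N *v e2)"
  by(rule frame)
 thus ?thesis using is_mid_frame[OF N(1) _ N(2,3)] assms by simp
next
 case False
 hence "dt v u > 0" using assms dt_swap[of v u] by simp
 then obtain N where N: "N \<in> SL2" "v = sqrt (dt v u) *\<^sub>R (N *v e1)" "u = sqrt (dt v u) *\<^sub>R (N *v e2)"
  by(rule frame)
 thus ?thesis using is_mid_frame[OF N(1) _ N(2,3)] \<open>dt v u > 0\<close> is_mid_swap[of u v] by simp
qed

lemma is_mid_mid: "dt u v \<noteq> 0 ==> is_mid u v (mid u v)"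
 unfolding mid_def using theI'[OF is_mid_ex1] by blast

lemma mid_eqI: "dt u v \<noteq> 0 ==> is_mid u v z ==> mid u v = z"
 using is_mid_ex1[of u v] is_mid_mid[of u v] by blast

lemma mid_line: "dt u v \<noteq> 0 ==> mid u v \<in> line u v"
 using is_mid_mid[of u v] by(simp add: is_mid_def line_def)

lemma mid_moeb: "dt u v \<noteq> 0 ==> M \<in> SL2 ==> mid (M *v u) (M *v v) = moeb M (mid u v)"
 using is_mid_mid[of u v] is_mid_moeb[of M "mid u v" u v] by(intro mid_eqI) (auto simp: dt_mat is_mid_def[of u v])

lemma mid_uminus [simp]: "mid (- u) v = mid u v" "mid u (- v) = mid u v"
 by(simp_all add: mid_def)

lemma mid_swap: "mid u v = mid v u"
 by(simp add: mid_def is_mid_swap[of u v])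

subsection \<open>Translations\<close>

text \<open>Splitting the diagonal matrix into its two projectors makes \<open>transl M\<close> a
  combination of two scalar exponentials, which is differentiated termwise.\<close>

lemma unit_translation_eq:
 assumes "M \<in> SL2"
 shows "unit_translation M = M ** mat2 (1/2) 0 0 (-1/2) ** adj M"
proof -
 define X where "X = M ** mat2 1 0 0 0 ** adj M"
 define Y where "Y = M ** mat2 0 0 0 1 ** adj M"
 have "transl M = (\<lambda>t. exp (t/2) *\<^sub>R X + exp (-t/2) *\<^sub>R Y)"
  by(rule ext) (simp add: transl_def matrix_inv_SL2[OF assms] X_def Y_def mat_eq2 algebra_simps)
 moreover have "((\<lambda>t. exp (t/2) *\<^sub>R X + exp (-t/2) *\<^sub>R Y) has_vector_derivative
   (1/2) *\<^sub>R X + (-1/2) *\<^sub>R Y) (at 0)"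
  by(rule has_vector_derivative_eq_rhs, rule has_vector_derivative_add;
    (rule has_vector_derivative_scaleR[OF _ has_vector_derivative_const])?)
   (auto intro!: derivative_eq_intros)
 ultimately have "unit_translation M = (1/2) *\<^sub>R X + (-1/2) *\<^sub>R Y"
  unfolding unit_translation_def by(simp add: vector_derivative_at)
 also have "\<dots> = M ** mat2 (1/2) 0 0 (-1/2) ** adj M"
  by(simp add: X_def Y_def mat_eq2 algebra_simps)
 finally show ?thesis .
qed

lemma geod_deriv:
 assumes "M \<in> SL2"
 shows "(geod M has_vector_derivative (\<i> * of_real (exp t) / (jac M (\<i> * of_real (exp t)))\<^sup>2)) (at t)"
proof -
 let ?z = "\<i> * complex_of_real (exp t)"
 have j: "jac M ?z \<noteq> 0" using jac_nonzero[OF assms] by simp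
 have d: "(of_real (M$1$1) * of_real (M$2$2) - of_real (M$1$2) * of_real (M$2$1) :: complex) = 1"
  using assms unfolding SL2_iff by(metis of_real_1 of_real_diff of_real_mult)
 have "(moeb M has_field_derivative
   (of_real (M$1$1) * jac M ?z - (of_real (M$1$1) * ?z + of_real (M$1$2)) * of_real (M$2$1)) / (jac M ?z * jac M ?z)) (at ?z)"
  unfolding moeb_jac[abs_def] using j unfolding jac_def
  by(auto intro!: derivative_eq_intros)
 moreover have "of_real (M$1$1) * jac M ?z - (of_real (M$1$1) * ?z + of_real (M$1$2)) * of_real (M$2$1)
  = of_real (M$1$1) * of_real (M$2$2) - of_real (M$1$2) * of_real (M$2$1)"
  by(simp add: jac_def algebra_simps)
 ultimately have m: "(moeb M has_field_derivative (1 / (jac M ?z)\<^sup>2)) (at ?z)"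
  using d by(simp add: power2_eq_square)
 have e: "((\<lambda>t. \<i> * complex_of_real (exp t)) has_vector_derivative ?z) (at t)"
  by(rule has_vector_derivative_mult_right, rule has_vector_derivative_of_real)
   (auto intro!: derivative_eq_intros simp: has_real_derivative_iff_has_vector_derivative[symmetric])
 have "((moeb M \<circ> (\<lambda>t. \<i> * complex_of_real (exp t))) has_vector_derivative ?z * (1 / (jac M ?z)\<^sup>2)) (at t)"
  by(rule field_vector_diff_chain_at[OF e m])
 moreover have "moeb M \<circ> (\<lambda>t. \<i> * complex_of_real (exp t)) = geod M"
  by(auto simp: geod_def)
 ultimately show ?thesis by simp
qed

lemma rotation_form:
 assumes "R \<in> SL2" "moeb R \<i> = \<i>"
 shows "R$1$1 = R$2$2" "R$1$2 = - R$2$1" "(R$2$1)\<^sup>2 + (R$2$2)\<^sup>2 = 1"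
proof -
 have "of_real (R$1$1) * \<i> + of_real (R$1$2) = \<i> * jac R \<i>"
  using assms(2) jac_nonzero[OF assms(1), of \<i>] by(simp add: moeb_jac field_simps)
 thus 1: "R$1$1 = R$2$2" and 2: "R$1$2 = - R$2$1"
  by(auto simp: jac_def complex_eq_iff)
 show "(R$2$1)\<^sup>2 + (R$2$2)\<^sup>2 = 1"
  using assms(1) 1 2 by(simp add: SL2_iff power2_eq_square)
qed

text \<open>The change of frame \<open>Q\<close> preserves the pair of ends of the imaginary axis,
  so it is diagonal or antidiagonal, and the parameters are related by \<open>t - s\<close> or its
  negative. This frees the orthogonality in \<open>strip_jump\<close> from the parametrisation of
  the lift.\<close>

lemma geod_reparam:
 assumes N: "N \<in> SL2" "N0 \<in> SL2" "geod_line N = geod_line N0" "geod N s = geod N0 0"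
 obtains c where "c \<noteq> 0" "vector_derivative (geod N) (at s) = of_real c * vector_derivative (geod N0) (at 0)"
proof -
 define Q where "Q = adj N0 ** N"
 have Q: "Q \<in> SL2" "N = N0 ** Q" using N by(auto simp: Q_def adj_cancel_left)
 have "line (N0 *v e1) (N0 *v e2) \<subseteq> line (N *v e1) (N *v e2)"
  using N by(simp add: geod_line_eq)
 hence ends: "(dt (N0 *v e1) (N *v e1) = 0 \<and> dt (N0 *v e2) (N *v e2) = 0) \<or>
   (dt (N0 *v e1) (N *v e2) = 0 \<and> dt (N0 *v e2) (N *v e1) = 0)"
  using N(1,2) by(intro line_subset_ends) (simp_all add: dt_mat)
 have Qe: "dt (N0 *v x) (N *v y) = dt x (Q *v y)" for x y
  unfolding Q(2) mat_vec_assoc[symmetric] using N(2) by(rule dt_mat)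
 have cases: "(Q$2$1 = 0 \<and> Q$1$2 = 0) \<or> (Q$2$2 = 0 \<and> Q$1$1 = 0)"
  using ends unfolding Qe by(auto simp: dt_def)
 have gN: "geod N t = moeb N0 (moeb Q (\<i> * of_real (exp t)))" for t
  unfolding geod_def Q(2) using moeb_mult[OF N(2) Q(1) Im_iexp] .
 have "moeb N0 (moeb Q (\<i> * of_real (exp s))) = moeb N0 \<i>"
  using N(4) unfolding gN by(simp add: geod_def)
 hence i: "moeb Q (\<i> * of_real (exp s)) = \<i>"
  using moeb_adj(1)[OF N(2), of \<i>] moeb_adj(1)[OF N(2), of "moeb Q (\<i> * of_real (exp s))"]
   moeb_half_plane[OF Q(1), of "\<i> * of_real (exp s)"] by(simp add: half_plane_iff)
 have dN0: "(geod N0 has_vector_derivative vector_derivative (geod N0) (at 0)) (at 0)"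
  using geod_deriv[OF N(2), of 0] vector_derivative_at by metis
 have "\<exists>k. k\<in>{1,-1} \<and> (\<forall>t. moeb Q (\<i> * of_real (exp t)) = \<i> * of_real (exp (k * (t - s))))"
  using cases
 proof
  assume c: "Q$2$1 = 0 \<and> Q$1$2 = 0"
  hence q: "Q$1$1 * Q$2$2 = 1" using Q(1) by(simp add: SL2_iff)
  hence q2: "Q$2$2 \<noteq> 0" "Q$1$1 \<noteq> 0" by auto
  have f: "moeb Q (\<i> * of_real (exp t)) = \<i> * of_real (Q$1$1/Q$2$2 * exp t)" for t
   using c by(simp add: moeb_def)
  have h: "Q$1$1/Q$2$2 * exp s = 1" using i q2 unfolding f by(auto simp: complex_eq_iff)
  hence "Q$1$1/Q$2$2 * exp t = exp (1 * (t - s))" for t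
  proof -
   have "Q$1$1/Q$2$2 * exp t = (Q$1$1/Q$2$2 * exp s) * exp (t - s)" by(simp add: exp_diff)
   thus ?thesis by(simp only: h mult_1_left)
  qed
  thus ?thesis using f by(metis insertI1)
 next
  assume c: "Q$2$2 = 0 \<and> Q$1$1 = 0"
  hence q: "Q$1$2 * Q$2$1 = - 1" using Q(1) by(simp add: SL2_iff)
  hence q2: "Q$2$1 \<noteq> 0" by auto
  have f: "moeb Q (\<i> * of_real (exp t)) = \<i> * of_real (- Q$1$2/Q$2$1 * exp (- t))" for t
   using c q2 by(simp add: moeb_def complex_eq_iff exp_minus Re_divide Im_divide power2_eq_square field_simps)
  have h: "- Q$1$2/Q$2$1 * exp (- s) = 1" using i unfolding f by(simp add: complex_eq_iff)
  hence "- Q$1$2/Q$2$1 * exp (- t) = exp (- 1 * (t - s))" for t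
  proof -
   have "- Q$1$2/Q$2$1 * exp (- t) = (- Q$1$2/Q$2$1 * exp (- s)) * exp (s - t)" by(simp add: exp_diff exp_minus divide_simps)
   also have "\<dots> = exp (- 1 * (t - s))" by(simp only: h mult_1_left) simp
   finally show ?thesis .
  qed
  thus ?thesis using f by(metis insertI1 insertI2)
 qed
 then obtain k where k: "k = 1 \<or> k = -1" "\<And>t. moeb Q (\<i> * of_real (exp t)) = \<i> * of_real (exp (k * (t - s)))"
  by auto
 have "geod N = geod N0 \<circ> (\<lambda>t. k * (t - s))"
  by(rule ext) (simp only: gN k(2), simp add: geod_def)
 moreover have "((geod N0 \<circ> (\<lambda>t. k * (t - s))) has_vector_derivative
   k *\<^sub>R vector_derivative (geod N0) (at 0)) (at s)"
  by(rule vector_diff_chain_at) (auto intro!: derivative_eq_intros simp: dN0)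
 ultimately have "vector_derivative (geod N) (at s) = k *\<^sub>R vector_derivative (geod N0) (at 0)"
  by(simp add: vector_derivative_at)
 thus thesis using that[of k] k(1) by(auto simp: scaleR_conv_of_real)
qed

text \<open>The rotation \<open>R\<close> multiplies velocities by the inverse square of
  \<open>jac R \<i>\<close>, a complex number of modulus one. Orthogonality is the vanishing of its
  real part, the difference of the squares of \<open>R$2$2\<close> and \<open>R$2$1\<close>.\<close>

lemma orthogonal_rotation:
 assumes "R \<in> SL2" "N0 \<in> SL2" "moeb R \<i> = \<i>"
 shows "orthogonal (vector_derivative (geod (N0 ** R)) (at 0)) (vector_derivative (geod N0) (at 0))
  \<longleftrightarrow> (R$2$1)\<^sup>2 = (R$2$2)\<^sup>2"
proof -
 note r = rotation_form[OF assms(1,3)]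
 let ?w = "jac N0 \<i>" and ?\<rho> = "jac R \<i>"
 have w: "?w \<noteq> 0" using jac_nonzero assms by simp
 have rho: "?\<rho> = Complex (R$2$2) (R$2$1)" by(simp add: jac_def complex_eq_iff)
 have rho2: "?\<rho> \<noteq> 0" using jac_nonzero assms by simp
 have "jac (N0 ** R) \<i> = ?w * ?\<rho>"
 proof -
  have "jac N0 (moeb R \<i>) * jac R \<i> = jac (N0 ** R) \<i>"
   using rho2 unfolding moeb_jac by(simp add: jac_def[of N0] jac_def[of "N0 ** R"] field_simps)
    (simp add: jac_def algebra_simps)
  thus ?thesis using assms(3) by simp
 qed
 hence "vector_derivative (geod (N0 ** R)) (at 0) = \<i> / (?w * ?\<rho>)\<^sup>2"
  using vector_derivative_at[OF geod_deriv[OF mult_SL2[OF assms(2,1)], of 0]] by simp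
 moreover have "vector_derivative (geod N0) (at 0) = \<i> / ?w\<^sup>2"
  using vector_derivative_at[OF geod_deriv[OF assms(2), of 0]] by simp
 moreover have "(\<i> / (?w * ?\<rho>)\<^sup>2) * cnj (\<i> / ?w\<^sup>2) = of_real (1 / (norm ?w)^4) * (1 / ?\<rho>\<^sup>2)"
 proof -
  have "(\<i> / (?w * ?\<rho>)\<^sup>2) * cnj (\<i> / ?w\<^sup>2) = 1 / ((?w * cnj ?w)\<^sup>2 * ?\<rho>\<^sup>2)"
   by(simp add: power_mult_distrib)
  also have "?w * cnj ?w = of_real ((norm ?w)\<^sup>2)" by(simp only: complex_norm_square)
  finally show ?thesis by(simp add: power_mult[symmetric])
 qed
 moreover have "1 / ?\<rho>\<^sup>2 = (cnj ?\<rho>)\<^sup>2"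
 proof -
  have "?\<rho> * cnj ?\<rho> = 1" unfolding complex_norm_square[symmetric] rho cmod_power2 using r(3)
   by(simp add: add.commute)
  hence "?\<rho>\<^sup>2 * (cnj ?\<rho>)\<^sup>2 = 1" by(simp add: power_mult_distrib[symmetric])
  thus ?thesis using rho2 by(simp add: field_simps)
 qed
 moreover have o: "orthogonal x y \<longleftrightarrow> Re (x * cnj y) = 0" for x y :: complex
  by(simp add: orthogonal_def inner_complex_def)
 moreover have "Re (of_real (1 / (norm ?w)^4) * (cnj ?\<rho>)\<^sup>2) = (1 / (norm ?w)^4) * ((R$2$2)\<^sup>2 - (R$2$1)\<^sup>2)"
  unfolding rho by(simp add: power2_eq_square)
 ultimately show ?thesis using w unfolding o by(simp only:) auto
qed

text \<open>There are two directions for the perpendicular at the midpoint. The sign of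
  \<open>R$2$1 * R$2$2\<close> decides which one is taken, and it fixes at once the sign of the
  translation and the side that is entered, in agreement with \<open>jump\<close>.\<close>

lemma perpendicular_geod:
 assumes d: "dt u v > 0" and N0: "N0 \<in> SL2" "u = sqrt (dt u v) *\<^sub>R (N0 *v e1)" "v = sqrt (dt u v) *\<^sub>R (N0 *v e2)"
  and R: "R \<in> SL2" "moeb R \<i> = \<i>" "(R$2$1)\<^sup>2 = (R$2$2)\<^sup>2" and M: "M = N0 ** R"
 shows "R$2$1 * R$2$2 = 1/2 \<or> R$2$1 * R$2$2 = - 1/2"
  "unit_translation M = (2 * (R$2$1 * R$2$2)) *\<^sub>R tv u v"
  "t > 0 ==> sgn (side u v (geod M t)) = - 2 * (R$2$1 * R$2$2)"
proof -
 note r = rotation_form[OF R(1,2)]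
 let ?c = "R$2$1" and ?d = "R$2$2"
 have sq: "?c\<^sup>2 = 1/2" "?d\<^sup>2 = 1/2" using r(3) R(3) by auto
 have "(?c * ?d)\<^sup>2 = 1/2 * (1/2)" by(simp only: power_mult_distrib sq)
 hence "(?c * ?d)\<^sup>2 = (1/2)\<^sup>2" by(simp add: power2_eq_square)
 thus cd: "?c * ?d = 1/2 \<or> ?c * ?d = - 1/2" unfolding power2_eq_iff by simp
 have Ms: "M \<in> SL2" using M N0 R by simp
 let ?s = "sqrt (dt u v)"
 have s: "?s > 0" "?s * ?s = dt u v" using d by simp_all
 have inner: "R ** mat2 (1/2) 0 0 (-1/2) ** adj R = (?c * ?d) *\<^sub>R mat2 0 1 1 0"
  using sq r by(simp add: mat_eq2 power2_eq_square algebra_simps)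
 have "unit_translation M = N0 ** (R ** mat2 (1/2) 0 0 (-1/2) ** adj R) ** adj N0"
  unfolding unit_translation_eq[OF Ms] unfolding M adj_mult_distrib by(simp add: matrix_mul_assoc)
 also have "\<dots> = (?c * ?d) *\<^sub>R (N0 ** mat2 0 1 1 0 ** adj N0)"
  unfolding inner by(simp add: mat_eq2 algebra_simps)
 also have "N0 ** mat2 0 1 1 0 ** adj N0 = 2 *\<^sub>R tv u v"
 proof (rule mat_basis_eq[of u v])
  have sw: "mat2 0 1 1 0 *v e1 = e2" "mat2 0 1 1 0 *v e2 = e1" by(simp_all add: vec_eq2)
  have "(N0 ** mat2 0 1 1 0 ** adj N0) *v (?s *\<^sub>R (N0 *v e1)) = ?s *\<^sub>R (N0 *v e2)"
   "(N0 ** mat2 0 1 1 0 ** adj N0) *v (?s *\<^sub>R (N0 *v e2)) = ?s *\<^sub>R (N0 *v e1)"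
   by(simp_all add: mat_vec_scale mat_vec_assoc[symmetric] adj_cancel_vec N0(1) sw)
  hence 1: "(N0 ** mat2 0 1 1 0 ** adj N0) *v u = v" "(N0 ** mat2 0 1 1 0 ** adj N0) *v v = u"
   using N0(2,3) by metis+
  have sc: "(x *\<^sub>R X) *v w = x *\<^sub>R (X *v w)" "(X - Y) *v w = X *v w - Y *v w"
   for x w and X Y :: "real^2^2"
   by(simp_all add: vec_eq2 algebra_simps)
  have 2: "(2 *\<^sub>R tv u v) *v u = v" "(2 *\<^sub>R tv u v) *v v = u"
   using d by(simp_all add: tv_def sc nil_vec dt_swap[of v u])
  show "(N0 ** mat2 0 1 1 0 ** adj N0) *v u = (2 *\<^sub>R tv u v) *v u"
   "(N0 ** mat2 0 1 1 0 ** adj N0) *v v = (2 *\<^sub>R tv u v) *v v" using 1 2 by simp_all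
 qed (use d in simp)
 finally show "unit_translation M = (2 * (?c * ?d)) *\<^sub>R tv u v" by simp
 assume t: "t > 0"
 let ?z = "\<i> * complex_of_real (exp t)"
 have g: "geod M t = moeb N0 (moeb R ?z)" unfolding geod_def M by(rule moeb_mult[OF N0(1) R(1) Im_iexp])
 have i: "Im (moeb R ?z) > 0" using moeb_half_plane[OF R(1), of ?z] by(simp add: half_plane_iff)
 have "side u v (geod M t) = ?s * ?s * side (N0 *v e1) (N0 *v e2) (geod M t)"
  using N0(2,3) side_scale by metis
 hence "sgn (side u v (geod M t)) = sgn (side e1 e2 (moeb R ?z))"
  unfolding s(2) g using d by(simp add: sgn_mult sgn_side_moeb[OF N0(1) i])
 also have "\<dots> = - sgn (Re (moeb R ?z))" by(simp add: side_e)
 also have "Re (moeb R ?z) = ?c * ?d * ((exp t)\<^sup>2 - 1) / ((exp t * ?c)\<^sup>2 + ?d\<^sup>2)"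
  unfolding moeb_def r by(simp add: Re_divide power2_eq_square algebra_simps)
 also have "sgn \<dots> = sgn (?c * ?d)"
 proof -
  have "(exp t)\<^sup>2 > 1" using t by(simp add: one_less_power)
  moreover have "(exp t * ?c)\<^sup>2 + ?d\<^sup>2 > 0" using sq(2) by(intro add_nonneg_pos) auto
  ultimately show ?thesis by(simp add: sgn_mult sgn_divide)
 qed
 also have "sgn (?c * ?d) = 2 * (?c * ?d)" using cd by auto
 finally show "sgn (side u v (geod M t)) = - 2 * (?c * ?d)" by simp
qed

section \<open>The holonomy group\<close>

locale cusped_torus =
 fixes A B :: "real^2^2" and q :: "complex => complex \<times> complex"
 assumes torus: "one_cusped_torus A B q"
begin

abbreviation "\<Gamma> \<equiv> holonomy_group A B"

lemma A_SL2: "A \<in> SL2" and B_SL2: "B \<in> SL2" and A_trace: "\<bar>trace A\<bar> > 2" and B_trace: "\<bar>trace B\<bar> > 2"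
 using torus by(auto simp: one_cusped_torus_def loxodromic_def)

lemma letter_SL2: "letter_image A B x \<in> SL2"
 using A_SL2 B_SL2 by(cases x) (auto simp: Let_def matrix_inv_SL2)

lemma word_Nil [simp]: "word_image A B [] = mat 1"
 and word_Cons: "word_image A B (x # w) = letter_image A B x ** word_image A B w"
 by(simp_all add: word_image_def)

lemma word_SL2: "word_image A B w \<in> SL2"
 by(induction w) (simp_all add: word_Cons letter_SL2)

lemma word_append: "word_image A B (v @ w) = word_image A B v ** word_image A B w"
 by(induction v) (simp_all add: word_Cons matrix_mul_assoc)

lemma letter_inv: "letter_image A B (g, \<not> s) = adj (letter_image A B (g, s))"
 using A_SL2 B_SL2 by(simp add: Let_def matrix_inv_SL2)

lemma word_inv: "\<exists>v. word_image A B v = adj (word_image A B w)"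
proof (induction w)
 case Nil
 have "adj (mat 1) = mat 1" by(simp add: mat_eq2)
 thus ?case by(metis word_Nil)
next
 case (Cons x w)
 then obtain v where v: "word_image A B v = adj (word_image A B w)" by blast
 obtain g s where x: "x = (g, s)" by(cases x)
 have "word_image A B (v @ [(g, \<not> s)]) = adj (word_image A B (x # w))"
  unfolding word_append v word_Cons x adj_mult_distrib letter_inv by simp
 thus ?case by blast
qed

lemma G_SL2: "g \<in> \<Gamma> ==> g \<in> SL2"
 by(auto simp: holonomy_group_def word_SL2)

lemma G_one [simp]: "mat 1 \<in> \<Gamma>"
 unfolding holonomy_group_def by(rule CollectI, rule exI[of _ "[]"]) simp

lemma G_uminus: "g \<in> \<Gamma> ==> - g \<in> \<Gamma>"
 by(auto simp: holonomy_group_def)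

lemma G_uminus_iff [simp]: "- g \<in> \<Gamma> \<longleftrightarrow> g \<in> \<Gamma>"
 using G_uminus[of g] G_uminus[of "- g"] by auto

lemma G_mult: "g \<in> \<Gamma> ==> h \<in> \<Gamma> ==> g ** h \<in> \<Gamma>"
proof -
 assume "g \<in> \<Gamma>" "h \<in> \<Gamma>"
 then obtain v w where "g = word_image A B v \<or> g = - word_image A B v" "h = word_image A B w \<or> h = - word_image A B w"
  by(auto simp: holonomy_group_def)
 hence "g ** h = word_image A B (v @ w) \<or> g ** h = - word_image A B (v @ w)"
  by(auto simp: word_append mat_uminus_left mat_uminus_right)
 thus ?thesis by(auto simp: holonomy_group_def)
qed

lemma G_adj: "g \<in> \<Gamma> ==> adj g \<in> \<Gamma>"
proof -
 assume "g \<in> \<Gamma>"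
 then obtain v where v: "g = word_image A B v \<or> g = - word_image A B v" by(auto simp: holonomy_group_def)
 obtain w where "word_image A B w = adj (word_image A B v)" using word_inv by blast
 hence "adj g = word_image A B w \<or> adj g = - word_image A B w" using v by(auto simp: adj_uminus)
 thus ?thesis by(auto simp: holonomy_group_def)
qed

lemma G_adj_iff [simp]: "adj g \<in> \<Gamma> \<longleftrightarrow> g \<in> \<Gamma>"
 using G_adj[of g] G_adj[of "adj g"] by auto

lemma A_G: "A \<in> \<Gamma>"
 unfolding holonomy_group_def by(rule CollectI, rule exI[of _ "[(True, True)]"]) (simp add: word_Cons)

lemma B_G: "B \<in> \<Gamma>"
 unfolding holonomy_group_def by(rule CollectI, rule exI[of _ "[(False, True)]"]) (simp add: word_Cons)

text \<open>The induction principle for properties of \<Gamma> that are stable under products and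
  sign.\<close>

lemma G_minimal:
 assumes "A \<in> H" "B \<in> H" "adj A \<in> H" "adj B \<in> H" "mat 1 \<in> H" "\<And>g h. g \<in> H ==> h \<in> H ==> g ** h \<in> H"
  "\<And>g. g \<in> H ==> - g \<in> H"
 shows "\<Gamma> \<subseteq> H"
proof -
 have "word_image A B w \<in> H" for w
 proof (induction w)
  case (Cons x w)
  have "letter_image A B x \<in> H" using assms A_SL2 B_SL2 by(cases x) (auto simp: Let_def matrix_inv_SL2)
  thus ?case using Cons assms(6) by(simp add: word_Cons)
 qed (simp add: assms)
 thus ?thesis using assms(7) by(auto simp: holonomy_group_def)
qed

lemma moeb_G_half_plane: "g \<in> \<Gamma> ==> Im z > 0 ==> Im (moeb g z) > 0"
 using moeb_half_plane[OF G_SL2, of g z] by(simp add: half_plane_iff)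

lemma covering: "covering_space half_plane q punctured_torus"
 using torus by(simp add: one_cusped_torus_def)

lemma q_eq_iff: "Im z > 0 ==> Im w > 0 ==> q z = q w \<longleftrightarrow> (\<exists>g\<in>\<Gamma>. w = moeb g z)"
 using torus by(simp add: one_cusped_torus_def half_plane_iff)

lemma q_moeb: "g \<in> \<Gamma> ==> Im z > 0 ==> q (moeb g z) = q z"
 using q_eq_iff[of z "moeb g z"] moeb_G_half_plane[of g z] by auto

lemma q_punctured: "Im z > 0 ==> q z \<in> punctured_torus"
 using covering covering_space_imp_surjective by(fastforce simp: half_plane_iff)

lemma q_surj: "y \<in> punctured_torus ==> \<exists>z. Im z > 0 \<and> q z = y"
 using covering_space_imp_surjective[OF covering] by(metis half_plane_iff imageE)

lemma q_cont: "continuous_on half_plane q"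
 using covering covering_space_imp_continuous by blast

lemma open_half_plane: "open half_plane"
 unfolding half_plane_def by(rule open_halfspace_Im_gt)

lemma convex_half_plane: "convex half_plane"
 unfolding half_plane_def by(rule convex_halfspace_Im_gt)

lemma q_locally_inj:
 assumes "Im z > 0"
 obtains W where "open W" "z \<in> W" "W \<subseteq> half_plane" "inj_on q W"
proof -
 have z: "z \<in> half_plane" using assms by(simp add: half_plane_iff)
 obtain T U f where T: "z \<in> T" "openin (top_of_set half_plane) T" "homeomorphism T U q f"
  using covering_space_local_homeomorphism[OF covering z] by metis
 have "open T" using T(2) open_half_plane openin_open_trans by blast
 moreover have "T \<subseteq> half_plane" using T(2) openin_imp_subset by blast
 moreover have "inj_on q T" using T(3) by(metis homeomorphism_apply1 inj_onI)
 ultimately show thesis using T(1) that by blast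
qed

text \<open>A fixed point of a deck transformation spreads to a neighbourhood, since the covering map is
 locally injective.\<close>

lemma moeb_fix_open:
 assumes "M \<in> SL2" "open W" "W \<noteq> {}" "W \<subseteq> half_plane" "\<And>w. w \<in> W ==> moeb M w = w"
 shows "M = mat 1 \<or> M = - mat 1"
proof -
 obtain z where z: "z \<in> W" using assms(3) by blast
 then obtain e where e: "e > 0" "ball z e \<subseteq> W" using assms(2) openE by blast
 have f: "of_real (M$2$1) * w * w + (of_real (M$2$2) - of_real (M$1$1)) * w - of_real (M$1$2) = 0" if "w \<in> W" for w
 proof -
  have w: "Im w > 0" using that assms(4) by(auto simp: half_plane_iff)
  have "of_real (M$1$1) * w + of_real (M$1$2) = w * jac M w"
   using assms(5)[OF that] jac_nonzero[OF assms(1) w] unfolding moeb_jac by(simp add: divide_eq_eq)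
  thus ?thesis by(simp add: jac_def algebra_simps)
 qed
 have Iz: "Im z > 0" using z assms(4) by(auto simp: half_plane_iff)
 \<comment> \<open>A second fixed point with another real part: after division by
   \<open>Im w\<close> the imaginary part of the fixed point equation is affine in
   \<open>Re w\<close>, so two values force \<open>M$2$1 = 0\<close>.\<close>
 have w1: "z + of_real (e/2) \<in> W" using e by(auto simp: subset_iff dist_norm)
 have i0: "2 * M$2$1 * Re w + (M$2$2 - M$1$1) = 0" if "w \<in> W" for w
 proof -
  have w: "Im w > 0" using that assms(4) by(auto simp: half_plane_iff)
  have "Im (of_real (M$2$1) * w * w + (of_real (M$2$2) - of_real (M$1$1)) * w - of_real (M$1$2)) = 0"
   using f[OF that] by simp
  hence "Im w * (2 * M$2$1 * Re w + (M$2$2 - M$1$1)) = 0" by(simp add: algebra_simps)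
  thus ?thesis using w by simp
 qed
 have "2 * M$2$1 * (e/2) = 0" using i0[OF z] i0[OF w1] by(simp add: algebra_simps)
 hence c: "M$2$1 = 0" using e by simp
 hence d: "M$2$2 = M$1$1" using i0[OF z] by simp
 have b: "M$1$2 = 0" using f[OF z] c d by simp
 have "M$1$1 * M$1$1 = 1" using assms(1) b c d by(simp add: SL2_iff)
 hence "M$1$1 = 1 \<or> M$1$1 = -1" by(metis power2_eq_1_iff power2_eq_square)
 thus ?thesis using b c d by(auto simp: mat_eq2)
qed

lemma free_action:
 assumes g: "g \<in> \<Gamma>" and z: "Im z > 0" and f: "moeb g z = z"
 shows "g = mat 1 \<or> g = - mat 1"
proof -
 obtain W where W: "open W" "z \<in> W" "W \<subseteq> half_plane" "inj_on q W" by(rule q_locally_inj[OF z])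
 have cont: "continuous_on half_plane (moeb g)" using g G_SL2 continuous_on_moeb by blast
 define V where "V = W \<inter> (half_plane \<inter> moeb g -` W)"
 have "open V" unfolding V_def
  using W(1) cont open_half_plane continuous_on_open_vimage[OF open_half_plane] by(metis Int_commute open_Int)
 moreover have "z \<in> V" using W f z by(auto simp: V_def half_plane_iff)
 moreover have "moeb g w = w" if "w \<in> V" for w
 proof -
  have "Im w > 0" using that by(auto simp: V_def half_plane_iff)
  thus ?thesis using q_moeb[OF g] W(4) that by(auto simp: V_def inj_on_def)
 qed
 ultimately show ?thesis
  using moeb_fix_open[OF G_SL2[OF g], of V] by(auto simp: V_def)
qed

lemma proper_nbhd:
 assumes "Im z > 0"
 obtains W where "open W" "z \<in> W" "W \<subseteq> half_plane" "inj_on q W"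
  "\<And>g w. g \<in> \<Gamma> ==> w \<in> W ==> moeb g w \<in> W ==> g = mat 1 \<or> g = - mat 1"
proof -
 obtain W where W: "open W" "z \<in> W" "W \<subseteq> half_plane" "inj_on q W" by(rule q_locally_inj[OF assms])
 show thesis
 proof (rule that[OF W])
  fix g w assume a: "g \<in> \<Gamma>" "w \<in> W" "moeb g w \<in> W"
  hence w: "Im w > 0" using W(3) by(auto simp: half_plane_iff)
  hence "moeb g w = w" using q_moeb[OF a(1) w] W(4) a by(auto simp: inj_on_def)
  thus "g = mat 1 \<or> g = - mat 1" using free_action a(1) w by blast
 qed
qed

lemma tendsto_moeb:
 assumes "\<And>i j. (\<lambda>n. (g n :: real^2^2)$i$j) \<longlonglongrightarrow> h$i$j" "h \<in> SL2" "Im z > 0"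
 shows "(\<lambda>n. moeb (g n) z) \<longlonglongrightarrow> moeb h z"
 unfolding moeb_def
 by(intro tendsto_intros assms) (use jac_nonzero[OF assms(2,3)] in \<open>simp add: jac_def\<close>)

text \<open>Discreteness is read off the covering: \<open>adj h ** g n\<close> moves \<i> less and
  less, and once it stays in a neighbourhood on which \<open>q\<close> is injective it must be the
  identity up to sign.\<close>

lemma discrete:
 assumes lim: "\<And>i j. (\<lambda>n. (g n)$i$j) \<longlonglongrightarrow> h$i$j" and G: "\<And>n. g n \<in> \<Gamma>" and h: "h \<in> \<Gamma>"
 shows "eventually (\<lambda>n. g n = h \<or> g n = - h) sequentially"
proof -
 have i: "Im \<i> > 0" by simp
 obtain W where W: "open W" "\<i> \<in> W" "W \<subseteq> half_plane"
  "\<And>g w. g \<in> \<Gamma> ==> w \<in> W ==> moeb g w \<in> W ==> g = mat 1 \<or> g = - mat 1"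
  by(rule proper_nbhd[OF i]) blast
 let ?k = "\<lambda>n. adj h ** g n"
 have "(\<lambda>n. (?k n)$i$j) \<longlonglongrightarrow> (adj h ** h)$i$j" for i j
  unfolding mat_mult2 by(intro tendsto_intros lim)
 hence "(\<lambda>n. moeb (?k n) \<i>) \<longlonglongrightarrow> moeb (adj h ** h) \<i>"
  using G_SL2[OF h] by(intro tendsto_moeb) (auto simp: i)
 hence "(\<lambda>n. moeb (?k n) \<i>) \<longlonglongrightarrow> \<i>" using G_SL2[OF h] by(simp add: adj_mult)
 hence "eventually (\<lambda>n. moeb (?k n) \<i> \<in> W) sequentially" using W(1,2) topological_tendstoD by blast
 thus ?thesis
 proof (rule eventually_mono)
  fix n assume "moeb (?k n) \<i> \<in> W"
  hence "?k n = mat 1 \<or> ?k n = - mat 1" using W(4)[of "?k n" \<i>] W(2) G_mult[OF _ G] h by simp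
  hence "h ** ?k n = h \<or> h ** ?k n = - h" by(auto simp: mat_uminus_right)
  thus "g n = h \<or> g n = - h" by(simp only: adj_cancel_left(2)[OF G_SL2[OF h]])
 qed
qed

subsection \<open>The commutator and the elliptic involutions\<close>

definition comm :: "real^2^2" where "comm = A ** B ** adj A ** adj B"

lemma comm_parabolic: "comm \<in> SL2" "\<bar>trace comm\<bar> = 2" "comm \<noteq> mat 1" "comm \<noteq> - mat 1"
 using torus by(auto simp: one_cusped_torus_def parabolic_def comm_def matrix_inv_SL2 A_SL2 B_SL2)

lemma comm_G: "comm \<in> \<Gamma>"
 unfolding comm_def by(intro G_mult A_G B_G G_adj)

text \<open>An element fixing the fixed point of a parabolic element is not hyperbolic: conjugating the
 parabolic by its powers would contradict discreteness.\<close>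

lemma parabolic_fix_unit:
 assumes v: "v \<noteq> 0" and P: "mat 1 + k *\<^sub>R nil v \<in> \<Gamma>" "k \<noteq> 0" and g: "g \<in> \<Gamma>" "g *v v = m *\<^sub>R v"
 shows "m = 1 \<or> m = -1"
proof -
 have conj: "mat 1 + (k * x^(2*n)) *\<^sub>R nil v \<in> \<Gamma>" if "h \<in> \<Gamma>" "h *v v = x *\<^sub>R v" for h x n
 proof (induction n)
  case (Suc n)
  have "h ** (mat 1 + (k * x^(2*n)) *\<^sub>R nil v) ** adj h = mat 1 + (k * x^(2*n)) *\<^sub>R Ad h (nil v)"
   using G_SL2[OF that(1)] by(simp add: Ad_SL2 matrix_add_mult_distrib2 adj_mult)
  also have "\<dots> = mat 1 + (k * x^(2 * Suc n)) *\<^sub>R nil v"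
   using G_SL2[OF that(1)] by(simp add: Ad_nil that(2) nil_scale power2_eq_square mult_ac)
  finally show ?case using that(1) Suc G_mult G_adj by metis
 qed (use P in simp)
 have no: False if h: "h \<in> \<Gamma>" "h *v v = x *\<^sub>R v" and x: "x \<noteq> 0" "\<bar>x\<bar> < 1" for h x
 proof -
  let ?g = "\<lambda>n. mat 1 + (k * x^(2*n)) *\<^sub>R nil v"
  have "(\<lambda>n. (x^2)^n) \<longlonglongrightarrow> 0" using x by(intro LIMSEQ_realpow_zero) (auto simp: abs_square_less_1)
  hence z: "(\<lambda>n. x^(2*n)) \<longlonglongrightarrow> 0" by(simp add: power_mult)
  have "(\<lambda>n. (?g n)$i$j) \<longlonglongrightarrow> (mat 1 :: real^2^2)$i$j" for i j
  proof -
   have "(\<lambda>n. (mat 1 :: real^2^2)$i$j + (k * x^(2*n)) * (nil v)$i$j) \<longlonglongrightarrow> (mat 1)$i$j + (k * 0) * (nil v)$i$j"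
    by(intro tendsto_intros z)
   thus ?thesis by simp
  qed
  hence "eventually (\<lambda>n. ?g n = mat 1 \<or> ?g n = - mat 1) sequentially"
   by(rule discrete) (use conj[OF h] in auto)
  then obtain n where n: "?g n = mat 1 \<or> ?g n = - mat 1" by(auto simp: eventually_sequentially)
  have "trace (?g n) = 2" by(simp add: trace_lin) (simp add: trace2)
  moreover have "trace (- mat 1 :: real^2^2) = - 2" by(simp add: trace2)
  ultimately have "?g n \<noteq> - mat 1" using arg_cong[of "?g n" "- mat 1" trace] by linarith
  hence "(k * x^(2*n)) *\<^sub>R nil v = 0" using n by simp
  hence "nil v = 0" using P(2) x by simp
  thus False using v by(auto simp: nil_def mat_eq2 vec_eq2)
 qed
 have inv: "adj g *v v = (1/m) *\<^sub>R v" "m \<noteq> 0"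
 proof -
  have e: "v = m *\<^sub>R (adj g *v v)"
   using adj_cancel_vec(1)[OF G_SL2[OF g(1)], of v] g(2) by(simp add: mat_vec_scale)
  thus "m \<noteq> 0" using v by auto
  thus "adj g *v v = (1/m) *\<^sub>R v" 
  proof -
   have "(1/m) *\<^sub>R v = (1/m) *\<^sub>R (m *\<^sub>R (adj g *v v))" by(simp only: e[symmetric])
   thus ?thesis using \<open>m \<noteq> 0\<close> by simp
  qed
 qed
 \<comment> \<open>A factor of modulus larger than one is excluded by passing to the inverse, which
   contracts.\<close>
 have "\<bar>m\<bar> = 1"
  using no[OF g] no[OF G_adj[OF g(1)] inv(1)] inv(2) by(cases "\<bar>m\<bar>" "1::real" rule: linorder_cases) auto
 thus ?thesis by linarith
qed

lemma nilpotent_form: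
 assumes "trace X = 0" "det (X::real^2^2) = 0" "X \<noteq> 0"
 obtains v k where "v \<noteq> 0" "k \<noteq> 0" "X = k *\<^sub>R nil v"
proof -
 define a b c where "a = X$1$1" "b = X$1$2" "c = X$2$1"
 have d: "X$2$2 = - a" using assms(1) by(simp add: trace2 a_b_c_def)
 have e: "a * a + b * c = 0" using assms(2) d by(simp add: det_2 a_b_c_def)
 show thesis
 proof (cases "b = 0")
  case False
  let ?v = "vector [b, - a] :: real^2"
  have "X = (1/b) *\<^sub>R nil ?v"
   using False d e by(simp add: mat_eq2 nil_def a_b_c_def[symmetric] field_simps)
  thus thesis using that[of ?v "1/b"] False by(simp add: vec_eq2)
 next
  case True
  hence a: "a = 0" using e by simp
  have c: "c \<noteq> 0" using assms(3) True a d by(auto simp: mat_eq2 a_b_c_def[symmetric])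
  have "X = (-c) *\<^sub>R nil e2"
   using True a d by(simp add: mat_eq2 nil_def a_b_c_def[symmetric])
  thus thesis using that[of e2 "-c"] c by(simp add: vec_eq2)
 qed
qed

text \<open>If the trace were 2, then \<open>A ** B - B ** A\<close> would be nilpotent with the
  same kernel as \<open>comm - mat 1\<close>. Its product with \<open>A\<close> has trace zero, so
  \<open>A\<close> would fix the parabolic fixed point, with eigenvalue 1 or -1 by
  \<open>parabolic_fix_unit\<close>, and could not be loxodromic.\<close>

lemma comm_trace: "trace comm = - 2"
proof (rule ccontr)
 assume "trace comm \<noteq> - 2"
 hence t: "trace comm = 2" using comm_parabolic(2) by linarith
 let ?X = "comm - mat 1"
 have "trace ?X = 0" using t by(simp add: trace_lin) (simp add: trace2)
 moreover have "det ?X = 0" using t comm_parabolic(1) by(simp add: det_2 SL2_iff trace2 algebra_simps)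
 moreover have "?X \<noteq> 0" using comm_parabolic by simp
 ultimately obtain v k where v: "v \<noteq> 0" "k \<noteq> 0" "?X = k *\<^sub>R nil v" by(rule nilpotent_form)
 hence P: "mat 1 + k *\<^sub>R nil v \<in> \<Gamma>" using comm_G by(simp add: v(3)[symmetric])
 define K where "K = A ** B - B ** A"
 have K1: "K = ?X ** (B ** A)"
 proof -
  have "comm ** (B ** A) = A ** (B ** (adj A ** (adj B ** (B ** A))))"
   by(simp add: comm_def matrix_mul_assoc)
  also have "\<dots> = A ** B" by(simp add: adj_cancel_left A_SL2 B_SL2) (simp add: adj_mult A_SL2)
  finally show ?thesis by(simp add: K_def matrix_add_mult_distrib2)
 qed
 have BA: "B ** A \<in> SL2" using A_SL2 B_SL2 by simp
 have trK: "trace K = 0" by(simp add: K_def trace2 algebra_simps)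
 have detK: "det K = 0" unfolding K1 det_mul using \<open>det ?X = 0\<close> by simp
 have "K \<noteq> 0"
 proof
  assume "K = 0"
  hence "K ** adj (B ** A) = 0" by(simp add: mat_eq2)
  moreover have "K ** adj (B ** A) = ?X"
   by(simp only: K1 matrix_mul_assoc[symmetric, of ?X "B ** A"] adj_mult(2)[OF BA] matrix_mul_rid)
  ultimately show False using \<open>?X \<noteq> 0\<close> by simp
 qed
 then obtain w l where w: "w \<noteq> 0" "l \<noteq> 0" "K = l *\<^sub>R nil w" using nilpotent_form[OF trK detK] by blast
 have sc: "(x *\<^sub>R X) *v u = x *\<^sub>R (X *v u)" for x u and X :: "real^2^2"
  by(simp add: vec_eq2 algebra_simps)
 obtain u where u: "dt w u \<noteq> 0"
 proof -
  have "dt w (vector [- w$2, w$1]) = w$1*w$1 + w$2*w$2" by(simp add: dt_def)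
  moreover have "w$1*w$1 + w$2*w$2 \<noteq> 0" using w(1) by(auto simp: vec_eq2 sum_squares_eq_zero_iff)
  ultimately show thesis using that by metis
 qed
 have lk: "l *\<^sub>R (dt w u *\<^sub>R w) = k *\<^sub>R (dt v ((B ** A) *v u) *\<^sub>R v)"
 proof -
  have "K *v u = (?X ** (B ** A)) *v u" using K1 by simp
  thus ?thesis unfolding mat_vec_assoc[symmetric] v(3) w(3) sc nil_vec by simp
 qed
 have "dt (l *\<^sub>R (dt w u *\<^sub>R w)) v = dt (k *\<^sub>R (dt v ((B ** A) *v u) *\<^sub>R v)) v" by(simp only: lk)
 hence "(l * dt w u) * dt w v = 0" by(simp add: dt_lin)
 hence wv: "dt v w = 0" using u w(2) dt_swap[of v w] by simp
 obtain x where x: "w = x *\<^sub>R v" using dt_zero_parallel[OF wv v(1)] by blast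
 \<comment> \<open>Since \<open>trace (nil w ** A) = dt w (A *v w)\<close>, the vanishing trace
   makes \<open>w\<close>, and with it \<open>v\<close>, an eigenvector of \<open>A\<close>.\<close>
 have "trace (K ** A) = 0" by(simp add: K_def trace2 algebra_simps)
 hence "l * x * x * dt v (A *v v) = 0"
  unfolding w(3) x nil_scale by(simp add: trace2 nil_def dt_def power2_eq_square algebra_simps)
 moreover have "x \<noteq> 0" using x w(1) by auto
 ultimately have "dt v (A *v v) = 0" using w(2) by simp
 then obtain m where m: "A *v v = m *\<^sub>R v" using dt_zero_parallel[OF _ v(1)] by blast
 have "m = 1 \<or> m = -1" by(rule parabolic_fix_unit[OF v(1) P v(2) A_G m])
 \<comment> \<open>Cayley-Hamilton on the eigenvector: an eigenvalue 1 or -1 would give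
   \<open>A\<close> the trace 2 or -2.\<close>
 moreover have "m * m - trace A * m + 1 = 0"
 proof -
  have "A *v (A *v v) = trace A *\<^sub>R (A *v v) - v"
   using SL2D[OF A_SL2] by(simp add: vec_eq2 trace2 algebra_simps)
  hence "(m * m - trace A * m + 1) *\<^sub>R v = 0"
   unfolding m mat_vec_scale by(simp add: algebra_simps)
  thus ?thesis using v(1) by simp
 qed
 ultimately show False using A_trace by auto
qed

end

section \<open>The hyperelliptic involution and the extended group\<close>

context cusped_torus
begin

lemma cayley: "X ** X = trace X *\<^sub>R X - det X *\<^sub>R mat 1" for X :: "real^2^2"
 by(simp add: mat_eq2 trace2 det_2 algebra_simps)

text \<open>Half the commutator of \<open>A\<close> and \<open>B\<close> in the matrix algebra represents the hyperelliptic
 involution: it inverts both generators.\<close>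

definition hyp :: "real^2^2" where "hyp = (1/2) *\<^sub>R (A ** B - B ** A)"

lemma trace_hyp: "trace hyp = 0"
 by(simp add: hyp_def trace2 algebra_simps)

text \<open>Here the trace -2 enters: \<open>det (comm - mat 1) = 2 - trace comm = 4\<close>, and
  the factor 1/2 in \<open>hyp\<close> normalises this to 1.\<close>

lemma hyp_SL2: "hyp \<in> SL2"
proof -
 let ?K = "A ** B - B ** A"
 have "comm ** (B ** A) = A ** (B ** (adj A ** (adj B ** (B ** A))))"
  by(simp add: comm_def matrix_mul_assoc)
 also have "\<dots> = A ** B" by(simp add: adj_cancel_left A_SL2 B_SL2) (simp add: adj_mult A_SL2)
 finally have "?K = (comm - mat 1) ** (B ** A)" by(simp add: matrix_add_mult_distrib2)
 moreover have "det (B ** A) = 1" using A_SL2 B_SL2 by(simp add: SL2_def det_mul)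
 moreover have "det (comm - mat 1) = 4"
  using comm_trace comm_parabolic(1) by(simp add: det_2 SL2_iff trace2 algebra_simps)
 ultimately have "det ?K = 4" by(simp only: det_mul)
 moreover have "det hyp = (1/4) * det ?K" by(simp add: hyp_def det_2 algebra_simps)
 ultimately show ?thesis by(simp add: SL2_def)
qed

lemma adj_trace0: "trace X = 0 ==> adj X = - X"
 by(simp add: mat_eq2 trace2 add_eq_0_iff2)

lemma adj_hyp: "adj hyp = - hyp"
 by(rule adj_trace0[OF trace_hyp])

lemma hyp_square: "hyp ** hyp = - mat 1"
 using adj_mult(2)[OF hyp_SL2] unfolding adj_hyp by(simp add: mat_uminus_right minus_equation_iff[of "hyp ** hyp"])

lemma hyp_square2: "hyp ** (hyp ** X) = - X" for X :: "real^2^2"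
 by(simp add: matrix_mul_assoc hyp_square mat_uminus_left)

text \<open>With \<open>K = A ** B - B ** A\<close>, Cayley-Hamilton for \<open>A\<close> gives
  \<open>A ** K ** A = K\<close>, which says that \<open>K\<close> conjugates \<open>A\<close> to
  its inverse; the same holds for \<open>B\<close>.\<close>

lemma hyp_A: "hyp ** A = adj A ** hyp" and hyp_B: "hyp ** B = adj B ** hyp"
proof -
 let ?K = "A ** B - B ** A"
 have cA: "A ** A = trace A *\<^sub>R A - mat 1" using cayley[of A] A_SL2 by(simp add: SL2_def)
 have cB: "B ** B = trace B *\<^sub>R B - mat 1" using cayley[of B] B_SL2 by(simp add: SL2_def)
 have "A ** ?K ** A = (A ** A) ** B ** A - A ** B ** (A ** A)"
  by(simp add: matrix_add_mult_distrib2 matrix_mul_assoc)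
 also have "\<dots> = ?K" unfolding cA by(simp add: matrix_add_mult_distrib2 matrix_mul_assoc)
 finally have kA: "A ** (?K ** A) = ?K" by(simp add: matrix_mul_assoc)
 have "adj A ** ?K = adj A ** (A ** (?K ** A))" by(simp only: kA)
 hence "?K ** A = adj A ** ?K" using A_SL2 by(simp add: adj_cancel_left)
 thus "hyp ** A = adj A ** hyp" by(simp add: hyp_def matrix_add_mult_distrib2)
 have "B ** ?K ** B = B ** A ** (B ** B) - (B ** B) ** A ** B"
  by(simp add: matrix_add_mult_distrib2 matrix_mul_assoc)
 also have "\<dots> = ?K" unfolding cB by(simp add: matrix_add_mult_distrib2 matrix_mul_assoc)
 finally have kB: "B ** (?K ** B) = ?K" by(simp add: matrix_mul_assoc)
 have "adj B ** ?K = adj B ** (B ** (?K ** B))" by(simp only: kB)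
 hence "?K ** B = adj B ** ?K" using B_SL2 by(simp add: adj_cancel_left)
 thus "hyp ** B = adj B ** hyp" by(simp add: hyp_def matrix_add_mult_distrib2)
qed

lemma hyp_normalizes: "g \<in> \<Gamma> ==> hyp ** g ** adj hyp \<in> \<Gamma>"
proof -
 let ?H = "{g. hyp ** g ** adj hyp \<in> \<Gamma>}"
 have "\<Gamma> \<subseteq> ?H"
 proof (rule G_minimal)
  have c: "hyp ** A ** adj hyp = adj A" "hyp ** B ** adj hyp = adj B"
   unfolding hyp_A hyp_B by(simp_all add: matrix_mul_assoc[symmetric] adj_mult hyp_SL2)
  have a: "hyp ** adj X ** adj hyp = adj (hyp ** X ** adj hyp)" for X
   by(simp add: adj_mult_distrib matrix_mul_assoc)
  show "A \<in> ?H" "B \<in> ?H" using c A_G B_G by auto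
  show "adj A \<in> ?H" "adj B \<in> ?H" unfolding mem_Collect_eq a c using A_G B_G by auto
  show "mat 1 \<in> ?H" by(simp add: adj_mult hyp_SL2)
  show "g ** h \<in> ?H" if "g \<in> ?H" "h \<in> ?H" for g h
  proof -
   have "(hyp ** g ** adj hyp) ** (hyp ** h ** adj hyp) = hyp ** g ** (adj hyp ** hyp) ** h ** adj hyp"
    by(simp only: matrix_mul_assoc)
   also have "\<dots> = hyp ** (g ** h) ** adj hyp" by(simp add: adj_mult hyp_SL2 matrix_mul_assoc)
   finally show ?thesis using that G_mult by fastforce
  qed
  show "- g \<in> ?H" if "g \<in> ?H" for g using that by(simp add: mat_uminus_left mat_uminus_right)
 qed
 thus "g \<in> \<Gamma> ==> ?thesis" by blast
qed

text \<open>The coset of the hyperelliptic involution. Products follow the parity rule: two odd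
  factors give an element of \<Gamma>.\<close>

definition odd_part :: "(real^2^2) set" ("\<Delta>") where "\<Delta> = {hyp ** g | g. g \<in> \<Gamma>}"

lemma odd_SL2: "g \<in> \<Delta> ==> g \<in> SL2"
 using G_SL2 hyp_SL2 by(auto simp: odd_part_def)

lemma odd_even: "g \<in> \<Delta> ==> h \<in> \<Gamma> ==> g ** h \<in> \<Delta>"
 unfolding odd_part_def using G_mult by(fastforce simp: matrix_mul_assoc[symmetric])

lemma even_hyp: "h \<in> \<Gamma> ==> h ** hyp = hyp ** (hyp ** h ** adj hyp)"
 by(simp add: adj_hyp matrix_mul_assoc hyp_square mat_uminus_left mat_uminus_right)

lemma even_odd: "h \<in> \<Gamma> ==> g \<in> \<Delta> ==> h ** g \<in> \<Delta>"
proof -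
 assume a: "h \<in> \<Gamma>" "g \<in> \<Delta>"
 then obtain g' where g: "g = hyp ** g'" "g' \<in> \<Gamma>" by(auto simp: odd_part_def)
 have "h ** g = hyp ** ((hyp ** h ** adj hyp) ** g')"
  unfolding g matrix_mul_assoc[of h hyp] even_hyp[OF a(1)] by(simp add: matrix_mul_assoc)
 thus ?thesis unfolding odd_part_def using G_mult[OF hyp_normalizes[OF a(1)] g(2)] by blast
qed

lemma odd_odd: "g \<in> \<Delta> ==> h \<in> \<Delta> ==> g ** h \<in> \<Gamma>"
proof -
 assume a: "g \<in> \<Delta>" "h \<in> \<Delta>"
 then obtain g' where g: "g = hyp ** g'" "g' \<in> \<Gamma>" by(auto simp: odd_part_def)
 have "g' ** h \<in> \<Delta>" using even_odd g(2) a(2) by blast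
 then obtain k where k: "g' ** h = hyp ** k" "k \<in> \<Gamma>" by(auto simp: odd_part_def)
 have "g ** h = - k" unfolding g matrix_mul_assoc[symmetric] k hyp_square2 ..
 thus ?thesis using k(2) by simp
qed

lemma hyp_odd: "hyp \<in> \<Delta>"
 unfolding odd_part_def by(rule CollectI, rule exI[of _ "mat 1"]) simp

lemma odd_uminus: "g \<in> \<Delta> ==> - g \<in> \<Delta>"
 using odd_even[of g "- mat 1"] by(simp add: mat_uminus_right)

lemma odd_uminus_iff [simp]: "- g \<in> \<Delta> \<longleftrightarrow> g \<in> \<Delta>"
 using odd_uminus[of g] odd_uminus[of "- g"] by auto

lemma odd_adj: "g \<in> \<Delta> ==> adj g \<in> \<Delta>"
proof -
 assume "g \<in> \<Delta>"
 then obtain g' where g: "g = hyp ** g'" "g' \<in> \<Gamma>" by(auto simp: odd_part_def)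
 have "adj g = adj g' ** (- hyp)" unfolding g adj_mult_distrib adj_hyp ..
 thus ?thesis using even_odd[of "adj g'" "- hyp"] g(2) hyp_odd by simp
qed

definition ext_group :: "(real^2^2) set" ("\<Lambda>") where "\<Lambda> = \<Gamma> \<union> \<Delta>"

lemma ext_SL2: "g \<in> \<Lambda> ==> g \<in> SL2"
 by(auto simp: ext_group_def G_SL2 odd_SL2)

lemma ext_mult: "g \<in> \<Lambda> ==> h \<in> \<Lambda> ==> g ** h \<in> \<Lambda>"
 by(auto simp: ext_group_def G_mult odd_odd odd_even even_odd)

lemma ext_adj: "g \<in> \<Lambda> ==> adj g \<in> \<Lambda>"
 by(auto simp: ext_group_def odd_adj)

lemma ext_uminus: "g \<in> \<Lambda> ==> - g \<in> \<Lambda>"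
 by(auto simp: ext_group_def)

lemma ext_normalizes: "g \<in> \<Lambda> ==> h \<in> \<Gamma> ==> g ** h ** adj g \<in> \<Gamma>"
 by(auto simp: ext_group_def G_mult odd_odd odd_even odd_adj)

lemma ext_conj_odd: "g \<in> \<Lambda> ==> h \<in> \<Delta> ==> g ** h ** adj g \<in> \<Delta>"
 by(auto simp: ext_group_def odd_even even_odd odd_adj odd_odd)

subsection \<open>The cusps\<close>

text \<open>A parabolic up to sign lying in \<Delta>: its square is minus the commutator of
  \<open>B\<close> and \<open>adj A\<close>, of trace 2. It fixes a boundary point, and so makes odd
  elements respect the orbit of the corresponding cusp.\<close>

definition half_par :: "real^2^2" where "half_par = - (B ** hyp ** A)"

lemma half_par_odd: "half_par \<in> \<Delta>"
 unfolding half_par_def using even_odd[OF B_G hyp_odd] odd_even[OF _ A_G] by simp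

lemma half_par_square: "half_par ** half_par = - (B ** adj A ** adj B ** A)"
proof -
 have "half_par ** half_par = B ** (hyp ** A) ** (B ** (hyp ** A))"
  by(simp add: half_par_def mat_uminus_left mat_uminus_right matrix_mul_assoc)
 also have "\<dots> = B ** adj A ** (hyp ** B) ** (hyp ** A)" unfolding hyp_A by(simp only: matrix_mul_assoc)
 also have "\<dots> = B ** adj A ** adj B ** (hyp ** (hyp ** A))" unfolding hyp_B by(simp only: matrix_mul_assoc)
 finally show ?thesis unfolding hyp_square2 by(simp add: mat_uminus_right)
qed

lemma half_par_form: "\<exists>v e k. v \<noteq> 0 \<and> (e = 1 \<or> e = -1) \<and> k \<noteq> 0 \<and> half_par = mat e + k *\<^sub>R nil v"
proof -
 let ?T = half_par
 have T: "?T \<in> SL2" using half_par_odd odd_SL2 by blast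
 have sq: "?T ** ?T = trace ?T *\<^sub>R ?T - mat 1" using cayley[of ?T] T by(simp add: SL2_def)
 have "trace (?T ** ?T) = - trace (B ** adj A ** adj B ** A)" by(simp add: half_par_square trace_lin)
 also have "trace (B ** adj A ** adj B ** A) = trace comm"
  using trace_mul_sym[of "B ** adj A ** adj B" A] by(simp add: comm_def matrix_mul_assoc)
 finally have "trace (?T ** ?T) = 2" using comm_trace by simp
 hence "trace ?T * trace ?T = 4" unfolding sq by(simp add: trace_lin) (simp add: trace2)
 hence "(trace ?T)\<^sup>2 = 2\<^sup>2" by(simp add: power2_eq_square)
 hence t: "trace ?T = 2 \<or> trace ?T = - 2" by(simp only: power2_eq_iff)
 then obtain e where e: "e = 1 \<or> e = -1" "trace ?T = 2 * e" by(metis mult_1_right mult_minus1_right)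
 have ne: "?T \<noteq> mat e"
 proof
  assume "?T = mat e"
  hence "?T ** ?T = mat 1" using e(1) by(auto simp: mat_eq2)
  hence c: "B ** adj A ** adj B ** A = - mat 1" using half_par_square by(simp add: minus_equation_iff)
  have "comm = A ** (B ** adj A ** adj B ** A) ** adj A"
   by(simp add: comm_def matrix_mul_assoc[symmetric] adj_mult A_SL2)
  also have "\<dots> = - mat 1" unfolding c using A_SL2 by(simp add: mat_uminus_left mat_uminus_right adj_mult)
  finally show False using comm_parabolic by blast
 qed
 have "trace (?T - mat e) = 0" using e by(simp add: trace_lin) (simp add: trace2)
 moreover have "det (?T - mat e) = 0"
  using T e by(auto simp: det_2 SL2_iff trace2 algebra_simps)
 moreover have "?T - mat e \<noteq> 0" using ne by simp
 ultimately obtain v k where "v \<noteq> 0" "k \<noteq> 0" "?T - mat e = k *\<^sub>R nil v" by(rule nilpotent_form)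
 thus ?thesis using e(1) by(metis add.commute diff_add_cancel)
qed

definition v0 :: "real^2" where
 "v0 = (SOME v. \<exists>e k. v \<noteq> 0 \<and> (e = 1 \<or> e = -1) \<and> k \<noteq> 0 \<and> half_par = mat e + k *\<^sub>R nil v)"

lemma v0_spec: "\<exists>e k. v0 \<noteq> 0 \<and> (e = 1 \<or> e = -1) \<and> k \<noteq> 0 \<and> half_par = mat e + k *\<^sub>R nil v0"
 unfolding v0_def using someI_ex[OF half_par_form] .

lemma v0_nonzero [simp]: "v0 \<noteq> 0"
 using v0_spec by blast

lemma mat_add_vec: "(X + Y) *v u = X *v u + Y *v u" "(x *\<^sub>R X) *v u = x *\<^sub>R (X *v u)" "mat x *v u = x *\<^sub>R u"
 for X Y :: "real^2^2"
 by(simp_all add: vec_eq2 algebra_simps)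

lemma half_par_v0: "half_par *v v0 = v0 \<or> half_par *v v0 = - v0"
 using v0_spec by(auto simp: mat_add_vec nil_vec)

lemma nil_nil [simp]: "nil v ** nil v = 0"
 by(simp add: mat_eq2 nil_def algebra_simps)

text \<open>By equivariance of \<open>nil\<close> the same number is the parameter of a parabolic in
  \<Gamma> at every cusp, see \<open>cusp_parabolic\<close>.\<close>

definition kap :: real where "kap = (SOME k. k \<noteq> 0 \<and> mat 1 + k *\<^sub>R nil v0 \<in> \<Gamma>)"

lemma kap_spec: "kap \<noteq> 0" "mat 1 + kap *\<^sub>R nil v0 \<in> \<Gamma>"
proof -
 obtain e k where e: "e = 1 \<or> e = -1" "k \<noteq> 0" "half_par = mat e + k *\<^sub>R nil v0" using v0_spec by blast
 have "half_par ** half_par = mat 1 + (2 * e * k) *\<^sub>R nil v0"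
  using e(1) unfolding e(3)
  by(simp add: matrix_add_mult_distrib2) (auto simp: mat_eq2 algebra_simps)
 hence "mat 1 + (2 * e * k) *\<^sub>R nil v0 \<in> \<Gamma>" using odd_odd[OF half_par_odd half_par_odd] by simp
 moreover have "2 * e * k \<noteq> 0" using e by auto
 ultimately show "kap \<noteq> 0" "mat 1 + kap *\<^sub>R nil v0 \<in> \<Gamma>"
  unfolding kap_def using someI[of "\<lambda>k. k \<noteq> 0 \<and> mat 1 + k *\<^sub>R nil v0 \<in> \<Gamma>"] by blast+
qed

text \<open>One orbit, taken up to sign, so that the decoration is equivariant and all horoballs
  have the same size.\<close>

definition cusps :: "(real^2) set" where "cusps = {u. \<exists>g\<in>\<Gamma>. u = g *v v0 \<or> u = - (g *v v0)}"

lemma cusps_uminus [simp]: "- u \<in> cusps \<longleftrightarrow> u \<in> cusps"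
 by(auto simp: cusps_def minus_equation_iff[of u])

lemma v0_cusp: "v0 \<in> cusps"
 unfolding cusps_def by(rule CollectI, rule bexI[of _ "mat 1"]) simp_all

lemma cusps_even: "g \<in> \<Gamma> ==> u \<in> cusps ==> g *v u \<in> cusps"
 unfolding cusps_def using G_mult by(fastforce simp: mat_vec_assoc)

text \<open>An odd element composed with the inverse of \<open>half_par\<close> is even, and
  \<open>half_par\<close> fixes \<open>v0\<close> up to sign.\<close>

lemma cusps_ext: "g \<in> \<Lambda> ==> u \<in> cusps ==> g *v u \<in> cusps"
proof -
 assume a: "g \<in> \<Lambda>" "u \<in> cusps"
 show ?thesis
 proof (cases "g \<in> \<Gamma>")
  case False
  hence g: "g \<in> \<Delta>" using a by(simp add: ext_group_def)
  obtain h where h: "h \<in> \<Gamma>" "u = h *v v0 \<or> u = - (h *v v0)" using a(2) by(auto simp: cusps_def)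
  let ?k = "g ** h ** adj half_par"
  have k: "?k \<in> \<Gamma>" using odd_odd odd_even[OF g h(1)] odd_adj[OF half_par_odd] by blast
  have T: "half_par \<in> SL2" using half_par_odd odd_SL2 by blast
  have "adj half_par *v v0 = v0 \<or> adj half_par *v v0 = - v0"
   using half_par_v0 adj_cancel_vec(1)[OF T, of v0] by(auto simp: minus_equation_iff)
  hence "?k *v v0 = g *v (h *v v0) \<or> ?k *v v0 = - (g *v (h *v v0))"
   by(auto simp: mat_vec_assoc[symmetric])
  hence "g *v u = ?k *v v0 \<or> g *v u = - (?k *v v0)" using h(2) by auto
  thus ?thesis unfolding cusps_def using k by blast
 qed (use a cusps_even in blast)
qed

lemma cusp_nonzero: "u \<in> cusps ==> u \<noteq> 0"
proof
 assume "u \<in> cusps" "u = 0"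
 then obtain g where g: "g \<in> \<Gamma>" "g *v v0 = 0" by(auto simp: cusps_def)
 hence "adj g *v (g *v v0) = 0" by(simp add: vec_eq2)
 thus False using adj_cancel_vec(1)[OF G_SL2[OF g(1)]] by simp
qed

lemma cusp_parabolic: "u \<in> cusps ==> mat 1 + kap *\<^sub>R nil u \<in> \<Gamma>"
proof -
 assume "u \<in> cusps"
 then obtain g where g: "g \<in> \<Gamma>" "u = g *v v0 \<or> u = - (g *v v0)" by(auto simp: cusps_def)
 have "g ** (mat 1 + kap *\<^sub>R nil v0) ** adj g = mat 1 + kap *\<^sub>R Ad g (nil v0)"
  using G_SL2[OF g(1)] by(simp add: Ad_SL2 matrix_add_mult_distrib2 adj_mult)
 also have "\<dots> = mat 1 + kap *\<^sub>R nil u" using g G_SL2[OF g(1)] by(auto simp: Ad_nil)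
 finally show ?thesis using G_mult[OF G_mult[OF g(1) kap_spec(2)] G_adj[OF g(1)]] by simp
qed

lemma nil_eq_imp: "nil u = nil v ==> dt u v = 0"
proof -
 assume "nil u = nil v"
 hence "dt u v *\<^sub>R u = 0" using nil_vec[of u v] nil_vec[of v v] by simp
 thus ?thesis by(auto simp: dt_lin)
qed

text \<open>Iterate: \<open>w (Suc n)\<close> is the image of \<open>v0\<close> under the parabolic
  at \<open>w n\<close>. The number \<open>kap * dt v0 (w n)\<close> becomes minus its square at
  each step. Starting below 1 in modulus, it tends to zero without vanishing; then
  \<open>w n\<close> tends to \<open>v0\<close>, and the parabolics at \<open>w n\<close> accumulate
  in \<Gamma>, against \<open>discrete\<close>.\<close>

lemma shimizu:
 assumes u: "u \<in> cusps" and d: "dt v0 u \<noteq> 0"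
 shows "\<bar>kap * dt v0 u\<bar> \<ge> 1"
proof (rule ccontr)
 assume "\<not> ?thesis"
 hence lt: "\<bar>kap * dt v0 u\<bar> < 1" by simp
 define w where "w = rec_nat u (\<lambda>_ w. v0 + (kap * dt w v0) *\<^sub>R w)"
 have w0: "w 0 = u" and wS: "w (Suc n) = v0 + (kap * dt (w n) v0) *\<^sub>R w n" for n by(simp_all add: w_def)
 define x where "x n = kap * dt v0 (w n)" for n
 have wS': "w (Suc n) = v0 - x n *\<^sub>R w n" for n
  unfolding wS x_def dt_swap[of "w n" v0] by simp
 have wV: "w n \<in> cusps" for n
 proof (induction n)
  case (Suc n)
  have "w (Suc n) = (mat 1 + kap *\<^sub>R nil (w n)) *v v0" by(simp add: wS mat_add_vec nil_vec)
  thus ?case using cusps_even[OF cusp_parabolic[OF Suc] v0_cusp] by simp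
 qed (use u w0 in simp)
 have xS: "x (Suc n) = - (x n)\<^sup>2" for n
  unfolding x_def wS' by(simp add: dt_lin x_def power2_eq_square algebra_simps)
 have xn: "\<bar>x n\<bar> \<le> \<bar>x 0\<bar> ^ Suc n \<and> x n \<noteq> 0" for n
 proof (induction n)
  case 0
  thus ?case using d kap_spec(1) by(simp add: x_def w0)
 next
  case (Suc n)
  have x0: "\<bar>x 0\<bar> \<le> 1" using lt by(simp add: x_def w0)
  have "\<bar>x n\<bar> \<le> \<bar>x 0\<bar> * \<bar>x 0\<bar> ^ n" using Suc by simp
  also have "\<dots> \<le> \<bar>x 0\<bar> * 1" using x0 by(intro mult_left_mono power_le_one) auto
  finally have a: "\<bar>x n\<bar> \<le> \<bar>x 0\<bar>" by simp
  have "\<bar>x (Suc n)\<bar> = \<bar>x n\<bar> * \<bar>x n\<bar>" by(simp add: xS power2_eq_square abs_mult)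
  also have "\<dots> \<le> \<bar>x 0\<bar> * \<bar>x 0\<bar> ^ Suc n" using a Suc by(intro mult_mono) auto
  finally show ?case using Suc by(simp add: xS)
 qed
 have x0: "\<bar>x 0\<bar> < 1" using lt by(simp add: x_def w0)
 have xlim: "x \<longlonglongrightarrow> 0"
 proof (rule Lim_null_comparison)
  show "eventually (\<lambda>n. norm (x n) \<le> \<bar>x 0\<bar> ^ Suc n) sequentially" using xn by simp
  show "(\<lambda>n. \<bar>x 0\<bar> ^ Suc n) \<longlonglongrightarrow> 0"
   using x0 by(intro LIMSEQ_ignore_initial_segment[of _ 0 1, simplified] LIMSEQ_realpow_zero) auto
 qed
 have xle: "\<bar>x n\<bar> \<le> \<bar>x 0\<bar>" for n
 proof -
  have "\<bar>x 0\<bar> * \<bar>x 0\<bar> ^ n \<le> \<bar>x 0\<bar> * 1" using x0 by(intro mult_left_mono power_le_one) auto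
  thus ?thesis using xn[of n] by simp
 qed
 \<comment> \<open>A bound preserved by the estimate \<open>norm (w (Suc n)) \<le> norm v0 + \<bar>x
   0\<bar> * norm (w n)\<close>: the fixed point of this affine map, enlarged to cover the
   start.\<close>
 define C where "C = max (norm u) (norm v0 / (1 - \<bar>x 0\<bar>))"
 have C: "norm (w n) \<le> C" for n
 proof (induction n)
  case (Suc n)
  have "norm v0 / (1 - \<bar>x 0\<bar>) \<le> C" by(simp add: C_def)
  hence c: "norm v0 \<le> C * (1 - \<bar>x 0\<bar>)" using x0 by(simp add: divide_le_eq)
  have "norm (w (Suc n)) \<le> norm v0 + \<bar>x n\<bar> * norm (w n)"
   unfolding wS' using norm_triangle_ineq4[of v0 "x n *\<^sub>R w n"] by simp
  also have "\<bar>x n\<bar> * norm (w n) \<le> \<bar>x 0\<bar> * C" using xle Suc by(intro mult_mono) auto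
  finally show ?case using c by(simp add: algebra_simps)
 qed (simp add: w0 C_def)
 have "(\<lambda>n. x n *\<^sub>R w n) \<longlonglongrightarrow> 0"
 proof (rule Lim_null_comparison)
  show "eventually (\<lambda>n. norm (x n *\<^sub>R w n) \<le> \<bar>x n\<bar> * C) sequentially"
   using C by(simp add: mult_left_mono)
  show "(\<lambda>n. \<bar>x n\<bar> * C) \<longlonglongrightarrow> 0"
   using tendsto_mult_left_zero[OF tendsto_rabs_zero[OF xlim]] by simp
 qed
 hence "(\<lambda>n. v0 - x n *\<^sub>R w n) \<longlonglongrightarrow> v0 - 0" by(intro tendsto_diff tendsto_const)
 hence "(\<lambda>n. w (Suc n)) \<longlonglongrightarrow> v0" by(simp add: wS')
 hence wl: "(\<lambda>n. w (Suc n) $ i) \<longlonglongrightarrow> v0 $ i" for i by(rule tendsto_vec_nth)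
 let ?g = "\<lambda>n. mat 1 + kap *\<^sub>R nil (w (Suc n))"
 have gl: "(\<lambda>n. (?g n)$i$j) \<longlonglongrightarrow> (mat 1 + kap *\<^sub>R nil v0)$i$j" for i j
 proof -
  have "(\<lambda>n. (nil (w (Suc n)))$i$j) \<longlonglongrightarrow> (nil v0)$i$j"
   using exhaust_2[of i] exhaust_2[of j] unfolding nil_def
   by(elim disjE) (auto intro!: tendsto_intros wl)
  thus ?thesis by(auto intro!: tendsto_intros)
 qed
 have "eventually (\<lambda>n. ?g n = mat 1 + kap *\<^sub>R nil v0 \<or> ?g n = - (mat 1 + kap *\<^sub>R nil v0)) sequentially"
  by(rule discrete[OF gl cusp_parabolic[OF wV] kap_spec(2)])
 then obtain n where n: "?g n = mat 1 + kap *\<^sub>R nil v0 \<or> ?g n = - (mat 1 + kap *\<^sub>R nil v0)"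
  by(auto simp: eventually_sequentially)
 have t: "trace (mat 1 + kap *\<^sub>R nil v) = 2" for v by(simp add: trace_lin) (simp add: trace2)
 have "?g n \<noteq> - (mat 1 + kap *\<^sub>R nil v0)"
 proof
  assume "?g n = - (mat 1 + kap *\<^sub>R nil v0)"
  hence "trace (?g n) = trace (- (mat 1 + kap *\<^sub>R nil v0))" by(rule arg_cong)
  also have "\<dots> = - 2" by(simp only: trace_lin(3) t)
  finally show False by(simp only: t)
 qed
 hence "nil (w (Suc n)) = nil v0" using n kap_spec(1) by simp
 hence "dt v0 (w (Suc n)) = 0" using nil_eq_imp dt_swap[of v0] by fastforce
 thus False using xn[of "Suc n"] by(simp add: x_def)
qed

lemma cusp_dt: "u \<in> cusps ==> v \<in> cusps ==> dt u v \<noteq> 0 ==> \<bar>kap * dt u v\<bar> \<ge> 1"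
proof -
 assume a: "u \<in> cusps" "v \<in> cusps" "dt u v \<noteq> 0"
 then obtain g where g: "g \<in> \<Gamma>" "u = g *v v0 \<or> u = - (g *v v0)" by(auto simp: cusps_def)
 have e: "dt (g *v v0) v = dt v0 (adj g *v v)"
  using dt_mat[OF G_SL2[OF g(1)], of v0 "adj g *v v"] adj_cancel_vec(2)[OF G_SL2[OF g(1)]] by simp
 have "\<bar>dt u v\<bar> = \<bar>dt v0 (adj g *v v)\<bar>" using g(2) e by(auto simp: dt_lin)
 moreover have "adj g *v v \<in> cusps" using g(1) a(2) cusps_even by simp
 ultimately show ?thesis using shimizu[of "adj g *v v"] a(3) by(simp add: abs_mult)
qed

text \<open>Parallel cusps yield an element of \<Gamma> that rescales \<open>v0\<close>, and by
  \<open>parabolic_fix_unit\<close> only by a sign. So every parabolic fixed point in the orbit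
  carries a single horoball.\<close>

lemma cusp_parallel: "u \<in> cusps ==> v \<in> cusps ==> dt u v = 0 ==> v = u \<or> v = - u"
proof -
 assume a: "u \<in> cusps" "v \<in> cusps" "dt u v = 0"
 obtain g where g: "g \<in> \<Gamma>" "u = g *v v0 \<or> u = - (g *v v0)" using a by(auto simp: cusps_def)
 obtain h where h: "h \<in> \<Gamma>" "v = h *v v0 \<or> v = - (h *v v0)" using a by(auto simp: cusps_def)
 have "dt (g *v v0) (h *v v0) = 0" using a(3) g(2) h(2) by(auto simp: dt_lin)
 moreover have "g *v v0 \<noteq> 0" using cusp_nonzero[OF a(1)] g(2) by auto
 ultimately obtain x where x: "h *v v0 = x *\<^sub>R (g *v v0)" using dt_zero_parallel by blast
 have "(adj g ** h) *v v0 = x *\<^sub>R v0"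
  unfolding mat_vec_assoc[symmetric] x mat_vec_scale adj_cancel_vec[OF G_SL2[OF g(1)]] ..
 hence "x = 1 \<or> x = -1"
  using parabolic_fix_unit[OF v0_nonzero kap_spec(2,1), of "adj g ** h" x] g(1) h(1) G_mult by simp
 thus ?thesis using g(2) h(2) x by auto
qed

text \<open>At height above \<open>\<bar>kap\<bar>\<close> over two cusps, \<open>ht_prod\<close>
  would bound \<open>\<bar>kap * dt u v\<bar>\<close> strictly below 1, against
  \<open>cusp_dt\<close>.\<close>

lemma horoball_disjoint:
 assumes "u \<in> cusps" "v \<in> cusps" "Im z > 0" "ht u z > \<bar>kap\<bar>" "ht v z > \<bar>kap\<bar>"
 shows "v = u \<or> v = - u"
proof (cases "dt u v = 0")
 case False
 have k: "\<bar>kap\<bar> > 0" using kap_spec(1) by simp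
 have "1 \<le> \<bar>kap * dt u v\<bar>\<^sup>2" using cusp_dt[OF assms(1,2) False] by(intro one_le_power)
 hence "1 \<le> \<bar>kap\<bar> * \<bar>kap\<bar> * (dt u v)\<^sup>2" by(simp add: power2_eq_square abs_mult mult_ac)
 also have "\<dots> < ht u z * ht v z * (dt u v)\<^sup>2"
  using assms(4,5) k False by(intro mult_strict_right_mono mult_strict_mono) auto
 finally show ?thesis using ht_prod[of u v z] cusp_nonzero assms by fastforce
qed (use cusp_parallel assms in blast)

end

section \<open>Neighbourhoods of the puncture and ends of lifted arcs\<close>

text \<open>The displacement is \<open>k * (ev u w)\<^sup>2 / jac\<close>, and the square of
  \<open>norm (ev u w)\<close> is \<open>Im w / ht u w\<close>. Depth enters a second time to keep
  \<open>jac\<close> away from zero, by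
  \<open>\<bar>u$2\<bar> * Im w \<le> norm (ev u w)\<close>.\<close>

lemma parabolic_move:
 assumes "Im w > 0" "ht u w > 2 * \<bar>k\<bar>"
 shows "norm (moeb (mat 1 + k *\<^sub>R nil u) w - w) \<le> 2 * \<bar>k\<bar> * Im w / ht u w"
proof (cases "u = 0")
 case True
 thus ?thesis using assms by(simp add: ht_def ev_def)
next
 case False
 let ?M = "mat 1 + k *\<^sub>R nil u" and ?e = "ev u w"
 have e: "?e \<noteq> 0" using ev_nonzero[OF False assms(1)] .
 have h: "ht u w > 0" using assms(1) e by(simp add: ht_def)
 have sq: "(norm ?e)\<^sup>2 = Im w / ht u w" using e h assms(1) by(simp add: ht_def)
 have u2: "\<bar>u$2\<bar> * Im w \<le> norm ?e"
  using abs_Im_le_cmod[of ?e] assms(1) by(simp add: ev_def abs_mult)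
 have j: "jac ?M w = 1 + of_real (k * u$2) * ?e"
  by(simp add: jac_def nil_def ev_def algebra_simps)
 have "\<bar>k * u$2\<bar> * norm ?e * Im w = \<bar>k\<bar> * norm ?e * (\<bar>u$2\<bar> * Im w)" by(simp add: abs_mult)
 also have "\<dots> \<le> \<bar>k\<bar> * norm ?e * norm ?e" using u2 by(intro mult_left_mono) auto
 also have "\<dots> = \<bar>k\<bar> * (Im w / ht u w)" unfolding sq[symmetric] by(simp add: power2_eq_square)
 finally have "(\<bar>k * u$2\<bar> * norm ?e) * Im w \<le> (\<bar>k\<bar> / ht u w) * Im w" by simp
 hence "\<bar>k * u$2\<bar> * norm ?e \<le> \<bar>k\<bar> / ht u w" using assms(1) by(rule mult_right_le_imp_le)
 also have "\<bar>k\<bar> / ht u w \<le> 1/2" using assms(2) h by(simp add: field_simps)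
 finally have "norm (of_real (k * u$2) * ?e) \<le> 1/2" by(simp add: norm_mult abs_mult)
 hence nj: "norm (jac ?M w) \<ge> 1/2"
  unfolding j using norm_triangle_ineq2[of 1 "- (of_real (k * u$2) * ?e)"] by simp
 have j0: "jac ?M w \<noteq> 0" using nj by auto
 have "moeb ?M w - w = of_real k * ?e\<^sup>2 / jac ?M w"
 proof -
  have "moeb ?M w - w = ((of_real (?M$1$1) * w + of_real (?M$1$2)) - w * jac ?M w) / jac ?M w"
   using j0 by(simp add: moeb_jac diff_divide_distrib)
  also have "(of_real (?M$1$1) * w + of_real (?M$1$2)) - w * jac ?M w = of_real k * ?e\<^sup>2"
   by(simp add: jac_def nil_def ev_def power2_eq_square algebra_simps)
  finally show ?thesis .
 qed
 hence "norm (moeb ?M w - w) = \<bar>k\<bar> * (Im w / ht u w) / norm (jac ?M w)"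
  by(simp add: norm_divide norm_mult norm_power sq)
 also have "\<dots> \<le> \<bar>k\<bar> * (Im w / ht u w) / (1/2)"
  using nj h assms(1) by(intro divide_left_mono) auto
 finally show ?thesis by(simp add: mult_ac)
qed

lemma continuous_ht: "u \<noteq> 0 ==> continuous_on half_plane (ht u)"
 unfolding ht_def
 by(intro continuous_intros) (use ev_nonzero[of u] in \<open>auto simp: half_plane_iff ev_def intro!: continuous_intros\<close>)

lemma open_horoball: "u \<noteq> 0 ==> open {z \<in> half_plane. ht u z > t}"
proof -
 assume u: "u \<noteq> 0"
 have o: "open half_plane" unfolding half_plane_def by(rule open_halfspace_Im_gt)
 have "{z \<in> half_plane. ht u z > t} = half_plane \<inter> ht u -` {t<..}" by auto
 thus ?thesis using continuous_open_preimage[OF continuous_ht[OF u] o open_greaterThan[of t]] by simp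
qed

lemma compact_torus: "compact torus"
 unfolding torus_def by(intro compact_Times compact_sphere)

text \<open>Discs in the angle coordinates around the puncture. For radius at most 1, which is below
  \<pi>, only the centre is sent to the puncture, so removing the puncture leaves a connected
  set.\<close>

definition disc_chart :: "real => (complex \<times> complex) set" where
 "disc_chart r = (\<lambda>(a, b). (cis a, cis b)) ` ball (0, 0) r"

lemma punctured_disc_connected: "r \<le> 1 ==> connected (disc_chart r - {puncture})"
proof -
 assume r: "r \<le> 1"
 let ?f = "\<lambda>(a::real, b::real). (cis a, cis b)"
 have "?f ` (ball (0, 0) r - {(0,0)}) = disc_chart r - {puncture}"
 proof -
  have z: "x = (0, 0)" if "x \<in> ball (0, 0) r" "?f x = puncture" for x
  proof -
   obtain a b where x: "x = (a, b)" by(cases x)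
   have "norm a \<le> norm (a, b)" "norm b \<le> norm (a, b)"
    using norm_fst_le[of a b] norm_snd_le[of b a] by simp_all
   moreover have "norm (a, b) < 1" using that(1) r unfolding x mem_ball zero_prod_def[symmetric] dist_0_norm by linarith
   ultimately have ab: "\<bar>a\<bar> < 1" "\<bar>b\<bar> < 1" by simp_all
   have "sin a = 0" "sin b = 0" using that(2) by(auto simp: x puncture_def complex_eq_iff)
   moreover have "(0::real) = 0 --> 1 < pi" using pi_gt3 by simp
   ultimately have "a = 0" "b = 0" using ab sin_eq_0_pi[of a] sin_eq_0_pi[of b] by auto
   thus ?thesis using x by simp
  qed
  have "?f (0, 0) = puncture" by(simp add: puncture_def)
  thus ?thesis unfolding disc_chart_def using z by auto
 qed
 moreover have "connected (ball (0::real, 0::real) r - {(0,0)})"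
  using connected_punctured_ball[of "(0::real,0::real)" r] by simp
 moreover have "continuous_on UNIV ?f"
  by(simp add: case_prod_unfold) (intro continuous_intros)
 ultimately show ?thesis by(metis connected_continuous_image continuous_on_subset subset_UNIV)
qed

lemma disc_chart_torus: "disc_chart r \<subseteq> torus"
 by(auto simp: disc_chart_def torus_def)

lemma disc_chart_small:
 assumes "open U" "puncture \<in> U"
 obtains r where "0 < r" "r \<le> 1" "disc_chart r \<subseteq> U"
proof -
 let ?f = "\<lambda>(a::real, b::real). (cis a, cis b)"
 have "continuous_on UNIV ?f"
  by(simp add: case_prod_unfold) (intro continuous_intros)
 hence "open (?f -` U)" using assms(1) by(simp add: continuous_on_open_vimage)
 moreover have "(0, 0) \<in> ?f -` U" using assms(2) by(simp add: puncture_def)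
 ultimately obtain e where e: "e > 0" "ball (0, 0) e \<subseteq> ?f -` U" by(meson openE)
 show thesis
 proof (rule that[of "min e 1"])
  show "disc_chart (min e 1) \<subseteq> U" using e(2) by(fastforce simp: disc_chart_def)
 qed (use e in auto)
qed

lemma disc_chart_nbhd:
 assumes "r > 0"
 obtains U where "open U" "puncture \<in> U" "U \<inter> torus \<subseteq> disc_chart r"
proof -
 let ?g = "\<lambda>z. Im (Ln z)"
 let ?S = "{z :: complex. Re z > 0}"
 have oS: "open ?S" by(rule open_halfspace_Re_gt)
 have c: "continuous_on ?S ?g"
  by(intro continuous_intros) (auto simp: complex_nonpos_Reals_iff)
 define V where "V = ?S \<inter> ?g -` {-(r/2)<..<r/2}"
 have oV: "open V" unfolding V_def using c oS by(metis Int_commute continuous_on_open_vimage open_greaterThanLessThan)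
 have p: "(1::complex) \<in> V" using assms by(simp add: V_def)
 show thesis
 proof (rule that[of "V \<times> V"])
  show "open (V \<times> V)" using oV by(simp add: open_Times)
  show "puncture \<in> V \<times> V" using p by(simp add: puncture_def)
  show "V \<times> V \<inter> torus \<subseteq> disc_chart r"
  proof
   fix y assume y: "y \<in> V \<times> V \<inter> torus"
   then obtain a b where ab: "y = (a, b)" "a \<in> V" "b \<in> V" "norm a = 1" "norm b = 1"
    by(auto simp: torus_def)
   have e: "w = cis (?g w)" if "norm w = 1" for w
   proof -
    have "w \<noteq> 0" using that by auto
    have "w = exp (Ln w)" using that by(subst exp_Ln) auto
    also have "Ln w = \<i> * of_real (?g w)" using that \<open>w \<noteq> 0\<close> by(simp add: complex_eq_iff Re_Ln) 
    finally show ?thesis by(simp only: cis_conv_exp)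
   qed
   have "norm (?g a, ?g b) \<le> norm (?g a) + norm (?g b)" by(rule norm_Pair_le)
   also have "\<dots> < r" using ab by(auto simp: V_def)
   finally have "(?g a, ?g b) \<in> ball (0, 0) r" by(simp add: dist_norm norm_Pair)
   thus "y \<in> disc_chart r" unfolding disc_chart_def ab(1)
    using e[OF ab(4)] e[OF ab(5)] by(intro image_eqI[of _ _ "(?g a, ?g b)"]) auto
  qed
 qed
qed

context cusped_torus
begin

lemma parabolic_ne: "u \<in> cusps ==> mat 1 + kap *\<^sub>R nil u \<noteq> mat 1 \<and> mat 1 + kap *\<^sub>R nil u \<noteq> - mat 1"
proof -
 assume u: "u \<in> cusps"
 have "nil u \<noteq> 0" using cusp_nonzero[OF u] by(auto simp: nil_def mat_eq2 vec_eq2)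
 hence 1: "mat 1 + kap *\<^sub>R nil u \<noteq> mat 1" using kap_spec(1) by simp
 have "trace (mat 1 + kap *\<^sub>R nil u) = 2" by(simp add: trace_lin) (simp add: trace2)
 moreover have "trace (- mat 1 :: real^2^2) = - 2" by(simp add: trace2)
 ultimately show ?thesis using 1 arg_cong[of "mat 1 + kap *\<^sub>R nil u" "- mat 1" trace] by auto
qed

text \<open>Deep inside a horoball the parabolic motion is almost the identity, so a deep point cannot
 project into an evenly covered neighbourhood of a point of the punctured torus.\<close>

lemma q_tends_puncture:
 assumes U: "open U" "puncture \<in> U"
 obtains t where "t > 0" "\<And>z. Im z > 0 ==> ht v0 z > t ==> q z \<in> U"
proof -
 have "\<exists>n::nat. \<forall>z. Im z > 0 \<and> ht v0 z > real (Suc n) --> q z \<in> U"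
 proof (rule ccontr)
  assume "\<not> ?thesis"
  hence "\<forall>n. \<exists>z. Im z > 0 \<and> ht v0 z > real (Suc n) \<and> q z \<notin> U" by auto
  then obtain z where z: "\<And>n. Im (z n) > 0" "\<And>n. ht v0 (z n) > real (Suc n)" "\<And>n. q (z n) \<notin> U" by metis
  have qz: "\<forall>n. q (z n) \<in> torus - U" using q_punctured[OF z(1)] z(3) by(auto simp: punctured_torus_def)
  have "compact (torus - U)" using compact_torus U(1) compact_diff by blast
  hence "\<exists>l\<in>torus - U. \<exists>r. strict_mono r \<and> ((\<lambda>n. q (z n)) \<circ> r) \<longlonglongrightarrow> l"
   unfolding compact_def by(rule allE[of _ "\<lambda>n. q (z n)"]) (rule mp[OF _ qz])
  then obtain y r where y: "y \<in> torus - U" "strict_mono (r :: nat => nat)" "((\<lambda>n. q (z n)) \<circ> r) \<longlonglongrightarrow> y"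
   by blast
  from y(3) have y3: "(\<lambda>n. q (z (r n))) \<longlonglongrightarrow> y" by(simp only: o_def)
  have "y \<in> punctured_torus" using y(1) U(2) by(auto simp: punctured_torus_def)
  then obtain w where w: "Im w > 0" "q w = y" using q_surj by blast
  obtain W where W: "open W" "w \<in> W" "W \<subseteq> half_plane"
   "\<And>g w. g \<in> \<Gamma> ==> w \<in> W ==> moeb g w \<in> W ==> g = mat 1 \<or> g = - mat 1"
   by(rule proper_nbhd[OF w(1)]) blast
  obtain e where e: "e > 0" "ball w e \<subseteq> W" using W(1,2) openE by blast
  let ?V = "ball w (e/2)"
  have VH: "?V \<subseteq> half_plane" using e W(3) by(auto simp: subset_iff)
  have "openin (top_of_set half_plane) ?V" using VH open_half_plane by(simp add: openin_open_eq)
  hence "openin (top_of_set punctured_torus) (q ` ?V)" using covering_space_open_map[OF covering] by blast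
  then obtain Y where Y: "open Y" "q ` ?V = punctured_torus \<inter> Y" by(metis openin_open)
  have "y \<in> Y" using Y w e by(metis IntD2 centre_in_ball half_gt_zero imageI)
  hence "eventually (\<lambda>n. q (z (r n)) \<in> Y) sequentially" using y3 Y(1) topological_tendstoD by blast
  then obtain m where m: "\<And>n. n \<ge> m ==> q (z (r n)) \<in> Y" by(auto simp: eventually_sequentially)
  \<comment> \<open>The first bound makes \<open>parabolic_move\<close> applicable; the second makes
    its estimate, with \<open>Im x < Im w + e\<close>, smaller than \<open>e / 2\<close>.\<close>
  obtain N :: nat where N: "real N > max (2 * \<bar>kap\<bar>) (4 * \<bar>kap\<bar> * (Im w + e) / e)" using reals_Archimedean2 by blast
  define n where "n = max m N"
  have "q (z (r n)) \<in> q ` ?V" using m[of n] Y(2) q_punctured[OF z(1)] by(simp add: n_def)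
  then obtain x where x: "x \<in> ?V" "q x = q (z (r n))" by auto
  have Ix: "Im x > 0" using x(1) VH by(auto simp: half_plane_iff)
  obtain g where g: "g \<in> \<Gamma>" "x = moeb g (z (r n))" using q_eq_iff[OF z(1) Ix] x(2) by metis
  let ?u = "g *v v0"
  have u: "?u \<in> cusps" using cusps_even[OF g(1) v0_cusp] .
  have "real (Suc (r n)) \<ge> real N" using seq_suble[OF y(2), of n] by(simp add: n_def)
  hence hx: "ht ?u x > real N" unfolding g(2) ht_moeb[OF G_SL2[OF g(1)] z(1)] using z(2)[of "r n"] by linarith
  have "\<bar>Im x - Im w\<bar> \<le> norm (x - w)" using abs_Im_le_cmod[of "x - w"] by simp
  hence "Im x < Im w + e" using x(1) e(1) by(simp add: dist_norm norm_minus_commute)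
  have N0: "real N > 0" using N by linarith
  have "norm (moeb (mat 1 + kap *\<^sub>R nil ?u) x - x) \<le> 2 * \<bar>kap\<bar> * Im x / ht ?u x"
   by(rule parabolic_move[OF Ix]) (use hx N in linarith)
  also have "\<dots> \<le> 2 * \<bar>kap\<bar> * (Im w + e) / real N"
   using hx N0 \<open>Im x < Im w + e\<close> Ix by(intro frac_le mult_left_mono) auto
  also have "\<dots> < e / 2" using N N0 e(1) by(simp add: field_simps)
  finally have d: "norm (moeb (mat 1 + kap *\<^sub>R nil ?u) x - x) < e/2" .
  have "dist w (moeb (mat 1 + kap *\<^sub>R nil ?u) x) \<le> dist w x + dist x (moeb (mat 1 + kap *\<^sub>R nil ?u) x)"
   by(rule dist_triangle)
  also have "\<dots> < e" using d x(1) by(simp add: dist_norm norm_minus_commute)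
  finally have "moeb (mat 1 + kap *\<^sub>R nil ?u) x \<in> W" using e(2) by auto
  moreover have "x \<in> W" using x(1) e by(auto simp: subset_iff)
  ultimately show False using W(4)[OF cusp_parabolic[OF u]] parabolic_ne[OF u] by blast
 qed
 then obtain n :: nat where "\<And>z. Im z > 0 ==> ht v0 z > real (Suc n) ==> q z \<in> U" by blast
 thus thesis using that[of "real (Suc n)"] by simp
qed

lemma cusp_frame:
 obtains N where "N \<in> SL2" "N *v e1 = v0"
proof -
 have "v0$1 * v0$1 + v0$2 * v0$2 \<noteq> 0" (is "?s \<noteq> 0") using v0_nonzero by(auto simp: vec_eq2 sum_squares_eq_zero_iff)
 hence "dt v0 ((1/?s) *\<^sub>R vector [- v0$2, v0$1]) = 1" by(simp add: dt_lin) (simp add: dt_def)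
 thus thesis using that[OF colmat_SL2] by simp
qed

text \<open>With \<open>v0\<close> moved to infinity the parabolic at \<open>v0\<close> is a
  horizontal translation by \<open>kap\<close>. A multiple of it brings any point into a vertical
  strip of width \<open>\<bar>kap\<bar>\<close>, so the part of the horoball between two heights has
  compact image.\<close>

lemma reduce_parabolic:
 assumes N: "N \<in> SL2" "N *v e1 = v0" and z: "Im z > 0"
 obtains x where "0 \<le> Re x" "Re x \<le> \<bar>kap\<bar>" "Im x = ht v0 z" "q (moeb N x) = q z"
proof -
 have sh: "q (moeb N (x + of_real kap)) = q (moeb N x)" if x: "Im x > 0" for x
 proof -
  let ?P = "mat 1 + kap *\<^sub>R nil v0"
  have P: "?P \<in> \<Gamma>" by(rule kap_spec)
  have "N ** (mat 1 + kap *\<^sub>R nil e1) = ?P ** N"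
  proof -
   have "?P = N ** (mat 1 + kap *\<^sub>R nil e1) ** adj N"
    using N Ad_nil[OF N(1), of e1] by(simp add: Ad_SL2 matrix_add_mult_distrib2 adj_mult)
   hence "?P ** N = N ** (mat 1 + kap *\<^sub>R nil e1) ** (adj N ** N)" by(simp only: matrix_mul_assoc)
   thus ?thesis by(simp add: adj_mult N(1))
  qed
  moreover have "moeb (mat 1 + kap *\<^sub>R nil e1) x = x + of_real kap" "mat 1 + kap *\<^sub>R nil e1 \<in> SL2"
   by(simp_all add: moeb_def nil_def SL2_iff)
  ultimately have "moeb N (x + of_real kap) = moeb ?P (moeb N x)"
   using moeb_mult[OF N(1) _ x] moeb_mult[OF G_SL2[OF P] N(1) x] by metis
  moreover have "Im (moeb N x) > 0" using moeb_half_plane[OF N(1), of x] x by(simp add: half_plane_iff)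
  ultimately show ?thesis using q_moeb[OF P] by simp
 qed
 have shn: "q (moeb N (x + of_nat n * of_real kap)) = q (moeb N x)" if x: "Im x > 0" for x n
 proof (induction n)
  case (Suc n)
  have eq: "x + of_nat (Suc n) * of_real kap = (x + of_nat n * of_real kap) + of_real kap" by(simp add: algebra_simps)
  show ?case unfolding eq using sh[of "x + of_nat n * of_real kap"] Suc x by simp
 qed simp
 have shi: "q (moeb N (x + of_int n * of_real kap)) = q (moeb N x)" if x: "Im x > 0" for x n
 proof (cases "n \<ge> 0")
  case True
  thus ?thesis using shn[OF x, of "nat n"] by simp
 next
  case False
  thus ?thesis using shn[of "x + of_int n * of_real kap" "nat (- n)"] x by simp
 qed
 have sha: "q (moeb N (x + of_int n * of_real \<bar>kap\<bar>)) = q (moeb N x)" if x: "Im x > 0" for x n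
  using shi[OF x, of n] shi[OF x, of "- n"] by(cases "kap \<ge> 0") auto
 define y where "y = moeb (adj N) z"
 have y: "Im y > 0" "moeb N y = z"
  using moeb_half_plane[of "adj N" z] moeb_adj(2)[OF N(1) z] z N(1) by(auto simp: y_def half_plane_iff)
 have Iy: "Im y = ht v0 z" using ht_moeb[OF N(1) y(1), of e1] y(2) N(2) by(simp add: ht_def ev_def)
 have k: "\<bar>kap\<bar> > 0" using kap_spec by simp
 define n where "n = \<lfloor>Re y / \<bar>kap\<bar>\<rfloor>"
 have "of_int n \<le> Re y / \<bar>kap\<bar>" "Re y / \<bar>kap\<bar> < of_int n + 1" unfolding n_def by linarith+
 hence b: "of_int n * \<bar>kap\<bar> \<le> Re y" "Re y \<le> of_int n * \<bar>kap\<bar> + \<bar>kap\<bar>" using k by(simp_all add: field_simps)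
 show thesis
 proof (rule that[of "y + of_int (- n) * of_real \<bar>kap\<bar>"])
  show "q (moeb N (y + of_int (- n) * of_real \<bar>kap\<bar>)) = q z" unfolding sha[OF y(1)] y(2) ..
 qed (use b Iy in auto)
qed

text \<open>The converse of \<open>q_tends_puncture\<close>: points near the puncture have only
  lifts that are deep in some horoball. The image \<open>X\<close> of an open horoball and the
  complement of the image \<open>X'\<close> of the closed one are both open; a connected punctured
  disc that avoids the image of the horocycle and meets \<open>X\<close> must lie in
  \<open>X\<close>.\<close>

lemma puncture_nbhd:
 assumes t: "t > 0"
 obtains U where "open U" "puncture \<in> U" "\<And>z. Im z > 0 ==> q z \<in> U ==> \<exists>u\<in>cusps. ht u z > t"
proof -
 obtain N where N: "N \<in> SL2" "N *v e1 = v0" by(rule cusp_frame)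
 have hN: "ht v0 (moeb N x) = Im x" if "Im x > 0" for x
  using ht_moeb[OF N(1) that, of e1] N(2) by(simp add: ht_def ev_def)
 define R where "R s = q ` moeb N ` cbox (Complex 0 t) (Complex \<bar>kap\<bar> s)" for s
 have box: "cbox (Complex 0 t) (Complex \<bar>kap\<bar> s) \<subseteq> half_plane" for s
  using t by(auto simp: in_cbox_complex_iff half_plane_iff)
 have cR: "compact (R s)" for s unfolding R_def
 proof (intro compact_continuous_image compact_cbox)
  show "continuous_on (cbox (Complex 0 t) (Complex \<bar>kap\<bar> s)) (moeb N)"
   by(rule continuous_on_subset[OF continuous_on_moeb[OF N(1)] box])
  have "moeb N ` cbox (Complex 0 t) (Complex \<bar>kap\<bar> s) \<subseteq> half_plane"
   using moeb_half_plane[OF N(1)] box[of s] by blast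
  thus "continuous_on (moeb N ` cbox (Complex 0 t) (Complex \<bar>kap\<bar> s)) q"
   by(rule continuous_on_subset[OF q_cont])
 qed
 define X where "X = q ` {z \<in> half_plane. ht v0 z > t}"
 define X' where "X' = q ` {z \<in> half_plane. ht v0 z \<ge> t}"
 have inR: "q z \<in> R s" if "Im z > 0" "t \<le> ht v0 z" "ht v0 z \<le> s" for z s
 proof -
  note z = that(1)
  obtain x where x: "0 \<le> Re x" "Re x \<le> \<bar>kap\<bar>" "Im x = ht v0 z" "q (moeb N x) = q z"
   by(rule reduce_parabolic[OF N z])
  thus ?thesis unfolding R_def x(4)[symmetric] using that by(intro imageI) (simp add: in_cbox_complex_iff)
 qed
 have X'X: "X' \<subseteq> X \<union> R t"
 proof
  fix y assume "y \<in> X'"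
  then obtain z where z: "Im z > 0" "ht v0 z \<ge> t" "y = q z" by(auto simp: X'_def half_plane_iff)
  thus "y \<in> X \<union> R t" using inR[of z t] by(cases "ht v0 z = t") (auto simp: X_def half_plane_iff)
 qed
 have XX': "X \<subseteq> X'" unfolding X_def X'_def by auto
 have oX: "openin (top_of_set punctured_torus) X"
  unfolding X_def using open_horoball[OF v0_nonzero] open_half_plane
  by(intro covering_space_open_map[OF covering]) (simp add: openin_open_eq)
 \<comment> \<open>Near a point outside \<open>X'\<close>, very deep points are excluded by
   separating the point from the puncture, and the remaining ones project to the compact set
   \<open>R s\<close>.\<close>
 have cX: "openin (top_of_set punctured_torus) (punctured_torus - X')"
 proof (subst openin_subopen, intro ballI)
  fix y assume y: "y \<in> punctured_torus - X'"
  hence "y \<noteq> puncture" by(simp add: punctured_torus_def)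
  then obtain U1 U2 where U: "open U1" "open U2" "puncture \<in> U1" "y \<in> U2" "U1 \<inter> U2 = {}"
   using hausdorff by metis
  obtain s where "s > 0" and s: "\<And>z. Im z > 0 ==> ht v0 z > s ==> q z \<in> U1" using q_tends_puncture[OF U(1,3)] by blast
  have "R s \<subseteq> X'"
  proof
   fix v assume "v \<in> R s"
   then obtain x where x: "v = q (moeb N x)" "x \<in> cbox (Complex 0 t) (Complex \<bar>kap\<bar> s)" by(auto simp: R_def)
   hence "Im x > 0" "Im x \<ge> t" using t by(auto simp: in_cbox_complex_iff)
   thus "v \<in> X'" unfolding x(1) X'_def using hN[of x] moeb_half_plane[OF N(1), of x]
    by(intro imageI) (simp add: half_plane_iff)
  qed
  hence yR: "y \<notin> R s" using y by blast
  show "\<exists>T. openin (top_of_set punctured_torus) T \<and> y \<in> T \<and> T \<subseteq> punctured_torus - X'"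
  proof (intro exI conjI)
   show "openin (top_of_set punctured_torus) (punctured_torus \<inter> (U2 - R s))"
    using U(2) compact_imp_closed[OF cR] by(intro openin_open_Int open_Diff)
   show "y \<in> punctured_torus \<inter> (U2 - R s)" using y U yR by auto
   show "punctured_torus \<inter> (U2 - R s) \<subseteq> punctured_torus - X'"
   proof
    fix v assume v: "v \<in> punctured_torus \<inter> (U2 - R s)"
    have "v \<notin> X'"
    proof
     assume "v \<in> X'"
     then obtain z where z: "Im z > 0" "ht v0 z \<ge> t" "v = q z" by(auto simp: X'_def half_plane_iff)
     show False using inR[OF z(1,2), of s] s[OF z(1)] v z(3) U(5) by(cases "ht v0 z \<le> s") auto
    qed
    thus "v \<in> punctured_torus - X'" using v by blast
   qed
  qed
 qed
 \<comment> \<open>\<open>R t\<close> comes from a degenerate box, a period of the horocycle at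
   height \<open>t\<close>. It is compact and misses the puncture, so a small disc avoids
   it.\<close>
 have "puncture \<notin> R t"
 proof
  assume "puncture \<in> R t"
  then obtain x where x: "x \<in> half_plane" "q x = puncture"
   using box moeb_half_plane[OF N(1)] unfolding R_def by fastforce
  thus False using q_punctured[of x] by(simp add: half_plane_iff punctured_torus_def)
 qed
 then obtain r where r: "0 < r" "r \<le> 1" "disc_chart r \<subseteq> - R t"
  using disc_chart_small[of "- R t"] compact_imp_closed[OF cR] by(metis ComplI open_Compl)
 obtain U where U: "open U" "puncture \<in> U" "U \<inter> torus \<subseteq> disc_chart r" by(rule disc_chart_nbhd[OF r(1)])
 let ?E = "disc_chart r - {puncture}"
 have E: "?E \<subseteq> punctured_torus" using disc_chart_torus by(auto simp: punctured_torus_def)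
 have "?E \<subseteq> X"
 proof -
  have conn: "connected ?E" by(rule punctured_disc_connected[OF r(2)])
  have sub: "openin (top_of_set ?E) (?E \<inter> Y)" if Y: "openin (top_of_set punctured_torus) Y" for Y
  proof -
   obtain T where T: "open T" "Y = punctured_torus \<inter> T" using Y unfolding openin_open by blast
   hence "?E \<inter> Y = ?E \<inter> T" using E by blast
   thus ?thesis using openin_open_Int[OF T(1), of ?E] by simp
  qed
  have o1: "openin (top_of_set ?E) (?E \<inter> X)" "openin (top_of_set ?E) (?E \<inter> (punctured_torus - X'))"
   using sub[OF oX] sub[OF cX] by auto
  have cov: "?E \<subseteq> (?E \<inter> X) \<union> (?E \<inter> (punctured_torus - X'))" using X'X r(3) E by blast
  have disj: "(?E \<inter> X) \<inter> (?E \<inter> (punctured_torus - X')) = {}" using XX' by blast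
  obtain s where s: "s > 0" "\<And>z. Im z > 0 ==> ht v0 z > s ==> q z \<in> U" using q_tends_puncture[OF U(1,2)] by blast
  let ?z = "moeb N (Complex 0 (s + t))"
  have z: "Im ?z > 0" "ht v0 ?z = s + t"
   using hN[of "Complex 0 (s + t)"] moeb_half_plane[OF N(1), of "Complex 0 (s+t)"] s(1) t by(auto simp: half_plane_iff)
  have "q ?z \<in> ?E" using s(2)[OF z(1)] z(2) t U(3) q_punctured[OF z(1)] by(auto simp: punctured_torus_def)
  moreover have "q ?z \<in> X" unfolding X_def using z s(1) by(intro imageI) (simp add: half_plane_iff)
  ultimately have "?E \<inter> X \<noteq> {}" by blast
  hence "?E \<inter> (punctured_torus - X') = {}" using conn o1 cov disj unfolding connected_openin by blast
  thus ?thesis using cov by blast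
 qed
 show thesis
 proof (rule that[OF U(1,2)])
  fix z assume z: "Im z > 0" "q z \<in> U"
  hence "q z \<in> ?E" using U(3) q_punctured[OF z(1)] by(auto simp: punctured_torus_def)
  then obtain w where w: "Im w > 0" "ht v0 w > t" "q w = q z" using \<open>?E \<subseteq> X\<close> by(auto simp: X_def half_plane_iff)
  obtain g where g: "g \<in> \<Gamma>" "z = moeb g w" using q_eq_iff[OF w(1) z(1)] w(3) by blast
  have "ht (g *v v0) z > t" unfolding g(2) ht_moeb[OF G_SL2[OF g(1)] w(1)] by(rule w(2))
  thus "\<exists>u\<in>cusps. ht u z > t" using cusps_even[OF g(1) v0_cusp] by blast
 qed
qed

end

section \<open>Embedded arcs and the cusps at the ends of their lifts\<close>

lemma embedded_arcD:
 assumes "embedded_arc c"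
 shows "continuous_on {0..1} c" "c 0 = puncture" "c 1 = puncture"
  "\<And>r. 0 < r ==> r < 1 ==> c r \<in> punctured_torus" "inj_on c {0<..<1}"
  "path_image c - {puncture} = c ` {0<..<1}"
proof -
 have p: "path c" "loop_free c" "path_image c \<subseteq> torus" "pathstart c = puncture" "pathfinish c = puncture"
  using assms by(auto simp: embedded_arc_def simple_path_def)
 show "continuous_on {0..1} c" using p(1) by(simp add: path_def)
 show c0: "c 0 = puncture" and c1: "c 1 = puncture" using p(4,5) by(simp_all add: pathstart_def pathfinish_def)
 have lf: "x = y \<or> x = 0 \<and> y = 1 \<or> x = 1 \<and> y = 0" if "c x = c y" "0 \<le> x" "x \<le> 1" "0 \<le> y" "y \<le> 1" for x y
  using p(2) that unfolding loop_free_def by auto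
 have ne: "c r \<noteq> puncture" if "0 < r" "r < 1" for r
  using lf[of r 0] that c0 by auto
 show "c r \<in> punctured_torus" if "0 < r" "r < 1" for r
  using p(3) ne[OF that] that by(auto simp: punctured_torus_def path_image_def)
 show "inj_on c {0<..<1}"
 proof (rule inj_onI)
  fix x y assume "x \<in> {0<..<1}" "y \<in> {0<..<1}" "c x = c y"
  thus "x = y" using lf[of x y] by auto
 qed
 show "path_image c - {puncture} = c ` {0<..<1}"
 proof (intro equalityI subsetI)
  fix y assume "y \<in> path_image c - {puncture}"
  then obtain r where r: "y = c r" "0 \<le> r" "r \<le> 1" "y \<noteq> puncture" by(auto simp: path_image_def)
  hence "r \<noteq> 0" "r \<noteq> 1" using c0 c1 by auto
  thus "y \<in> c ` {0<..<1}" using r by auto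
 next
  fix y assume "y \<in> c ` {0<..<1}"
  thus "y \<in> path_image c - {puncture}" using ne by(auto simp: path_image_def)
 qed
qed

lemma embedded_arc_reverse: "embedded_arc c ==> embedded_arc (reversepath c)"
 by(simp add: embedded_arc_def simple_path_reversepath)

text \<open>A closed subset of the open interval becomes compact when both ends are added, and these
  ends are sent to the puncture. Hence the restricted map is closed.\<close>

lemma embedded_arc_homeomorphism:
 assumes c: "embedded_arc c"
 obtains ci where "homeomorphism {0<..<1} (path_image c - {puncture}) c ci"
proof -
 define G where G: "G = path_image c - {puncture}"
 note ca = embedded_arcD[OF c]
 have Gc: "G = c ` {0<..<1}" using G ca(6) by simp
 have cc: "continuous_on {0<..<1} c" using ca(1) by(rule continuous_on_subset) auto
 have "\<exists>ci. homeomorphism {0<..<1} G c ci"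
 proof (rule homeomorphism_injective_closed_map[OF cc Gc[symmetric] ca(5)])
  show "\<exists>ci. homeomorphism {0<..<1} G c ci" if "homeomorphism {0<..<1} G c g" for g using that by blast
 next
  fix U assume "closedin (top_of_set {0<..<1::real}) U"
  then obtain C where C: "closed C" "U = {0<..<1} \<inter> C" by(auto simp: closedin_closed)
  have "compact (({0..1} \<inter> C) \<union> {0, 1})"
   by(intro compact_Un compact_Int_closed C(1)) auto
  hence "compact (c ` (({0..1} \<inter> C) \<union> {0, 1}))"
   by(intro compact_continuous_image continuous_on_subset[OF ca(1)]) auto
  hence "closedin (top_of_set G) (G \<inter> c ` (({0..1} \<inter> C) \<union> {0, 1}))"
   by(intro closedin_closed_Int compact_imp_closed)
  moreover have "c ` U = G \<inter> c ` (({0..1} \<inter> C) \<union> {0, 1})"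
  proof
   show "c ` U \<subseteq> G \<inter> c ` (({0..1} \<inter> C) \<union> {0, 1})" using C Gc by auto
   show "G \<inter> c ` (({0..1} \<inter> C) \<union> {0, 1}) \<subseteq> c ` U"
   proof
    fix y assume y: "y \<in> G \<inter> c ` (({0..1} \<inter> C) \<union> {0, 1})"
    then obtain r where r: "y = c r" "r \<in> ({0..1} \<inter> C) \<union> {0, 1}" by blast
    have "y \<noteq> puncture" using y G by blast
    hence "r \<noteq> 0" "r \<noteq> 1" using r ca(2,3) by auto
    thus "y \<in> c ` U" using r C(2) by auto
   qed
  qed
  ultimately show "closedin (top_of_set G) (c ` U)" by simp
 qed
 thus thesis using that G by blast
qed

text \<open>Convergence to the cusp through its horoballs as the parameter tends to 0, which is
  stronger than convergence to the boundary point. The other end is treated by reversing the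
  parameter.\<close>

definition tends0 :: "real^2 => (real => complex) => bool" where
 "tends0 u k \<longleftrightarrow> (\<forall>t. \<exists>d>0. \<forall>r. 0 < r \<and> r < d \<and> r < 1 --> ht u (k r) > t)"

lemma tends0D:
 assumes "tends0 u k"
 obtains d where "0 < d" "d \<le> 1" "\<And>r. 0 < r ==> r < d ==> ht u (k r) > t"
proof -
 obtain d where d: "d > 0" "\<And>r. 0 < r \<and> r < d \<and> r < 1 ==> ht u (k r) > t"
  using assms unfolding tends0_def by blast
 show thesis by(rule that[of "min d 1"]) (use d in auto)
qed

lemma tends0_uminus [simp]: "tends0 (- u) k = tends0 u k"
 by(simp add: tends0_def)

lemma tends0_cong: "(\<And>r. 0 < r ==> r < 1 ==> k r = k' r) ==> tends0 u k ==> tends0 u k'"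
proof -
 assume a: "\<And>r. 0 < r ==> r < 1 ==> k r = k' r" "tends0 u k"
 show ?thesis unfolding tends0_def
 proof
  fix t
  obtain d where d: "d > 0" "\<And>r. 0 < r \<and> r < d \<and> r < 1 ==> ht u (k r) > t"
   using a(2) unfolding tends0_def by blast
  thus "\<exists>d>0. \<forall>r. 0 < r \<and> r < d \<and> r < 1 --> ht u (k' r) > t" using a(1) by(intro exI[of _ d]) auto
 qed
qed

lemma tends0_family:
 assumes "\<And>t. \<exists>d>0. \<forall>s\<in>{0..1::real}. \<forall>r. 0 < r \<and> r < d \<and> r < 1 --> ht w (K (s, r)) > t" "s \<in> {0..1}"
 shows "tends0 w (\<lambda>r. K (s, r))"
 unfolding tends0_def using assms by blast

lemma tends0_moeb:
 assumes "\<And>r. 0 < r ==> r < 1 ==> Im (k r) > 0" "g \<in> SL2" "tends0 u k"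
 shows "tends0 (g *v u) (\<lambda>r. moeb g (k r))"
 unfolding tends0_def
proof
 fix t
 obtain d where d: "d > 0" "\<And>r. 0 < r \<and> r < d \<and> r < 1 ==> ht u (k r) > t"
  using assms(3) unfolding tends0_def by blast
 have "ht (g *v u) (moeb g (k r)) > t" if "0 < r" "r < d" "r < 1" for r
  using d(2)[of r] ht_moeb[OF assms(2) assms(1)[of r]] that by simp
 thus "\<exists>d>0. \<forall>r. 0 < r \<and> r < d \<and> r < 1 --> ht (g *v u) (moeb g (k r)) > t" using d(1) by blast
qed

lemma adj_vec_solve: "N \<in> SL2 ==> adj N *v w = x *\<^sub>R e ==> w = x *\<^sub>R (N *v e)"
 using adj_cancel_vec(2)[of N w] by(simp add: mat_vec_scale)

context cusped_torus
begin

text \<open>Above the height \<open>\<bar>kap\<bar>\<close> the horoballs are open and, up to the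
  sign of the cusp, disjoint, so a connected set cannot meet two of them.\<close>

lemma horoball_connected:
 assumes X: "connected X" "X \<subseteq> half_plane" "z0 \<in> X" and t: "t \<ge> \<bar>kap\<bar>"
  and h: "\<And>z. z \<in> X ==> \<exists>u\<in>cusps. ht u z > t"
 obtains u where "u \<in> cusps" "\<And>z. z \<in> X ==> ht u z > t"
proof -
 obtain u where u: "u \<in> cusps" "ht u z0 > t" using h[OF X(3)] by blast
 let ?H = "\<lambda>v. {z \<in> half_plane. ht v z > t}"
 let ?V = "{v \<in> cusps. v \<noteq> u \<and> v \<noteq> - u}"
 have o: "open (?H v)" if "v \<in> cusps" for v using open_horoball[OF cusp_nonzero[OF that]] .
 have o2: "open (\<Union>v\<in>?V. ?H v)" using o by(intro open_UN) auto
 have cov: "X \<subseteq> ?H u \<union> (\<Union>v\<in>?V. ?H v)"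
 proof
  fix z assume z: "z \<in> X"
  then obtain v where v: "v \<in> cusps" "ht v z > t" using h by blast
  have zh: "z \<in> half_plane" using z X(2) by blast
  show "z \<in> ?H u \<union> (\<Union>v\<in>?V. ?H v)"
  proof (cases "v = u \<or> v = - u")
   case True
   hence "ht u z > t" using v(2) by auto
   thus ?thesis using zh by blast
  qed (use v zh in blast)
 qed
 have disj: "?H u \<inter> (\<Union>v\<in>?V. ?H v) \<inter> X = {}"
 proof -
  have False if "z \<in> half_plane" "ht u z > t" "ht v z > t" "v \<in> ?V" for z v
   using horoball_disjoint[of u v z] u(1) that t by(auto simp: half_plane_iff)
  thus ?thesis by blast
 qed
 have "?H u \<inter> X \<noteq> {}" using u(2) X by blast
 hence "(\<Union>v\<in>?V. ?H v) \<inter> X = {}"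
  using X(1) o[OF u(1)] o2 cov disj unfolding connected_def by blast
 hence "X \<subseteq> ?H u" using cov by blast
 thus thesis using that[OF u(1)] by blast
qed

text \<open>By uniform continuity the whole strip of parameters near \<open>r = 0\<close> projects
  close to the puncture, and its lift is connected, so it lies in one horoball. All members of the
  family therefore end at the same cusp, uniformly; a constant family gives the end of a single
  arc.\<close>

lemma family_end:
 assumes K: "continuous_on ({0..1} \<times> {0<..<1}) K" "K ` ({0..1::real} \<times> {0<..<1::real}) \<subseteq> half_plane"
  and h: "continuous_on ({0..1} \<times> {0..1}) h" "\<And>s. s \<in> {0..1} ==> h (s, 0) = puncture"
  and qK: "\<And>s r. s \<in> {0..1} ==> 0 < r ==> r < 1 ==> h (s, r) = q (K (s, r))"
 obtains u where "u \<in> cusps"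
  "\<And>t. \<exists>d>0. \<forall>s\<in>{0..1}. \<forall>r. 0 < r \<and> r < d \<and> r < 1 --> ht u (K (s, r)) > t"
proof -
 have near: "\<exists>u\<in>cusps. \<exists>d>0. d \<le> 1 \<and> (\<forall>s\<in>{0..1}. \<forall>r. 0 < r \<and> r < d --> ht u (K (s, r)) > t)"
  if t: "t \<ge> \<bar>kap\<bar>" for t
 proof -
  have t0: "t > 0" using t kap_spec(1) by auto
  obtain U where U: "open U" "puncture \<in> U" "\<And>z. Im z > 0 ==> q z \<in> U ==> \<exists>u\<in>cusps. ht u z > t"
   using puncture_nbhd[OF t0] by blast
  obtain e where e: "e > 0" "ball puncture e \<subseteq> U" using U openE by blast
  have "uniformly_continuous_on ({0..1} \<times> {0..1}) h"
   using h(1) by(intro compact_uniformly_continuous compact_Times compact_Icc)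
  then obtain d where d: "d > 0" "\<And>x y. x \<in> {0..1} \<times> {0..1} ==> y \<in> {0..1} \<times> {0..1} ==> dist y x < d ==> dist (h y) (h x) < e"
   unfolding uniformly_continuous_on_def using e(1) by blast
  define d' where "d' = min d 1"
  have d': "d' > 0" "d' \<le> 1" "d' \<le> d" using d(1) by(auto simp: d'_def)
  let ?X = "K ` ({0..1} \<times> {0<..<d'})"
  have sub: "{0..1::real} \<times> {0<..<d'} \<subseteq> {0..1} \<times> {0<..<1}" using d' by auto
  have c: "connected ?X"
   by(rule connected_continuous_image[OF continuous_on_subset[OF K(1) sub]]) (intro connected_Times, auto)
  have XH: "?X \<subseteq> half_plane" using K(2) sub by blast
  have m: "K (0, d'/2) \<in> ?X" using d' by(intro imageI) auto
  have cu: "\<exists>u\<in>cusps. ht u z > t" if z: "z \<in> ?X" for z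
  proof -
   obtain s r where sr: "z = K (s, r)" "s \<in> {0..1}" "0 < r" "r < d'" using z by auto
   have "dist (s, r) (s, 0) < d" using sr d' by(simp add: dist_Pair_Pair)
   hence "dist (h (s, r)) (h (s, 0)) < e" using sr d' by(intro d(2)) auto
   hence "h (s, r) \<in> U" using e(2) h(2)[OF sr(2)] by(auto simp: dist_commute)
   hence "q z \<in> U" using qK[OF sr(2,3)] sr d' by simp
   moreover have "Im z > 0" using z XH by(auto simp: half_plane_iff)
   ultimately show ?thesis using U(3) by blast
  qed
  obtain u where u: "u \<in> cusps" "\<And>z. z \<in> ?X ==> ht u z > t"
   using horoball_connected[OF c XH m t cu] by blast
  have "ht u (K (s, r)) > t" if "s \<in> {0..1}" "0 < r" "r < d'" for s r
   using that by(intro u(2) imageI) auto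
  thus ?thesis using u(1) d' by blast
 qed
 obtain u0 d0 where u0: "u0 \<in> cusps" "d0 > 0" "d0 \<le> 1" "\<And>s r. s \<in> {0..1} ==> 0 < r ==> r < d0 ==> ht u0 (K (s, r)) > \<bar>kap\<bar>"
  using near[of "\<bar>kap\<bar>"] by blast
 show thesis
 proof (rule that[OF u0(1)])
  fix t
  obtain u1 d1 where u1: "u1 \<in> cusps" "d1 > 0" "d1 \<le> 1" "\<And>s r. s \<in> {0..1} ==> 0 < r ==> r < d1 ==> ht u1 (K (s, r)) > max t \<bar>kap\<bar>"
   using near[of "max t \<bar>kap\<bar>"] by auto
  define r0 where "r0 = min d0 d1 / 2"
  have r0: "0 < r0" "r0 < d0" "r0 < d1" "r0 < 1" using u0(2,3) u1(2) by(auto simp: r0_def min_def)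
  have "K (0, r0) \<in> half_plane" using K(2) r0 by(intro subsetD[OF K(2)] imageI) auto
  \<comment> \<open>At a common parameter both horoballs contain the point, so the cusp found for
    the threshold \<open>t\<close> is the one fixed at the start.\<close>
  hence "u1 = u0 \<or> u1 = - u0"
   using horoball_disjoint[OF u0(1) u1(1)] u0(4)[of 0 r0] u1(4)[of 0 r0] r0 by(auto simp: half_plane_iff)
  hence "ht u0 (K (s, r)) > t" if "s \<in> {0..1}" "0 < r" "r < d1" for s r
   using u1(4)[OF that] by auto
  thus "\<exists>d>0. \<forall>s\<in>{0..1}. \<forall>r. 0 < r \<and> r < d \<and> r < 1 --> ht u0 (K (s, r)) > t"
   using u1(2) by blast
 qed
qed

definition is_lift :: "loop => (real => complex) => bool" where
 "is_lift c k \<longleftrightarrow> continuous_on {0<..<1} k \<and> k ` {0<..<1} \<subseteq> half_plane \<and> (\<forall>r\<in>{0<..<1}. q (k r) = c r)"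

definition has_ends :: "loop => real^2 => real^2 => bool" where
 "has_ends c u v \<longleftrightarrow> u \<in> cusps \<and> v \<in> cusps \<and> (\<exists>k. is_lift c k \<and> tends0 u k \<and> tends0 v (\<lambda>r. k (1 - r)))"

lemma is_lift_reverse: "is_lift c k ==> is_lift (reversepath c) (\<lambda>r. k (1 - r))"
proof -
 assume a: "is_lift c k"
 have "continuous_on {0<..<1} (k \<circ> (\<lambda>r. 1 - r))"
  by(rule continuous_on_compose2[of "{0<..<1}" k, folded o_def])
   (use a in \<open>auto simp: is_lift_def intro!: continuous_intros\<close>)
 thus ?thesis using a by(auto simp: is_lift_def reversepath_def o_def)
qed

lemma has_ends_reverse: "has_ends c u v ==> has_ends (reversepath c) v u"
proof -
 assume "has_ends c u v"
 then obtain k where k: "u \<in> cusps" "v \<in> cusps" "is_lift c k" "tends0 u k" "tends0 v (\<lambda>r. k (1 - r))"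
  by(auto simp: has_ends_def)
 have "tends0 u (\<lambda>r. (\<lambda>r. k (1 - r)) (1 - r))" using k(4) by simp
 thus ?thesis unfolding has_ends_def using k is_lift_reverse by blast
qed

lemma tends0_unique:
 assumes "is_lift c k" "u \<in> cusps" "u' \<in> cusps" "tends0 u k" "tends0 u' k"
 shows "u' = u \<or> u' = - u"
proof -
 obtain d where d: "0 < d" "d \<le> 1" "\<And>r. 0 < r ==> r < d ==> ht u (k r) > \<bar>kap\<bar>"
  using tends0D[OF assms(4)] by blast
 obtain d' where d': "0 < d'" "d' \<le> 1" "\<And>r. 0 < r ==> r < d' ==> ht u' (k r) > \<bar>kap\<bar>"
  using tends0D[OF assms(5)] by blast
 define r where "r = min d d' / 2"
 have r: "0 < r" "r < d" "r < d'" "r < 1" using d d' by(auto simp: r_def)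
 have "k r \<in> half_plane" using assms(1) r by(auto simp: is_lift_def)
 thus ?thesis using horoball_disjoint[OF assms(2,3)] d(3) d'(3) r by(simp add: half_plane_iff)
qed

lemma arc_lift_end:
 assumes "embedded_arc c" "is_lift c k"
 obtains u where "u \<in> cusps" "tends0 u k"
proof -
 note c = embedded_arcD[OF assms(1)]
 have kc: "continuous_on {0<..<1} k" using assms(2) by(simp add: is_lift_def)
 have 1: "continuous_on ({0..1::real} \<times> {0<..<1}) (\<lambda>x. k (snd x))"
  by(rule continuous_on_compose2[OF kc continuous_on_snd[OF continuous_on_id]]) auto
 have 2: "continuous_on ({0..1::real} \<times> {0..1}) (\<lambda>x. c (snd x))"
  by(rule continuous_on_compose2[OF c(1) continuous_on_snd[OF continuous_on_id]]) auto
 have r4: "c (snd (s, 0)) = puncture" for s :: real using c(2) by simp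
 have r5: "c (snd (s, r)) = q (k (snd (s, r)))" if "0 < r" "r < 1" for s r :: real
  using that assms(2) by(simp add: is_lift_def)
 have 3: "(\<lambda>x. k (snd x)) ` ({0..1::real} \<times> {0<..<1}) \<subseteq> half_plane" using assms(2) by(auto simp: is_lift_def)
 obtain u where "u \<in> cusps" "\<And>t. \<exists>d>0. \<forall>s\<in>{0..1::real}. \<forall>r. 0 < r \<and> r < d \<and> r < 1 --> ht u (k (snd (s, r))) > t"
  using family_end[OF 1 3 2 r4 r5] by blast
 hence "u \<in> cusps" "tends0 u k" using tends0_family[of u "\<lambda>x. k (snd x)" 0] by auto
 thus thesis by(rule that)
qed

lemma arc_lift_ends:
 assumes "embedded_arc c" "is_lift c k"
 obtains u v where "u \<in> cusps" "v \<in> cusps" "tends0 u k" "tends0 v (\<lambda>r. k (1 - r))"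
proof -
 obtain u where u: "u \<in> cusps" "tends0 u k" by(rule arc_lift_end[OF assms])
 obtain v where v: "v \<in> cusps" "tends0 v (\<lambda>r. k (1 - r))"
  by(rule arc_lift_end[OF embedded_arc_reverse[OF assms(1)] is_lift_reverse[OF assms(2)]])
 show thesis by(rule that[OF u(1) v(1) u(2) v(2)])
qed

text \<open>Lift the homotopy. By \<open>family_end\<close> the cusp at the start is constant along
  it, and the reversed family gives the same for the other end.\<close>

lemma homotopic_has_ends:
 assumes hom: "homotopic_with_canon embedded_arc {0..1} torus c c'" and e: "has_ends c u v"
 shows "has_ends c' u v"
proof -
 have "\<exists>h. continuous_on ({0..1::real} \<times> {0..1::real}) h \<and> (\<forall>r. h (0, r) = c r) \<and> (\<forall>r. h (1, r) = c' r) \<and>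
  (\<forall>s\<in>{0..1}. embedded_arc (\<lambda>r. h (s, r)))"
  using hom unfolding homotopic_with_def continuous_map_iff_continuous prod_topology_subtopology_eu by auto
 then obtain h where h: "continuous_on ({0..1} \<times> {0..1}) h" "\<And>r. h (0, r) = c r" "\<And>r. h (1, r) = c' r"
  "\<And>s::real. s \<in> {0..1} ==> embedded_arc (\<lambda>r. h (s, r))"
  by blast
 obtain k where k: "u \<in> cusps" "v \<in> cusps" "is_lift c k" "tends0 u k" "tends0 v (\<lambda>r. k (1 - r))"
  using e by(auto simp: has_ends_def)
 note a = embedded_arcD[OF h(4)]
 have hp: "continuous_on ({0..1} \<times> {0<..<1}) h" by(rule continuous_on_subset[OF h(1)]) auto
 obtain K where K: "continuous_on ({0..1} \<times> {0<..<1}) K" "K \<in> ({0..1} \<times> {0<..<1}) \<rightarrow> half_plane"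
  "\<And>y. y \<in> {0<..<1} ==> K (0, y) = k y" "\<And>z. z \<in> {0..1} \<times> {0<..<1} ==> h z = q (K z)"
 proof (rule covering_space_lift_homotopy[OF covering hp, of k])
  show "h \<in> {0..1} \<times> {0<..<1} \<rightarrow> punctured_torus" using a(4) by auto
 qed (use k(3) h(2) in \<open>auto simp: is_lift_def\<close>)
 define k' where "k' r = K (1, r)" for r
 have "continuous_on {0<..<1} k'" unfolding k'_def
  by(rule continuous_on_compose2[OF K(1)]) (auto intro!: continuous_intros)
 moreover have "k' r \<in> half_plane" "q (k' r) = c' r" if "r \<in> {0<..<1}" for r
 proof -
  have r: "(1::real, r) \<in> {0..1} \<times> {0<..<1}" using that by auto
  show "k' r \<in> half_plane" using K(2) r unfolding k'_def by(rule funcset_mem)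
  show "q (k' r) = c' r" using K(4)[OF r] h(3)[of r] by(simp add: k'_def)
 qed
 ultimately have lift': "is_lift c' k'" by(auto simp: is_lift_def)
 have K2: "K ` ({0..1} \<times> {0<..<1}) \<subseteq> half_plane" using K(2) by auto
 have K4: "h (s, r) = q (K (s, r))" if "s \<in> {0..1}" "0 < r" "r < 1" for s r using K(4) that by simp
 have 1: "tends0 u k'"
 proof -
  obtain w where w: "w \<in> cusps"
   "\<And>t. \<exists>d>0. \<forall>s\<in>{0..1}. \<forall>r. 0 < r \<and> r < d \<and> r < 1 --> ht w (K (s, r)) > t"
   using family_end[OF K(1) K2 h(1) a(2) K4] by blast
  have "tends0 w (\<lambda>r. K (0, r))" "tends0 w k'"
   using tends0_family[of w K 0] tends0_family[of w K 1] w(2) unfolding k'_def[abs_def] by auto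
  moreover have "tends0 u (\<lambda>r. K (0, r))" using tends0_cong[OF _ k(4)] K(3) by simp
  moreover have "is_lift c (\<lambda>r. K (0, r))"
   using k(3) K(3) continuous_on_cong[of "{0<..<1}" "{0<..<1}" "\<lambda>r. K (0, r)" k] by(auto simp: is_lift_def)
  ultimately have "u = w \<or> u = - w" using tends0_unique w(1) k(1) by blast
  thus ?thesis using \<open>tends0 w k'\<close> by auto
 qed
 have 2: "tends0 v (\<lambda>r. k' (1 - r))"
 proof -
  let ?K = "\<lambda>(s, r). K (s, 1 - r)" and ?h = "\<lambda>(s, r). h (s, 1 - r)"
  have r1: "continuous_on ({0..1} \<times> {0<..<1}) ?K" unfolding case_prod_unfold
   by(rule continuous_on_compose2[OF K(1)]) (auto intro!: continuous_intros)
  have r2: "continuous_on ({0..1} \<times> {0..1}) ?h" unfolding case_prod_unfold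
   by(rule continuous_on_compose2[OF h(1)]) (auto intro!: continuous_intros)
  have r3: "?K ` ({0..1} \<times> {0<..<1}) \<subseteq> half_plane" using K(2) by auto
  have r4: "?h (s, 0) = puncture" if "s \<in> {0..1}" for s using a(3)[OF that] by simp
  have r5: "?h (s, r) = q (?K (s, r))" if "s \<in> {0..1}" "0 < r" "r < 1" for s r using K(4) that by simp
  obtain w where w: "w \<in> cusps"
   "\<And>t. \<exists>d>0. \<forall>s\<in>{0..1}. \<forall>r. 0 < r \<and> r < d \<and> r < 1 --> ht w (?K (s, r)) > t"
   using family_end[OF r1 r3 r2 r4 r5] by blast
  have "tends0 w (\<lambda>r. ?K (0, r))" "tends0 w (\<lambda>r. ?K (1, r))" using tends0_family[of w ?K 0] tends0_family[of w ?K 1] w(2) by auto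
  hence t: "tends0 w (\<lambda>r. K (0, 1 - r))" "tends0 w (\<lambda>r. k' (1 - r))" by(simp_all add: k'_def)
  moreover have "tends0 v (\<lambda>r. K (0, 1 - r))" using tends0_cong[OF _ k(5)] K(3) by simp
  moreover have "is_lift c (\<lambda>r. K (0, r))"
   using k(3) K(3) continuous_on_cong[of "{0<..<1}" "{0<..<1}" "\<lambda>r. K (0, r)" k] by(auto simp: is_lift_def)
  hence "is_lift (reversepath c) (\<lambda>r. K (0, 1 - r))" using is_lift_reverse by blast
  ultimately have "v = w \<or> v = - w" using tends0_unique w(1) k(2) by blast
  thus ?thesis using t(2) by auto
 qed
 show ?thesis unfolding has_ends_def using k(1,2) lift' 1 2 by blast
qed

text \<open>Two lifts differ by a deck transformation at one parameter, hence everywhere by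
  uniqueness of lifts, and a lift has one cusp, up to sign, at each end.\<close>

lemma has_ends_unique:
 assumes c: "embedded_arc c" and e: "has_ends c u v" "has_ends c u' v'"
 obtains g where "g \<in> \<Gamma>" "u' = g *v u \<or> u' = - (g *v u)" "v' = g *v v \<or> v' = - (g *v v)"
proof -
 obtain k where k: "u \<in> cusps" "v \<in> cusps" "is_lift c k" "tends0 u k" "tends0 v (\<lambda>r. k (1 - r))"
  using e(1) by(auto simp: has_ends_def)
 obtain k' where k': "u' \<in> cusps" "v' \<in> cusps" "is_lift c k'" "tends0 u' k'" "tends0 v' (\<lambda>r. k' (1 - r))"
  using e(2) by(auto simp: has_ends_def)
 have I: "Im (k r) > 0" "Im (k' r) > 0" if "0 < r" "r < 1" for r
  using that k(3) k'(3) by(auto simp: is_lift_def half_plane_iff image_subset_iff)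
 have h: "(1/2::real) > 0" "(1/2::real) < 1" by simp_all
 have "q (k (1/2)) = q (k' (1/2))" using k(3) k'(3) by(simp add: is_lift_def)
 then obtain g where g: "g \<in> \<Gamma>" "k' (1/2) = moeb g (k (1/2))" using q_eq_iff[OF I(1)[OF h] I(2)[OF h]] by blast
 have gS: "g \<in> SL2" using G_SL2 g(1) by blast
 have cc: "continuous_on {0<..<1} c" using embedded_arcD(1)[OF c] by(rule continuous_on_subset) auto
 have cm: "c \<in> {0<..<1} \<rightarrow> punctured_torus" using embedded_arcD(4)[OF c] by auto
 have gk1: "continuous_on {0<..<1} (\<lambda>r. moeb g (k r))"
  using k(3) by(intro continuous_on_compose2[OF continuous_on_moeb[OF gS]]) (auto simp: is_lift_def)
 have gk2: "(\<lambda>r. moeb g (k r)) \<in> {0<..<1} \<rightarrow> half_plane"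
  using moeb_G_half_plane[OF g(1)] I(1) by(auto simp: half_plane_iff)
 have gk3: "c r = q (moeb g (k r))" if "r \<in> {0<..<1}" for r
  using that k(3) q_moeb[OF g(1)] I(1)[of r] by(auto simp: is_lift_def)
 have k'1: "continuous_on {0<..<1} k'" "k' \<in> {0<..<1} \<rightarrow> half_plane" "\<And>r. r \<in> {0<..<1} ==> c r = q (k' r)"
  using k'(3) by(auto simp: is_lift_def)
 have eq: "k' r = moeb g (k r)" if "0 < r" "r < 1" for r
  by(rule covering_space_lift_unique[OF covering g(2) cc cm k'1 gk1 gk2 gk3]) (use that in auto)
 have t1: "tends0 (g *v u) k'"
  by(rule tends0_cong[OF _ tends0_moeb[OF I(1) gS k(4)]]) (simp_all add: eq)
 have t2: "tends0 (g *v v) (\<lambda>r. k' (1 - r))"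
  by(rule tends0_cong[OF _ tends0_moeb[OF _ gS k(5)]]) (simp_all add: eq I)
 show thesis
 proof (rule that[OF g(1)])
  show "u' = g *v u \<or> u' = - (g *v u)"
   using tends0_unique[OF k'(3) cusps_even[OF g(1) k(1)] k'(1) t1 k'(4)] .
  show "v' = g *v v \<or> v' = - (g *v v)"
   using tends0_unique[OF is_lift_reverse[OF k'(3)] cusps_even[OF g(1) k(2)] k'(2) t2 k'(5)] .
 qed
qed

subsection \<open>Geodesic representatives\<close>

lemma ht_geod_bound:
 assumes N: "N \<in> SL2" and x: "x = (adj N *v u)$1" and y: "y = (adj N *v u)$2"
 shows "ht u (geod N s) = exp s / (x\<^sup>2 + y\<^sup>2 * (exp s)\<^sup>2)"
proof -
 have "ht u (geod N s) = ht (N *v (adj N *v u)) (moeb N (\<i> * of_real (exp s)))"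
  using adj_cancel_vec(2)[OF N] by(simp add: geod_def)
 also have "\<dots> = ht (adj N *v u) (\<i> * of_real (exp s))" by(rule ht_moeb[OF N Im_iexp])
 finally show ?thesis unfolding x y by(simp add: ht_def ev_def cmod_power2 power_mult_distrib)
qed

text \<open>In the frame of the geodesic, with \<open>s\<close> the exponential of the parameter,
  the height over \<open>u\<close> is \<open>s / (x\<^sup>2 + y\<^sup>2 * s\<^sup>2)\<close>, which
  is at most \<open>1 / (2 * \<bar>x * y\<bar>)\<close> by the inequality of the means. Unbounded
  height forces \<open>u\<close> to be an end of the geodesic.\<close>

lemma tends_end_cases:
 assumes N: "N \<in> SL2" and t: "tends0 u (\<lambda>r. geod N (\<psi> r))"
 shows "(adj N *v u)$1 = 0 \<or> (adj N *v u)$2 = 0"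
proof (rule ccontr)
 define x y where "x = (adj N *v u)$1" and "y = (adj N *v u)$2"
 assume "\<not> ?thesis"
 hence xy: "x \<noteq> 0" "y \<noteq> 0" by(auto simp: x_def y_def)
 obtain d where d: "0 < d" "d \<le> 1" "\<And>r. 0 < r ==> r < d ==> ht u (geod N (\<psi> r)) > 1 / (2 * \<bar>x * y\<bar>)"
  using tends0D[OF t] by blast
 let ?s = "exp (\<psi> (d/2))"
 have "ht u (geod N (\<psi> (d/2))) = ?s / (x\<^sup>2 + y\<^sup>2 * ?s\<^sup>2)" by(rule ht_geod_bound[OF N x_def y_def])
 moreover have "?s / (x\<^sup>2 + y\<^sup>2 * ?s\<^sup>2) \<le> 1 / (2 * \<bar>x * y\<bar>)"
 proof -
  have "0 \<le> (\<bar>x\<bar> - \<bar>y\<bar> * ?s)\<^sup>2" by simp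
  hence "2 * \<bar>x * y\<bar> * ?s \<le> x\<^sup>2 + y\<^sup>2 * ?s\<^sup>2" by(simp add: power2_diff power_mult_distrib abs_mult mult_ac)
  moreover have "x\<^sup>2 + y\<^sup>2 * ?s\<^sup>2 > 0" using xy by(simp add: add_pos_nonneg)
  ultimately show ?thesis using xy by(simp add: divide_le_eq le_divide_eq mult_ac)
 qed
 ultimately show False using d(3)[of "d/2"] d(1) by simp
qed

lemma tends_end_unbounded:
 assumes N: "N \<in> SL2" and t: "tends0 u (\<lambda>r. geod N (\<psi> r))" and u: "u \<noteq> 0"
 shows "(adj N *v u)$1 = 0 ==> \<exists>d>0. d \<le> 1 \<and> (\<forall>r. 0 < r \<and> r < d --> \<psi> r < 0)"
  "(adj N *v u)$2 = 0 ==> \<exists>d>0. d \<le> 1 \<and> (\<forall>r. 0 < r \<and> r < d --> \<psi> r > 0)"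
proof -
 define x y where "x = (adj N *v u)$1" and "y = (adj N *v u)$2"
 have nz: "\<not> (x = 0 \<and> y = 0)"
 proof
  assume "x = 0 \<and> y = 0"
  hence "adj N *v u = 0" by(simp add: vec_eq2 x_def y_def)
  hence "N *v (adj N *v u) = 0" by(simp add: vec_eq2)
  thus False using u adj_cancel_vec(2)[OF N] by simp
 qed
 note b = ht_geod_bound[OF N x_def y_def]
 { assume x0: "(adj N *v u)$1 = 0"
  hence y0: "y \<noteq> 0" "x = 0" using nz by(auto simp: x_def)
  obtain d where d: "0 < d" "d \<le> 1" "\<And>r. 0 < r ==> r < d ==> ht u (geod N (\<psi> r)) > 1 / y\<^sup>2"
   using tends0D[OF t] by blast
  have "\<psi> r < 0" if "0 < r" "r < d" for r
  proof -
   have "1 / y\<^sup>2 < exp (\<psi> r) / (y\<^sup>2 * (exp (\<psi> r))\<^sup>2)" using d(3)[OF that] b y0 by simp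
   also have "\<dots> = (1 / y\<^sup>2) * exp (- \<psi> r)" by(simp add: power2_eq_square exp_minus field_simps)
   finally have "1 < exp (- \<psi> r)" using y0(1) by(simp add: divide_less_cancel)
   thus ?thesis by simp
  qed
  thus "\<exists>d>0. d \<le> 1 \<and> (\<forall>r. 0 < r \<and> r < d --> \<psi> r < 0)" using d(1,2) by blast }
 { assume y0: "(adj N *v u)$2 = 0"
  hence x0: "x \<noteq> 0" "y = 0" using nz by(auto simp: y_def)
  obtain d where d: "0 < d" "d \<le> 1" "\<And>r. 0 < r ==> r < d ==> ht u (geod N (\<psi> r)) > 1 / x\<^sup>2"
   using tends0D[OF t] by blast
  have "\<psi> r > 0" if "0 < r" "r < d" for r
  proof -
   have "1 / x\<^sup>2 < exp (\<psi> r) / x\<^sup>2" using d(3)[OF that] b x0 by simp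
   hence "1 < exp (\<psi> r)" using x0(1) by(simp add: divide_less_cancel)
   thus ?thesis by simp
  qed
  thus "\<exists>d>0. d \<le> 1 \<and> (\<forall>r. 0 < r \<and> r < d --> \<psi> r > 0)" using d(1,2) by blast }
qed

text \<open>A homeomorphism from the open interval onto the line cannot tend to the same infinite end at
 both ends of the interval.\<close>

lemma not_same_end:
 fixes \<psi> :: "real => real"
 assumes c: "continuous_on {0<..<1} \<psi>" and s: "\<psi> ` {0<..<1} = (UNIV :: real set)"
  and d: "\<exists>d>0. d \<le> 1 \<and> (\<forall>r. 0 < r \<and> r < d --> \<psi> r < 0)"
  and d': "\<exists>d>0. d \<le> 1 \<and> (\<forall>r. 0 < r \<and> r < d --> \<psi> (1 - r) < 0)"
 shows False
proof -
 obtain a where a: "a > 0" "a \<le> 1" "\<And>r. 0 < r ==> r < a ==> \<psi> r < 0" using d by blast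
 obtain b where b: "b > 0" "b \<le> 1" "\<And>r. 0 < r ==> r < b ==> \<psi> (1 - r) < 0" using d' by blast
 have sub: "{a/2..1 - b/2} \<subseteq> {0<..<1}" using a(1) b(1) by force
 have "bounded (\<psi> ` {a/2..1 - b/2})"
  by(intro compact_imp_bounded compact_continuous_image continuous_on_subset[OF c sub] compact_Icc)
 then obtain B where B: "B > 0" "\<And>r. r \<in> {a/2..1 - b/2} ==> \<bar>\<psi> r\<bar> \<le> B" unfolding bounded_pos by auto
 have "B + 1 \<in> \<psi> ` {0<..<1}" using s by simp
 then obtain r where r: "0 < r" "r < 1" "\<psi> r = B + 1" by auto
 consider "r < a" | "1 - r < b" | "r \<in> {a/2..1 - b/2}" using a(1) b(1) by force
 thus False using a(3)[of r] b(3)[of "1 - r"] B(1) B(2)[of r] r by cases auto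
qed

text \<open>Injectivity of \<open>q\<close> on the line makes the lifts pairwise disjoint; their
  local finiteness makes crossing numbers and strip sums finite.\<close>

definition simple_pair :: "real^2 => real^2 => bool" where
 "simple_pair u v \<longleftrightarrow> u \<in> cusps \<and> v \<in> cusps \<and> dt u v \<noteq> 0 \<and> inj_on q (line u v) \<and>
  closedin (top_of_set punctured_torus) (q ` line u v) \<and>
  (\<forall>K. compact K \<and> K \<subseteq> half_plane --> finite {g \<in> \<Gamma>. line (g *v u) (g *v v) \<inter> K \<noteq> {}})"

text \<open>The geodesic comes without information on its ends. Comparing its parametrisation with
  that of the arc gives a homeomorphism of the line with the open interval, hence a lift of the arc
  running along the geodesic; the cusps of this lift must be the two ends. The map \<rho> is the
  continuous inverse of \<open>q\<close> on the line.\<close>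

lemma geodesic_arc:
 assumes c: "embedded_arc c" and G: "G = path_image c - {puncture}" and N: "N \<in> SL2" and b: "bij_betw q (geod_line N) G"
 obtains u v \<rho> where "has_ends c u v" "dt u v \<noteq> 0" "geod_line N = line u v" "continuous_on G \<rho>"
  "\<And>z. z \<in> line u v ==> \<rho> (q z) = z"
proof -
 note ca = embedded_arcD[OF c]
 have Gc: "G = c ` {0<..<1}" using G ca(6) by simp
 have cc: "continuous_on {0<..<1} c" using ca(1) by(rule continuous_on_subset) auto
 obtain ci where ci: "homeomorphism {0<..<1} G c ci" using embedded_arc_homeomorphism[OF c] G by blast
 have gl: "geod N t \<in> half_plane" for t
  using moeb_half_plane[OF N, of "\<i> * of_real (exp t)"] by(simp add: geod_def half_plane_iff)
 have glc: "continuous_on UNIV (geod N)"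
  by(intro continuous_at_imp_continuous_on ballI) (rule has_vector_derivative_continuous[OF geod_deriv[OF N]])
 have glinj: "inj (geod N)"
 proof (rule injI)
  fix s t assume "geod N s = geod N t"
  hence "moeb (adj N) (geod N s) = moeb (adj N) (geod N t)" by simp
  thus "s = t" unfolding geod_def moeb_adj(1)[OF N Im_iexp] by simp
 qed
 define \<phi> where "\<phi> t = ci (q (geod N t))" for t
 have qG: "q (geod N t) \<in> G" for t using b by(auto simp: bij_betw_def geod_line_def)
 have "continuous_on UNIV (\<lambda>t. q (geod N t))"
  by(rule continuous_on_compose2[OF q_cont glc]) (use gl in auto)
 hence p1: "continuous_on UNIV \<phi>" unfolding \<phi>_def
  by(rule continuous_on_compose2[OF homeomorphism_cont2[OF ci]]) (use qG in auto)
 have p2: "inj \<phi>"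
 proof (rule injI)
  fix s t assume "\<phi> s = \<phi> t"
  hence "c (ci (q (geod N s))) = c (ci (q (geod N t)))" by(simp add: \<phi>_def)
  hence "q (geod N s) = q (geod N t)" by(simp only: homeomorphism_apply2[OF ci qG])
  hence "geod N s = geod N t" using b by(auto simp: bij_betw_def inj_on_def geod_line_def)
  thus "s = t" using glinj by(auto dest: injD)
 qed
 have p3: "\<phi> ` UNIV = {0<..<1}"
 proof
  show "\<phi> ` UNIV \<subseteq> {0<..<1}" using homeomorphism_image2[OF ci] qG unfolding \<phi>_def by blast
  show "{0<..<1} \<subseteq> \<phi> ` UNIV"
  proof
   fix r :: real assume r: "r \<in> {0<..<1}"
   hence "c r \<in> G" using Gc by blast
   then obtain t where "c r = q (geod N t)" using b by(auto simp: bij_betw_def geod_line_def)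
   hence "\<phi> t = r" unfolding \<phi>_def using homeomorphism_apply1[OF ci r] by simp
   thus "r \<in> \<phi> ` UNIV" by blast
  qed
 qed
 \<comment> \<open>By invariance of domain the injective continuous \<phi> is a homeomorphism onto
   the interval; its inverse reparametrises the geodesic as a lift of \<open>c\<close>.\<close>
 obtain \<psi> where "homeomorphism UNIV (\<phi> ` UNIV) \<phi> \<psi>"
  using invariance_of_domain_homeomorphism[OF open_UNIV p1 _ p2] by auto
 hence psi: "homeomorphism UNIV {0<..<1} \<phi> \<psi>" unfolding p3 .
 define k where "k r = geod N (\<psi> r)" for r
 have "continuous_on {0<..<1} k" unfolding k_def
  by(rule continuous_on_compose2[OF glc homeomorphism_cont2[OF psi]]) auto
 moreover have "q (k r) = c r" if "r \<in> {0<..<1}" for r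
 proof -
  have "ci (q (k r)) = r" using homeomorphism_apply2[OF psi that] by(simp add: \<phi>_def k_def)
  thus ?thesis using homeomorphism_apply2[OF ci qG, of "\<psi> r"] by(simp add: k_def)
 qed
 ultimately have lift: "is_lift c k" using gl by(auto simp: is_lift_def k_def)
 obtain u v where uv: "u \<in> cusps" "v \<in> cusps" "tends0 u k" "tends0 v (\<lambda>r. k (1 - r))"
  by(rule arc_lift_ends[OF c lift])
 have u0: "u \<noteq> 0" "v \<noteq> 0" using uv cusp_nonzero by blast+
 have tu: "tends0 u (\<lambda>r. geod N (\<psi> r))" and tv: "tends0 v (\<lambda>r. geod N (\<psi> (1 - r)))"
  using uv by(simp_all add: k_def[abs_def])
 have pc: "continuous_on {0<..<1} \<psi>" "\<psi> ` {0<..<1} = UNIV"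
  using homeomorphism_cont2[OF psi] homeomorphism_image2[OF psi] by auto
 have n1: "\<not> ((adj N *v u)$1 = 0 \<and> (adj N *v v)$1 = 0)"
  using not_same_end[OF pc] tends_end_unbounded(1)[OF N tu u0(1)] tends_end_unbounded(1)[OF N tv u0(2)] by blast
 \<comment> \<open>The other end of the geodesic is excluded by the same argument after reversing
   the line.\<close>
 have n2: "\<not> ((adj N *v u)$2 = 0 \<and> (adj N *v v)$2 = 0)"
 proof
  assume a: "(adj N *v u)$2 = 0 \<and> (adj N *v v)$2 = 0"
  have "continuous_on {0<..<1} (\<lambda>r. - \<psi> r)" using pc(1) by(rule continuous_on_minus)
  moreover have "(\<lambda>r. - \<psi> r) ` {0<..<1} = UNIV"
  proof -
   have "x \<in> (\<lambda>r. - \<psi> r) ` {0<..<1}" for x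
   proof -
    have "- x \<in> \<psi> ` {0<..<1}" using pc(2) by simp
    then obtain r where "r \<in> {0<..<1}" "- x = \<psi> r" by blast
    hence "x = - \<psi> r" by simp
    thus ?thesis using \<open>r \<in> {0<..<1}\<close> by blast
   qed
   thus ?thesis by blast
  qed
  ultimately show False
   using not_same_end[of "\<lambda>r. - \<psi> r"] tends_end_unbounded(2)[OF N tu u0(1)] tends_end_unbounded(2)[OF N tv u0(2)] a
   by simp
 qed
 have cu: "(adj N *v u)$1 = 0 \<or> (adj N *v u)$2 = 0" by(rule tends_end_cases[OF N tu])
 have cv: "(adj N *v v)$1 = 0 \<or> (adj N *v v)$2 = 0" by(rule tends_end_cases[OF N tv])
 have uN: "u = N *v (adj N *v u)" "v = N *v (adj N *v v)" using adj_cancel_vec(2)[OF N] by simp_all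
 have nz: "adj N *v u \<noteq> 0" "adj N *v v \<noteq> 0"
  using uN u0 by(auto simp: matrix_vector_mult_0_right)
 have dtuv: "dt u v = dt (adj N *v u) (adj N *v v)" using dt_mat[of "adj N" u v] N by simp
 have lN: "geod_line N = line u v \<and> dt u v \<noteq> 0"
 proof (cases "(adj N *v u)$1 = 0")
  case True
  hence v2: "(adj N *v v)$2 = 0" "(adj N *v v)$1 \<noteq> 0" "(adj N *v u)$2 \<noteq> 0" using cv n1 nz by(auto simp: vec_eq2)
  have "adj N *v u = (adj N *v u)$2 *\<^sub>R e2" "adj N *v v = (adj N *v v)$1 *\<^sub>R e1"
   using True v2 by(simp_all only: vec_eq2) simp_all
  hence e: "u = (adj N *v u)$2 *\<^sub>R (N *v e2)" "v = (adj N *v v)$1 *\<^sub>R (N *v e1)"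
   by(auto intro: adj_vec_solve[OF N])
  have "line u v = line (N *v e2) (N *v e1)"
   by(subst e(1), subst e(2)) (rule line_scale[OF v2(3,2)])
  moreover have "dt u v \<noteq> 0" unfolding dtuv using True v2 by(simp add: dt_def)
  ultimately show ?thesis using geod_line_eq[OF N] line_swap by simp
 next
  case False
  hence v2: "(adj N *v u)$2 = 0" "(adj N *v v)$1 = 0" "(adj N *v v)$2 \<noteq> 0" using cu cv n2 nz by(auto simp: vec_eq2)
  have "adj N *v u = (adj N *v u)$1 *\<^sub>R e1" "adj N *v v = (adj N *v v)$2 *\<^sub>R e2"
   using False v2 by(simp_all only: vec_eq2) simp_all
  hence e: "u = (adj N *v u)$1 *\<^sub>R (N *v e1)" "v = (adj N *v v)$2 *\<^sub>R (N *v e2)"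
   by(auto intro: adj_vec_solve[OF N])
  have "line u v = line (N *v e1) (N *v e2)"
   by(subst e(1), subst e(2)) (rule line_scale[OF False v2(3)])
  moreover have "dt u v \<noteq> 0" unfolding dtuv using False v2 by(simp add: dt_def)
  ultimately show ?thesis using geod_line_eq[OF N] by simp
 qed
 define \<rho> where "\<rho> y = geod N (\<psi> (ci y))" for y
 have "continuous_on G (\<lambda>y. \<psi> (ci y))"
  by(rule continuous_on_compose2[OF homeomorphism_cont2[OF psi] homeomorphism_cont2[OF ci]])
   (use homeomorphism_image2[OF ci] in simp)
 hence "continuous_on G \<rho>" unfolding \<rho>_def by(rule continuous_on_compose2[OF glc]) auto
 moreover have "\<rho> (q z) = z" if "z \<in> line u v" for z
 proof -
  obtain t where t: "z = geod N t" using \<open>z \<in> line u v\<close> lN by(auto simp: geod_line_def)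
  have "\<psi> (\<phi> t) = t" using homeomorphism_apply1[OF psi] by simp
  thus ?thesis unfolding \<rho>_def t by(simp add: \<phi>_def)
 qed
 ultimately show thesis using that[of u v \<rho>] lN lift uv by(auto simp: has_ends_def)
qed

text \<open>Local finiteness is proved pointwise. Away from the lifts, the arc with the puncture is
  closed. On a lift, continuity of \<rho> leaves a single lift nearby: another one would give two
  points of the same line over one point of the arc. Compactness does the rest.\<close>

lemma geodesic_simple_pair:
 assumes c: "embedded_arc c" and G: "G = path_image c - {puncture}" and N: "N \<in> SL2" and b: "bij_betw q (geod_line N) G"
 obtains u v where "has_ends c u v" "simple_pair u v" "G = q ` line u v"
proof -
 obtain u v \<rho> where u: "has_ends c u v" "dt u v \<noteq> 0" "geod_line N = line u v" "continuous_on G \<rho>"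
  "\<And>z. z \<in> line u v ==> \<rho> (q z) = z"
  using geodesic_arc[OF assms] by blast
 have Gq: "G = q ` line u v" and inj: "inj_on q (line u v)" using b u(3) by(auto simp: bij_betw_def)
 have pc: "closed (path_image c)" using c by(simp add: embedded_arc_def closed_simple_path_image)
 have Gsub: "G \<subseteq> punctured_torus" using c G by(auto simp: embedded_arc_def punctured_torus_def)
 have "G = punctured_torus \<inter> path_image c" using Gsub G by(auto simp: punctured_torus_def)
 hence cl: "closedin (top_of_set punctured_torus) G" using pc by(simp add: closedin_closed_Int)
 have lH: "line a b \<subseteq> half_plane" for a b by(auto simp: line_def half_plane_iff)
 have lG: "q z \<in> G" if "g \<in> \<Gamma>" "z \<in> line (g *v u) (g *v v)" for g z
 proof -
  note g = that(1)
  have "z \<in> moeb g ` line u v" using that(2) line_moeb[OF G_SL2[OF g], of u v] by simp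
  then obtain x where x: "x \<in> line u v" "z = moeb g x" by blast
  have "Im x > 0" using x(1) by(simp add: line_def)
  hence "q z = q x" using q_moeb[OF g] x(2) by simp
  thus ?thesis using x Gq by blast
 qed
 have fin: "finite {g \<in> \<Gamma>. line (g *v u) (g *v v) \<inter> K \<noteq> {}}" if K: "compact K" "K \<subseteq> half_plane" for K
 proof -
  have "\<exists>W. open W \<and> z \<in> W \<and> finite {g \<in> \<Gamma>. line (g *v u) (g *v v) \<inter> W \<noteq> {}}" if z: "z \<in> half_plane" for z
  proof (cases "q z \<in> G")
   case False
   hence "q z \<notin> path_image c" using G q_punctured[of z] z by(auto simp: punctured_torus_def half_plane_iff)
   let ?W = "half_plane \<inter> q -` (- path_image c)"
   have "open ?W" using continuous_open_preimage[OF q_cont open_half_plane] pc by(simp add: open_Compl)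
   moreover have "{g \<in> \<Gamma>. line (g *v u) (g *v v) \<inter> ?W \<noteq> {}} = {}" using lG G by blast
   hence "finite {g \<in> \<Gamma>. line (g *v u) (g *v v) \<inter> ?W \<noteq> {}}" by(simp only: finite.emptyI)
   ultimately show ?thesis using z \<open>q z \<notin> path_image c\<close> by(intro exI[of _ ?W]) auto
  next
   case True
   then obtain z0 where z0: "z0 \<in> line u v" "q z0 = q z" using Gq by(metis imageE)
   have Iz: "Im z > 0" "Im z0 > 0" using z z0(1) by(auto simp: half_plane_iff line_def)
   obtain g0 where g0: "g0 \<in> \<Gamma>" "z = moeb g0 z0" using q_eq_iff[OF Iz(2,1)] z0(2) by blast
   have g0S: "g0 \<in> SL2" "adj g0 \<in> SL2" using G_SL2 g0(1) by auto
   obtain W where W: "open W" "z0 \<in> W" "W \<subseteq> half_plane"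
    "\<And>g w. g \<in> \<Gamma> ==> w \<in> W ==> moeb g w \<in> W ==> g = mat 1 \<or> g = - mat 1"
    by(rule proper_nbhd[OF Iz(2)]) blast
   \<comment> \<open>\<open>T\<close> cuts out of \<open>G\<close> the points whose preimage on the
     chosen line lies in \<open>W\<close>.\<close>
   obtain T where T: "open T" "T \<inter> G = \<rho> -` W \<inter> G"
    using u(4) W(1) unfolding continuous_on_open_invariant by blast
   define W1 where "W1 = half_plane \<inter> q -` T"
   define W2 where "W2 = half_plane \<inter> moeb (adj g0) -` W"
   have o: "open W1" "open W2" unfolding W1_def W2_def
    using continuous_open_preimage[OF q_cont open_half_plane T(1)]
     continuous_open_preimage[OF continuous_on_moeb[OF g0S(2)] open_half_plane W(1)] by auto
   have "\<rho> (q z) = z0" using u(5)[OF z0(1)] z0(2) by simp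
   hence "q z \<in> T" using T(2) W(2) True by blast
   hence "z \<in> W1 \<inter> W2" using z W(2) moeb_adj(1)[OF g0S(1) Iz(2)] g0(2) by(auto simp: W1_def W2_def)
   moreover
   have "{g \<in> \<Gamma>. line (g *v u) (g *v v) \<inter> (W1 \<inter> W2) \<noteq> {}} \<subseteq> {g0, - g0}"
   proof
    fix g assume "g \<in> {g \<in> \<Gamma>. line (g *v u) (g *v v) \<inter> (W1 \<inter> W2) \<noteq> {}}"
    then obtain y where g: "g \<in> \<Gamma>" and y: "y \<in> line (g *v u) (g *v v)" "y \<in> W1" "y \<in> W2" by blast
    have gS: "g \<in> SL2" using G_SL2 g by blast
    obtain x where x: "x \<in> line u v" "y = moeb g x" using y(1) line_moeb[OF gS, of u v] by blast
    have Ix: "Im x > 0" using x(1) by(simp add: line_def)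
    have qy: "q y = q x" "q y \<in> G" using q_moeb[OF g Ix] x Gq by auto
    hence "\<rho> (q y) = x" using u(5)[OF x(1)] by simp
    hence xW: "x \<in> W" using qy(2) y(2) T(2) by(auto simp: W1_def)
    have "moeb (adj g0 ** g) x \<in> W" using y(3) x(2) moeb_mult[OF g0S(2) gS Ix] by(simp add: W2_def)
    hence "adj g0 ** g = mat 1 \<or> adj g0 ** g = - mat 1"
     using W(4)[of "adj g0 ** g" x] xW g g0(1) G_mult by simp
    hence "g0 ** (adj g0 ** g) = g0 \<or> g0 ** (adj g0 ** g) = - g0" by(auto simp: mat_uminus_right)
    thus "g \<in> {g0, - g0}" unfolding adj_cancel_left(2)[OF g0S(1)] by simp
   qed
   hence "finite {g \<in> \<Gamma>. line (g *v u) (g *v v) \<inter> (W1 \<inter> W2) \<noteq> {}}" by(rule finite_subset) simp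
   ultimately show ?thesis using open_Int[OF o] by blast
  qed
  hence "\<exists>W. \<forall>z\<in>half_plane. open (W z) \<and> z \<in> W z \<and> finite {g \<in> \<Gamma>. line (g *v u) (g *v v) \<inter> W z \<noteq> {}}"
   by(intro bchoice ballI)
  then obtain W where W: "\<forall>z\<in>half_plane. open (W z) \<and> z \<in> W z \<and> finite {g \<in> \<Gamma>. line (g *v u) (g *v v) \<inter> W z \<noteq> {}}"
   by(rule exE)
  have op: "open (W z)" "z \<in> W z" if "z \<in> K" for z using bspec[OF W, of z] that K(2) by auto
  hence cov: "K \<subseteq> (\<Union>z\<in>K. W z)" by auto
  obtain F where F: "F \<subseteq> K" "finite F" "K \<subseteq> (\<Union>z\<in>F. W z)"
   by(rule compactE_image[OF K(1) op(1) cov])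
  have "{g \<in> \<Gamma>. line (g *v u) (g *v v) \<inter> K \<noteq> {}} \<subseteq> (\<Union>z\<in>F. {g \<in> \<Gamma>. line (g *v u) (g *v v) \<inter> W z \<noteq> {}})"
   using F(3) by blast
  moreover have "finite (\<Union>z\<in>F. {g \<in> \<Gamma>. line (g *v u) (g *v v) \<inter> W z \<noteq> {}})"
  proof (intro finite_UN_I F(2))
   fix z assume "z \<in> F"
   hence "z \<in> half_plane" using F(1) K(2) by blast
   thus "finite {g \<in> \<Gamma>. line (g *v u) (g *v v) \<inter> W z \<noteq> {}}" using W by simp
  qed
  ultimately show ?thesis by(rule finite_subset)
 qed
 have "simple_pair u v" unfolding simple_pair_def
  using u(1,2) inj cl fin unfolding Gq has_ends_def by simp
 thus thesis using that u(1) Gq by blast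
qed

definition arc_pair :: "loop set => real^2 => real^2 => bool" where
 "arc_pair \<alpha> u v \<longleftrightarrow> simple_pair u v \<and> geodesic_of q \<alpha> = q ` line u v \<and>
  (\<forall>c\<in>\<alpha>. embedded_arc c \<and> (has_ends c u v \<or> has_ends c v u)) \<and>
  (\<exists>c\<in>\<alpha>. path_image c - {puncture} = q ` line u v)"

lemma isotopic_has_ends:
 assumes "isotopic c c'" "has_ends c u v"
 shows "has_ends c' u v \<or> has_ends c' v u"
 using assms(1) unfolding isotopic_def
proof
 assume "homotopic_with_canon embedded_arc {0..1} torus c c'"
 thus ?thesis using homotopic_has_ends assms(2) by blast
next
 assume "homotopic_with_canon embedded_arc {0..1} torus c (reversepath c')"
 hence "has_ends (reversepath c') u v" using homotopic_has_ends assms(2) by blast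
 hence "has_ends (reversepath (reversepath c')) v u" by(rule has_ends_reverse)
 thus ?thesis by simp
qed

lemma isotopic_has_ends_sym:
 assumes "isotopic c c'" "has_ends c' u v"
 shows "has_ends c u v \<or> has_ends c v u"
 using assms(1) unfolding isotopic_def
proof
 assume "homotopic_with_canon embedded_arc {0..1} torus c c'"
 hence "homotopic_with_canon embedded_arc {0..1} torus c' c" by(rule homotopic_with_symD)
 thus ?thesis using homotopic_has_ends assms(2) by blast
next
 assume "homotopic_with_canon embedded_arc {0..1} torus c (reversepath c')"
 hence "homotopic_with_canon embedded_arc {0..1} torus (reversepath c') c" by(rule homotopic_with_symD)
 thus ?thesis using homotopic_has_ends has_ends_reverse[OF assms(2)] by blast
qed

lemma line_G_image:
 assumes g: "g \<in> \<Gamma>"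
 shows "q ` line (g *v u) (g *v v) = q ` line u v"
proof -
 have "q ` line (g *v u) (g *v v) = q ` moeb g ` line u v" using line_moeb[OF G_SL2[OF g]] by simp
 also have "\<dots> = q ` line u v" unfolding image_image
  by(rule image_cong[OF refl]) (use q_moeb[OF g] in \<open>auto simp: line_def\<close>)
 finally show ?thesis .
qed

text \<open>All members of the class have the same ends up to \<Gamma>, order and sign, and a
  geodesic is determined by its ends. So all geodesic representatives coincide, and
  \<open>geodesic_of\<close> denotes the one at hand.\<close>

lemma arc_vertex_pair:
 assumes "\<alpha> \<in> arc_vertices q"
 obtains u v where "arc_pair \<alpha> u v"
proof -
 obtain c0 G where c0: "\<alpha> = isotopy_class c0" "embedded_arc c0" "geodesic_rep q \<alpha> G"
  using assms by(auto simp: arc_vertices_def)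
 have emb: "embedded_arc c" if "c \<in> \<alpha>" for c using that c0(1) by(simp add: isotopy_class_def)
 have rep: "\<exists>c u v. c \<in> \<alpha> \<and> has_ends c u v \<and> simple_pair u v \<and> G' = q ` line u v \<and> path_image c - {puncture} = G'" if "geodesic_rep q \<alpha> G'" for G'
 proof -
  obtain c N where c: "c \<in> \<alpha>" "G' = path_image c - {puncture}" "N \<in> SL2" "bij_betw q (geod_line N) G'"
   using \<open>geodesic_rep q \<alpha> G'\<close> unfolding geodesic_rep_def by blast
  obtain u v where "has_ends c u v" "simple_pair u v" "G' = q ` line u v"
   by(rule geodesic_simple_pair[OF emb[OF c(1)] c(2-4)])
  thus ?thesis using c(1,2) by blast
 qed
 have trans: "has_ends c' u v \<or> has_ends c' v u" if "c \<in> \<alpha>" "c' \<in> \<alpha>" "has_ends c u v" for c c' u v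
 proof -
  have "isotopic c0 c" "isotopic c0 c'" using that c0(1) by(auto simp: isotopy_class_def)
  thus ?thesis using isotopic_has_ends_sym[OF _ that(3)] isotopic_has_ends by blast
 qed
 obtain c u v where c: "c \<in> \<alpha>" "has_ends c u v" "simple_pair u v" "G = q ` line u v" "path_image c - {puncture} = G" using rep[OF c0(3)] by blast
 have "geodesic_of q \<alpha> = G" unfolding geodesic_of_def
 proof (rule the_equality)
  show "geodesic_rep q \<alpha> G" by(rule c0(3))
  fix G' assume "geodesic_rep q \<alpha> G'"
  then obtain c' u' v' where c': "c' \<in> \<alpha>" "has_ends c' u' v'" "simple_pair u' v'" "G' = q ` line u' v'" using rep by blast
  have un: "q ` line x' y' = q ` line x y" if "has_ends c' x y" "has_ends c' x' y'" for x y x' y'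
  proof -
   note e = that
   obtain g where g: "g \<in> \<Gamma>" "x' = g *v x \<or> x' = - (g *v x)" "y' = g *v y \<or> y' = - (g *v y)"
    by(rule has_ends_unique[OF emb[OF c'(1)] e])
   hence "line x' y' = line (g *v x) (g *v y)" by auto
   thus ?thesis using line_G_image[OF g(1)] by simp
  qed
  from trans[OF c(1) c'(1) c(2)] show "G' = G"
  proof
   assume "has_ends c' u v"
   from un[OF this c'(2)] show "G' = G" by(simp only: c'(4) c(4))
  next
   assume "has_ends c' v u"
   from un[OF this c'(2)] show "G' = G" by(simp only: c'(4) c(4) line_swap[of v u])
  qed
 qed
 hence "geodesic_of q \<alpha> = q ` line u v" using c(4) by simp
 moreover have "\<forall>c\<in>\<alpha>. embedded_arc c \<and> (has_ends c u v \<or> has_ends c v u)"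
  using trans[OF c(1) _ c(2)] emb by simp
 moreover have "\<exists>c\<in>\<alpha>. path_image c - {puncture} = q ` line u v" using c(1,4,5) by auto
 ultimately have "arc_pair \<alpha> u v" unfolding arc_pair_def using c(3) by simp
 thus thesis by(rule that)
qed

end

section \<open>Disjoint arcs\<close>

text \<open>The two pairs separate each other on the boundary circle. The expression is quadratic in
  each vector taken over both pairs, so signs and scales of the cusps do not matter.\<close>

definition linked :: "real^2 => real^2 => real^2 => real^2 => bool" where
 "linked a b c d \<longleftrightarrow> dt a c * dt a d * (dt b c * dt b d) < 0"

lemma linked_mat: "M \<in> SL2 ==> linked (M *v a) (M *v b) (M *v c) (M *v d) = linked a b c d"
 by(simp add: linked_def dt_mat)

lemma linked_uminus [simp]: "linked (- a) b c d = linked a b c d" "linked a (- b) c d = linked a b c d"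
 "linked a b (- c) d = linked a b c d" "linked a b c (- d) = linked a b c d"
 by(simp_all add: linked_def dt_lin)

lemma linked_swap: "linked b a c d = linked a b c d" "linked a b d c = linked a b c d"
 by(simp_all add: linked_def mult_ac)

lemma linked_sym: "linked c d a b = linked a b c d"
 by(simp add: linked_def dt_swap[of c] dt_swap[of d] mult_ac)

abbreviation bpt :: "real^2 => real" where "bpt u \<equiv> u$1 / u$2"

text \<open>A horoball is a Euclidean disc tangent to the real line at \<open>bpt u\<close>, here
  with diameter \<open>1 / (t * (u$2)\<^sup>2)\<close>.\<close>

lemma horoball_near_bpt:
 assumes u: "u$2 \<noteq> 0" and z: "Im z > 0" and h: "ht u z > t" and t: "t > 0"
 shows "norm (z - of_real (bpt u)) \<le> 1 / (t * (u$2)\<^sup>2)"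
proof -
 let ?d = "norm (z - of_real (bpt u))"
 have "ev u z = of_real (u$2) * (of_real (bpt u) - z)" using u by(simp add: ev_def algebra_simps)
 hence n: "norm (ev u z) = \<bar>u$2\<bar> * ?d" by(simp only: norm_mult norm_of_real norm_minus_commute)
 have d: "?d > 0" using z by(auto simp: complex_eq_iff)
 have "Im z \<le> ?d" using abs_Im_le_cmod[of "z - of_real (bpt u)"] by simp
 moreover have "Im z > t * ((u$2)\<^sup>2 * ?d\<^sup>2)"
  using h u d unfolding ht_def n by(simp add: power_mult_distrib less_divide_eq)
 ultimately have "t * (u$2)\<^sup>2 * ?d * ?d < 1 * ?d" by(simp add: power2_eq_square mult_ac)
 hence "t * (u$2)\<^sup>2 * ?d < 1" using d by(simp only: mult_less_cancel_right_pos)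
 thus ?thesis using t u by(simp add: less_divide_eq mult_ac less_imp_le)
qed

definition extend :: "real => real => (real => complex) => real => complex" where
 "extend x y k r = (if r \<le> 0 then of_real x else if r \<ge> 1 then of_real y else k r)"

lemma tends0_limit:
 assumes u: "u$2 \<noteq> 0" and I: "\<And>r. 0 < r ==> r < 1 ==> Im (k r) > 0" and t: "tends0 u k" and e: "e > 0"
 shows "\<exists>d>0. \<forall>r. 0 < r \<and> r < d --> norm (k r - of_real (bpt u)) < e"
proof -
 let ?t = "2 / (e * (u$2)\<^sup>2)"
 have t0: "?t > 0" using e u by simp
 obtain d where d: "0 < d" "d \<le> 1" "\<And>r. 0 < r ==> r < d ==> ht u (k r) > ?t"
  using tends0D[OF t] by blast
 have "norm (k r - of_real (bpt u)) < e" if "0 < r" "r < d" for r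
 proof -
  have "norm (k r - of_real (bpt u)) \<le> 1 / (?t * (u$2)\<^sup>2)"
   using that d by(intro horoball_near_bpt u I t0) auto
  also have "\<dots> = e / 2" using u e by simp
  also have "\<dots> < e" using e by simp
  finally show ?thesis .
 qed
 thus ?thesis using d(1) by blast
qed

lemma path_extend:
 assumes c: "continuous_on {0<..<1} k" and I: "\<And>r. 0 < r ==> r < 1 ==> Im (k r) > 0"
  and u: "u$2 \<noteq> 0" "tends0 u k" and v: "v$2 \<noteq> 0" "tends0 v (\<lambda>r. k (1 - r))"
 shows "path (extend (bpt u) (bpt v) k)"
 unfolding path_def
proof (rule continuous_onI)
 let ?E = "extend (bpt u) (bpt v) k"
 fix x e :: real assume x: "x \<in> {0..1}" and e: "e > 0"
 consider "x = 0" | "x = 1" | "0 < x" "x < 1" using x by force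
 thus "\<exists>d>0. \<forall>x'\<in>{0..1}. dist x' x < d --> dist (?E x') (?E x) \<le> e"
 proof cases
  case 1
  obtain d where d: "d > 0" "\<And>r. 0 < r \<and> r < d ==> norm (k r - of_real (bpt u)) < e"
   using tends0_limit[OF u(1) I u(2) e] by blast
  have "dist (?E x') (?E x) \<le> e" if "x' \<in> {0..1}" "dist x' x < min d 1" for x'
   using that d(2)[of x'] e by(auto simp: 1 extend_def dist_norm less_imp_le)
  thus ?thesis using d(1) by(intro exI[of _ "min d 1"]) auto
 next
  case 2
  have I': "Im (k (1 - r)) > 0" if "0 < r" "r < 1" for r using I[of "1 - r"] that by simp
  obtain d where d: "d > 0" "\<And>r. 0 < r \<and> r < d ==> norm (k (1 - r) - of_real (bpt v)) < e"
   using tends0_limit[OF v(1) I' v(2) e] by blast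
  have "dist (?E x') (?E x) \<le> e" if "x' \<in> {0..1}" "dist x' x < min d 1" for x'
   using that d(2)[of "1 - x'"] e by(auto simp: 2 extend_def dist_norm less_imp_le)
  thus ?thesis using d(1) by(intro exI[of _ "min d 1"]) auto
 next
  case 3
  have "continuous (at x) k" using c 3 continuous_on_eq_continuous_at[of "{0<..<1}" k] by auto
  then obtain d where d: "d > 0" "\<And>x'. dist x' x < d ==> dist (k x') (k x) < e"
   unfolding continuous_at_eps_delta using e by blast
  let ?d = "min d (min x (1 - x))"
  have "dist (?E x') (?E x) \<le> e" if "x' \<in> {0..1}" "dist x' x < ?d" for x'
  proof -
   have "0 < x'" "x' < 1" using that(2) by(auto simp: dist_real_def)
   thus ?thesis using d(2)[of x'] that 3 by(auto simp: extend_def less_imp_le)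
  qed
  thus ?thesis using d(1) 3 by(intro exI[of _ ?d]) auto
 qed
qed

definition meets :: "(real => complex) => (real => complex) => bool" where
 "meets f g \<longleftrightarrow> (\<exists>r\<in>{0..1}. \<exists>s\<in>{0..1}. f r = g s)"

lemma meets_sym: "meets f g ==> meets g f"
 unfolding meets_def by force

lemma meets_reverse: "meets (reversepath f) g ==> meets f g"
proof -
 assume "meets (reversepath f) g"
 then obtain r s where "r \<in> {0..1}" "s \<in> {0..1}" "f (1 - r) = g s" by(auto simp: meets_def reversepath_def)
 moreover have "1 - r \<in> {0..1}" using \<open>r \<in> {0..1}\<close> by simp
 ultimately show ?thesis unfolding meets_def by blast
qed

text \<open>Both paths lie in a box whose bottom edge is on the real line, with all four ends on
  that edge; this is the situation of \<open>fashoda_interlace\<close>.\<close>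

lemma complex_fashoda:
 assumes "path f" "path g" "\<forall>r\<in>{0..1}. Im (f r) \<ge> 0" "\<forall>r\<in>{0..1}. Im (g r) \<ge> 0"
  "f 0 = of_real x1" "f 1 = of_real x2" "g 0 = of_real y1" "g 1 = of_real y2"
  "x1 < y1" "y1 < x2" "x2 < y2"
 shows "meets f g"
proof -
 let ?h = "\<lambda>z. (\<chi> i. if i = 1 then Re z else Im z) :: real^2"
 have "continuous_on UNIV (\<lambda>z. if i = 1 then Re z else Im z)" for i :: 2
  by(cases "i = 1") (simp_all add: continuous_on_Re continuous_on_Im continuous_on_id)
 hence hc: "continuous_on UNIV ?h" by(intro continuous_on_vec_lambda)
 obtain B where B: "B > 0" "\<And>r. r \<in> {0..1} ==> norm (f r) \<le> B" "\<And>r. r \<in> {0..1} ==> norm (g r) \<le> B"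
 proof -
  have "bounded (path_image f \<union> path_image g)" using assms(1,2) by(simp add: bounded_path_image)
  then obtain B where "B > 0" "\<And>x. x \<in> path_image f \<union> path_image g ==> norm x \<le> B" unfolding bounded_pos by blast
  thus thesis by(intro that[of B]) (auto simp: path_image_def)
 qed
 let ?a = "vector [- B, 0] :: real^2" and ?b = "vector [B, B] :: real^2"
 have box: "?h z \<in> cbox ?a ?b" if "norm z \<le> B" "Im z \<ge> 0" for z
  using that abs_Re_le_cmod[of z] abs_Im_le_cmod[of z] by(auto simp: mem_box_cart forall_2)
 have p: "path (?h \<circ> f)" "path (?h \<circ> g)"
  using assms(1,2) hc by(auto intro!: path_continuous_image continuous_on_subset[OF hc])
 have im: "path_image (?h \<circ> f) \<subseteq> cbox ?a ?b" "path_image (?h \<circ> g) \<subseteq> cbox ?a ?b"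
  using B assms(3,4) box unfolding path_image_def by(auto simp only: image_subset_iff o_def)
 have se: "pathstart (?h \<circ> f) = ?h (of_real x1)" "pathfinish (?h \<circ> f) = ?h (of_real x2)"
  "pathstart (?h \<circ> g) = ?h (of_real y1)" "pathfinish (?h \<circ> g) = ?h (of_real y2)"
  by(simp_all only: pathstart_def pathfinish_def o_def assms)
 have h2: "?h (of_real x) $ 2 = ?a $ 2" "?h (of_real x) $ 1 = x" for x by simp_all
 obtain z where z: "z \<in> path_image (?h \<circ> f)" "z \<in> path_image (?h \<circ> g)"
  by(rule fashoda_interlace[OF p im]) (simp_all only: se h2 assms)
 then obtain r s where "r \<in> {0..1}" "s \<in> {0..1}" "?h (f r) = ?h (g s)" by(auto simp: path_image_def)
 moreover have "f r = g s" if "?h (f r) = ?h (g s)" for r s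
  using that by(simp add: vec_eq2 complex_eq_iff)
 ultimately show ?thesis unfolding meets_def by blast
qed

text \<open>The eight interleaved orders of two pairs. Each of them reduces to that of
  \<open>complex_fashoda\<close> by reversing paths or exchanging them.\<close>

lemma crossing_order:
 fixes x1 x2 y1 y2 :: real
 assumes "(x1 - y1) * (x1 - y2) * ((x2 - y1) * (x2 - y2)) < 0"
 shows "x1 < y1 \<and> y1 < x2 \<and> x2 < y2 \<or> x1 < y2 \<and> y2 < x2 \<and> x2 < y1 \<or>
    x2 < y1 \<and> y1 < x1 \<and> x1 < y2 \<or> x2 < y2 \<and> y2 < x1 \<and> x1 < y1 \<or>
    y1 < x1 \<and> x1 < y2 \<and> y2 < x2 \<or> y1 < x2 \<and> x2 < y2 \<and> y2 < x1 \<or>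
    y2 < x1 \<and> x1 < y1 \<and> y1 < x2 \<or> y2 < x2 \<and> x2 < y1 \<and> y1 < x1"
proof -
 have b: "(x - p) * (x - r) < 0 \<longleftrightarrow> p < x \<and> x < r \<or> r < x \<and> x < p" for x p r :: real
  by(auto simp: mult_less_0_iff)
 have o: "0 < (x - p) * (x - r) \<longleftrightarrow> p < x \<and> r < x \<or> x < p \<and> x < r" for x p r :: real
  by(auto simp: zero_less_mult_iff)
 have "(x1 - y1) * (x1 - y2) < 0 \<and> (x2 - y1) * (x2 - y2) > 0 \<or> (x1 - y1) * (x1 - y2) > 0 \<and> (x2 - y1) * (x2 - y2) < 0"
  using assms unfolding mult_less_0_iff[of "(x1 - y1) * (x1 - y2)"] by blast
 thus ?thesis unfolding b o by blast
qed

lemma linked_paths_meet: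
 assumes f: "path f" "\<forall>r\<in>{0..1}. Im (f r) \<ge> 0" "f 0 = of_real x1" "f 1 = of_real x2"
  and g: "path g" "\<forall>r\<in>{0..1}. Im (g r) \<ge> 0" "g 0 = of_real y1" "g 1 = of_real y2"
  and l: "(x1 - y1) * (x1 - y2) * ((x2 - y1) * (x2 - y2)) < 0"
 shows "meets f g"
proof -
 let ?f = "reversepath f" and ?g = "reversepath g"
 have f': "path ?f" "\<forall>r\<in>{0..1}. Im (?f r) \<ge> 0" "?f 0 = of_real x2" "?f 1 = of_real x1"
  using f by(auto simp: reversepath_def[abs_def] path_reversepath[of f, unfolded reversepath_def[abs_def]])
 have g': "path ?g" "\<forall>r\<in>{0..1}. Im (?g r) \<ge> 0" "?g 0 = of_real y2" "?g 1 = of_real y1"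
  using g by(auto simp: reversepath_def[abs_def] path_reversepath[of g, unfolded reversepath_def[abs_def]])
 have w1: "meets f g" if "meets ?f g" using that by(rule meets_reverse)
 have w2: "meets f g" if "meets f ?g" by(rule meets_sym, rule meets_reverse, rule meets_sym, rule that)
 have w3: "meets f g" if "meets ?f ?g"
  by(rule meets_reverse, rule meets_sym, rule meets_reverse, rule meets_sym, rule that)
 from crossing_order[OF l] show ?thesis
 proof (elim disjE conjE)
  assume o: "x1 < y1" "y1 < x2" "x2 < y2"
  show ?thesis by(rule complex_fashoda[OF f(1) g(1) f(2) g(2) f(3,4) g(3,4) o])
 next
  assume o: "x1 < y2" "y2 < x2" "x2 < y1"
  show ?thesis by(rule w2[OF complex_fashoda[OF f(1) g'(1) f(2) g'(2) f(3,4) g'(3,4) o]])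
 next
  assume o: "x2 < y1" "y1 < x1" "x1 < y2"
  show ?thesis by(rule w1[OF complex_fashoda[OF f'(1) g(1) f'(2) g(2) f'(3,4) g(3,4) o]])
 next
  assume o: "x2 < y2" "y2 < x1" "x1 < y1"
  show ?thesis by(rule w3[OF complex_fashoda[OF f'(1) g'(1) f'(2) g'(2) f'(3,4) g'(3,4) o]])
 next
  assume o: "y1 < x1" "x1 < y2" "y2 < x2"
  show ?thesis by(rule meets_sym[OF complex_fashoda[OF g(1) f(1) g(2) f(2) g(3,4) f(3,4) o]])
 next
  assume o: "y1 < x2" "x2 < y2" "y2 < x1"
  show ?thesis by(rule w1[OF meets_sym[OF complex_fashoda[OF g(1) f'(1) g(2) f'(2) g(3,4) f'(3,4) o]]])
 next
  assume o: "y2 < x1" "x1 < y1" "y1 < x2"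
  show ?thesis by(rule w2[OF meets_sym[OF complex_fashoda[OF g'(1) f(1) g'(2) f(2) g'(3,4) f(3,4) o]]])
 next
  assume o: "y2 < x2" "x2 < y1" "y1 < x1"
  show ?thesis by(rule w3[OF meets_sym[OF complex_fashoda[OF g'(1) f'(1) g'(2) f'(2) g'(3,4) f'(3,4) o]]])
 qed
qed

text \<open>A projective change of coordinates that keeps finitely many cusps away from infinity, so
  that their boundary points are real numbers.\<close>

lemma finite_position:
 assumes "finite F" "0 \<notin> F"
 obtains M where "M \<in> SL2" "\<And>u. u \<in> F ==> (M *v u)$2 \<noteq> 0"
proof -
 have "finite (\<Union>u\<in>F. {x. u$1 * x + u$2 = 0 \<and> u$1 \<noteq> 0})"
 proof (intro finite_UN_I assms(1))
  fix u :: "real^2"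
  have "{x. u$1 * x + u$2 = 0 \<and> u$1 \<noteq> 0} \<subseteq> {- u$2 / u$1}" by(auto simp: field_simps add_eq_0_iff)
  thus "finite {x. u$1 * x + u$2 = 0 \<and> u$1 \<noteq> 0}" by(rule finite_subset) simp
 qed
 then obtain x where x: "x \<notin> (\<Union>u\<in>F. {x. u$1 * x + u$2 = 0 \<and> u$1 \<noteq> 0})"
  using ex_new_if_finite[OF infinite_UNIV_char_0] by blast
 show thesis
 proof (rule that[of "mat2 1 0 x 1"])
  show "mat2 1 0 x 1 \<in> SL2" by(simp add: SL2_iff)
  fix u assume u: "u \<in> F"
  hence "u \<noteq> 0" using assms(2) by auto
  thus "(mat2 1 0 x 1 *v u)$2 \<noteq> 0" using x u by(auto simp: vec_eq2 mult.commute)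
 qed
qed

lemma linked_bpt:
 assumes "a$2 \<noteq> 0" "b$2 \<noteq> 0" "c$2 \<noteq> 0" "d$2 \<noteq> 0" "linked a b c d"
 shows "(bpt a - bpt c) * (bpt a - bpt d) * ((bpt b - bpt c) * (bpt b - bpt d)) < 0"
proof -
 have e: "dt x y = (x$2 * y$2) * (bpt x - bpt y)" if "x$2 \<noteq> 0" "y$2 \<noteq> 0" for x y
  using that by(simp add: dt_def field_simps)
 have "dt a c * dt a d * (dt b c * dt b d) =
   (a$2 * b$2 * c$2 * d$2)\<^sup>2 * ((bpt a - bpt c) * (bpt a - bpt d) * ((bpt b - bpt c) * (bpt b - bpt d)))"
  by(simp only: e[OF assms(1,3)] e[OF assms(1,4)] e[OF assms(2,3)] e[OF assms(2,4)] power2_eq_square mult_ac)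
 moreover have "(a$2 * b$2 * c$2 * d$2)\<^sup>2 > 0" using assms(1-4) by simp
 ultimately show ?thesis using assms(5) unfolding linked_def by(simp add: mult_less_0_iff)
qed

subsection \<open>Arcs with the same image\<close>

lemma embedded_arc_cong:
 assumes "\<And>r. 0 \<le> r ==> r \<le> 1 ==> c r = d r" "embedded_arc c"
 shows "embedded_arc d"
proof -
 have c: "continuous_on {0..1} c" "loop_free c" "path_image c \<subseteq> torus" "c 0 = puncture" "c 1 = puncture"
  using assms(2) by(auto simp: embedded_arc_def simple_path_def path_def pathstart_def pathfinish_def)
 have "continuous_on {0..1} d" by(rule continuous_on_eq[OF c(1)]) (simp add: assms(1))
 moreover have "loop_free d" using c(2) unfolding loop_free_def by(simp add: assms(1)[symmetric])
 moreover have "path_image d = path_image c" unfolding path_image_def by(rule image_cong) (simp_all add: assms(1)[symmetric])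
 moreover have "d 0 = c 0" "d 1 = c 1" by(simp_all add: assms(1)[symmetric])
 ultimately show ?thesis using c by(simp add: embedded_arc_def simple_path_def path_def pathstart_def pathfinish_def)
qed

lemma embedded_arc_reparam:
 assumes c: "embedded_arc c" and e: "continuous_on {0..1} e" "strict_mono_on {0..1} e" "e 0 = 0" "e 1 = 1"
 shows "embedded_arc (\<lambda>r. c (e r))"
proof -
 have c': "continuous_on {0..1} c" "loop_free c" "path_image c \<subseteq> torus" "c 0 = puncture" "c 1 = puncture"
  using c by(auto simp: embedded_arc_def simple_path_def path_def pathstart_def pathfinish_def)
 have m: "mono_on {0..1} e" by(rule strict_mono_on_imp_mono_on[OF e(2)])
 have r: "0 \<le> e r" "e r \<le> 1" if "0 \<le> r" "r \<le> 1" for r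
  using mono_onD[OF m, of 0 r] mono_onD[OF m, of r 1] that e(3,4) by simp_all
 have i: "inj_on e {0..1}" by(rule strict_mono_on_imp_inj_on[OF e(2)])
 have "continuous_on {0..1} (\<lambda>r. c (e r))"
  by(rule continuous_on_compose2[OF c'(1) e(1)]) (use r in auto)
 moreover have "loop_free (\<lambda>r. c (e r))" unfolding loop_free_def
 proof (intro ballI impI)
  fix x y :: real assume x: "x \<in> {0..1}" and y: "y \<in> {0..1}" and eq: "c (e x) = c (e y)"
  have ex: "e x \<in> {0..1}" "e y \<in> {0..1}" using r x y by auto
  hence "e x = e y \<or> e x = 0 \<and> e y = 1 \<or> e x = 1 \<and> e y = 0" using c'(2) eq unfolding loop_free_def by blast
  moreover have "x = z" if "e x = e z" "z \<in> {0..1}" for z using i that x by(auto dest: inj_onD)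
  moreover have "y = z" if "e y = e z" "z \<in> {0..1}" for z using i that y by(auto dest: inj_onD)
  ultimately show "x = y \<or> x = 0 \<and> y = 1 \<or> x = 1 \<and> y = 0" using e(3,4) y by force
 qed
 moreover have "path_image (\<lambda>r. c (e r)) \<subseteq> torus"
 proof -
  have "(\<lambda>r. c (e r)) ` {0..1} \<subseteq> c ` {0..1}" using r by auto
  thus ?thesis using c'(3) unfolding path_image_def by(rule order_trans)
 qed
 ultimately show ?thesis using c' e(3,4) by(simp add: embedded_arc_def simple_path_def path_def pathstart_def pathfinish_def)
qed

text \<open>The convex combinations of \<open>e\<close> with the identity remain strictly increasing
  with fixed ends, so every stage of the straight homotopy is embedded.\<close>

lemma homotopic_reparam:
 assumes c: "embedded_arc c" and e: "continuous_on {0..1} e" "strict_mono_on {0..1} e" "e 0 = 0" "e 1 = 1"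
  and d: "\<And>r. 0 \<le> r ==> r \<le> 1 ==> d r = c (e r)"
 shows "homotopic_with_canon embedded_arc {0..1} torus d c"
proof (subst homotopic_with)
 \<comment> \<open>Loops are total functions; homotopy needs a predicate that sees only the values
   on [0, 1].\<close>
 show "embedded_arc h = embedded_arc k" if "\<And>x. x \<in> topspace (top_of_set {0..1}) ==> h x = k x" for h k
  using embedded_arc_cong[of h k] embedded_arc_cong[of k h] that by auto
 let ?e = "\<lambda>s r. (1 - s) * e r + s * r"
 let ?h = "\<lambda>x. c (?e (fst x) (snd x))"
 have m: "mono_on {0..1} e" by(rule strict_mono_on_imp_mono_on[OF e(2)])
 have r: "0 \<le> e r" "e r \<le> 1" if "0 \<le> r" "r \<le> 1" for r
  using mono_onD[OF m, of 0 r] mono_onD[OF m, of r 1] that e(3,4) by simp_all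
 have range: "?e s r \<in> {0..1}" if "s \<in> {0..1}" "r \<in> {0..1}" for s r
  using r[of r] that convex_bound_le[of "e r" 1 r "1 - s" s] by auto
 have cc: "continuous_on {0..1} c" using embedded_arcD(1)[OF c] .
 have es: "continuous_on ({0..1::real} \<times> {0..1}) (\<lambda>x. e (snd x))"
  by(rule continuous_on_compose2[OF e(1) continuous_on_snd[OF continuous_on_id]]) auto
 have "continuous_on ({0..1} \<times> {0..1}) (\<lambda>x. ?e (fst x) (snd x))"
  by(intro continuous_on_add continuous_on_mult continuous_on_diff continuous_on_const es
    continuous_on_fst continuous_on_snd continuous_on_id)
 hence hc: "continuous_on ({0..1} \<times> {0..1}) ?h"
  by(rule continuous_on_compose2[OF cc]) (use range in auto)
 have sm: "strict_mono_on {0..1} (?e s)" if s: "s \<in> {0..1}" for s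
 proof (rule strict_mono_onI)
  fix x y :: real assume xy: "x \<in> {0..1}" "y \<in> {0..1}" "x < y"
  have "e x < e y" using strict_mono_onD[OF e(2) xy] .
  hence "(1 - s) * e x \<le> (1 - s) * e y" using s by(intro mult_left_mono) auto
  moreover have "s * x \<le> s * y" using s xy by(intro mult_left_mono) auto
  moreover have "(1 - s) * e x < (1 - s) * e y \<or> s * x < s * y"
   using \<open>e x < e y\<close> xy(3) s by(cases "s = 0") auto
  ultimately show "?e s x < ?e s y" by linarith
 qed
 have emb: "embedded_arc (\<lambda>x. ?h (s, x))" if s: "s \<in> {0..1}" for s
 proof -
  have "continuous_on {0..1} (?e s)"
   by(intro continuous_on_add continuous_on_mult continuous_on_const e(1) continuous_on_id)
  from embedded_arc_reparam[OF c this sm[OF s]] show ?thesis using e(3,4) by simp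
 qed
 have him: "?h ` ({0..1} \<times> {0..1}) \<subseteq> torus"
 proof
  fix y assume "y \<in> ?h ` ({0..1} \<times> {0..1})"
  then obtain s r where "y = c (?e s r)" "s \<in> {0..1}" "r \<in> {0..1}" by auto
  hence "y \<in> path_image c" using range[of s r] unfolding path_image_def by blast
  thus "y \<in> torus" using c by(auto simp: embedded_arc_def)
 qed
 show "\<exists>h. continuous_map (prod_topology (top_of_set {0..1::real}) (top_of_set {0..1})) (top_of_set torus) h \<and>
   (\<forall>x\<in>topspace (top_of_set {0..1}). h (0, x) = d x) \<and> (\<forall>x\<in>topspace (top_of_set {0..1}). h (1, x) = c x) \<and>
   (\<forall>t\<in>{0..1::real}. embedded_arc (\<lambda>x. h (t, x)))"
 proof (rule exI[where x = ?h], intro conjI)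
  show "continuous_map (prod_topology (top_of_set {0..1::real}) (top_of_set {0..1})) (top_of_set torus) ?h"
   using hc him by(simp add: continuous_map_in_subtopology prod_topology_subtopology_eu image_subset_iff Pi_iff)
 qed (use d emb in auto)
qed

lemma homotopic_reverse:
 assumes "homotopic_with_canon embedded_arc {0..1} torus a b"
 shows "homotopic_with_canon embedded_arc {0..1} torus (a \<circ> (\<lambda>r. 1 - r)) (b \<circ> (\<lambda>r. 1 - r))"
proof (rule homotopic_with_compose_continuous_map_right[OF assms])
 show "continuous_map (top_of_set {0..1}) (top_of_set {0..1}) (\<lambda>r::real. 1 - r)"
  by(simp add: continuous_map_in_subtopology Pi_iff) (intro continuous_on_diff continuous_on_const continuous_on_id)
 show "embedded_arc (j \<circ> (\<lambda>r. 1 - r))" if "embedded_arc j" for j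
  using embedded_arc_reverse[OF that] by(simp add: reversepath_def o_def)
qed

lemma isotopic_sym: "isotopic c d ==> isotopic d c"
 unfolding isotopic_def
proof (elim disjE)
 assume "homotopic_with_canon embedded_arc {0..1} torus c (reversepath d)"
 from homotopic_reverse[OF homotopic_with_symD[OF this]]
 have "homotopic_with_canon embedded_arc {0..1} torus d (reversepath c)" by(simp add: reversepath_def o_def)
 thus "homotopic_with_canon embedded_arc {0..1} torus d c \<or> homotopic_with_canon embedded_arc {0..1} torus d (reversepath c)" ..
qed (use homotopic_with_symD in blast)

lemma isotopic_trans: "isotopic a b ==> isotopic b c ==> isotopic a c"
proof -
 assume ab: "isotopic a b" and bc: "isotopic b c"
 let ?H = "homotopic_with_canon embedded_arc {0..1} torus"
 have r: "?H (reversepath x) (reversepath y)" if "?H x y" for x y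
  using homotopic_reverse[OF that] by(simp add: reversepath_def o_def)
 have t: "?H x z" if "?H x y" "?H y z" for x y z using homotopic_with_trans that by blast
 have "?H a b \<or> ?H a (reversepath b)" "?H b c \<or> ?H b (reversepath c)"
  using ab bc by(simp_all add: isotopic_def)
 hence "?H a c \<or> ?H a (reversepath c)"
 proof (elim disjE)
  assume "?H a b" "?H b c" from t[OF this] show ?thesis ..
 next
  assume "?H a b" "?H b (reversepath c)" from t[OF this] show ?thesis ..
 next
  assume a: "?H a (reversepath b)" "?H b c"
  from t[OF a(1) r[OF a(2)]] show ?thesis ..
 next
  assume a: "?H a (reversepath b)" "?H b (reversepath c)"
  from t[OF a(1) r[OF a(2)]] show ?thesis by simp
 qed
 thus ?thesis by(simp add: isotopic_def)
qed

text \<open>The transition map between two parametrisations is an injective continuous map of the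
  open interval onto itself, hence monotone. It extends to the closed interval, and
  \<open>homotopic_reparam\<close> applies, after a reversal in the decreasing case.\<close>

lemma isotopic_same_image:
 assumes c: "embedded_arc c" and d: "embedded_arc d" and im: "path_image c - {puncture} = path_image d - {puncture}"
  and ci: "homeomorphism {0<..<1} (path_image c - {puncture}) c ci"
 shows "isotopic d c"
proof -
 have Gc: "path_image c - {puncture} = c ` {0<..<1}" "path_image c - {puncture} = d ` {0<..<1}"
  using embedded_arcD(6)[OF c] embedded_arcD(6)[OF d] im by simp_all
 have dc: "continuous_on {0<..<1} d" using embedded_arcD(1)[OF d] by(rule continuous_on_subset) auto
 define \<phi> where "\<phi> r = ci (d r)" for r
 have dG: "d r \<in> path_image c - {puncture}" if "r \<in> {0<..<1}" for r unfolding Gc(2) using that by(rule imageI)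
 have cphi: "c (\<phi> r) = d r" if "r \<in> {0<..<1}" for r
  unfolding \<phi>_def by(rule homeomorphism_apply2[OF ci dG[OF that]])
 have pc: "continuous_on {0<..<1} \<phi>" unfolding \<phi>_def
  by(rule continuous_on_compose2[OF homeomorphism_cont2[OF ci] dc]) (simp only: Gc(2)[symmetric] order_refl)
 have pim: "\<phi> ` {0<..<1} = {0<..<1}"
 proof -
  have "\<phi> ` {0<..<1} = ci ` (d ` {0<..<1})" unfolding \<phi>_def by(simp only: image_image)
  thus ?thesis using homeomorphism_image2[OF ci] Gc(2) by simp
 qed
 have pinj: "inj_on \<phi> {0<..<1}"
 proof (rule inj_onI)
  fix x y assume xy: "x \<in> {0<..<1}" "y \<in> {0<..<1}" "\<phi> x = \<phi> y"
  hence "d x = d y" using cphi[OF xy(1)] cphi[OF xy(2)] by simp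
  thus "x = y" using embedded_arcD(5)[OF d] xy by(auto dest: inj_onD)
 qed
 have main: "homotopic_with_canon embedded_arc {0..1} torus d' c"
  if p: "continuous_on {0<..<1} p" "p ` {0<..<1} = {0<..<1}" "strict_mono_on {0<..<1} p"
   and cd: "\<And>r. r \<in> {0<..<1} ==> c (p r) = d' r" and d': "d' 0 = puncture" "d' 1 = puncture" for p :: "real => real" and d'
 proof -
  define e where "e r = (if r \<le> 0 then 0 else if r \<ge> 1 then 1 else p r)" for r
  have pr: "0 < p r" "p r < 1" if "0 < r" "r < 1" for r using p(2) that by(force simp: image_def)+
  have e01: "e 0 = 0" "e 1 = 1" by(simp_all add: e_def)
  have sm: "strict_mono_on {0..1} e"
  proof (rule strict_mono_onI)
   fix x y :: real assume xy: "x \<in> {0..1}" "y \<in> {0..1}" "x < y"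
   show "e x < e y"
    using xy pr[of x] pr[of y] strict_mono_onD[OF p(3), of x y] by(auto simp: e_def)
  qed
  have img: "\<exists>r. 0 < r \<and> r < 1 \<and> p r = t" if "0 < t" "t < 1" for t
  proof -
   have "t \<in> p ` {0<..<1}" using p(2) that by simp
   thus ?thesis by auto
  qed
  have "continuous_on {0..1} e"
  proof (rule continuous_onI)
   fix x eps :: real assume x: "x \<in> {0..1}" and eps: "eps > 0"
   consider "x = 0" | "x = 1" | "0 < x" "x < 1" using x by force
   thus "\<exists>d>0. \<forall>x'\<in>{0..1}. dist x' x < d --> dist (e x') (e x) \<le> eps"
   proof cases
    case 1
    \<comment> \<open>Surjectivity and monotonicity give continuity at the end: below the preimage
      of \<open>min eps (1/2)\<close> all values are smaller than \<open>eps\<close>.\<close>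
    obtain r where r: "0 < r" "r < 1" "p r = min eps (1/2)" using img[of "min eps (1/2)"] eps by(auto simp: min_less_iff_disj)
    have "dist (e x') (e x) \<le> eps" if "x' \<in> {0..1}" "dist x' x < r" for x'
     using that r eps pr[of x'] strict_mono_onD[OF p(3), of x' r] by(auto simp: 1 e_def dist_real_def)
    thus ?thesis using r(1) by blast
   next
    case 2
    obtain r where r: "0 < r" "r < 1" "p r = max (1 - eps) (1/2)" using img[of "max (1 - eps) (1/2)"] eps by(auto simp: less_max_iff_disj)
    have "dist (e x') (e x) \<le> eps" if "x' \<in> {0..1}" "dist x' x < 1 - r" for x'
     using that r eps pr[of x'] strict_mono_onD[OF p(3), of r x'] by(auto simp: 2 e_def dist_real_def)
    thus ?thesis using r(2) by(intro exI[of _ "1 - r"]) auto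
   next
    case 3
    have "continuous (at x) p" using p(1) 3 continuous_on_eq_continuous_at[of "{0<..<1}" p] by auto
    then obtain dd where dd: "dd > 0" "\<And>x'. dist x' x < dd ==> dist (p x') (p x) < eps"
     unfolding continuous_at_eps_delta using eps by blast
    let ?d = "min dd (min x (1 - x))"
    have "dist (e x') (e x) \<le> eps" if "x' \<in> {0..1}" "dist x' x < ?d" for x'
    proof -
     have "0 < x'" "x' < 1" using that(2) by(auto simp: dist_real_def)
     thus ?thesis using dd(2)[of x'] that 3 by(auto simp: e_def less_imp_le)
    qed
    thus ?thesis using dd(1) 3 by(intro exI[of _ ?d]) auto
   qed
  qed
  moreover have "d' r = c (e r)" if "0 \<le> r" "r \<le> 1" for r
   using that cd[of r] d' embedded_arcD(2,3)[OF c] by(auto simp: e_def)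
  ultimately show ?thesis by(intro homotopic_reparam[OF c _ sm e01])
 qed
 have "is_interval {0<..<1::real}" by(simp add: is_interval_oo)
 hence "strict_mono_on {0<..<1} \<phi> \<or> strict_antimono_on {0<..<1} \<phi>"
  using injective_eq_monotone_map[OF _ pc] pinj by blast
 thus ?thesis
 proof
  assume "strict_mono_on {0<..<1} \<phi>"
  hence "homotopic_with_canon embedded_arc {0..1} torus d c"
   using main[OF pc pim _ cphi embedded_arcD(2,3)[OF d]] by blast
  thus ?thesis by(simp add: isotopic_def)
 next
  assume am: "strict_antimono_on {0<..<1} \<phi>"
  let ?p = "\<lambda>r. \<phi> (1 - r)"
  have "continuous_on {0<..<1} ?p"
   by(rule continuous_on_compose2[OF pc]) (auto intro!: continuous_on_diff continuous_on_const continuous_on_id)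
  moreover have "?p ` {0<..<1} = {0<..<1}"
  proof -
   have "(\<lambda>r. 1 - r) ` {0<..<1::real} = {0<..<1}" by(auto simp: image_iff intro!: bexI[of _ "1 - _"])
   thus ?thesis using pim by(simp only: image_image[symmetric, of \<phi> "\<lambda>r. 1 - r"])
  qed
  moreover have "strict_mono_on {0<..<1} ?p"
  proof (rule strict_mono_onI)
   fix x y :: real assume xy: "x \<in> {0<..<1}" "y \<in> {0<..<1}" "x < y"
   have "1 - y \<in> {0<..<1}" "1 - x \<in> {0<..<1}" "1 - y < 1 - x" using xy by auto
   thus "?p x < ?p y" using am unfolding monotone_on_def by blast
  qed
  moreover have "c (?p r) = reversepath d r" if "r \<in> {0<..<1}" for r
   using cphi[of "1 - r"] that by(simp add: reversepath_def)
  moreover have "reversepath d 0 = puncture" "reversepath d 1 = puncture"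
   using embedded_arcD(2,3)[OF d] by(simp_all add: reversepath_def)
  ultimately have "homotopic_with_canon embedded_arc {0..1} torus (reversepath d) c" by(rule main)
  hence "homotopic_with_canon embedded_arc {0..1} torus (reversepath d \<circ> (\<lambda>r. 1 - r)) (c \<circ> (\<lambda>r. 1 - r))"
   by(rule homotopic_reverse)
  thus ?thesis by(simp add: isotopic_def reversepath_def o_def)
 qed
qed

section \<open>Disjoint arcs have unlinked lifts\<close>

context cusped_torus
begin

text \<open>The lifts, extended by their boundary points, are paths in the closed half-plane with
  interleaved ends, so they meet. A meeting point in the interior projects to a common point of the
  arcs; one on the boundary would make two ends coincide, which strict linking forbids.\<close>

lemma disjoint_arcs_unlinked:
 assumes c: "has_ends c u v" and d: "has_ends d u' v'"
  and disj: "c ` {0<..<1} \<inter> d ` {0<..<1} = {}"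
 shows "\<not> linked u v u' v'"
proof
 assume l: "linked u v u' v'"
 obtain k where k: "u \<in> cusps" "v \<in> cusps" "is_lift c k" "tends0 u k" "tends0 v (\<lambda>r. k (1 - r))"
  using c by(auto simp: has_ends_def)
 obtain m where m: "u' \<in> cusps" "v' \<in> cusps" "is_lift d m" "tends0 u' m" "tends0 v' (\<lambda>r. m (1 - r))"
  using d by(auto simp: has_ends_def)
 obtain M where M: "M \<in> SL2" "\<And>x. x \<in> {u, v, u', v'} ==> (M *v x)$2 \<noteq> 0"
 proof (rule finite_position[of "{u, v, u', v'}"])
  show "0 \<notin> {u, v, u', v'}" using cusp_nonzero k(1,2) m(1,2) by(auto simp: eq_commute[of 0])
 qed auto
 have n: "(M *v u)$2 \<noteq> 0" "(M *v v)$2 \<noteq> 0" "(M *v u')$2 \<noteq> 0" "(M *v v')$2 \<noteq> 0" using M(2) by blast+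
 have I: "Im (k r) > 0" "Im (m r) > 0" if "0 < r" "r < 1" for r
  using that k(3) m(3) by(auto simp: is_lift_def half_plane_iff image_subset_iff)
 have I': "Im (k (1 - r)) > 0" "Im (m (1 - r)) > 0" if "0 < r" "r < 1" for r using I[of "1 - r"] that by simp_all
 have MI: "Im (moeb M z) > 0" if "Im z > 0" for z using moeb_half_plane[OF M(1), of z] that by(simp add: half_plane_iff)
 define f where "f = extend (bpt (M *v u)) (bpt (M *v v)) (\<lambda>r. moeb M (k r))"
 define g where "g = extend (bpt (M *v u')) (bpt (M *v v')) (\<lambda>r. moeb M (m r))"
 have ck: "continuous_on {0<..<1} (\<lambda>r. moeb M (k r))" "continuous_on {0<..<1} (\<lambda>r. moeb M (m r))"
  using k(3) m(3) by(auto simp: is_lift_def intro!: continuous_on_compose2[OF continuous_on_moeb[OF M(1)]])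
 have pf: "path f" unfolding f_def
  by(rule path_extend[OF ck(1) _ n(1) tends0_moeb[OF I(1) M(1) k(4)] n(2) tends0_moeb[OF I'(1) M(1) k(5)]])
   (simp_all add: MI I)
 have pg: "path g" unfolding g_def
  by(rule path_extend[OF ck(2) _ n(3) tends0_moeb[OF I(2) M(1) m(4)] n(4) tends0_moeb[OF I'(2) M(1) m(5)]])
   (simp_all add: MI I)
 have If: "Im (f r) \<ge> 0" "Im (g r) \<ge> 0" for r
  using MI[OF I(1)[of r]] MI[OF I(2)[of r]] by(auto simp: f_def g_def extend_def)
 have l': "linked (M *v u) (M *v v) (M *v u') (M *v v')" using l linked_mat[OF M(1)] by simp
 note lb = linked_bpt[OF n l']
 have ends: "f 0 = of_real (bpt (M *v u))" "f 1 = of_real (bpt (M *v v))"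
  "g 0 = of_real (bpt (M *v u'))" "g 1 = of_real (bpt (M *v v'))"
  by(simp_all only: f_def g_def extend_def) simp_all
 have If': "\<forall>r\<in>{0..1}. Im (f r) \<ge> 0" "\<forall>r\<in>{0..1}. Im (g r) \<ge> 0" using If by simp_all
 obtain r s where rs: "r \<in> {0..1}" "s \<in> {0..1}" "f r = g s"
  using linked_paths_meet[OF pf If'(1) ends(1,2) pg If'(2) ends(3,4) lb] unfolding meets_def by blast
 have fi: "Im (f r) > 0 \<longleftrightarrow> 0 < r \<and> r < 1" "Im (g r) > 0 \<longleftrightarrow> 0 < r \<and> r < 1" for r
  using MI[OF I(1)[of r]] MI[OF I(2)[of r]] by(auto simp: f_def g_def extend_def)
 show False
 proof (cases "0 < r \<and> r < 1")
  case True
  hence s: "0 < s \<and> s < 1" using fi rs(3) by metis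
  hence "moeb M (k r) = moeb M (m s)" using rs(3) True by(simp add: f_def g_def extend_def)
  hence "moeb (adj M) (moeb M (k r)) = moeb (adj M) (moeb M (m s))" by simp
  hence "k r = m s" using moeb_adj(1)[OF M(1)] I True s by simp
  moreover have "c r = q (k r)" "d s = q (m s)" using k(3) m(3) True s by(simp_all add: is_lift_def)
  ultimately have "c r = d s" by simp
  moreover have "c r \<in> c ` {0<..<1}" "d s \<in> d ` {0<..<1}" using True s by auto
  ultimately show False using disj by auto
 next
  case False
  hence "\<not> (0 < s \<and> s < 1)" using fi rs(3) by metis
  hence rs': "r = 0 \<or> r = 1" "s = 0 \<or> s = 1" using rs(1,2) False by auto
  hence "bpt (M *v u) = bpt (M *v u') \<or> bpt (M *v u) = bpt (M *v v') \<or>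
   bpt (M *v v) = bpt (M *v u') \<or> bpt (M *v v) = bpt (M *v v')"
   using rs(3) ends by(elim disjE) (simp_all only: of_real_eq_iff, auto)
  thus False using lb by auto
 qed
qed

lemma has_ends_translate:
 assumes "has_ends c u v" "g \<in> \<Gamma>"
 shows "has_ends c (g *v u) (g *v v)"
proof -
 obtain k where k: "u \<in> cusps" "v \<in> cusps" "is_lift c k" "tends0 u k" "tends0 v (\<lambda>r. k (1 - r))"
  using assms(1) by(auto simp: has_ends_def)
 have gS: "g \<in> SL2" using G_SL2 assms(2) by blast
 have I: "Im (k r) > 0" if "0 < r" "r < 1" for r
  using that k(3) by(auto simp: is_lift_def half_plane_iff image_subset_iff)
 have I': "Im (k (1 - r)) > 0" if "0 < r" "r < 1" for r using I[of "1 - r"] that by simp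
 have "is_lift c (\<lambda>r. moeb g (k r))"
  unfolding is_lift_def
 proof (intro conjI ballI)
  show "continuous_on {0<..<1} (\<lambda>r. moeb g (k r))"
   using k(3) by(auto simp: is_lift_def intro!: continuous_on_compose2[OF continuous_on_moeb[OF gS]])
  show "(\<lambda>r. moeb g (k r)) ` {0<..<1} \<subseteq> half_plane"
   using moeb_G_half_plane[OF assms(2)] I by(auto simp: half_plane_iff)
  fix r :: real assume r: "r \<in> {0<..<1}"
  hence "q (k r) = c r" using k(3) by(simp add: is_lift_def)
  thus "q (moeb g (k r)) = c r" using r q_moeb[OF assms(2) I[of r]] by simp
 qed
 thus ?thesis unfolding has_ends_def
  using cusps_even[OF assms(2)] k(1,2) tends0_moeb[OF I gS k(4)] tends0_moeb[OF I' gS k(5)] by blast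
qed

lemma arc_pair_unlinked:
 assumes "arc_pair \<alpha> u v" "arc_pair \<beta> u' v'" "c \<in> \<alpha>" "d \<in> \<beta>"
  "path_image c \<inter> path_image d = {puncture}" "g \<in> \<Gamma>"
 shows "\<not> linked (g *v u) (g *v v) u' v'"
proof -
 have c: "embedded_arc c" "has_ends c u v \<or> has_ends c v u" using assms by(auto simp: arc_pair_def)
 have d: "embedded_arc d" "has_ends d u' v' \<or> has_ends d v' u'" using assms by(auto simp: arc_pair_def)
 have disj: "c ` {0<..<1} \<inter> d ` {0<..<1} = {}"
  unfolding embedded_arcD(6)[OF c(1), symmetric] embedded_arcD(6)[OF d(1), symmetric] using assms(5) by blast
 have "has_ends c (g *v u) (g *v v) \<or> has_ends c (g *v v) (g *v u)" using has_ends_translate assms(6) c(2) by blast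
 thus ?thesis using disjoint_arcs_unlinked[OF _ _ disj] d(2) linked_swap by blast
qed

text \<open>Both classes contain a parametrisation of the common geodesic, and
  \<open>isotopic_same_image\<close> joins these two.\<close>

lemma same_geodesic_eq:
 assumes a: "\<alpha> \<in> arc_vertices q" "arc_pair \<alpha> u v" and b: "\<beta> \<in> arc_vertices q" "arc_pair \<beta> u' v'"
  and e: "q ` line u v = q ` line u' v'"
 shows "\<alpha> = \<beta>"
proof -
 obtain c0 where c0: "\<alpha> = isotopy_class c0" using a(1) by(auto simp: arc_vertices_def)
 obtain d0 where d0: "\<beta> = isotopy_class d0" using b(1) by(auto simp: arc_vertices_def)
 obtain c where c: "c \<in> \<alpha>" "embedded_arc c" "path_image c - {puncture} = q ` line u v"
  using a(2) unfolding arc_pair_def by blast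
 obtain d where d: "d \<in> \<beta>" "embedded_arc d" "path_image d - {puncture} = q ` line u' v'"
  using b(2) unfolding arc_pair_def by blast
 obtain ci where ci: "homeomorphism {0<..<1} (path_image c - {puncture}) c ci"
  by(rule embedded_arc_homeomorphism[OF c(2)])
 have "path_image c - {puncture} = path_image d - {puncture}" using c(3) d(3) e by simp
 hence dc: "isotopic d c" by(rule isotopic_same_image[OF c(2) d(2) _ ci])
 have "isotopic c0 c" using c(1) unfolding c0 isotopy_class_def by blast
 moreover have "isotopic d0 d" using d(1) unfolding d0 isotopy_class_def by blast
 ultimately have cd: "isotopic d0 c0" using dc isotopic_trans isotopic_sym by blast
 have "isotopic c0 x \<longleftrightarrow> isotopic d0 x" for x using cd isotopic_trans isotopic_sym by blast
 thus ?thesis unfolding c0 d0 isotopy_class_def by simp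
qed

lemma simple_pair_inj:
 assumes s: "simple_pair u v" and g: "g \<in> \<Gamma>" and z: "z \<in> line u v" "z \<in> line (g *v u) (g *v v)"
 shows "g = mat 1 \<or> g = - mat 1"
proof -
 have "z \<in> moeb g ` line u v" using z(2) line_moeb[OF G_SL2[OF g], of u v] by simp
 then obtain x where x: "x \<in> line u v" "z = moeb g x" by blast
 have Ix: "Im x > 0" using x(1) by(simp add: line_def)
 have "q z = q x" using q_moeb[OF g Ix] x(2) by simp
 hence "z = x" using s z(1) x(1) by(auto simp: simple_pair_def inj_on_def)
 thus ?thesis using free_action[OF g Ix] x(2) by simp
qed

end

section \<open>Triangulations and flips\<close>

text \<open>As \<open>v\<close> runs over the boundary circle, the sign changes exactly at
  \<open>s\<close> and \<open>t\<close>: it tells on which side of the line \<open>s t\<close> the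
  cusp lies.\<close>

definition sg :: "real^2 => real^2 => real^2 => real" where
 "sg s t v = dt s v * dt t v"

lemma linked_sg: "linked s t b c \<longleftrightarrow> sg s t b * sg s t c < 0"
 by(simp add: linked_def sg_def mult_ac)

text \<open>Affine coordinate on the circle at infinity with \<open>a\<close> placed at infinity.\<close>

definition xi :: "real^2 => real^2 => real^2 => real" where
 "xi a b v = dt v b / dt a v"

lemma dt_xi:
 assumes "dt a u \<noteq> 0" "dt a v \<noteq> 0"
 shows "dt a b * dt u v = dt a u * dt a v * (xi a b u - xi a b v)"
proof -
 have "dt a u * dt a v * (xi a b u - xi a b v) = dt u b * dt a v - dt v b * dt a u"
  using assms by(simp add: xi_def right_diff_distrib)
 also have "\<dots> = dt a b * dt u v" by(simp add: dt_def algebra_simps)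
 finally show ?thesis by simp
qed

text \<open>Linking becomes an order relation between four real numbers;
  \<open>linked_xi_inf\<close> is the case where one of the four points is \<open>a\<close>, at
  infinity.\<close>

lemma linked_xi:
 assumes "dt a b \<noteq> 0" and s: "dt a s \<noteq> 0" and t: "dt a t \<noteq> 0" and u: "dt a u \<noteq> 0" and v: "dt a v \<noteq> 0"
 shows "linked s t u v \<longleftrightarrow> (xi a b s - xi a b u) * (xi a b s - xi a b v) * ((xi a b t - xi a b u) * (xi a b t - xi a b v)) < 0"
  (is "_ \<longleftrightarrow> ?R < 0")
proof -
 have "(dt a b * dt s u) * (dt a b * dt s v) * ((dt a b * dt t u) * (dt a b * dt t v)) =
   (dt a s * dt a t * dt a u * dt a v)\<^sup>2 * ?R"
  unfolding dt_xi[OF s u] dt_xi[OF s v] dt_xi[OF t u] dt_xi[OF t v] power2_eq_square by(simp only: mult_ac)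
 hence "(dt a b)^4 * (dt s u * dt s v * (dt t u * dt t v)) = (dt a s * dt a t * dt a u * dt a v)\<^sup>2 * ?R"
  by(simp add: power4_eq_xxxx mult_ac)
 moreover have "(dt a b)^4 > 0" using assms(1) by simp
 moreover have "(dt a s * dt a t * dt a u * dt a v)\<^sup>2 > 0" using s t u v by simp
 ultimately show ?thesis unfolding linked_def by(metis mult_less_0_iff not_less_iff_gr_or_eq)
qed

lemma linked_xi_inf:
 assumes "dt a b \<noteq> 0" and s: "dt a s \<noteq> 0" and t: "dt a t \<noteq> 0" and u: "dt a u \<noteq> 0"
 shows "linked s t a u \<longleftrightarrow> (xi a b s - xi a b u) * (xi a b t - xi a b u) < 0" (is "_ \<longleftrightarrow> ?R < 0")
proof -
 have "(dt a s * dt a t) * ((dt a b * dt s u) * (dt a b * dt t u)) = (dt a s * dt a t * dt a u)\<^sup>2 * ?R"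
  unfolding dt_xi[OF s u] dt_xi[OF t u] power2_eq_square by(simp only: mult_ac)
 hence "(dt a b)\<^sup>2 * (dt s a * dt s u * (dt t a * dt t u)) = (dt a s * dt a t * dt a u)\<^sup>2 * ?R"
  by(simp add: power2_eq_square dt_swap[of s a] dt_swap[of t a] mult_ac)
 moreover have "(dt a b)\<^sup>2 > 0" using assms(1) by simp
 moreover have "(dt a s * dt a t * dt a u)\<^sup>2 > 0" using s t u by simp
 ultimately show ?thesis unfolding linked_def by(metis mult_less_0_iff not_less_iff_gr_or_eq)
qed

lemma neg_prod_iff: "(x::real) * y < 0 \<longleftrightarrow> x < 0 \<and> y > 0 \<or> x > 0 \<and> y < 0"
 by(auto simp: mult_less_0_iff)

lemma linked_nonzero: "linked s t u v ==> dt s u \<noteq> 0 \<and> dt s v \<noteq> 0 \<and> dt t u \<noteq> 0 \<and> dt t v \<noteq> 0"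
 by(auto simp: linked_def)

text \<open>Put \<open>a\<close> at infinity, so that \<open>x\<close> lies between \<open>b\<close>
  and \<open>c\<close>. The line \<open>s t\<close> surrounds \<open>c\<close> without surrounding
  \<open>x\<close>; both of its ends are then on the side of \<open>x\<close> away from
  \<open>b\<close>, so it cuts \<open>c\<close> off from \<open>b\<close> but not \<open>b\<close>
  from infinity.\<close>

lemma corner_crossing:
 assumes abc: "dt a b \<noteq> 0" "dt a c \<noteq> 0" and x: "linked a x b c" and u: "\<not> linked s t a x" and s: "linked s t c a"
 shows "linked s t b c \<and> \<not> linked s t a b"
proof -
 have n: "dt a s \<noteq> 0" "dt a t \<noteq> 0" "dt a x \<noteq> 0"
 proof -
  show "dt a s \<noteq> 0" "dt a t \<noteq> 0" using linked_nonzero[OF s] dt_swap[of a s] dt_swap[of a t] by auto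
  show "dt a x \<noteq> 0"
  proof
   assume "dt a x = 0"
   moreover have "a \<noteq> 0" using abc(1) by(auto simp: dt_lin)
   ultimately obtain k where "x = k *\<^sub>R a" using dt_zero_parallel by blast
   hence "dt a b * dt a c * (dt x b * dt x c) = (k * dt a b * dt a c)\<^sup>2" by(simp add: dt_lin power2_eq_square)
   thus False using x unfolding linked_def by(metis not_less zero_le_power2)
  qed
 qed
 let ?x = "xi a b x" and ?s = "xi a b s" and ?t = "xi a b t" and ?c = "xi a b c" and ?b = "xi a b b"
 have lx: "(?b - ?x) * (?c - ?x) < 0"
  using x linked_xi_inf[OF abc(1) abc(1) abc(2) n(3)] linked_sym linked_swap by blast
 have ls: "(?s - ?c) * (?t - ?c) < 0"
  using s linked_xi_inf[OF abc(1) n(1,2) abc(2)] linked_swap by blast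
 have lu: "\<not> (?s - ?x) * (?t - ?x) < 0" using u linked_xi_inf[OF abc(1) n(1,2,3)] by blast
 have "(?s - ?b) * (?s - ?c) * ((?t - ?b) * (?t - ?c)) < 0 \<and> \<not> (?s - ?b) * (?t - ?b) < 0"
 proof -
  have r: "(?s - ?b) * (?t - ?b) > 0"
   using lx ls lu unfolding neg_prod_iff zero_less_mult_iff by(smt (verit))
  have e: "(?s - ?b) * (?s - ?c) * ((?t - ?b) * (?t - ?c)) = ((?s - ?b) * (?t - ?b)) * ((?s - ?c) * (?t - ?c))"
   by(simp only: mult_ac)
  show ?thesis unfolding e by(intro conjI mult_pos_neg[OF r ls]) (use r in simp)
 qed
 thus ?thesis
  using linked_xi[OF abc(1) n(1,2) abc(1,2)] linked_xi_inf[OF abc(1) n(1,2) abc(1)] by blast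
qed

text \<open>A line entering the triangle through \<open>b c\<close> leaves it through another side
  or ends at \<open>a\<close>: at \<open>a\<close> the sign agrees weakly with those at
  \<open>b\<close> and \<open>c\<close>, which are opposite, so it is zero.\<close>

lemma end_at_vertex:
 assumes "linked s t b c" "\<not> linked s t c a" "\<not> linked s t a b"
 shows "dt s a = 0 \<or> dt t a = 0"
proof -
 have "sg s t b * sg s t c < 0" "\<not> sg s t c * sg s t a < 0" "\<not> sg s t a * sg s t b < 0"
  using assms by(simp_all add: linked_sg)
 hence "sg s t a = 0" unfolding neg_prod_iff by linarith
 thus ?thesis by(simp add: sg_def)
qed

text \<open>If \<open>s t\<close> met the diagonal without meeting \<open>b c\<close>, it would cut
  off \<open>a\<close> or \<open>a'\<close> from \<open>b\<close> and \<open>c\<close>, and hence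
  cross \<open>a x\<close> or \<open>a' y\<close>, since both of these continue beyond
  \<open>b c\<close>.\<close>

lemma diagonal_crossing:
 assumes abc: "dt a b \<noteq> 0" "dt a c \<noteq> 0" and a': "linked a a' b c" and x: "linked a x b c" and y: "linked a' y b c"
  and ux: "\<not> linked s t a x" and uy: "\<not> linked s t a' y" and s: "linked s t a a'"
 shows "linked s t b c"
proof -
 have nz: "dt a w \<noteq> 0" if "linked a w b c" for w
 proof
  assume "dt a w = 0"
  moreover have "a \<noteq> 0" using abc(1) by(auto simp: dt_lin)
  ultimately obtain k where "w = k *\<^sub>R a" using dt_zero_parallel by blast
  hence "dt a b * dt a c * (dt w b * dt w c) = (k * dt a b * dt a c)\<^sup>2" by(simp add: dt_lin power2_eq_square)
  thus False using that unfolding linked_def by(metis not_less zero_le_power2)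
 qed
 have n: "dt a s \<noteq> 0" "dt a t \<noteq> 0" "dt a x \<noteq> 0" "dt a a' \<noteq> 0"
  using linked_nonzero[OF s] dt_swap[of a s] dt_swap[of a t] nz[OF x] nz[OF a'] by auto
 let ?x = "xi a b x" and ?s = "xi a b s" and ?t = "xi a b t" and ?c = "xi a b c" and ?b = "xi a b b" and ?a = "xi a b a'" and ?y = "xi a b y"
 have lx: "(?b - ?x) * (?c - ?x) < 0"
  using x linked_xi_inf[OF abc(1) abc(1) abc(2) n(3)] linked_sym linked_swap by blast
 have la: "(?b - ?a) * (?c - ?a) < 0"
  using a' linked_xi_inf[OF abc(1) abc(1) abc(2) n(4)] linked_sym linked_swap by blast
 have ls: "(?s - ?a) * (?t - ?a) < 0" using s linked_xi_inf[OF abc(1) n(1,2,4)] by blast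
 have lu: "\<not> (?s - ?x) * (?t - ?x) < 0" using ux linked_xi_inf[OF abc(1) n(1,2,3)] by blast
 have uy': "\<not> ((?s < ?a \<and> ?a < ?t \<or> ?t < ?a \<and> ?a < ?s) \<and> dt a y = 0)"
 proof
  assume a: "(?s < ?a \<and> ?a < ?t \<or> ?t < ?a \<and> ?a < ?s) \<and> dt a y = 0"
  have "a \<noteq> 0" using abc(1) by(auto simp: dt_lin)
  then obtain k where k: "y = k *\<^sub>R a" using dt_zero_parallel a by blast
  have "y \<noteq> 0" using y by(auto simp: linked_def dt_lin)
  hence "k \<noteq> 0" using k by auto
  have "dt s a' * dt s a * (dt t a' * dt t a) < 0" using s unfolding linked_def by(simp add: mult_ac)
  hence "k\<^sup>2 * (dt s a' * dt s a * (dt t a' * dt t a)) < 0" using \<open>k \<noteq> 0\<close> by(simp add: mult_less_0_iff)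
  hence "linked s t a' y" unfolding linked_def k by(simp add: dt_lin power2_eq_square mult_ac)
  thus False using uy by simp
 qed
 have main: "(?s - ?b) * (?s - ?c) * ((?t - ?b) * (?t - ?c)) < 0"
 \<comment> \<open>When \<open>y\<close> is \<open>a\<close> up to scale, the line
   \<open>a' y\<close> is the diagonal itself, which \<open>s t\<close> crosses; \<open>uy'\<close>
   excludes this.\<close>
 proof (cases "dt a y = 0")
  case True
  thus ?thesis using uy' ls unfolding neg_prod_iff by linarith
 next
  case False
  have ly: "(?a - ?b) * (?a - ?c) * ((?y - ?b) * (?y - ?c)) < 0"
   using y linked_xi[OF abc(1) n(4) False abc(1,2)] by blast
  have lsy: "\<not> (?s - ?a) * (?s - ?y) * ((?t - ?a) * (?t - ?y)) < 0"
   using uy linked_xi[OF abc(1) n(1,2,4) False] by blast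
  have "(?a - ?b) * (?a - ?c) < 0" using la by(auto simp: neg_prod_iff)
  hence y1: "(?y - ?b) * (?y - ?c) > 0" using ly by(simp add: neg_prod_iff[of "(?a - ?b) * (?a - ?c)"])
  have "(?s - ?a) * (?s - ?y) * ((?t - ?a) * (?t - ?y)) = ((?s - ?a) * (?t - ?a)) * ((?s - ?y) * (?t - ?y))" by(simp only: mult_ac)
  hence y2: "\<not> (?s - ?y) * (?t - ?y) > 0"
   using lsy ls by(metis mult_neg_pos)
  have D: "(?s - ?b) * (?t - ?b) > 0 \<and> (?s - ?c) * (?t - ?c) < 0 \<or> (?s - ?b) * (?t - ?b) < 0 \<and> (?s - ?c) * (?t - ?c) > 0"
   using lx la ls lu y1 y2 unfolding neg_prod_iff zero_less_mult_iff by(smt (verit))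
  have e: "(?s - ?b) * (?s - ?c) * ((?t - ?b) * (?t - ?c)) = ((?s - ?b) * (?t - ?b)) * ((?s - ?c) * (?t - ?c))"
   by(simp only: mult_ac)
  show ?thesis unfolding e using D by(blast intro: mult_pos_neg mult_neg_pos)
 qed
 thus ?thesis using linked_xi[OF abc(1) n(1,2) abc(1,2)] by blast
qed

lemma neg_quotient: "(y::real) * x < 0 ==> - x / y > 0"
 by(auto simp: neg_prod_iff divide_pos_neg divide_neg_pos)

text \<open>In the frame with \<open>b\<close> at infinity and \<open>c\<close> at 0,
  \<open>side p r\<close> at height y on the axis is a constant plus a multiple of the square of y.
  Linking gives the two coefficients opposite signs, and the positive root is
  \<open>\<bar>dt b c\<bar> * sqrt \<rho>\<close>.\<close>

lemma crossing_point:
 assumes d: "dt b c \<noteq> 0" and l: "linked p r b c"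
 defines "\<rho> \<equiv> - (dt p c * dt r c) / (dt b p * dt b r)"
 shows "\<rho> > 0" "moeb (colmat ((1 / dt b c) *\<^sub>R b) c) (\<i> * of_real (\<bar>dt b c\<bar> * sqrt \<rho>)) \<in> line p r \<inter> line b c"
proof -
 let ?D = "dt b c" and ?N = "colmat ((1 / dt b c) *\<^sub>R b) c"
 have nz: "dt p b \<noteq> 0" "dt r b \<noteq> 0" "dt p c \<noteq> 0" "dt r c \<noteq> 0" using linked_nonzero[OF l] by auto
 have "dt p b * dt p c * (dt r b * dt r c) < 0" using l by(simp add: linked_def)
 hence "(dt b p * dt b r) * (dt p c * dt r c) < 0" by(simp add: dt_swap[of b] mult_ac)
 thus rp: "\<rho> > 0" unfolding \<rho>_def by(rule neg_quotient)
 have N: "?N \<in> SL2" using d by(intro colmat_SL2) (simp add: dt_lin)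
 let ?y = "\<bar>?D\<bar> * sqrt \<rho>"
 let ?z = "\<i> * complex_of_real ?y"
 have y: "?y > 0" using d rp by simp
 have y2: "?y\<^sup>2 = ?D\<^sup>2 * \<rho>" using rp by(simp add: power_mult_distrib)
 have Iz: "Im ?z > 0" using y by simp
 have c: "(adj ?N *v w)$1 = dt w c" "(adj ?N *v w)$2 = (1/?D) * dt b w" for w
  by(simp_all add: adj_def colmat_def dt_def[of w c] dt_def[of b w] algebra_simps diff_divide_distrib)
 have z1: "?z \<in> line (adj ?N *v p) (adj ?N *v r)"
 proof -
  have "side (adj ?N *v p) (adj ?N *v r) ?z = dt p c * dt r c + (1/?D)\<^sup>2 * (dt b p * dt b r) * ?y\<^sup>2"
   unfolding side_explicit c by(simp add: power2_eq_square)
  also have "\<dots> = dt p c * dt r c + (dt b p * dt b r) * \<rho>" unfolding y2 using d by(simp add: power2_eq_square)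
  also have "\<dots> = 0"
  proof -
   have "dt b p * dt b r \<noteq> 0" using nz dt_swap[of b p] dt_swap[of b r] by simp
   thus ?thesis unfolding \<rho>_def by simp
  qed
  finally show ?thesis using Iz by(simp add: line_def)
 qed
 have z2: "?z \<in> line (adj ?N *v b) (adj ?N *v c)"
  using Iz unfolding line_def side_explicit c by simp
 have "moeb ?N ?z \<in> line (?N *v (adj ?N *v p)) (?N *v (adj ?N *v r))" "moeb ?N ?z \<in> line (?N *v (adj ?N *v b)) (?N *v (adj ?N *v c))"
  using z1 z2 line_moeb[OF N, symmetric] by(auto simp: image_iff)
 thus "moeb ?N ?z \<in> line p r \<inter> line b c" unfolding adj_cancel_vec(2)[OF N] by simp
qed

text \<open>A line that is not crossed by its own translate under a parabolic element cannot go deep into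
 the horoball of that element.\<close>

lemma parabolic_depth:
 assumes d: "dt b c \<noteq> 0" and l: "linked p r b c" and k: "k \<noteq> 0"
  and u: "\<not> linked p r ((mat 1 + k *\<^sub>R nil b) *v p) ((mat 1 + k *\<^sub>R nil b) *v r)"
 shows "- (dt p c * dt r c) / (dt b p * dt b r) \<le> (k * dt b c)\<^sup>2 / 4"
proof -
 let ?P = "mat 1 + k *\<^sub>R nil b" and ?x = "xi b c" and ?k = "k * dt b c"
 have nz: "dt b p \<noteq> 0" "dt b r \<noteq> 0" using linked_nonzero[OF l] dt_swap[of b p] dt_swap[of b r] by auto
 have Pv: "?P *v v = v + (k * dt b v) *\<^sub>R b" for v
  by(simp add: vec_eq2 nil_def dt_def algebra_simps)
 have dP: "dt b (?P *v v) = dt b v" for v unfolding Pv by(simp add: dt_lin)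
 \<comment> \<open>In the coordinate \<open>xi b c\<close> the parabolic is the translation by
   \<open>?k\<close>, so not being linked with the translate bounds the distance between the two
   ends by \<open>\<bar>?k\<bar>\<close>.\<close>
 have xP: "?x (?P *v v) = ?x v + ?k" if "dt b v \<noteq> 0" for v
  using that unfolding xi_def dP unfolding Pv by(simp add: dt_lin add_divide_distrib)
 have "\<not> (?x p - ?x (?P *v p)) * (?x p - ?x (?P *v r)) * ((?x r - ?x (?P *v p)) * (?x r - ?x (?P *v r))) < 0"
  using u linked_xi[OF d nz, of "?P *v p" "?P *v r"] nz unfolding dP by blast
 hence n1: "\<not> (- ?k) * (?x p - ?x r - ?k) * ((?x r - ?x p - ?k) * (- ?k)) < 0"
  unfolding xP[OF nz(1)] xP[OF nz(2)] by(simp add: algebra_simps)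
 have n2: "(- ?k) * (?x p - ?x r - ?k) * ((?x r - ?x p - ?k) * (- ?k)) = - (?k\<^sup>2 * ((?x p - ?x r)\<^sup>2 - ?k\<^sup>2))"
  by(simp add: power2_eq_square algebra_simps)
 have n3: "?k\<^sup>2 > 0" using k d by simp
 have "?k\<^sup>2 * ((?x p - ?x r)\<^sup>2 - ?k\<^sup>2) \<le> 0" using n1 unfolding n2 by linarith
 hence "(?x p - ?x r)\<^sup>2 - ?k\<^sup>2 \<le> 0" using n3 by(metis mult_pos_pos not_less)
 hence "(?x p - ?x r)\<^sup>2 \<le> ?k\<^sup>2" by simp
 \<comment> \<open>The depth is minus the product of the two end coordinates, at most the square of
   half their distance.\<close>
 moreover have "- (?x p * ?x r) \<le> (?x p - ?x r)\<^sup>2 / 4"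
  using zero_le_power2[of "?x p + ?x r"] by(simp add: power2_eq_square algebra_simps)
 moreover have "- (dt p c * dt r c) / (dt b p * dt b r) = - (?x p * ?x r)" by(simp add: xi_def)
 ultimately show ?thesis by simp
qed

section \<open>Finiteness and invariance of crossing numbers\<close>

context cusped_torus
begin

lemma family_unlinked:
 assumes s: "simple_pair p r" and g: "g \<in> \<Gamma>" and h: "h \<in> \<Gamma>"
 shows "\<not> linked (g *v p) (g *v r) (h *v p) (h *v r)"
proof
 assume l: "linked (g *v p) (g *v r) (h *v p) (h *v r)"
 let ?k = "adj h ** g"
 have hS: "h \<in> SL2" "adj h \<in> SL2" using G_SL2 h by auto
 have k: "?k \<in> \<Gamma>" using g h G_mult by simp
 have "linked (adj h *v (g *v p)) (adj h *v (g *v r)) (adj h *v (h *v p)) (adj h *v (h *v r))"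
  using l linked_mat[OF hS(2)] by simp
 hence l': "linked (?k *v p) (?k *v r) p r" 
  by(simp only: mat_vec_assoc adj_mult(1)[OF hS(1)] matrix_vector_mul_lid)
 have d: "dt p r \<noteq> 0" using s by(simp add: simple_pair_def)
 obtain z where "z \<in> line (?k *v p) (?k *v r)" "z \<in> line p r" using crossing_point(2)[OF d l'] by blast
 hence "?k = mat 1 \<or> ?k = - mat 1" using simple_pair_inj[OF s k] by blast
 hence "linked p r p r" using l' by auto
 thus False by(simp add: linked_def)
qed

text \<open>\<open>b c\<close> is noncompact, so local finiteness alone is not enough:
  \<open>parabolic_depth\<close> at both ends confines all crossing points to a compact segment of
  the line.\<close>

lemma finite_crossings:
 assumes s: "simple_pair p r" and b: "b \<in> cusps" "c \<in> cusps" and d: "dt b c \<noteq> 0"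
 shows "finite {g \<in> \<Gamma>. linked (g *v p) (g *v r) b c}"
proof -
 let ?N = "colmat ((1 / dt b c) *\<^sub>R b) c"
 \<comment> \<open>The bound of \<open>parabolic_depth\<close>. Applied at \<open>b\<close> and at
   \<open>c\<close>, it keeps \<rho> between \<open>1 / M\<close> and \<open>M\<close>.\<close>
 define M where "M = (kap * dt b c)\<^sup>2 / 4"
 have M: "M > 0" using kap_spec(1) d by(simp add: M_def)
 define I where "I = {\<bar>dt b c\<bar> * sqrt (1 / M)..\<bar>dt b c\<bar> * sqrt M}"
 define K where "K = moeb ?N ` (\<lambda>y. \<i> * complex_of_real y) ` I"
 have N: "?N \<in> SL2" using d by(intro colmat_SL2) (simp add: dt_lin)
 have Ipos: "y > 0" if "y \<in> I" for y
 proof -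
  have "\<bar>dt b c\<bar> * sqrt (1 / M) > 0" using d M by simp
  thus ?thesis using that by(simp add: I_def)
 qed
 have im: "(\<lambda>y. \<i> * complex_of_real y) ` I \<subseteq> half_plane" using Ipos by(auto simp: half_plane_iff)
 have K1: "compact K" unfolding K_def
 proof (intro compact_continuous_image)
  show "continuous_on ((\<lambda>y. \<i> * complex_of_real y) ` I) (moeb ?N)"
   by(rule continuous_on_subset[OF continuous_on_moeb[OF N] im])
  show "continuous_on I (\<lambda>y. \<i> * complex_of_real y)"
   by(intro continuous_on_mult continuous_on_const continuous_on_of_real continuous_on_id)
  show "compact I" by(simp add: I_def)
 qed
 have K2: "K \<subseteq> half_plane" unfolding K_def using im moeb_half_plane[OF N] by blast
 have sub: "{g \<in> \<Gamma>. linked (g *v p) (g *v r) b c} \<subseteq> {g \<in> \<Gamma>. line (g *v p) (g *v r) \<inter> K \<noteq> {}}"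
 proof
  fix g assume "g \<in> {g \<in> \<Gamma>. linked (g *v p) (g *v r) b c}"
  hence g: "g \<in> \<Gamma>" and l: "linked (g *v p) (g *v r) b c" by auto
  let ?p = "g *v p" and ?r = "g *v r"
  define \<rho> where "\<rho> = - (dt ?p c * dt ?r c) / (dt b ?p * dt b ?r)"
  have unl: "\<not> linked ?p ?r ((mat 1 + kap *\<^sub>R nil x) *v ?p) ((mat 1 + kap *\<^sub>R nil x) *v ?r)" if "x \<in> cusps" for x
   using family_unlinked[OF s g G_mult[OF cusp_parabolic[OF that] g]] unfolding mat_vec_assoc .
  have r0: "\<rho> > 0" unfolding \<rho>_def by(rule crossing_point(1)[OF d l])
  have r1: "\<rho> \<le> M" unfolding \<rho>_def M_def by(rule parabolic_depth[OF d l kap_spec(1) unl[OF b(1)]])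
  have d': "dt c b \<noteq> 0" using d dt_swap[of c b] by simp
  have l': "linked ?p ?r c b" using l linked_swap by blast
  have "- (dt ?p b * dt ?r b) / (dt c ?p * dt c ?r) \<le> (kap * dt c b)\<^sup>2 / 4"
   by(rule parabolic_depth[OF d' l' kap_spec(1) unl[OF b(2)]])
  also have "(kap * dt c b)\<^sup>2 / 4 = M" unfolding M_def dt_swap[of c b] by simp
  also have "- (dt ?p b * dt ?r b) / (dt c ?p * dt c ?r) = 1 / \<rho>"
   unfolding \<rho>_def dt_swap[of c] dt_swap[of b] by simp
  finally have r2: "1 / M \<le> \<rho>" using r0 M by(simp add: field_simps)
  have "\<bar>dt b c\<bar> * sqrt \<rho> \<in> I" unfolding I_def using r1 r2 by(auto intro!: mult_left_mono)
  hence "moeb ?N (\<i> * of_real (\<bar>dt b c\<bar> * sqrt \<rho>)) \<in> K" unfolding K_def by(intro imageI)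
  moreover have "moeb ?N (\<i> * of_real (\<bar>dt b c\<bar> * sqrt \<rho>)) \<in> line ?p ?r"
   using crossing_point(2)[OF d l] unfolding \<rho>_def by blast
  ultimately show "g \<in> {g \<in> \<Gamma>. line (g *v p) (g *v r) \<inter> K \<noteq> {}}" using g by blast
 qed
 have "finite {g \<in> \<Gamma>. line (g *v p) (g *v r) \<inter> K \<noteq> {}}" using s K1 K2 unfolding simple_pair_def by blast
 thus ?thesis using sub by(rule rev_finite_subset)
qed

text \<open>Each geometric crossing is counted twice, by \<open>g\<close> and by
  \<open>- g\<close>.\<close>

definition crossings :: "real^2 => real^2 => real^2 => real^2 => nat" where
 "crossings p r b c = card {g \<in> \<Gamma>. linked (g *v p) (g *v r) b c}"

lemma crossings_simps [simp]: "crossings p r (- b) c = crossings p r b c" "crossings p r b (- c) = crossings p r b c"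
 by(simp_all add: crossings_def)

lemma crossings_swap: "crossings p r c b = crossings p r b c"
 by(simp add: crossings_def linked_swap(2))

lemma crossings_even:
 assumes h: "h \<in> \<Gamma>"
 shows "crossings p r (h *v b) (h *v c) = crossings p r b c"
proof -
 have hS: "h \<in> SL2" using G_SL2 h by blast
 have l: "linked ((h ** g) *v p) ((h ** g) *v r) (h *v b) (h *v c) = linked (g *v p) (g *v r) b c" for g
  using linked_mat[OF hS] by(simp only: mat_vec_assoc[symmetric])
 have "bij_betw (\<lambda>g. h ** g) {g \<in> \<Gamma>. linked (g *v p) (g *v r) b c} {g \<in> \<Gamma>. linked (g *v p) (g *v r) (h *v b) (h *v c)}"
 proof (rule bij_betw_byWitness[where f' = "\<lambda>g. adj h ** g"])
  show "\<forall>g\<in>{g \<in> \<Gamma>. linked (g *v p) (g *v r) b c}. adj h ** (h ** g) = g"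
   "\<forall>g\<in>{g \<in> \<Gamma>. linked (g *v p) (g *v r) (h *v b) (h *v c)}. h ** (adj h ** g) = g"
   by(simp_all add: adj_cancel_left[OF hS])
  show "(\<lambda>g. h ** g) ` {g \<in> \<Gamma>. linked (g *v p) (g *v r) b c} \<subseteq> {g \<in> \<Gamma>. linked (g *v p) (g *v r) (h *v b) (h *v c)}"
  proof (rule image_subsetI)
   fix g assume "g \<in> {g \<in> \<Gamma>. linked (g *v p) (g *v r) b c}"
   hence g: "g \<in> \<Gamma>" "linked (g *v p) (g *v r) b c" by auto
   show "h ** g \<in> {g \<in> \<Gamma>. linked (g *v p) (g *v r) (h *v b) (h *v c)}"
    by(intro CollectI conjI G_mult[OF h g(1)]) (simp only: l g(2))
  qed
  show "(\<lambda>g. adj h ** g) ` {g \<in> \<Gamma>. linked (g *v p) (g *v r) (h *v b) (h *v c)} \<subseteq> {g \<in> \<Gamma>. linked (g *v p) (g *v r) b c}"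
  proof
   fix g' assume "g' \<in> (\<lambda>g. adj h ** g) ` {g \<in> \<Gamma>. linked (g *v p) (g *v r) (h *v b) (h *v c)}"
   then obtain g where g: "g' = adj h ** g" "g \<in> \<Gamma>" "linked (g *v p) (g *v r) (h *v b) (h *v c)" by blast
   have "g' \<in> \<Gamma>" unfolding g(1) by(rule G_mult) (simp_all add: h g(2))
   moreover have "linked (g' *v p) (g' *v r) b c"
    using l[of g'] g(3) unfolding g(1) adj_cancel_left(2)[OF hS] by blast
   ultimately show "g' \<in> {g \<in> \<Gamma>. linked (g *v p) (g *v r) b c}" by blast
  qed
 qed
 thus ?thesis unfolding crossings_def by(rule bij_betw_same_card[symmetric])
qed

text \<open>If \<open>h\<close> is odd, then \<open>h ** Jm b c\<close> is even and has the same
  effect on the pair \<open>b\<close>, \<open>c\<close> up to order and sign.\<close>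

lemma crossings_ext:
 assumes h: "h \<in> \<Lambda>" and J: "Jm b c \<in> \<Delta>" "dt b c \<noteq> 0"
 shows "crossings p r (h *v b) (h *v c) = crossings p r b c"
proof (cases "h \<in> \<Gamma>")
 case False
 hence "h ** Jm b c \<in> \<Gamma>" using h J odd_odd by(simp add: ext_group_def)
 from crossings_even[OF this, of p r b c]
 have "crossings p r (h *v c) (- (h *v b)) = crossings p r b c"
  by(simp only: mat_vec_assoc[symmetric] Jm_left[OF J(2)] Jm_right[OF J(2)] mat_vec_uminus_right)
 thus ?thesis by(simp add: crossings_swap)
qed (rule crossings_even)

section \<open>Edges, folded triangles and their flips\<close>

definition is_edge :: "real^2 => real^2 => real^2 => real^2 => bool" where
 "is_edge b c p r \<longleftrightarrow> (\<exists>g\<in>\<Gamma>. (b = g *v p \<or> b = - (g *v p)) \<and> (c = g *v r \<or> c = - (g *v r)) \<or>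
  (c = g *v p \<or> c = - (g *v p)) \<and> (b = g *v r \<or> b = - (g *v r)))"

lemma is_edge_swap: "is_edge c b p r = is_edge b c p r"
 unfolding is_edge_def by blast

lemma is_edge_simps [simp]: "is_edge (- b) c p r = is_edge b c p r" "is_edge b (- c) p r = is_edge b c p r"
proof -
 have n: "(- w = x \<or> - w = - x) = (w = x \<or> w = - x)" for w x :: "real^2" by auto
 show "is_edge (- b) c p r = is_edge b c p r" "is_edge b (- c) p r = is_edge b c p r"
  by(simp_all only: is_edge_def n)
qed

lemma is_edge_even: "h \<in> \<Gamma> ==> is_edge b c p r ==> is_edge (h *v b) (h *v c) p r"
proof -
 assume h: "h \<in> \<Gamma>" and e: "is_edge b c p r"
 then obtain g where g: "g \<in> \<Gamma>" "(b = g *v p \<or> b = - (g *v p)) \<and> (c = g *v r \<or> c = - (g *v r)) \<or>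
  (c = g *v p \<or> c = - (g *v p)) \<and> (b = g *v r \<or> b = - (g *v r))" unfolding is_edge_def by blast
 have "h *v (g *v x) = (h ** g) *v x" "h *v (- (g *v x)) = - ((h ** g) *v x)" for x
  by(simp_all add: mat_vec_assoc)
 hence "(h *v b = (h ** g) *v p \<or> h *v b = - ((h ** g) *v p)) \<and> (h *v c = (h ** g) *v r \<or> h *v c = - ((h ** g) *v r)) \<or>
  (h *v c = (h ** g) *v p \<or> h *v c = - ((h ** g) *v p)) \<and> (h *v b = (h ** g) *v r \<or> h *v b = - ((h ** g) *v r))"
  using g(2) by auto
 thus ?thesis unfolding is_edge_def using G_mult[OF h g(1)] by blast
qed

lemma is_edge_ext1:
 assumes h: "h \<in> \<Lambda>" and J: "Jm b c \<in> \<Delta>" "dt b c \<noteq> 0" and e: "is_edge b c p r"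
 shows "is_edge (h *v b) (h *v c) p r"
proof (cases "h \<in> \<Gamma>")
 case False
 hence "h ** Jm b c \<in> \<Gamma>" using h J odd_odd by(simp add: ext_group_def)
 from is_edge_even[OF this e]
 have "is_edge (h *v c) (- (h *v b)) p r"
  by(simp only: mat_vec_assoc[symmetric] Jm_left[OF J(2)] Jm_right[OF J(2)] mat_vec_uminus_right)
 thus ?thesis by(simp add: is_edge_swap)
qed (rule is_edge_even[OF _ e])

lemma is_edge_ext:
 assumes h: "h \<in> \<Lambda>" and J: "Jm b c \<in> \<Delta>" "dt b c \<noteq> 0"
 shows "is_edge (h *v b) (h *v c) p r = is_edge b c p r"
proof
 have hS: "h \<in> SL2" using ext_SL2 h by blast
 assume e: "is_edge (h *v b) (h *v c) p r"
 have "Jm (h *v b) (h *v c) \<in> \<Delta>" using ext_conj_odd[OF h J(1)] Jm_conj[OF J(2) hS] by simp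
 hence "is_edge (adj h *v (h *v b)) (adj h *v (h *v c)) p r"
  using is_edge_ext1[OF ext_adj[OF h] _ _ e] J(2) dt_mat[OF hS] by simp
 thus "is_edge b c p r" by(simp only: adj_cancel_vec[OF hS])
qed (rule is_edge_ext1[OF assms])

text \<open>The three half turns generate a group containing \<Gamma>. Products and signs suffice,
  since the inverse of a half turn is its negative.\<close>

definition generating :: "real^2 => real^2 => real^2 => bool" where
 "generating a b c \<longleftrightarrow> (\<forall>H. (\<forall>g\<in>H. \<forall>h\<in>H. g ** h \<in> H) \<and> (\<forall>g\<in>H. - g \<in> H) \<and>
  Jm a b \<in> H \<and> Jm b c \<in> H \<and> Jm c a \<in> H --> \<Gamma> \<subseteq> H)"

text \<open>A triangle of an ideal triangulation whose sides are folded by elliptic involutions of the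
 extended group; the vertices are normalised to be positively oriented.\<close>

definition tri :: "real^2 => real^2 => real^2 => bool" where
 "tri a b c \<longleftrightarrow> dt a b > 0 \<and> dt b c > 0 \<and> dt c a > 0 \<and> Jm a b \<in> \<Delta> \<and> Jm b c \<in> \<Delta> \<and> Jm c a \<in> \<Delta> \<and>
  a \<in> cusps \<and> b \<in> cusps \<and> c \<in> cusps \<and> generating a b c"

lemma triD:
 assumes "tri a b c"
 shows "dt a b > 0" "dt b c > 0" "dt c a > 0" "Jm a b \<in> \<Delta>" "Jm b c \<in> \<Delta>" "Jm c a \<in> \<Delta>"
  "a \<in> cusps" "b \<in> cusps" "c \<in> cusps" "generating a b c"
  "dt a b \<noteq> 0" "dt b c \<noteq> 0" "dt c a \<noteq> 0" "dt a c \<noteq> 0"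
 using assms dt_swap[of a c] by(auto simp: tri_def)

lemma generating_rot:
 assumes "generating a b c"
 shows "generating b c a"
 unfolding generating_def
proof (intro allI impI)
 fix H assume H: "(\<forall>g\<in>H. \<forall>h\<in>H. g ** h \<in> H) \<and> (\<forall>g\<in>H. - g \<in> H) \<and>
  Jm b c \<in> H \<and> Jm c a \<in> H \<and> Jm a b \<in> H"
 show "\<Gamma> \<subseteq> H"
  by(rule assms[unfolded generating_def, THEN spec, THEN mp]) (intro conjI; insert H; elim conjE; assumption)
qed

lemma tri_rot: "tri a b c ==> tri b c a"
 unfolding tri_def by(elim conjE, intro conjI; (erule generating_rot | assumption))

lemma generating_ext:
 assumes t: "tri a b c" and h: "h \<in> \<Lambda>"
 shows "generating (h *v a) (h *v b) (h *v c)"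
 unfolding generating_def
proof (intro allI impI)
 fix H assume H: "(\<forall>g\<in>H. \<forall>h\<in>H. g ** h \<in> H) \<and> (\<forall>g\<in>H. - g \<in> H) \<and>
  Jm (h *v a) (h *v b) \<in> H \<and> Jm (h *v b) (h *v c) \<in> H \<and> Jm (h *v c) (h *v a) \<in> H"
 note t = triD[OF t]
 have hS: "h \<in> SL2" using ext_SL2 h by blast
 let ?H = "{g. h ** g ** adj h \<in> H}"
 have "\<Gamma> \<subseteq> ?H"
 proof (rule t(10)[unfolded generating_def, rule_format], intro conjI ballI)
  fix g k assume a: "g \<in> ?H" "k \<in> ?H"
  have "(h ** g ** adj h) ** (h ** k ** adj h) = h ** g ** (adj h ** h) ** k ** adj h" by(simp only: matrix_mul_assoc)
  also have "\<dots> = h ** (g ** k) ** adj h" by(simp add: adj_mult[OF hS] matrix_mul_assoc)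
  finally have eq: "(h ** g ** adj h) ** (h ** k ** adj h) = h ** (g ** k) ** adj h" .
  have "(h ** g ** adj h) ** (h ** k ** adj h) \<in> H" using H a by blast
  thus "g ** k \<in> ?H" unfolding eq by simp
 next
  fix g assume "g \<in> ?H"
  hence "- (h ** g ** adj h) \<in> H" using H by blast
  thus "- g \<in> ?H" by(simp add: mat_uminus_left mat_uminus_right)
 qed (use H Jm_conj[OF t(11) hS] Jm_conj[OF t(12) hS] Jm_conj[OF t(13) hS] in simp_all)
 show "\<Gamma> \<subseteq> H"
 proof
  fix g assume g: "g \<in> \<Gamma>"
  have "adj h ** g ** adj (adj h) \<in> \<Gamma>" by(rule ext_normalizes[OF ext_adj[OF h] g])
  hence "h ** (adj h ** g ** h) ** adj h \<in> H" using \<open>\<Gamma> \<subseteq> ?H\<close> by auto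
  moreover have "h ** (adj h ** g ** h) ** adj h = (h ** adj h) ** g ** (h ** adj h)" by(simp only: matrix_mul_assoc)
  ultimately show "g \<in> H" by(simp add: adj_mult[OF hS])
 qed
qed

lemma tri_ext:
 assumes t: "tri a b c" and h: "h \<in> \<Lambda>"
 shows "tri (h *v a) (h *v b) (h *v c)"
proof -
 note t' = triD[OF t]
 have hS: "h \<in> SL2" using ext_SL2 h by blast
 have J: "Jm (h *v a) (h *v b) \<in> \<Delta>" "Jm (h *v b) (h *v c) \<in> \<Delta>" "Jm (h *v c) (h *v a) \<in> \<Delta>"
  unfolding Jm_conj[OF t'(11) hS, symmetric] Jm_conj[OF t'(12) hS, symmetric] Jm_conj[OF t'(13) hS, symmetric]
  by(intro ext_conj_odd[OF h] t')+
 show ?thesis unfolding tri_def dt_mat[OF hS]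
  by(intro conjI t'(1-3) J generating_ext[OF t h] cusps_ext[OF h] t'(7-9))
qed

definition total :: "real^2 => real^2 => real^2 => real^2 => real^2 => nat" where
 "total p r a b c = crossings p r a b + crossings p r b c + crossings p r c a"

definition tedge :: "real^2 => real^2 => real^2 => real^2 => real^2 => bool" where
 "tedge a b c p r \<longleftrightarrow> is_edge a b p r \<or> is_edge b c p r \<or> is_edge c a p r"

text \<open>Many triangles represent the same triangulation; crossing totals and edges do not see
  which one is used.\<close>

definition same_edges :: "real^2 => real^2 => real^2 => real^2 => real^2 => real^2 => bool" where
 "same_edges a b c a' b' c' \<longleftrightarrow> (\<forall>p r. total p r a' b' c' = total p r a b c \<and> tedge a' b' c' p r = tedge a b c p r)"

lemma same_edges_rot: "same_edges a b c b c a"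
 by(auto simp: same_edges_def total_def tedge_def)

lemma same_edges_ext:
 assumes "tri a b c" "h \<in> \<Lambda>"
 shows "same_edges a b c (h *v a) (h *v b) (h *v c)"
proof -
 note t = triD[OF assms(1)]
 show ?thesis unfolding same_edges_def total_def tedge_def
  crossings_ext[OF assms(2) t(4,11)] crossings_ext[OF assms(2) t(5,12)] crossings_ext[OF assms(2) t(6,13)]
  is_edge_ext[OF assms(2) t(4,11)] is_edge_ext[OF assms(2) t(5,12)] is_edge_ext[OF assms(2) t(6,13)] by simp
qed

lemma same_edges_trans: "same_edges a b c a' b' c' ==> same_edges a' b' c' x y z ==> same_edges a b c x y z"
 by(simp add: same_edges_def)

lemma odd_ext: "g \<in> \<Delta> ==> g \<in> \<Lambda>"
 by(simp add: ext_group_def)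

text \<open>The neighbour across \<open>c a\<close> is the image of the triangle under the half turn
  of that side. With \<open>tri_prev\<close>, the neighbour across \<open>a b\<close>, it continues
  the fan around \<open>a\<close>.\<close>

lemma tri_next:
 assumes t: "tri a b c"
 shows "tri a (- c) (Jm c a *v b)" "same_edges a b c a (- c) (Jm c a *v b)"
proof -
 note t' = triD[OF t]
 have h: "Jm c a \<in> \<Lambda>" by(rule odd_ext[OF t'(6)])
 have e: "Jm c a *v a = - c" "Jm c a *v c = a" using t'(13) by(simp_all add: Jm_left Jm_right)
 have "tri (- c) (Jm c a *v b) a" using tri_ext[OF t h] unfolding e .
 from tri_rot[OF tri_rot[OF this]] show "tri a (- c) (Jm c a *v b)" .
 have S: "same_edges a b c (- c) (Jm c a *v b) a" using same_edges_ext[OF t h] unfolding e .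
 show "same_edges a b c a (- c) (Jm c a *v b)"
  by(rule same_edges_trans[OF S], rule same_edges_trans, rule same_edges_rot, rule same_edges_rot)
qed

lemma tri_prev:
 assumes t: "tri a b c"
 shows "tri (- a) (Jm a b *v c) b" "same_edges a b c (- a) (Jm a b *v c) b"
proof -
 note t' = triD[OF t]
 have h: "Jm a b \<in> \<Lambda>" by(rule odd_ext[OF t'(4)])
 have e: "Jm a b *v a = b" "Jm a b *v b = - a" using t'(11) by(simp_all add: Jm_left Jm_right)
 have "tri b (- a) (Jm a b *v c)" using tri_ext[OF t h] unfolding e .
 from tri_rot[OF this] show "tri (- a) (Jm a b *v c) b" .
 have S: "same_edges a b c b (- a) (Jm a b *v c)" using same_edges_ext[OF t h] unfolding e .
 show "same_edges a b c (- a) (Jm a b *v c) b"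
  by(rule same_edges_trans[OF S], rule same_edges_rot)
qed

text \<open>The half turn of \<open>b c\<close> exchanges \<open>a\<close> with the opposite vertex,
  so it folds the new diagonal as well, and it carries \<open>c a\<close> to the remaining new side.
  The sign restores positive orientation.\<close>

lemma tri_flip:
 assumes t: "tri a b c"
 shows "tri a b (- (Jm b c *v a))"
proof -
 note t' = triD[OF t]
 let ?J = "Jm b c" and ?a = "Jm b c *v a"
 have J: "?J \<in> SL2" by(rule Jm_SL2[OF t'(12)])
 have e: "?J *v b = c" "?J *v c = - b" using t'(12) by(simp_all add: Jm_left Jm_right)
 have b: "b = - (?J *v c)" using e by simp
 have a': "?a = (1 / dt b c) *\<^sub>R (dt a c *\<^sub>R c - dt b a *\<^sub>R b)" by(rule Jm_vec[OF t'(12)])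
 have 1: "dt b (- ?a) = dt c a"
 proof -
  have "dt b (- ?a) = dt (?J *v c) (?J *v a)" by(subst b) (simp add: dt_lin)
  thus ?thesis using dt_mat[OF J] by simp
 qed
 have 2: "dt (- ?a) a > 0"
 proof -
  have "dt (- ?a) a = (1 / dt b c) * (dt c a * dt c a + dt a b * dt a b)"
   using t'(12) dt_swap[of a c] dt_swap[of b a] unfolding a' by(simp add: dt_lin field_simps)
  moreover have "dt c a * dt c a + dt a b * dt a b > 0" using t'(1,3) by(simp add: add_pos_pos)
  ultimately show ?thesis using t'(2) by simp
 qed
 have 3: "Jm (- ?a) a = ?J"
 proof (rule mat_basis_eq[of "- ?a" a])
  have "?J *v (?J *v a) = - a" by(simp add: mat_vec_assoc Jm_square[OF t'(12)])
  moreover have "Jm (- ?a) a *v - ?a = a" by(rule Jm_left) (use 2 in simp)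
  ultimately show "Jm (- ?a) a *v - ?a = ?J *v - ?a" by(simp only: mat_vec_uminus_right[of ?J] minus_minus)
  show "Jm (- ?a) a *v a = ?J *v a" using 2 by(simp add: Jm_right)
 qed (use 2 in simp)
 have 4: "Jm b (- ?a) = ?J ** Jm c a ** adj ?J"
 proof -
  have "?J ** Jm c a ** adj ?J = Jm (- b) ?a" using Jm_conj[OF t'(13) J] e by simp
  also have "\<dots> = Jm b (- ?a)" using 1 t'(3) by(simp add: Jm_flips dt_lin)
  finally show ?thesis by simp
 qed
 have gen: "generating a b (- ?a)" unfolding generating_def
 proof (intro allI impI)
  fix H assume H: "(\<forall>g\<in>H. \<forall>h\<in>H. g ** h \<in> H) \<and> (\<forall>g\<in>H. - g \<in> H) \<and>
   Jm a b \<in> H \<and> Jm b (- ?a) \<in> H \<and> Jm (- ?a) a \<in> H"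
  hence J': "?J \<in> H" "Jm b (- ?a) \<in> H" by(simp_all add: 3)
  have "adj ?J \<in> H" using H J' by(simp add: adj_Jm)
  hence "adj ?J ** (?J ** Jm c a ** adj ?J) ** ?J \<in> H" using H J' unfolding 4 by blast
  moreover have "adj ?J ** (?J ** Jm c a ** adj ?J) ** ?J = (adj ?J ** ?J) ** Jm c a ** (adj ?J ** ?J)"
   by(simp only: matrix_mul_assoc)
  ultimately have "Jm c a \<in> H" by(simp add: adj_mult[OF J])
  thus "\<Gamma> \<subseteq> H" using t'(10)[unfolded generating_def] H J' by blast
 qed
 have "?a \<in> cusps" by(rule cusps_ext[OF odd_ext[OF t'(5)] t'(7)])
 thus ?thesis unfolding tri_def
 proof (intro conjI t' gen 2)
  show "dt b (- ?a) > 0" unfolding 1 by(rule t'(3))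
  show "Jm b (- ?a) \<in> \<Delta>" unfolding 4 by(rule ext_conj_odd[OF odd_ext[OF t'(5)] t'(6)])
  show "Jm (- ?a) a \<in> \<Delta>" unfolding 3 by(rule t'(5))
  show "- ?a \<in> cusps" using \<open>?a \<in> cusps\<close> by simp
 qed
qed

end

section \<open>The fan of triangles around a cusp and descent by flips\<close>

context cusped_torus
begin

text \<open>The half turns carry \<open>a\<close> to \<open>b\<close>, to \<open>c\<close> and back,
  so the product is parabolic at \<open>a\<close>. Its parameter \<kappa> is the sum of the three
  ratios of the form \<open>dt b c / (dt c a * dt a b)\<close>, the lengths of the horocycle arcs in
  the corners of the triangle.\<close>

lemma triple_product:
 assumes t: "tri a b c"
 defines "\<kappa> \<equiv> ((dt a b)\<^sup>2 + (dt b c)\<^sup>2 + (dt c a)\<^sup>2) / (dt b c * dt c a * dt a b)"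
 shows "Jm c a ** Jm b c ** Jm a b = mat 1 + \<kappa> *\<^sub>R nil a"
proof (rule mat_basis_eq[of a b])
 note t' = triD[OF t]
 let ?l1 = "dt b c" and ?l2 = "dt c a" and ?l3 = "dt a b"
 have ac: "dt a c = - ?l2" and ba: "dt b a = - ?l3" and cb: "dt c b = - ?l1"
  by(simp_all only: dt_swap[of a c] dt_swap[of b a] dt_swap[of c b])
 have l: "?l1 > 0" "?l2 > 0" "?l3 > 0" using t' by auto
 have c: "c = (- ?l1 / ?l3) *\<^sub>R a + (- ?l2 / ?l3) *\<^sub>R b"
 proof -
  have "?l3 *\<^sub>R c = (- ?l1) *\<^sub>R a + (- ?l2) *\<^sub>R b" using dt_expand[of a b c] unfolding ac cb .
  hence "(1 / ?l3) *\<^sub>R (?l3 *\<^sub>R c) = (1 / ?l3) *\<^sub>R ((- ?l1) *\<^sub>R a + (- ?l2) *\<^sub>R b)" by simp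
  thus ?thesis using l by(simp add: scaleR_add_right scaleR_diff_right)
 qed
 show "?l3 \<noteq> 0" using l by simp
 show "(Jm c a ** Jm b c ** Jm a b) *v a = (mat 1 + \<kappa> *\<^sub>R nil a) *v a"
 proof -
  have "(mat 1 + \<kappa> *\<^sub>R nil a) *v a = a" by(simp add: vec_eq2 nil_def algebra_simps)
  thus ?thesis
   by(simp only: mat_vec_assoc[symmetric] Jm_left[OF t'(11)] Jm_left[OF t'(12)] Jm_left[OF t'(13)])
 qed
 have Pb: "(mat 1 + \<kappa> *\<^sub>R nil a) *v b = b + (\<kappa> * ?l3) *\<^sub>R a"
  by(simp add: vec_eq2 nil_def dt_def algebra_simps)
 have 1: "Jm b c *v (- a) = (?l2 / ?l1) *\<^sub>R c - (?l3 / ?l1) *\<^sub>R b"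
  unfolding Jm_vec[OF t'(12)] by(simp add: dt_lin ac ba scaleR_diff_right)
 have 2: "Jm c a *v b = (?l1 / ?l2) *\<^sub>R c - (?l3 / ?l2) *\<^sub>R a"
  unfolding Jm_vec[OF t'(13)] by(simp add: cb ba scaleR_diff_right)
 have 3: "Jm c a *v c = a" by(rule Jm_left[OF t'(13)])
 have "(Jm c a ** Jm b c ** Jm a b) *v b = Jm c a *v (Jm b c *v (- a))"
  by(simp only: mat_vec_assoc[symmetric] Jm_right[OF t'(11)])
 also have "\<dots> = (?l2 / ?l1) *\<^sub>R a - (?l3 / ?l1) *\<^sub>R ((?l1 / ?l2) *\<^sub>R c - (?l3 / ?l2) *\<^sub>R a)"
 proof -
  have d: "M *v (x *\<^sub>R u - y *\<^sub>R v) = x *\<^sub>R (M *v u) - y *\<^sub>R (M *v v)" for M x y u and v :: "real^2"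
   by(simp add: vec_eq2 algebra_simps)
  show ?thesis unfolding 1 d 2 3 ..
 qed
 also have "\<dots> = (?l2 / ?l1 + ?l3\<^sup>2 / (?l1 * ?l2)) *\<^sub>R a - (?l3 / ?l2) *\<^sub>R c"
  using l by(simp add: vec_eq2 power2_eq_square field_simps)
 also have "\<dots> = (?l2 / ?l1 + ?l3\<^sup>2 / (?l1 * ?l2) + ?l1 / ?l2) *\<^sub>R a + b"
  using l by(subst (3) c) (simp add: vec_eq2 field_simps)
 also have "?l2 / ?l1 + ?l3\<^sup>2 / (?l1 * ?l2) + ?l1 / ?l2 = \<kappa> * ?l3"
  unfolding \<kappa>_def using l by(simp add: power2_eq_square field_simps)
 finally show "(Jm c a ** Jm b c ** Jm a b) *v b = (mat 1 + \<kappa> *\<^sub>R nil a) *v b"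
  unfolding Pb by(simp add: add.commute)
qed

lemma parabolic_powers:
 assumes P: "mat 1 + k *\<^sub>R nil a \<in> \<Lambda>"
 shows "mat 1 + (of_int n * k) *\<^sub>R nil a \<in> \<Lambda>"
proof -
 have m: "(mat 1 + x *\<^sub>R nil a) ** (mat 1 + y *\<^sub>R nil a) = mat 1 + (x + y) *\<^sub>R nil a" for x y
  by(simp add: matrix_add_mult_distrib2 algebra_simps)
 have pos: "mat 1 + (of_nat n * k) *\<^sub>R nil a \<in> \<Lambda>" for n
 proof (induction n)
  case 0
  thus ?case by(simp add: ext_group_def)
 next
  case (Suc n)
  have "mat 1 + (of_nat (Suc n) * k) *\<^sub>R nil a = (mat 1 + (of_nat n * k) *\<^sub>R nil a) ** (mat 1 + k *\<^sub>R nil a)"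
   unfolding m by(simp add: algebra_simps)
  thus ?case using ext_mult[OF Suc P] by simp
 qed
 have adj: "adj (mat 1 + x *\<^sub>R nil a) = mat 1 + (- x) *\<^sub>R nil a" for x
  by(simp add: mat_eq2 nil_def)
 show ?thesis
 proof (cases "n \<ge> 0")
  case True
  thus ?thesis using pos[of "nat n"] by simp
 next
  case False
  thus ?thesis using ext_adj[OF pos[of "nat (- n)"]] unfolding adj by simp
 qed
qed

text \<open>In the coordinate \<open>xi a b\<close> the triangles of the fan around \<open>a\<close>
  occupy consecutive intervals, and the parabolic of \<open>triple_product\<close> translates by
  \<open>K\<close>, the width of three of them. A power of it brings \<open>x\<close> to the
  triangle itself or to one of its two neighbours.\<close>

lemma sector:
 assumes t: "tri a b c" and x: "dt a x \<noteq> 0"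
 shows "\<exists>a' b' c'. tri a' b' c' \<and> (a' = a \<or> a' = - a) \<and> same_edges a b c a' b' c' \<and> (dt b' x = 0 \<or> linked a x b' c')"
proof -
 note t' = triD[OF t]
 let ?l1 = "dt b c" and ?l2 = "dt c a" and ?l3 = "dt a b"
 have ac: "dt a c = - ?l2" and ba: "dt b a = - ?l3" and cb: "dt c b = - ?l1"
  by(simp_all only: dt_swap[of a c] dt_swap[of b a] dt_swap[of c b])
 have l: "?l1 > 0" "?l2 > 0" "?l3 > 0" using t' by auto
 define \<kappa> where "\<kappa> = (?l3\<^sup>2 + ?l1\<^sup>2 + ?l2\<^sup>2) / (?l1 * ?l2 * ?l3)"
 define K where "K = \<kappa> * ?l3"
 have K: "K = (?l3\<^sup>2 + ?l1\<^sup>2 + ?l2\<^sup>2) / (?l1 * ?l2)" using l by(simp add: K_def \<kappa>_def)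
 have K0: "K > 0" unfolding K using l by(simp add: add_pos_pos)
 have "Jm c a ** Jm b c ** Jm a b \<in> \<Lambda>" using t' by(intro ext_mult odd_ext)
 hence P: "mat 1 + \<kappa> *\<^sub>R nil a \<in> \<Lambda>" unfolding triple_product[OF t] \<kappa>_def by(simp add: add.commute)
 let ?xi = "xi a b"
 \<comment> \<open>The three intervals begin at \<open>- ?l2 / ?l1\<close>, the coordinate of the
   far vertex of the previous triangle.\<close>
 define n where "n = \<lfloor>(?xi x + ?l2 / ?l1) / K\<rfloor>"
 define h where "h = mat 1 + (of_int n * \<kappa>) *\<^sub>R nil a"
 define y where "y = mat 1 + (of_int (- n) * \<kappa>) *\<^sub>R nil a"
 have h: "h \<in> \<Lambda>" "y \<in> \<Lambda>" unfolding h_def y_def by(rule parabolic_powers[OF P])+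
 have hS: "h \<in> SL2" using ext_SL2 h by blast
 have Pv: "(mat 1 + k *\<^sub>R nil a) *v v = v + (k * dt a v) *\<^sub>R a" for v k
  by(simp add: vec_eq2 nil_def dt_def algebra_simps)
 define x' where "x' = y *v x"
 have hx: "h *v x' = x" unfolding x'_def h_def y_def Pv by(simp add: dt_lin)
 have ha: "h *v a = a" unfolding h_def Pv by simp
 have x'1: "dt a x' \<noteq> 0" using x unfolding x'_def y_def Pv by(simp add: dt_lin)
 have xx: "?xi x' = ?xi x - of_int n * K"
  unfolding xi_def x'_def y_def Pv using x by(simp add: dt_lin K_def field_simps)
 have fl: "of_int n \<le> (?xi x + ?l2 / ?l1) / K" "(?xi x + ?l2 / ?l1) / K < of_int n + 1"
  unfolding n_def by linarith+
 have r1: "- ?l2 / ?l1 \<le> ?xi x'"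
  using fl(1) K0 unfolding xx by(simp add: le_divide_eq)
 have r2: "?xi x' < K - ?l2 / ?l1"
  using fl(2) K0 unfolding xx by(simp add: divide_less_eq algebra_simps)
 have key: "\<exists>a' b' c'. tri a' b' c' \<and> (a' = a \<or> a' = - a) \<and> same_edges a b c a' b' c' \<and> (dt b' x = 0 \<or> linked a x b' c')"
  if T: "tri e u v" "e = a \<or> e = - a" "same_edges a b c e u v" and ne: "dt a u \<noteq> 0" "dt a v \<noteq> 0"
   and between: "?xi u \<le> ?xi x'" "?xi x' < ?xi v" for e u v
 proof -
  have "tri (h *v e) (h *v u) (h *v v)" by(rule tri_ext[OF T(1) h(1)])
  moreover have "h *v e = a \<or> h *v e = - a" using T(2) ha by auto
  moreover have "same_edges a b c (h *v e) (h *v u) (h *v v)"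
   by(rule same_edges_trans[OF T(3) same_edges_ext[OF T(1) h(1)]])
  moreover have "dt (h *v u) x = 0 \<or> linked a x (h *v u) (h *v v)"
  proof (cases "?xi u = ?xi x'")
   case True
   hence "dt a b * dt u x' = 0" unfolding dt_xi[OF ne(1) x'1] by simp
   hence "dt u x' = 0" using l by simp
   thus ?thesis using dt_mat[OF hS, of u x'] hx by simp
  next
   case False
   hence "(?xi u - ?xi x') * (?xi v - ?xi x') < 0" using between by(intro mult_neg_pos) auto
   hence "linked u v a x'" using linked_xi_inf[OF t'(11) ne x'1] by blast
   hence "linked (h *v a) (h *v x') (h *v u) (h *v v)" unfolding linked_mat[OF hS] linked_sym[of a x'] .
   thus ?thesis unfolding ha hx by blast
  qed
  ultimately show ?thesis by blast
 qed
 have xb: "?xi b = 0" "dt a b \<noteq> 0" using l by(simp_all add: xi_def)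
 have xc: "?xi c = ?l1 / ?l2" "dt a c \<noteq> 0" using l by(simp_all add: xi_def ac cb)
 have xmc: "?xi (- c) = ?l1 / ?l2" "dt a (- c) \<noteq> 0" using l by(simp_all add: xi_def ac cb dt_lin)
 let ?d = "Jm c a *v b" and ?f = "Jm a b *v c"
 have d: "?d = (1 / ?l2) *\<^sub>R (dt b a *\<^sub>R a - dt c b *\<^sub>R c)" by(rule Jm_vec[OF t'(13)])
 have f: "?f = (1 / ?l3) *\<^sub>R (dt c b *\<^sub>R b - dt a c *\<^sub>R a)" by(rule Jm_vec[OF t'(11)])
 have dd: "dt ?d b = - (?l3\<^sup>2 + ?l1\<^sup>2) / ?l2" "dt a ?d = - ?l1"
  unfolding d using l by(simp_all add: dt_lin ba cb ac power2_eq_square field_simps)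
 have xd: "?xi ?d = (?l3\<^sup>2 + ?l1\<^sup>2) / (?l1 * ?l2)" "dt a ?d \<noteq> 0"
  unfolding xi_def dd using l by(simp_all add: field_simps)
 have ff: "dt ?f b = ?l2" "dt a ?f = - ?l1"
  unfolding f using l by(simp_all add: dt_lin ba cb ac)
 have xf: "?xi ?f = - ?l2 / ?l1" "dt a ?f \<noteq> 0"
  unfolding xi_def ff using l by simp_all
 have Kd: "K - ?l2 / ?l1 = ?xi ?d" unfolding K xd(1) using l by(simp add: power2_eq_square field_simps)
 consider "?xi x' < 0" | "0 \<le> ?xi x'" "?xi x' < ?l1 / ?l2" | "?l1 / ?l2 \<le> ?xi x'" by linarith
 thus ?thesis
 proof cases
  case 1
  show ?thesis by(rule key[OF tri_prev(1)[OF t] _ tri_prev(2)[OF t] xf(2) xb(2)]) (use 1 r1 xf(1) xb(1) in auto)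
 next
  case 2
  have "same_edges a b c a b c" by(simp add: same_edges_def)
  thus ?thesis by(rule key[OF t _ _ xb(2) xc(2), rotated]) (use 2 xc(1) xb(1) in auto)
 next
  case 3
  show ?thesis by(rule key[OF tri_next(1)[OF t] _ tri_next(2)[OF t] xmc(2) xd(2)]) (use 3 r2 Kd xmc(1) in auto)
 qed
qed

lemma opposite_vertex:
 assumes t: "tri a b c"
 shows "linked a (Jm b c *v a) b c" "dt a (Jm b c *v a) \<noteq> 0" "Jm b c *v a \<in> cusps"
proof -
 note t' = triD[OF t]
 let ?a = "Jm b c *v a"
 have ac: "dt a c = - dt c a" and ba: "dt b a = - dt a b" and cb: "dt c b = - dt b c"
  by(simp_all only: dt_swap[of a c] dt_swap[of b a] dt_swap[of c b])
 have a': "?a = (1 / dt b c) *\<^sub>R (dt a c *\<^sub>R c - dt b a *\<^sub>R b)" by(rule Jm_vec[OF t'(12)])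
 have 1: "dt ?a b = dt c a" "dt ?a c = dt a b"
  unfolding a' using t'(2) by(simp_all add: dt_lin ac ba cb)
 show "linked a ?a b c" unfolding linked_def 1 ac using t' by(simp add: mult_neg_pos mult_pos_neg)
 have "dt a ?a = (dt c a * dt c a + dt a b * dt a b) / dt b c"
  unfolding a' using t'(2) by(simp add: dt_lin ac ba field_simps)
 moreover have "dt c a * dt c a + dt a b * dt a b > 0" using t'(1,3) by(simp add: add_pos_pos)
 ultimately have "dt a ?a > 0" using t'(2) by(simp only: divide_pos_pos)
 thus "dt a ?a \<noteq> 0" by simp
 show "?a \<in> cusps" by(rule cusps_ext[OF odd_ext[OF t'(5)] t'(7)])
qed

text \<open>Lifts crossing \<open>c a\<close> or \<open>a b\<close> all cross \<open>b c\<close> and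
  never do both, and \<open>g0\<close> crosses only \<open>b c\<close>; so the two counts add up to
  less than that of \<open>b c\<close>. By the half turn the same counts occur in the opposite
  triangle, whose two other sides therefore miss some lift through \<open>b c\<close>, and that lift
  ends at the opposite vertex. With a lift issuing from each end of the new diagonal,
  \<open>diagonal_crossing\<close> embeds its crossings into those of \<open>b c\<close>, and
  \<open>g0\<close> is left out.\<close>

lemma flip_crossings:
 assumes t: "tri a b c" and s: "simple_pair p r" and g0: "g0 \<in> \<Gamma>" "a = g0 *v p \<or> a = - (g0 *v p)"
  and l: "linked a (g0 *v r) b c"
 shows "crossings p r a (Jm b c *v a) < crossings p r b c"
proof -
 note t' = triD[OF t]
 let ?J = "Jm b c" and ?a = "Jm b c *v a" and ?x = "g0 *v r"
 have J: "?J \<in> SL2" by(rule Jm_SL2[OF t'(12)])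
 have e: "?J *v b = c" "?J *v c = - b" using t'(12) by(simp_all add: Jm_left Jm_right)
 note o = opposite_vertex[OF t]
 let ?S = "\<lambda>u v. {g \<in> \<Gamma>. linked (g *v p) (g *v r) u v}"
 have fin: "finite (?S u v)" if "u \<in> cusps" "v \<in> cusps" "dt u v \<noteq> 0" for u v
  by(rule finite_crossings[OF s that])
 have unl: "\<not> linked (g *v p) (g *v r) a ?x" if "g \<in> \<Gamma>" for g
  using family_unlinked[OF s that g0(1)] g0(2) by auto
 have fbc: "finite (?S b c)" by(rule fin[OF t'(8,9,12)])
 have fca: "finite (?S c a)" by(rule fin[OF t'(9,7,13)])
 have fab: "finite (?S a b)" by(rule fin[OF t'(7,8,11)])
 have sub1: "?S c a \<subseteq> ?S b c - ?S a b"
 proof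
  fix g assume "g \<in> ?S c a"
  hence g: "g \<in> \<Gamma>" "linked (g *v p) (g *v r) c a" by auto
  show "g \<in> ?S b c - ?S a b" using corner_crossing[OF t'(11,14) l unl[OF g(1)] g(2)] g(1) by auto
 qed
 have l': "linked a ?x c b" using l unfolding linked_swap(2)[of a ?x b c] .
 have sub2: "?S a b \<subseteq> ?S b c"
 proof
  fix g assume g: "g \<in> ?S a b"
  hence g: "g \<in> \<Gamma>" "linked (g *v p) (g *v r) b a" by(auto simp: linked_swap(2)[of _ _ b a])
  have "linked (g *v p) (g *v r) c b" using corner_crossing[OF t'(14,11) l' unl[OF g(1)] g(2)] by blast
  thus "g \<in> ?S b c" using g(1) unfolding linked_swap(2)[of _ _ c b] by simp
 qed
 have g0S: "g0 \<in> ?S b c" using l g0 by auto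
 have z: "\<not> linked (g0 *v p) (g0 *v r) u v" if "u = a \<or> v = a" for u v
  using g0(2) that by(auto simp: linked_def dt_lin)
 have g0n: "g0 \<notin> ?S c a" "g0 \<notin> ?S a b" using z by blast+
 have card: "card (?S c a) + card (?S a b) < card (?S b c)"
 proof -
  have "card (?S c a) + card (?S a b) = card (?S c a \<union> ?S a b)"
   using sub1 by(intro card_Un_disjoint[symmetric] fca fab) blast
  also have "\<dots> < card (?S b c)"
   by(rule psubset_card_mono[OF fbc]) (use sub1 sub2 g0S g0n in blast)
  finally show ?thesis .
 qed
 have c1: "card (?S c ?a) = card (?S a b)"
  using crossings_ext[OF odd_ext[OF t'(5)] t'(4,11), of p r] unfolding e crossings_swap[of p r ?a c]
  unfolding crossings_def .
 have c2: "card (?S ?a b) = card (?S c a)"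
  using crossings_ext[OF odd_ext[OF t'(5)] t'(6,13), of p r] unfolding e crossings_simps crossings_swap[of p r b ?a]
  unfolding crossings_def .
 have "\<not> ?S b c \<subseteq> ?S c ?a \<union> ?S ?a b"
 proof
  assume "?S b c \<subseteq> ?S c ?a \<union> ?S ?a b"
  moreover have "finite (?S c ?a \<union> ?S ?a b)"
   using o(1) linked_nonzero[OF o(1)] dt_swap[of c ?a] by(intro finite_UnI fin o(3) t'(8,9)) auto
  ultimately have "card (?S b c) \<le> card (?S c ?a \<union> ?S ?a b)" by(intro card_mono)
  also have "\<dots> \<le> card (?S c ?a) + card (?S ?a b)" by(rule card_Un_le)
  \<comment> \<open>The opposite triangle has, by the half turn, the same two counts, too small to
    cover the crossings of \<open>b c\<close>.\<close>
  finally show False using card c1 c2 by linarith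
 qed
 then obtain g1 where g1: "g1 \<in> \<Gamma>" "linked (g1 *v p) (g1 *v r) b c"
  "\<not> linked (g1 *v p) (g1 *v r) c ?a" "\<not> linked (g1 *v p) (g1 *v r) ?a b" by blast
 have pr: "p \<in> cusps" "r \<in> cusps" using s by(auto simp: simple_pair_def)
 have "dt (g1 *v p) ?a = 0 \<or> dt (g1 *v r) ?a = 0" by(rule end_at_vertex[OF g1(2-4)])
 hence "\<exists>y. linked ?a y b c \<and> (\<forall>s t. linked s t ?a y = linked s t (g1 *v p) (g1 *v r))"
 proof
  assume "dt (g1 *v p) ?a = 0"
  hence "?a = g1 *v p \<or> ?a = - (g1 *v p)" using cusp_parallel[OF cusps_even[OF g1(1) pr(1)] o(3)] by blast
  thus ?thesis using g1(2) by(intro exI[of _ "g1 *v r"]) (elim disjE, simp_all)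
 next
  assume "dt (g1 *v r) ?a = 0"
  hence "?a = g1 *v r \<or> ?a = - (g1 *v r)" using cusp_parallel[OF cusps_even[OF g1(1) pr(2)] o(3)] by blast
  thus ?thesis using g1(2)
   by(intro exI[of _ "g1 *v p"])
    (elim disjE, simp_all add: linked_swap(1)[of "g1 *v r" "g1 *v p"] linked_swap(2)[of _ _ "g1 *v r" "g1 *v p"])
 qed
 then obtain y where y: "linked ?a y b c" "\<And>s t. linked s t ?a y = linked s t (g1 *v p) (g1 *v r)" by blast
 have "?S a ?a \<subset> ?S b c"
 proof
  show "?S a ?a \<subseteq> ?S b c"
  proof
   fix g assume g: "g \<in> ?S a ?a"
   hence "g \<in> \<Gamma>" by simp
   hence uy: "\<not> linked (g *v p) (g *v r) ?a y" unfolding y(2) by(rule family_unlinked[OF s _ g1(1)])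
   have g': "g \<in> \<Gamma>" "linked (g *v p) (g *v r) a ?a" using g by auto
   have "linked (g *v p) (g *v r) b c"
    by(rule diagonal_crossing[OF t'(11,14) o(1) l y(1) unl[OF g'(1)] uy g'(2)])
   thus "g \<in> ?S b c" using g'(1) by simp
  qed
  have "g0 \<notin> ?S a ?a" using z by blast
  thus "?S a ?a \<noteq> ?S b c" using g0S by blast
 qed
 thus ?thesis unfolding crossings_def by(rule psubset_card_mono[OF fbc])
qed

text \<open>The cusps form one orbit up to sign, so some lift of the arc starts at any given
  cusp.\<close>

lemma simple_pair_end:
 assumes s: "simple_pair p r" and a: "a \<in> cusps"
 obtains g where "g \<in> \<Gamma>" "a = g *v p \<or> a = - (g *v p)" "dt a (g *v r) \<noteq> 0" "g *v r \<in> cusps"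
proof -
 have pr: "p \<in> cusps" "r \<in> cusps" "dt p r \<noteq> 0" using s by(auto simp: simple_pair_def)
 obtain h where h: "h \<in> \<Gamma>" "p = h *v v0 \<or> p = - (h *v v0)" using pr(1) by(auto simp: cusps_def)
 obtain k where k: "k \<in> \<Gamma>" "a = k *v v0 \<or> a = - (k *v v0)" using a by(auto simp: cusps_def)
 let ?g = "k ** adj h"
 have g: "?g \<in> \<Gamma>" using h k G_mult by simp
 have hS: "h \<in> SL2" using G_SL2 h by blast
 have "?g *v p = k *v v0 \<or> ?g *v p = - (k *v v0)"
  using h(2) by(auto simp: mat_vec_assoc[symmetric] adj_cancel_vec[OF hS])
 hence ag: "a = ?g *v p \<or> a = - (?g *v p)" using k(2) by auto
 have "dt (?g *v p) (?g *v r) \<noteq> 0" using dt_mat[OF G_SL2[OF g]] pr(3) by simp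
 hence "dt a (?g *v r) \<noteq> 0" using ag by(auto simp: dt_lin)
 thus thesis using that[OF g ag] cusps_even[OF g pr(2)] by blast
qed

definition unlinked_pairs :: "real^2 => real^2 => real^2 => real^2 => bool" where
 "unlinked_pairs p r p' r' \<longleftrightarrow> (\<forall>g\<in>\<Gamma>. \<forall>h\<in>\<Gamma>. \<not> linked (g *v p) (g *v r) (h *v p') (h *v r'))"

lemma edge_linked:
 assumes e: "is_edge b c p' r'" and u: "unlinked_pairs p r p' r'" and g: "g \<in> \<Gamma>"
 shows "\<not> linked (g *v p) (g *v r) b c"
proof -
 obtain h where h: "h \<in> \<Gamma>" "(b = h *v p' \<or> b = - (h *v p')) \<and> (c = h *v r' \<or> c = - (h *v r')) \<or>
  (c = h *v p' \<or> c = - (h *v p')) \<and> (b = h *v r' \<or> b = - (h *v r'))" using e unfolding is_edge_def by blast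
 have n: "\<not> linked (g *v p) (g *v r) (h *v p') (h *v r')" using u g h(1) by(simp add: unlinked_pairs_def)
 have n': "\<not> linked (g *v p) (g *v r) (h *v r') (h *v p')" using n unfolding linked_swap(2)[of _ _ "h *v r'" "h *v p'"] .
 show ?thesis using h(2) n n' by(elim disjE conjE) (simp_all only: linked_uminus, simp_all)
qed

lemma flip_edges:
 assumes t: "tri a b c" and e: "is_edge a b p r \<or> is_edge c a p r"
 shows "tedge a b (- (Jm b c *v a)) p r"
proof -
 note t' = triD[OF t]
 have e': "Jm b c *v c = - b" using t'(12) by(simp add: Jm_right)
 have "is_edge b (- (Jm b c *v a)) p r" if "is_edge c a p r"
  using is_edge_ext[OF odd_ext[OF t'(5)] t'(6,13), of p r] that unfolding e' by simp
 thus ?thesis using e unfolding tedge_def by blast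
qed

text \<open>Repeatedly flipping an edge crossed by the arc makes the arc an edge, and never destroys an edge
 disjoint from the arc.\<close>

lemma descent:
 assumes s: "simple_pair p r" and t: "tri a b c"
 shows "\<exists>a' b' c'. tri a' b' c' \<and> tedge a' b' c' p r \<and>
  (\<forall>p' r'. unlinked_pairs p r p' r' \<and> tedge a b c p' r' --> tedge a' b' c' p' r')"
 using t
proof (induction "total p r a b c" arbitrary: a b c rule: less_induct)
 case less
 note t = less.prems
 obtain g where g: "g \<in> \<Gamma>" "a = g *v p \<or> a = - (g *v p)" "dt a (g *v r) \<noteq> 0" "g *v r \<in> cusps"
  by(rule simple_pair_end[OF s triD(7)[OF t]])
 obtain a1 b1 c1 where T: "tri a1 b1 c1" "a1 = a \<or> a1 = - a" "same_edges a b c a1 b1 c1"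
  "dt b1 (g *v r) = 0 \<or> linked a (g *v r) b1 c1"
  using sector[OF t g(3)] by blast
 have te: "tedge a1 b1 c1 p' r' = tedge a b c p' r'" "total p' r' a1 b1 c1 = total p' r' a b c" for p' r'
  using T(3) by(auto simp: same_edges_def)
 have g': "a1 = g *v p \<or> a1 = - (g *v p)" using g(2) T(2) by auto
 show ?case
 proof (cases "dt b1 (g *v r) = 0")
  case True
  hence "b1 = g *v r \<or> b1 = - (g *v r)"
   using cusp_parallel[OF g(4) triD(8)[OF T(1)]] dt_swap[of b1] by auto
  hence "is_edge a1 b1 p r" unfolding is_edge_def using g(1) g' by blast
  hence "tedge a1 b1 c1 p r" by(simp add: tedge_def)
  thus ?thesis using T(1) te(1) by blast
 next
  case False
  hence "linked a (g *v r) b1 c1" using T(4) by blast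
  hence l: "linked a1 (g *v r) b1 c1" using T(2) by auto
  let ?a = "Jm b1 c1 *v a1"
  have tf: "tri a1 b1 (- ?a)" by(rule tri_flip[OF T(1)])
  have "crossings p r a1 ?a < crossings p r b1 c1" by(rule flip_crossings[OF T(1) s g(1) g' l])
  moreover have "crossings p r b1 (- ?a) = crossings p r c1 a1"
  proof -
   note t1 = triD[OF T(1)]
   have "Jm b1 c1 *v c1 = - b1" using t1(12) by(simp add: Jm_right)
   thus ?thesis using crossings_ext[OF odd_ext[OF t1(5)] t1(6,13), of p r] by simp
  qed
  ultimately have "total p r a1 b1 (- ?a) < total p r a1 b1 c1"
   unfolding total_def by(simp add: crossings_swap[of p r a1 ?a])
  hence "total p r a1 b1 (- ?a) < total p r a b c" unfolding te(2) .
  from less.hyps[OF this tf] obtain a2 b2 c2 where T2: "tri a2 b2 c2" "tedge a2 b2 c2 p r"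
   "\<And>p' r'. unlinked_pairs p r p' r' ==> tedge a1 b1 (- ?a) p' r' ==> tedge a2 b2 c2 p' r'" by blast
  have "tedge a2 b2 c2 p' r'" if u: "unlinked_pairs p r p' r'" and e: "tedge a b c p' r'" for p' r'
  proof (rule T2(3)[OF u flip_edges[OF T(1)]])
   have "linked (g *v p) (g *v r) b1 c1" using l g' by auto
   hence "\<not> is_edge b1 c1 p' r'" using edge_linked[OF _ u g(1)] by blast
   thus "is_edge a1 b1 p' r' \<or> is_edge c1 a1 p' r'" using e te(1)[of p' r'] by(auto simp: tedge_def)
  qed
  thus ?thesis using T2(1,2) by blast
 qed
qed

text \<open>The new arc leaves \<open>a\<close> through a side \<open>b c\<close>, which cannot be
  the second or third arc and so is the first. Beyond it the remaining sides of the quadrilateral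
  are translates of the second and third arcs and cannot be crossed, so the new arc ends at the
  opposite vertex.\<close>

lemma flip_unique:
 assumes t: "tri a b c" and s: "simple_pair p r"
  and e: "tedge a b c p0 r0" "tedge a b c p1 r1" "tedge a b c p2 r2"
  and d: "\<And>x y. \<not> (is_edge x y p0 r0 \<and> is_edge x y p1 r1)" "\<And>x y. \<not> (is_edge x y p0 r0 \<and> is_edge x y p2 r2)"
   "\<And>x y. \<not> (is_edge x y p1 r1 \<and> is_edge x y p2 r2)"
  and u: "unlinked_pairs p r p1 r1" "unlinked_pairs p r p2 r2"
  and ne: "\<not> tedge a b c p r"
 shows "\<exists>a' b' c'. tri a' b' c' \<and> is_edge b' c' p0 r0 \<and> is_edge a' (Jm b' c' *v a') p r \<and>
  (is_edge c' a' p1 r1 \<and> is_edge a' b' p2 r2 \<or> is_edge c' a' p2 r2 \<and> is_edge a' b' p1 r1)"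
proof -
 obtain g where g: "g \<in> \<Gamma>" "a = g *v p \<or> a = - (g *v p)" "dt a (g *v r) \<noteq> 0" "g *v r \<in> cusps"
  by(rule simple_pair_end[OF s triD(7)[OF t]])
 obtain a1 b1 c1 where T: "tri a1 b1 c1" "a1 = a \<or> a1 = - a" "same_edges a b c a1 b1 c1"
  "dt b1 (g *v r) = 0 \<or> linked a (g *v r) b1 c1"
  using sector[OF t g(3)] by blast
 note t1 = triD[OF T(1)]
 have te: "tedge a1 b1 c1 p' r' = tedge a b c p' r'" for p' r'
  using T(3) by(auto simp: same_edges_def)
 have g': "a1 = g *v p \<or> a1 = - (g *v p)" using g(2) T(2) by auto
 have "dt b1 (g *v r) \<noteq> 0"
 proof
  assume "dt b1 (g *v r) = 0"
  hence "b1 = g *v r \<or> b1 = - (g *v r)"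
   using cusp_parallel[OF g(4) t1(8)] dt_swap[of b1] by auto
  hence "is_edge a1 b1 p r" unfolding is_edge_def using g(1) g' by blast
  thus False using ne te[of p r] by(simp add: tedge_def)
 qed
 hence "linked a (g *v r) b1 c1" using T(4) by blast
 hence "linked a1 (g *v r) b1 c1" using T(2) by auto
 hence l: "linked (g *v p) (g *v r) b1 c1" using g' by auto
 have n: "\<not> is_edge b1 c1 p1 r1" "\<not> is_edge b1 c1 p2 r2"
  using l edge_linked[OF _ u(1) g(1)] edge_linked[OF _ u(2) g(1)] by blast+
 have E: "tedge a1 b1 c1 p0 r0" "tedge a1 b1 c1 p1 r1" "tedge a1 b1 c1 p2 r2" using e te by blast+
 have 1: "is_edge c1 a1 p1 r1 \<and> is_edge a1 b1 p2 r2 \<or> is_edge c1 a1 p2 r2 \<and> is_edge a1 b1 p1 r1"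
  using E(2,3) n d(3)[of a1 b1] d(3)[of c1 a1] unfolding tedge_def by blast
 have 2: "is_edge b1 c1 p0 r0"
  using E(1) 1 d(1)[of a1 b1] d(2)[of a1 b1] d(1)[of c1 a1] d(2)[of c1 a1] unfolding tedge_def by blast
 let ?J = "Jm b1 c1" and ?a = "Jm b1 c1 *v a1"
 have e: "?J *v b1 = c1" "?J *v c1 = - b1" using t1(12) by(simp_all add: Jm_left Jm_right)
 have un: "\<not> linked (g *v p) (g *v r) x y" if "is_edge x y p1 r1 \<or> is_edge x y p2 r2" for x y
  using that edge_linked[OF _ u(1) g(1)] edge_linked[OF _ u(2) g(1)] by blast
 have ca: "is_edge (- b1) ?a p' r' = is_edge c1 a1 p' r'" for p' r'
  using is_edge_ext[OF odd_ext[OF t1(5)] t1(6,13), of p' r'] unfolding e .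
 have ab: "is_edge ?a c1 p' r' = is_edge a1 b1 p' r'" for p' r'
  using is_edge_ext[OF odd_ext[OF t1(5)] t1(4,11), of p' r'] unfolding e .
 have "\<not> linked (g *v p) (g *v r) (- b1) ?a" by(rule un) (use 1 ca in blast)
 hence n1: "\<not> linked (g *v p) (g *v r) ?a b1" unfolding linked_uminus linked_swap(2)[of _ _ ?a b1] .
 have "\<not> linked (g *v p) (g *v r) ?a c1" by(rule un) (use 1 ab in blast)
 hence n2: "\<not> linked (g *v p) (g *v r) c1 ?a" unfolding linked_swap(2)[of _ _ c1 ?a] .
 have "dt (g *v p) ?a = 0 \<or> dt (g *v r) ?a = 0" by(rule end_at_vertex[OF l n2 n1])
 moreover have "dt (g *v p) ?a \<noteq> 0" using opposite_vertex(2)[OF T(1)] g' by(auto simp: dt_lin)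
 ultimately have "dt (g *v r) ?a = 0" by blast
 hence "?a = g *v r \<or> ?a = - (g *v r)" using cusp_parallel[OF g(4) opposite_vertex(3)[OF T(1)]] by blast
 hence "is_edge a1 ?a p r" unfolding is_edge_def using g(1) g' by blast
 thus ?thesis using T(1) 1 2 by blast
qed

end

section \<open>Strip deformations\<close>

text \<open>In the coordinates \<open>(Re z, |z|\<^sup>2)\<close> of the Klein model every \<open>side\<close> is affine; this gives
 convexity of the complementary regions of a family of lines.\<close>

definition klein :: "complex => complex => real => complex" where
 "klein z w t = Complex ((1 - t) * Re z + t * Re w)
  (sqrt ((1 - t) * ((Re z)\<^sup>2 + (Im z)\<^sup>2) + t * ((Re w)\<^sup>2 + (Im w)\<^sup>2) - ((1 - t) * Re z + t * Re w)\<^sup>2))"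

lemma klein_pos:
 assumes z: "Im z > 0" and w: "Im w > 0" and t: "0 \<le> t" "t \<le> 1"
 shows "(1 - t) * ((Re z)\<^sup>2 + (Im z)\<^sup>2) + t * ((Re w)\<^sup>2 + (Im w)\<^sup>2) - ((1 - t) * Re z + t * Re w)\<^sup>2 > 0" (is "?d > 0")
proof -
 have "?d = (1 - t) * (Im z)\<^sup>2 + t * (Im w)\<^sup>2 + (1 - t) * t * (Re z - Re w)\<^sup>2"
  by(simp add: power2_eq_square algebra_simps)
 moreover have "(1 - t) * t * (Re z - Re w)\<^sup>2 \<ge> 0" using t by simp
 moreover have "(1 - t) * (Im z)\<^sup>2 + t * (Im w)\<^sup>2 > 0"
 proof (cases "t = 0")
  case False
  hence "t * (Im w)\<^sup>2 > 0" using t w by simp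
  moreover have "(1 - t) * (Im z)\<^sup>2 \<ge> 0" using t by simp
  ultimately show ?thesis by linarith
 qed (use z in simp)
 ultimately show ?thesis by linarith
qed

lemma klein_ends:
 assumes "Im z > 0" "Im w > 0"
 shows "klein z w 0 = z" "klein z w 1 = w"
 using assms by(simp_all add: klein_def complex_eq_iff)

lemma klein_Im:
 assumes "Im z > 0" "Im w > 0" "0 \<le> t" "t \<le> 1"
 shows "Im (klein z w t) > 0"
 using klein_pos[OF assms] by(simp add: klein_def)

lemma side_klein:
 assumes "Im z > 0" "Im w > 0" "0 \<le> t" "t \<le> 1"
 shows "side u v (klein z w t) = (1 - t) * side u v z + t * side u v w"
proof -
 have e1: "(Re (klein z w t))\<^sup>2 + (Im (klein z w t))\<^sup>2 = (1 - t) * ((Re z)\<^sup>2 + (Im z)\<^sup>2) + t * ((Re w)\<^sup>2 + (Im w)\<^sup>2)"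
  using klein_pos[OF assms] by(simp add: klein_def)
 have e2: "Re (klein z w t) = (1 - t) * Re z + t * Re w" by(simp add: klein_def)
 have s: "side u v (klein z w t) = u$1 * v$1 - (u$1 * v$2 + u$2 * v$1) * ((1 - t) * Re z + t * Re w) +
   u$2 * v$2 * ((1 - t) * ((Re z)\<^sup>2 + (Im z)\<^sup>2) + t * ((Re w)\<^sup>2 + (Im w)\<^sup>2))"
  unfolding side_explicit e1 unfolding e2 ..
 show ?thesis unfolding s unfolding side_explicit by(simp add: algebra_simps)
qed

lemma continuous_klein: "continuous_on {0..1} (klein z w)"
proof -
 have e: "klein z w t = of_real ((1 - t) * Re z + t * Re w) + \<i> * of_real
  (sqrt ((1 - t) * ((Re z)\<^sup>2 + (Im z)\<^sup>2) + t * ((Re w)\<^sup>2 + (Im w)\<^sup>2) - ((1 - t) * Re z + t * Re w)\<^sup>2))" for t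
  by(simp add: klein_def complex_eq_iff)
 show ?thesis unfolding e by(intro continuous_intros)
qed

lemma sgn_convex:
 fixes x y :: real
 assumes "sgn x = sgn y" "0 \<le> t" "t \<le> 1"
 shows "sgn ((1 - t) * x + t * y) = sgn x"
proof (cases x "0::real" rule: linorder_cases)
 case less
 hence y: "y < 0" using assms(1) by(auto simp: sgn_if split: if_splits)
 have "(1 - t) * x + t * y < 0"
 proof (cases "t = 1")
  case False
  hence "(1 - t) * x < 0" "t * y \<le> 0" using less y assms by(auto simp: mult_less_0_iff mult_le_0_iff)
  thus ?thesis by linarith
 qed (use y in simp)
 thus ?thesis using less by simp
next
 case greater
 hence y: "y > 0" using assms(1) by(auto simp: sgn_if split: if_splits)
 have "(1 - t) * x + t * y > 0"
 proof (cases "t = 1")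
  case False
  hence "(1 - t) * x > 0" "t * y \<ge> 0" using greater y assms by auto
  thus ?thesis by linarith
 qed (use y in simp)
 thus ?thesis using greater by simp
next
 case equal
 thus ?thesis using assms(1) by(simp add: sgn_if split: if_splits)
qed

lemma sgn_connected:
 fixes f :: "'a::topological_space => real"
 assumes "connected X" "continuous_on X f" "0 \<notin> f ` X" "x \<in> X" "y \<in> X"
 shows "sgn (f x) = sgn (f y)"
proof -
 have c: "connected (f ` X)" by(rule connected_continuous_image[OF assms(2,1)])
 have n: "\<not> (f a < 0 \<and> f b > 0)" if "a \<in> X" "b \<in> X" for a b
 proof
  assume "f a < 0 \<and> f b > 0"
  hence "0 \<in> f ` X" using connectedD_interval[OF c, of "f a" "f b" 0] that by auto
  thus False using assms(3) by simp
 qed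
 have "f x \<noteq> 0" "f y \<noteq> 0" using assms(3,4,5) by force+
 thus ?thesis using n[OF assms(4,5)] n[OF assms(5,4)] by(cases "f x > 0"; cases "f y > 0") auto
qed

lemma line_connected: "dt u v \<noteq> 0 ==> connected (line u v)"
proof -
 assume "dt u v \<noteq> 0"
 then obtain N where N: "N \<in> SL2" "line u v = geod_line N" by(rule line_geod)
 have "continuous_on UNIV (geod N)"
  using geod_deriv[OF N(1)] by(intro continuous_at_imp_continuous_on ballI) (blast intro: has_vector_derivative_continuous)
 thus "connected (line u v)" unfolding N(2) geod_line_def by(rule connected_continuous_image) simp
qed

lemma line_axis:
 assumes d: "dt u v \<noteq> 0" and y: "y \<noteq> y'" "y > 0" "y' > 0"
  and l: "side u v (\<i> * of_real y) = 0" "side u v (\<i> * of_real y') = 0"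
 shows "line u v = line e1 e2"
proof -
 have l': "u$1 * v$1 + u$2 * v$2 * y\<^sup>2 = 0" "u$1 * v$1 + u$2 * v$2 * y'\<^sup>2 = 0"
  using l unfolding side_explicit by simp_all
 moreover have "u$2 * v$2 * (y\<^sup>2 - y'\<^sup>2) = (u$1 * v$1 + u$2 * v$2 * y\<^sup>2) - (u$1 * v$1 + u$2 * v$2 * y'\<^sup>2)"
  by(simp add: right_diff_distrib)
 ultimately have "u$2 * v$2 * (y\<^sup>2 - y'\<^sup>2) = 0" by simp
 moreover have "y\<^sup>2 \<noteq> y'\<^sup>2" using y by(simp add: power2_eq_iff_nonneg)
 ultimately have p: "u$2 * v$2 = 0" by simp
 with l' have p': "u$1 * v$1 = 0" by simp
 have c: "u$1 * v$2 + u$2 * v$1 \<noteq> 0" using d p p' unfolding dt_def by auto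
 show ?thesis using c unfolding line_def side_explicit[of u v] side_e p p' by auto
qed

lemma line_two_points:
 assumes d: "dt u v \<noteq> 0" and N: "N \<in> SL2" and s: "s \<noteq> t" "geod N s \<in> line u v" "geod N t \<in> line u v"
 shows "geod_line N = line u v"
proof -
 let ?u = "adj N *v u" and ?v = "adj N *v v"
 have N': "adj N \<in> SL2" using N by simp
 have z: "side ?u ?v (\<i> * of_real (exp x)) = 0" if "geod N x \<in> line u v" for x
 proof -
  have I: "Im (\<i> * of_real (exp x)) > 0" by simp
  have "side u v (moeb N (\<i> * of_real (exp x))) = 0" using that by(simp add: line_def geod_def)
  hence "side (N *v ?u) (N *v ?v) (moeb N (\<i> * of_real (exp x))) = 0" unfolding adj_cancel_vec(2)[OF N] .
  thus ?thesis unfolding side_moeb[OF N I] using jac_nonzero[OF N I] by simp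
 qed
 have "dt ?u ?v \<noteq> 0" unfolding dt_mat[OF N'] by(rule d)
 hence "line ?u ?v = line e1 e2"
  by(rule line_axis[OF _ _ _ _ z[OF s(2)] z[OF s(3)]]) (use s(1) in simp_all)
 hence "moeb N ` line ?u ?v = moeb N ` line e1 e2" by simp
 thus ?thesis unfolding line_moeb[OF N] adj_cancel_vec(2)[OF N] geod_line_eq[OF N] by simp
qed

lemma line_inf_points:
 assumes d: "dt u v \<noteq> 0" and N: "N \<in> SL2" and T: "infinite T" "\<And>t. t \<in> T ==> geod N t \<in> line u v"
 shows "geod_line N = line u v"
proof -
 obtain s where s: "s \<in> T" using T(1) by fastforce
 have "infinite (T - {s})" using T(1) by simp
 hence "T - {s} \<noteq> {}" by(rule infinite_imp_nonempty)
 then obtain t where "t \<in> T" "t \<noteq> s" by blast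
 thus ?thesis using line_two_points[OF d N, of t s] T(2) s by blast
qed

context cusped_torus
begin

lemma q_line_iff:
 assumes "Im z > 0"
 shows "q z \<in> q ` line u v \<longleftrightarrow> (\<exists>g\<in>\<Gamma>. z \<in> line (g *v u) (g *v v))"
proof
 assume "q z \<in> q ` line u v"
 then obtain w where w: "w \<in> line u v" "q w = q z" by auto
 hence "Im w > 0" by(simp add: line_def)
 then obtain g where "g \<in> \<Gamma>" "z = moeb g w" using q_eq_iff[OF _ assms] w(2) by blast
 thus "\<exists>g\<in>\<Gamma>. z \<in> line (g *v u) (g *v v)" using line_moeb[OF G_SL2, of g u v] w(1) by blast
next
 assume "\<exists>g\<in>\<Gamma>. z \<in> line (g *v u) (g *v v)"
 thus "q z \<in> q ` line u v" using line_G_image by blast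
qed

end

section \<open>Tiles and strips of one simple geodesic\<close>

locale simple_geodesic = cusped_torus +
 fixes u v :: "real^2"
 assumes sp: "simple_pair u v" and pos: "dt u v > 0"
begin

abbreviation sd :: "real^2^2 => complex => real" where "sd g z \<equiv> side (g *v u) (g *v v) z"

abbreviation jp :: "real^2^2 => complex => complex => real^2^2" where "jp g z w \<equiv> jump (g *v u) (g *v v) z w"

abbreviation region :: "complex set" where "region \<equiv> {z \<in> half_plane. q z \<notin> q ` line u v}"

text \<open>Equality of the sign vectors with respect to all lifts; on the region this is the same
  as lying in one tile, see \<open>tile_eq_iff\<close>.\<close>

abbreviation same_cell :: "complex => complex => bool" where
 "same_cell z w \<equiv> (\<forall>g\<in>\<Gamma>. sgn (sd g z) = sgn (sd g w))"

lemma dtn: "dt u v \<noteq> 0" using sp by(simp add: simple_pair_def)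

lemma dt_G: "g \<in> \<Gamma> ==> dt (g *v u) (g *v v) = dt u v"
 by(rule dt_mat[OF G_SL2])

lemma loc_fin: "compact K ==> K \<subseteq> half_plane ==> finite {g \<in> \<Gamma>. line (g *v u) (g *v v) \<inter> K \<noteq> {}}"
 using sp by(simp add: simple_pair_def)

lemma region_iff: "Im z > 0 ==> z \<in> region \<longleftrightarrow> (\<forall>g\<in>\<Gamma>. sd g z \<noteq> 0)"
 using q_line_iff[of z u v] by(auto simp: half_plane_iff line_def)

lemma regionD: "z \<in> region ==> g \<in> \<Gamma> ==> sd g z \<noteq> 0" "z \<in> region ==> Im z > 0"
 using region_iff[of z] by(auto simp: half_plane_iff)

lemma sd_unique:
 assumes g: "g \<in> \<Gamma>" and h: "h \<in> \<Gamma>" and z: "Im z > 0" "sd g z = 0" "sd h z = 0"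
 shows "h = g \<or> h = - g"
proof -
 have gS: "g \<in> SL2" using G_SL2 g by blast
 let ?k = "adj g ** h" and ?z = "moeb (adj g) z"
 have k: "?k \<in> \<Gamma>" using g h G_mult by simp
 have "z \<in> line (g *v u) (g *v v)" "z \<in> line (h *v u) (h *v v)" using z by(auto simp: line_def)
 hence "?z \<in> line (adj g *v (g *v u)) (adj g *v (g *v v))" "?z \<in> line (adj g *v (h *v u)) (adj g *v (h *v v))"
  using line_moeb[of "adj g"] gS by auto
 hence "?z \<in> line u v" "?z \<in> line (?k *v u) (?k *v v)"
  by(simp_all only: adj_cancel_vec(1)[OF gS] mat_vec_assoc[of "adj g" h])
 hence "?k = mat 1 \<or> ?k = - mat 1" using simple_pair_inj[OF sp k] by blast
 hence "g ** ?k = g \<or> g ** ?k = - g" by(auto simp: mat_uminus_right)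
 thus ?thesis by(simp add: adj_cancel_left(2)[OF gS])
qed

text \<open>Only finitely many lifts come near \<open>m\<close>. Those that miss a closed disc
  around \<open>m\<close> have constant sign there, and the finitely many others are handled by
  continuity.\<close>

lemma cell_near:
 assumes m: "Im m > 0"
 obtains d where "d > 0" "ball m d \<subseteq> half_plane"
  "\<And>g x. g \<in> \<Gamma> ==> sd g m \<noteq> 0 ==> x \<in> ball m d ==> sgn (sd g x) = sgn (sd g m)"
proof -
 obtain r where r: "r > 0" "cball m r \<subseteq> half_plane"
  using open_contains_cball[THEN iffD1, OF open_half_plane] m[folded half_plane_iff] by blast
 let ?F = "{g \<in> \<Gamma>. line (g *v u) (g *v v) \<inter> cball m r \<noteq> {}}"
 let ?F' = "{g \<in> ?F. sd g m \<noteq> 0}"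
 have "finite ?F" by(rule loc_fin[OF compact_cball r(2)])
 hence fin: "finite ?F'" by(rule rev_finite_subset) blast
 have "eventually (\<lambda>x. sgn (sd g x) = sgn (sd g m)) (nhds m)" if "g \<in> ?F'" for g
 proof -
  have t: "(sd g \<longlongrightarrow> sd g m) (nhds m)"
  proof -
   have "isCont (sd g) m" using continuous_side[of UNIV "g *v u" "g *v v"] by(simp add: continuous_on_eq_continuous_at)
   thus ?thesis unfolding isCont_def tendsto_at_iff_tendsto_nhds .
  qed
  show ?thesis
  proof (cases "sd g m > 0")
   case True
   thus ?thesis using order_tendstoD(1)[OF t True] by(auto elim: eventually_mono)
  next
   case False
   hence n: "sd g m < 0" using that by simp
   thus ?thesis using order_tendstoD(2)[OF t n] by(auto elim: eventually_mono)
  qed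
 qed
 hence "eventually (\<lambda>x. \<forall>g\<in>?F'. sgn (sd g x) = sgn (sd g m)) (nhds m)"
  by(intro eventually_ball_finite[OF fin] ballI)
 then obtain e where e: "e > 0" "\<And>x. dist x m < e ==> \<forall>g\<in>?F'. sgn (sd g x) = sgn (sd g m)"
  unfolding eventually_nhds_metric by blast
 show thesis
 proof (rule that[of "min e r"])
  show "min e r > 0" using e r by simp
  show "ball m (min e r) \<subseteq> half_plane" using r(2) by auto
  fix g x assume g: "g \<in> \<Gamma>" and n: "sd g m \<noteq> 0" and x: "x \<in> ball m (min e r)"
  show "sgn (sd g x) = sgn (sd g m)"
  proof (cases "g \<in> ?F")
   case True
   thus ?thesis using e(2)[of x] x n by(auto simp: dist_commute)
  next
   case False
   hence "0 \<notin> sd g ` cball m r" using g r(2) by(auto simp: line_def half_plane_iff subset_eq)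
   show ?thesis
    by(rule sgn_connected[OF _ continuous_side \<open>0 \<notin> sd g ` cball m r\<close>]) (use x r in auto)
  qed
 qed
qed

lemma klein_region:
 assumes z: "z \<in> region" "w \<in> region" and s: "same_cell z w"
 shows "klein z w ` {0..1} \<subseteq> region"
proof
 fix x assume "x \<in> klein z w ` {0..1}"
 then obtain t where t: "x = klein z w t" "0 \<le> t" "t \<le> 1" by auto
 have I: "Im z > 0" "Im w > 0" using z by(auto simp: half_plane_iff)
 have "sd g x \<noteq> 0" if "g \<in> \<Gamma>" for g
 proof -
  have "sgn (sd g x) = sgn (sd g z)"
   unfolding t(1) side_klein[OF I t(2,3)] by(rule sgn_convex) (use s that t in auto)
  thus ?thesis using regionD(1)[OF z(1) that] by(metis sgn_zero_iff)
 qed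
 thus "x \<in> region" using region_iff klein_Im[OF I t(2,3)] unfolding t(1) by blast
qed

text \<open>Klein segments join two points with equal signs inside the region, since every
  \<open>side\<close> is affine along them. Conversely, the signs are constant on a tile because it
  is connected.\<close>

lemma same_cell_tile:
 assumes z: "z \<in> region" "w \<in> region" and s: "same_cell z w" and e: "e \<in> tiles q (q ` line u v)" "z \<in> e"
 shows "w \<in> e"
proof -
 have I: "Im z > 0" "Im w > 0" using z by(auto simp: half_plane_iff)
 have c: "connected (klein z w ` {0..1})" by(rule connected_continuous_image[OF continuous_klein]) simp
 have "klein z w 0 \<in> klein z w ` {0..1}" "klein z w 1 \<in> klein z w ` {0..1}" by(intro imageI; simp)+
 hence "z \<in> klein z w ` {0..1}" "w \<in> klein z w ` {0..1}" unfolding klein_ends[OF I] .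
 thus ?thesis
  using components_maximal[OF e(1)[unfolded tiles_def] c klein_region[OF z s]] e(2) by blast
qed

lemma tile_subset: "e \<in> tiles q (q ` line u v) ==> e \<subseteq> region"
 unfolding tiles_def by(rule in_components_subset)

lemma tile_nonempty: "e \<in> tiles q (q ` line u v) ==> \<exists>z. z \<in> e"
 unfolding tiles_def using in_components_nonempty by blast

lemma tile_same_cell:
 assumes e: "e \<in> tiles q (q ` line u v)" "z \<in> e" "w \<in> e"
 shows "same_cell z w"
proof
 fix g assume g: "g \<in> \<Gamma>"
 have "connected e" using e(1) unfolding tiles_def by(rule in_components_connected)
 moreover have "0 \<notin> sd g ` e" using tile_subset[OF e(1)] regionD(1)[OF _ g] by fastforce
 ultimately show "sgn (sd g z) = sgn (sd g w)" by(rule sgn_connected[OF _ continuous_side]) (use e in auto)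
qed

definition tile :: "complex => complex set" where "tile z = connected_component_set region z"

lemma tile_in: "z \<in> region ==> tile z \<in> tiles q (q ` line u v)" "z \<in> region ==> z \<in> tile z"
 by(auto simp: tile_def tiles_def componentsI)

lemma tile_eq: "e \<in> tiles q (q ` line u v) ==> z \<in> e ==> tile z = e"
proof -
 assume e: "e \<in> tiles q (q ` line u v)" "z \<in> e"
 hence "z \<in> region" using tile_subset by blast
 thus ?thesis
  using components_nonoverlap[of e region "tile z"] tile_in[of z] e unfolding tiles_def by blast
qed

lemma tile_eq_iff:
 assumes r: "z \<in> region" "w \<in> region"
 shows "tile z = tile w \<longleftrightarrow> same_cell z w"
proof
 show "same_cell z w" if "tile z = tile w"
  by(rule tile_same_cell[OF tile_in(1)[OF r(1)] tile_in(2)[OF r(1)]]) (use tile_in(2)[OF r(2)] that in simp)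
 show "tile z = tile w" if "same_cell z w"
  by(rule tile_eq[OF tile_in(1)[OF r(2)] same_cell_tile[OF r(2,1)]]) (use that tile_in[OF r(2)] in simp_all)
qed

lemma region_moeb:
 assumes g: "g \<in> \<Gamma>" and z: "z \<in> region"
 shows "moeb g z \<in> region"
 using regionD(2)[OF z] moeb_G_half_plane[OF g] q_moeb[OF g] z by(simp add: half_plane_iff)

lemma tile_moeb:
 assumes g: "g \<in> \<Gamma>" and e: "e \<in> tiles q (q ` line u v)"
 shows "moeb g ` e \<in> tiles q (q ` line u v)"
proof -
 have gS: "g \<in> SL2" using G_SL2 g by blast
 have c: "connected (moeb h ` x)" if "h \<in> \<Gamma>" "x \<in> tiles q (q ` line u v)" for h x
 proof (rule connected_continuous_image)
  show "continuous_on x (moeb h)"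
   by(rule continuous_on_subset[OF continuous_on_moeb[OF G_SL2[OF that(1)]]]) (use tile_subset[OF that(2)] in blast)
  show "connected x" using that(2) unfolding tiles_def by(rule in_components_connected)
 qed
 have s: "moeb h ` x \<subseteq> region" if "h \<in> \<Gamma>" "x \<in> tiles q (q ` line u v)" for h x
  using region_moeb[OF that(1)] tile_subset[OF that(2)] by blast
 obtain z where z: "z \<in> e" using tile_nonempty[OF e] by blast
 hence zr: "z \<in> region" using tile_subset[OF e] by blast
 let ?f = "tile (moeb g z)"
 have f: "?f \<in> tiles q (q ` line u v)" "moeb g z \<in> ?f" using tile_in[OF region_moeb[OF g zr]] by auto
 have 1: "moeb g ` e \<subseteq> ?f"
  using components_maximal[OF f(1)[unfolded tiles_def] c[OF g e] s[OF g e]] f(2) z by blast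
 have ag: "adj g \<in> \<Gamma>" using g by simp
 have zz: "moeb (adj g) (moeb g z) = z" by(rule moeb_adj(1)[OF gS regionD(2)[OF zr]])
 hence "z \<in> moeb (adj g) ` ?f" using f(2) by(metis imageI)
 hence 2: "moeb (adj g) ` ?f \<subseteq> e"
  using components_maximal[OF e[unfolded tiles_def] c[OF ag f(1)] s[OF ag f(1)]] z by blast
 have "?f \<subseteq> moeb g ` e"
 proof
  fix x assume x: "x \<in> ?f"
  hence "moeb (adj g) x \<in> e" using 2 by blast
  moreover have "moeb g (moeb (adj g) x) = x"
   by(rule moeb_adj(2)[OF gS]) (use x tile_subset[OF f(1)] regionD(2) in blast)
  ultimately show "x \<in> moeb g ` e" by(metis imageI)
 qed
 thus ?thesis using 1 f(1) by(metis subset_antisym)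
qed

definition cut :: "complex => complex => (real^2^2) set" where
 "cut z w = {g \<in> \<Gamma>. sgn (sd g z) \<noteq> sgn (sd g w)}"

text \<open>The total translation met on the way from \<open>z\<close> to \<open>w\<close>. The
  factor 1/2 corrects the double count of each lift by \<open>g\<close> and
  \<open>- g\<close>.\<close>

definition strip :: "complex => complex => real^2^2" where
 "strip z w = (1/2) *\<^sub>R (\<Sum>g\<in>cut z w. jp g z w)"

lemma finite_cut:
 assumes "Im z > 0" "Im w > 0"
 shows "finite (cut z w)"
proof -
 let ?K = "closed_segment z w"
 have K: "?K \<subseteq> half_plane" using closed_segment_subset[OF _ _ convex_half_plane, of z w] assms by(simp add: half_plane_iff)
 have "cut z w \<subseteq> {g \<in> \<Gamma>. line (g *v u) (g *v v) \<inter> ?K \<noteq> {}}"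
 proof
  fix g assume g: "g \<in> cut z w"
  have "0 \<in> sd g ` ?K"
  proof (rule ccontr)
   assume "0 \<notin> sd g ` ?K"
   hence "sgn (sd g z) = sgn (sd g w)"
    by(rule sgn_connected[OF connected_segment(1) continuous_side]) auto
   thus False using g by(simp add: cut_def)
  qed
  then obtain x where "x \<in> ?K" "sd g x = 0" by force
  hence "x \<in> line (g *v u) (g *v v) \<inter> ?K" using K by(auto simp: line_def half_plane_iff)
  thus "g \<in> {g \<in> \<Gamma>. line (g *v u) (g *v v) \<inter> ?K \<noteq> {}}" using g by(auto simp: cut_def)
 qed
 thus ?thesis using loc_fin[OF compact_segment K] by(rule finite_subset)
qed

lemma strip_superset:
 assumes "finite F" "cut z w \<subseteq> F" "F \<subseteq> \<Gamma>"
 shows "strip z w = (1/2) *\<^sub>R (\<Sum>g\<in>F. jp g z w)"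
proof -
 have "(\<Sum>g\<in>cut z w. jp g z w) = (\<Sum>g\<in>F. jp g z w)"
  by(rule sum.mono_neutral_left[OF assms(1,2)]) (use assms(3) in \<open>auto simp: cut_def intro!: jump_same\<close>)
 thus ?thesis by(simp add: strip_def)
qed

lemma strip_add:
 assumes "Im x > 0" "Im y > 0" "Im z > 0"
 shows "strip x z = strip x y + strip y z"
proof -
 let ?F = "cut x y \<union> cut y z"
 have F: "finite ?F" "?F \<subseteq> \<Gamma>" using finite_cut assms by(auto simp: cut_def)
 have s: "cut x z \<subseteq> ?F" by(auto simp: cut_def)
 have "strip x z = (1/2) *\<^sub>R (\<Sum>g\<in>?F. jp g x y + jp g y z)"
  unfolding strip_superset[OF F(1) s F(2)] by(simp only: jump_add[of _ _ x z y])
 also have "\<dots> = strip x y + strip y z"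
  using strip_superset[OF F(1) Un_upper1 F(2)] strip_superset[OF F(1) Un_upper2 F(2)]
  by(simp add: sum.distrib scaleR_add_right)
 finally show ?thesis .
qed

lemma strip_same_cell: "same_cell z w ==> strip z w = 0"
proof -
 assume "same_cell z w"
 hence "cut z w = {}" by(auto simp: cut_def)
 thus ?thesis by(simp add: strip_def)
qed

lemma trace_strip [simp]: "trace (strip z w) = 0"
proof -
 have "trace (\<Sum>g\<in>F. f g) = 0" if "\<And>g. trace (f g) = 0" for F and f :: "real^2^2 => real^2^2"
  by(induction F rule: infinite_finite_induct) (simp_all add: trace_lin that)
 thus ?thesis by(simp add: strip_def trace_lin)
qed

text \<open>Stated for a permutation \<open>f\<close> of the lifts and a sign \<open>e\<close>: an
  element that reverses the lifts changes the sign of \<open>side\<close> and of \<open>tv\<close>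
  together, which leaves every jump equivariant.\<close>

lemma strip_equivariant:
 assumes h: "h \<in> SL2" and z: "Im z > 0" "Im w > 0" and bij: "bij_betw f \<Gamma> \<Gamma>"
  and side: "\<And>g x. g \<in> \<Gamma> ==> Im x > 0 ==> sgn (sd (f g) (moeb h x)) = e * sgn (sd g x)" and e: "e = 1 \<or> e = -1"
  and tv: "\<And>g. g \<in> \<Gamma> ==> tv (f g *v u) (f g *v v) = e *\<^sub>R Ad h (tv (g *v u) (g *v v))"
 shows "strip (moeb h z) (moeb h w) = Ad h (strip z w)"
proof -
 have j: "jp (f g) (moeb h z) (moeb h w) = Ad h (jp g z w)" if "g \<in> \<Gamma>" for g
  unfolding jump_def side[OF that z(1)] side[OF that z(2)] tv[OF that] Ad_lin(1)[OF h]
  using e by(elim disjE) (simp_all add: diff_divide_distrib scaleR_left_diff_distrib)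
 have c: "cut (moeb h z) (moeb h w) = f ` cut z w"
 proof
  have iff: "f g \<in> cut (moeb h z) (moeb h w) \<longleftrightarrow> g \<in> cut z w" if "g \<in> \<Gamma>" for g
   using that bij_betwE[OF bij] side[OF that z(1)] side[OF that z(2)] e by(auto simp: cut_def)
  show "f ` cut z w \<subseteq> cut (moeb h z) (moeb h w)" using iff by(auto simp: cut_def)
  show "cut (moeb h z) (moeb h w) \<subseteq> f ` cut z w"
  proof
   fix k assume k: "k \<in> cut (moeb h z) (moeb h w)"
   hence "k \<in> \<Gamma>" by(simp add: cut_def)
   then obtain g where g: "g \<in> \<Gamma>" "k = f g" using bij_betw_imp_surj_on[OF bij] by blast
   thus "k \<in> f ` cut z w" using iff k by blast
  qed
 qed
 have cG: "cut z w \<subseteq> \<Gamma>" by(auto simp: cut_def)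
 have inj: "inj_on f (cut z w)" using bij_betw_imp_inj_on[OF bij] cG by(rule inj_on_subset)
 have "(\<Sum>g\<in>cut (moeb h z) (moeb h w). jp g (moeb h z) (moeb h w)) = (\<Sum>g\<in>cut z w. Ad h (jp g z w))"
  unfolding c sum.reindex[OF inj] using j cG by(intro sum.cong) auto
 thus ?thesis unfolding strip_def Ad_lin(1)[OF h] Ad_sum[OF h] by simp
qed

lemma strip_even:
 assumes h: "h \<in> \<Gamma>" and z: "Im z > 0" "Im w > 0"
 shows "strip (moeb h z) (moeb h w) = Ad h (strip z w)"
proof (rule strip_equivariant[OF G_SL2[OF h] z, where f = "\<lambda>g. h ** g" and e = 1])
 have hS: "h \<in> SL2" using G_SL2 h by blast
 show "bij_betw (\<lambda>g. h ** g) \<Gamma> \<Gamma>"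
  by(rule bij_betw_byWitness[where f' = "\<lambda>g. adj h ** g"])
   (auto simp: adj_cancel_left[OF hS] h G_mult)
 show "sgn (sd (h ** g) (moeb h x)) = 1 * sgn (sd g x)" if "Im x > 0" for g x
  using sgn_side_moeb[OF hS that, of "g *v u" "g *v v"] by(simp only: mat_vec_assoc mult_1)
 show "tv ((h ** g) *v u) ((h ** g) *v v) = 1 *\<^sub>R Ad h (tv (g *v u) (g *v v))" for g
  using Ad_tv[OF hS, of "g *v u" "g *v v"] by(simp only: mat_vec_assoc scaleR_one)
qed simp

text \<open>For odd \<open>h\<close> the lifts are permuted by \<open>h ** g ** Jm u v\<close>,
  which reverses each of them, so the sign is -1. The symmetry of \<open>tv\<close> under exchange
  of the ends, that is, a waist fixed by the half turn, is what makes this work.\<close>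

lemma strip_ext:
 assumes J: "Jm u v \<in> \<Delta>" and h: "h \<in> \<Lambda>" and z: "Im z > 0" "Im w > 0"
 shows "strip (moeb h z) (moeb h w) = Ad h (strip z w)"
proof (cases "h \<in> \<Gamma>")
 case False
 hence hD: "h \<in> \<Delta>" using h by(simp add: ext_group_def)
 have hS: "h \<in> SL2" using ext_SL2 h by blast
 let ?J = "Jm u v"
 have JS: "?J \<in> SL2" by(rule Jm_SL2[OF dtn])
 have Jv: "?J *v u = v" "?J *v v = - u" using Jm_left[OF dtn] Jm_right[OF dtn] by auto
 have fu: "(h ** g ** ?J) *v u = h *v (g *v v)" "(h ** g ** ?J) *v v = - (h *v (g *v u))" for g
  unfolding mat_vec_assoc[symmetric] Jv by simp_all
 have hJ: "h ** g ** ?J \<in> \<Gamma>" if "g \<in> \<Gamma>" for g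
  using odd_odd[OF odd_even[OF hD that] J] .
 have hJ': "adj h ** g ** adj ?J \<in> \<Gamma>" if "g \<in> \<Gamma>" for g
  using odd_odd[OF odd_even[OF odd_adj[OF hD] that] odd_adj[OF J]] .
 show ?thesis
 proof (rule strip_equivariant[OF hS z, where f = "\<lambda>g. h ** g ** ?J" and e = "-1"])
  show "bij_betw (\<lambda>g. h ** g ** ?J) \<Gamma> \<Gamma>"
  proof (rule bij_betw_byWitness[where f' = "\<lambda>g. adj h ** g ** adj ?J"])
   have "adj h ** (h ** g ** ?J) ** adj ?J = (adj h ** h) ** g ** (?J ** adj ?J)"
    "h ** (adj h ** g ** adj ?J) ** ?J = (h ** adj h) ** g ** (adj ?J ** ?J)" for g
    by(simp_all only: matrix_mul_assoc)
   thus "\<forall>g\<in>\<Gamma>. adj h ** (h ** g ** ?J) ** adj ?J = g" "\<forall>g\<in>\<Gamma>. h ** (adj h ** g ** adj ?J) ** ?J = g"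
    by(simp_all add: adj_mult[OF hS] adj_mult[OF JS])
  qed (use hJ hJ' in blast)+
  show "sgn (sd (h ** g ** ?J) (moeb h x)) = -1 * sgn (sd g x)" if "Im x > 0" for g x
  proof -
   have "sd (h ** g ** ?J) (moeb h x) = - side (h *v (g *v u)) (h *v (g *v v)) (moeb h x)"
    unfolding fu side_uminus by(simp only: side_swap)
   thus ?thesis using sgn_side_moeb[OF hS that, of "g *v u" "g *v v"] by(simp add: sgn_minus)
  qed
  show "tv ((h ** g ** ?J) *v u) ((h ** g ** ?J) *v v) = -1 *\<^sub>R Ad h (tv (g *v u) (g *v v))" for g
   unfolding fu tv_uminus Ad_tv[OF hS] by(simp add: tv_sym[of "h *v (g *v u)"])
 qed simp
qed (rule strip_even[OF _ z])

lemma strip_cocycle_value: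
 assumes z0: "Im z0 > 0"
 shows "cocycle \<Gamma> (\<lambda>g. strip z0 (moeb g z0))"
 unfolding cocycle_def
proof (intro conjI ballI)
 fix M N assume M: "M \<in> \<Gamma>" and N: "N \<in> \<Gamma>"
 have I: "Im (moeb M z0) > 0" "Im (moeb N z0) > 0" "Im (moeb M (moeb N z0)) > 0"
  using moeb_G_half_plane M N z0 by auto
 have "strip z0 (moeb (M ** N) z0) = strip z0 (moeb M z0) + strip (moeb M z0) (moeb M (moeb N z0))"
  unfolding moeb_mult[OF G_SL2[OF M] G_SL2[OF N] z0] by(rule strip_add[OF z0 I(1,3)])
 thus "strip z0 (moeb (M ** N) z0) = strip z0 (moeb M z0) + Ad M (strip z0 (moeb N z0))"
  unfolding strip_even[OF M z0 I(2)] .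
qed simp

end

section \<open>Comparison with the definition of the strip map by tiles\<close>

context simple_geodesic
begin

lemma sd_uminus [simp]: "sd (- g) z = sd g z"
 by simp

text \<open>A compact piece of the geodesic is covered by finitely many lifts, so one of them
  contains infinitely many of its points, and two common points already force equality.\<close>

lemma lift_line:
 assumes N: "N \<in> SL2" and im: "q ` geod_line N = q ` line u v"
 obtains g where "g \<in> \<Gamma>" "geod_line N = line (g *v u) (g *v v)"
proof -
 let ?K = "geod N ` {0..1}"
 have cont: "continuous_on {0..1} (geod N)"
  using geod_deriv[OF N] by(intro continuous_at_imp_continuous_on ballI) (blast intro: has_vector_derivative_continuous)
 have I: "Im (geod N t) > 0" for t
  unfolding geod_def using moeb_half_plane[OF N] Im_iexp half_plane_iff by blast
 have K: "compact ?K" "?K \<subseteq> half_plane" using cont I by(auto intro: compact_continuous_image simp: half_plane_iff)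
 let ?F = "{g \<in> \<Gamma>. line (g *v u) (g *v v) \<inter> ?K \<noteq> {}}"
 let ?T = "\<lambda>g. {t \<in> {0..1}. geod N t \<in> line (g *v u) (g *v v)}"
 have fin: "finite ?F" by(rule loc_fin[OF K])
 have "{0..1} \<subseteq> (\<Union>g\<in>?F. ?T g)"
 proof
  fix t :: real assume t: "t \<in> {0..1}"
  have "q (geod N t) \<in> q ` line u v" unfolding im[symmetric] by(simp add: geod_line_def)
  then obtain g where "g \<in> \<Gamma>" "geod N t \<in> line (g *v u) (g *v v)" using q_line_iff[OF I] by blast
  thus "t \<in> (\<Union>g\<in>?F. ?T g)" using t by blast
 qed
 moreover have "infinite {0..1::real}" by simp
 ultimately have "infinite (\<Union>g\<in>?F. ?T g)" using finite_subset by blast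
 hence "\<exists>g\<in>?F. infinite (?T g)" using finite_UN_I[OF fin, of ?T] by blast
 then obtain g where g: "g \<in> \<Gamma>" "infinite (?T g)" by blast
 have "dt (g *v u) (g *v v) \<noteq> 0" using dt_G[OF g(1)] dtn by simp
 hence "geod_line N = line (g *v u) (g *v v)" by(rule line_inf_points[OF _ N g(2)]) simp
 thus thesis using that g(1) by blast
qed

lemma lift_frame:
 assumes g: "g \<in> \<Gamma>"
 obtains N where "N \<in> SL2" "g *v u = sqrt (dt u v) *\<^sub>R (N *v e1)" "g *v v = sqrt (dt u v) *\<^sub>R (N *v e2)"
  "geod_line N = line (g *v u) (g *v v)" "geod N 0 = mid (g *v u) (g *v v)"
  "\<And>z. Im z > 0 ==> sgn (sd g (moeb N z)) = - sgn (Re z)"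
proof -
 have d: "dt (g *v u) (g *v v) > 0" using dt_G[OF g] pos by simp
 obtain N where N: "N \<in> SL2" "g *v u = sqrt (dt u v) *\<^sub>R (N *v e1)" "g *v v = sqrt (dt u v) *\<^sub>R (N *v e2)"
  using frame[OF d] unfolding dt_G[OF g] by blast
 have s: "sqrt (dt u v) > 0" using pos by simp
 show thesis
 proof (rule that[OF N])
  show "geod_line N = line (g *v u) (g *v v)"
   unfolding geod_line_eq[OF N(1)] N(2,3) using s by(simp add: line_scale)
  have "is_mid (g *v u) (g *v v) (mid (g *v u) (g *v v))" using d by(intro is_mid_mid) simp
  hence "mid (g *v u) (g *v v) = moeb N \<i>" using is_mid_frame[OF N(1) _ N(2,3)] s by simp
  thus "geod N 0 = mid (g *v u) (g *v v)" by(simp add: geod_def)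
  fix z assume z: "Im z > 0"
  have "sd g (moeb N z) = dt u v * side (N *v e1) (N *v e2) (moeb N z)"
   unfolding N(2,3) side_scale using pos by simp
  hence "sgn (sd g (moeb N z)) = sgn (side (N *v e1) (N *v e2) (moeb N z))"
   using pos by(simp add: sgn_mult)
  thus "sgn (sd g (moeb N z)) = - sgn (Re z)"
   unfolding sgn_side_moeb[OF N(1) z] side_e by(simp add: sgn_minus)
 qed
qed

lemma mid_G: "g \<in> \<Gamma> ==> mid (g *v u) (g *v v) = moeb g (mid u v)" "Im (mid u v) > 0"
 using mid_moeb[OF dtn G_SL2] mid_line[OF dtn] by(auto simp: line_def)

lemma cut_single:
 assumes g: "g \<in> \<Gamma>" and c: "cut z w = {g, - g}"
 shows "strip z w = jp g z w"
proof -
 have "g \<noteq> - g"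
 proof
  assume "g = - g"
  hence "g$1$1 = 0 \<and> g$1$2 = 0" unfolding mat_eq2 by simp
  thus False using G_SL2[OF g] by(simp add: SL2_iff)
 qed
 thus ?thesis unfolding strip_def c by(simp flip: scaleR_2)
qed

text \<open>The separating line is the lift of some \<open>g\<close>, the point over the waist is
  its midpoint, and the perpendicular is the frame of \<open>g\<close> turned by \<open>R\<close>.
  Near the midpoint no other lift separates the tiles, so the sum in \<open>strip\<close> reduces to
  the term of \<open>g\<close>.\<close>

lemma strip_jump_value:
 assumes sj: "strip_jump q (q ` line u v) (q (mid u v)) e e' M" and z: "z \<in> e" and w: "w \<in> e'"
 shows "strip z w = unit_translation M"
proof -
 from sj obtain N s where e: "e \<in> tiles q (q ` line u v)" "e' \<in> tiles q (q ` line u v)" "e \<noteq> e'" and M: "M \<in> SL2"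
  and N: "N \<in> SL2" "q ` geod_line N = q ` line u v" "geod_line N \<subseteq> closure e \<inter> closure e'"
   "geod M 0 = geod N s" "q (geod M 0) = q (mid u v)"
   "orthogonal (vector_derivative (geod M) (at 0)) (vector_derivative (geod N) (at s))"
   "\<forall>\<^sub>F t in at_right 0. geod M t \<in> e'"
  unfolding strip_jump_def by blast
 obtain g where g: "g \<in> \<Gamma>" "geod_line N = line (g *v u) (g *v v)" by(rule lift_line[OF N(1,2)])
 obtain N0 where N0: "N0 \<in> SL2" "g *v u = sqrt (dt u v) *\<^sub>R (N0 *v e1)" "g *v v = sqrt (dt u v) *\<^sub>R (N0 *v e2)"
  "geod_line N0 = line (g *v u) (g *v v)" "geod N0 0 = mid (g *v u) (g *v v)"
  by(rule lift_frame[OF g(1)]) blast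
 let ?m = "geod M 0"
 have mI: "Im ?m > 0" unfolding geod_def using moeb_half_plane[OF M] Im_iexp half_plane_iff by blast
 have mN: "?m \<in> geod_line N" unfolding N(4) geod_line_def by simp
 hence mg: "sd g ?m = 0" unfolding g(2) by(simp add: line_def)
 obtain h where h: "h \<in> \<Gamma>" "?m = moeb h (mid u v)"
  using q_eq_iff[OF mid_G(2) mI, THEN iffD1, OF N(5)[symmetric]] by blast
 have "?m \<in> line (h *v u) (h *v v)"
  unfolding h(2) line_moeb[OF G_SL2[OF h(1)], symmetric] using mid_line[OF dtn] by(rule imageI)
 \<comment> \<open>A point over the waist is the midpoint of some lift \<open>h\<close>; as it lies
   on the lift of \<open>g\<close> and lifts are disjoint, it is the midpoint of that one.\<close>
 hence "h = g \<or> h = - g" using sd_unique[OF g(1) h(1) mI mg] by(simp add: line_def)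
 hence m0: "?m = geod N0 0" unfolding N0(5) mid_G(1)[OF g(1)] h(2) by auto
 define R where "R = adj N0 ** M"
 have R: "R \<in> SL2" using N0(1) M by(simp add: R_def)
 have MR: "M = N0 ** R" unfolding R_def by(simp only: adj_cancel_left[OF N0(1)])
 have Ri: "moeb R \<i> = \<i>"
 proof -
  have "moeb M \<i> = moeb N0 \<i>" using m0 by(simp add: geod_def)
  hence "moeb R \<i> = moeb (adj N0) (moeb N0 \<i>)" using moeb_mult[of "adj N0" M \<i>] N0(1) M by(simp add: R_def)
  thus ?thesis using moeb_adj(1)[OF N0(1)] by simp
 qed
 obtain c :: real where c: "c \<noteq> 0" "vector_derivative (geod N) (at s) = of_real c * vector_derivative (geod N0) (at 0)"
 proof (rule geod_reparam[OF N(1) N0(1)])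
  show "geod_line N = geod_line N0" unfolding g(2) N0(4) ..
  show "geod N s = geod N0 0" unfolding m0[symmetric] N(4) ..
 qed
 have "orthogonal (vector_derivative (geod M) (at 0)) (vector_derivative (geod N0) (at 0))"
  using N(6) c(1) unfolding c(2) scaleR_conv_of_real[symmetric] orthogonal_def by simp
 hence sq: "(R$2$1)\<^sup>2 = (R$2$2)\<^sup>2" unfolding MR orthogonal_rotation[OF R N0(1) Ri] .
 have d: "dt (g *v u) (g *v v) > 0" "dt (g *v u) (g *v v) = dt u v" using dt_G[OF g(1)] pos by auto
 note p = perpendicular_geod[OF d(1) N0(1) N0(2,3)[folded d(2)] R Ri sq MR]
 define eps where "eps = 2 * (R$2$1 * R$2$2)"
 have eps: "eps = 1 \<or> eps = -1" using p(1) by(auto simp: eps_def)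
 have ut: "unit_translation M = eps *\<^sub>R tv (g *v u) (g *v v)" using p(2) by(simp add: eps_def)
 have se: "sgn (sd g (geod M t)) = - eps" if "t > 0" for t using p(3)[OF that] by(simp add: eps_def)
 have "eventually (\<lambda>t. geod M t \<in> e' \<and> 0 < t) (at_right 0)"
  using N(7) eventually_at_right_less[of "0::real"] by(rule eventually_conj)
 then obtain t where t: "geod M t \<in> e'" "t > 0" using eventually_happens'[OF trivial_limit_at_right_real] by blast
 have wg: "sgn (sd g w) = - eps" using tile_same_cell[OF e(2) w t(1)] g(1) se[OF t(2)] by simp
 obtain dd where dd: "dd > 0" "\<And>g x. g \<in> \<Gamma> ==> sd g ?m \<noteq> 0 ==> x \<in> ball ?m dd ==> sgn (sd g x) = sgn (sd g ?m)"
  by(rule cell_near[OF mI]) blast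
 obtain z1 where z1: "z1 \<in> e" "dist z1 ?m < dd" using N(3) mN dd(1) closure_approachable by blast
 obtain w1 where w1: "w1 \<in> e'" "dist w1 ?m < dd" using N(3) mN dd(1) closure_approachable by blast
 have other: "sgn (sd h z) = sgn (sd h w)" if "h \<in> \<Gamma>" "h \<noteq> g" "h \<noteq> - g" for h
 proof -
  have n: "sd h ?m \<noteq> 0" using sd_unique[OF g(1) that(1) mI mg] that by blast
  have "sgn (sd h z1) = sgn (sd h w1)"
   using dd(2)[OF that(1) n, of z1] dd(2)[OF that(1) n, of w1] z1 w1 by(simp add: dist_commute)
  thus ?thesis using tile_same_cell[OF e(1) z z1(1)] tile_same_cell[OF e(2) w w1(1)] that(1) by simp
 qed
 have zr: "z \<in> region" "w \<in> region" using tile_subset e z w by blast+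
 have ne: "sgn (sd g z) \<noteq> sgn (sd g w)"
 proof
  assume a: "sgn (sd g z) = sgn (sd g w)"
  have "same_cell z w"
  proof
   fix h assume "h \<in> \<Gamma>"
   thus "sgn (sd h z) = sgn (sd h w)" using a other[of h] by(cases "h = g \<or> h = - g") auto
  qed
  hence "w \<in> e" by(rule same_cell_tile[OF zr _ e(1) z])
  thus False using tile_eq[OF e(1)] tile_eq[OF e(2) w] e(3) by blast
 qed
 have "cut z w = {g, - g}" using ne other g(1) by(auto simp: cut_def)
 hence s: "strip z w = jp g z w" by(rule cut_single[OF g(1)])
 have "sgn (sd g z) = 1 \<or> sgn (sd g z) = -1" using regionD(1)[OF zr(1) g(1)] by(auto simp: sgn_if)
 hence zg: "sgn (sd g z) = eps" using ne wg eps by auto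
 show ?thesis unfolding s ut jump_def zg wg by simp
qed

lemma strip_cocycle_strip:
 assumes z0: "Im z0 > 0"
 shows "strip_cocycle \<Gamma> q (q ` line u v) (q (mid u v)) (\<lambda>g. strip z0 (moeb g z0))"
 unfolding strip_cocycle_def
\<comment> \<open>The field on a tile is the strip from the base point to an arbitrary point of the
  tile; it does not depend on this point because \<open>strip\<close> vanishes inside a
  cell.\<close>
proof (intro exI[of _ "\<lambda>e. strip z0 (SOME z. z \<in> e)"] conjI allI ballI impI)
 fix e e' M assume sj: "strip_jump q (q ` line u v) (q (mid u v)) e e' M"
 hence e: "e \<in> tiles q (q ` line u v)" "e' \<in> tiles q (q ` line u v)" by(auto simp: strip_jump_def)
 let ?z = "SOME z. z \<in> e" and ?w = "SOME z. z \<in> e'"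
 have z: "?z \<in> e" "?w \<in> e'"
  using someI_ex[OF tile_nonempty[OF e(1)]] someI_ex[OF tile_nonempty[OF e(2)]] .
 have I: "Im ?z > 0" "Im ?w > 0" using tile_subset e z regionD(2) by blast+
 show "strip z0 ?w - strip z0 ?z = unit_translation M"
  using strip_add[OF z0 I] strip_jump_value[OF sj z] by simp
next
 fix M e assume M: "M \<in> \<Gamma>" and e: "e \<in> tiles q (q ` line u v)"
 let ?z = "SOME z. z \<in> e" and ?x = "SOME z. z \<in> moeb M ` e"
 have z: "?z \<in> e" by(rule someI_ex[OF tile_nonempty[OF e]])
 have x2: "moeb M ?z \<in> moeb M ` e" using z by(rule imageI)
 have x1: "?x \<in> moeb M ` e" using x2 by(rule someI)
 note x = x1 x2
 note eM = tile_moeb[OF M e]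
 have I: "Im ?z > 0" "Im ?x > 0" "Im (moeb M ?z) > 0" "Im (moeb M z0) > 0"
  using tile_subset[OF e] tile_subset[OF eM] z x regionD(2) moeb_G_half_plane[OF M z0] by blast+
 have "strip (moeb M ?z) ?x = 0" by(rule strip_same_cell[OF tile_same_cell[OF eM x(2,1)]])
 thus "strip z0 ?x = Ad M (strip z0 ?z) + strip z0 (moeb M z0)"
  using strip_add[OF z0 I(4,2)] strip_add[OF I(4,3,2)] strip_even[OF M z0 I(1)] by simp
qed simp

text \<open>Other lifts do not meet the lift of \<open>g\<close>, so their signs are constant along
  it. Hence a point close to \<open>m'\<close> on the side of \<open>x\<close> has the sign vector
  of \<open>x\<close>.\<close>

lemma cell_point:
 assumes g: "g \<in> \<Gamma>" and m: "m \<in> line (g *v u) (g *v v)" and m': "m' \<in> line (g *v u) (g *v v)" and x: "x \<in> region"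
  and nx: "\<And>h. h \<in> \<Gamma> ==> sd h m \<noteq> 0 ==> sgn (sd h x) = sgn (sd h m)"
  and p: "Im p > 0" "\<And>h. h \<in> \<Gamma> ==> sd h m' \<noteq> 0 ==> sgn (sd h p) = sgn (sd h m')" "sgn (sd g p) = sgn (sd g x)"
 shows "p \<in> tile x"
proof -
 have c: "same_cell x p"
 proof
  fix h assume h: "h \<in> \<Gamma>"
  show "sgn (sd h x) = sgn (sd h p)"
  proof (cases "h = g \<or> h = - g")
   case False
   have n: "sd h y \<noteq> 0" if "y \<in> line (g *v u) (g *v v)" for y
    using sd_unique[OF g h, of y] that False by(auto simp: line_def)
   have "sgn (sd h m) = sgn (sd h m')"
   proof (rule sgn_connected[OF line_connected continuous_side _ m m'])
    show "dt (g *v u) (g *v v) \<noteq> 0" using dt_G[OF g] dtn by simp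
    show "0 \<notin> sd h ` line (g *v u) (g *v v)" using n by force
   qed
   thus ?thesis using nx[OF h n[OF m]] p(2)[OF h n[OF m']] by simp
  qed (use p(3) in auto)
 qed
 have "sd h p \<noteq> 0" if "h \<in> \<Gamma>" for h
  using c that regionD(1)[OF x that] by(metis sgn_zero_iff)
 hence "p \<in> region" using region_iff[OF p(1)] by blast
 thus ?thesis using same_cell_tile[OF x _ c] tile_in[OF x] by blast
qed

lemma side_point:
 assumes g: "g \<in> \<Gamma>" and m: "m \<in> line (g *v u) (g *v v)" and d: "d > 0" and e: "e = 1 \<or> e = (-1::real)"
 obtains p where "p \<in> ball m d" "Im p > 0" "sgn (sd g p) = e"
proof -
 obtain N where N: "N \<in> SL2" "geod_line N = line (g *v u) (g *v v)"
  "\<And>z. Im z > 0 ==> sgn (sd g (moeb N z)) = - sgn (Re z)"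
  by(rule lift_frame[OF g]) blast
 obtain t where t: "m = geod N t" using m N(2) unfolding geod_line_def by blast
 let ?y = "\<i> * complex_of_real (exp t)"
 have I: "?y \<in> half_plane" by(simp add: half_plane_iff)
 have "continuous (at ?y) (moeb N)"
  using continuous_on_moeb[OF N(1)] open_half_plane I by(simp add: continuous_on_eq_continuous_at)
 then obtain r where r: "r > 0" "\<And>x. dist x ?y < r ==> dist (moeb N x) (moeb N ?y) < d"
  unfolding continuous_at_eps_delta using d by blast
 let ?x = "?y - of_real (e * r / 2)"
 have "dist ?x ?y = \<bar>e * r / 2\<bar>" by(simp add: dist_norm norm_mult abs_mult)
 also have "\<dots> < r" using e r(1) by auto
 finally have x: "dist (moeb N ?x) m < d" using r(2) unfolding t geod_def by blast
 have Ix: "Im ?x > 0" by simp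
 show thesis
 proof (rule that)
  show "moeb N ?x \<in> ball m d" using x by(simp add: dist_commute)
  show "Im (moeb N ?x) > 0" using moeb_half_plane[OF N(1)] Ix half_plane_iff by blast
  have "- sgn (Re ?x) = e" using e r(1) by(auto simp: sgn_if)
  thus "sgn (sd g (moeb N ?x)) = e" using N(3)[OF Ix] by simp
 qed
qed

text \<open>Conversely to \<open>strip_jump_value\<close>, two cells that touch at a point of a lift
  are adjacent along that whole lift, and a perpendicular at its waist exists. This gives enough
  jumps for the uniqueness argument.\<close>

lemma adjacent_jump:
 assumes g: "g \<in> \<Gamma>" and m: "m \<in> line (g *v u) (g *v v)" and x: "x \<in> region" and y: "y \<in> region"
  and nx: "\<And>h. h \<in> \<Gamma> ==> sd h m \<noteq> 0 ==> sgn (sd h x) = sgn (sd h m)"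
  and ny: "\<And>h. h \<in> \<Gamma> ==> sd h m \<noteq> 0 ==> sgn (sd h y) = sgn (sd h m)"
  and s: "sgn (sd g x) = 1" "sgn (sd g y) = - 1"
 shows "\<exists>M. strip_jump q (q ` line u v) (q (mid u v)) (tile x) (tile y) M"
proof -
 obtain N where N: "N \<in> SL2" "g *v u = sqrt (dt u v) *\<^sub>R (N *v e1)" "g *v v = sqrt (dt u v) *\<^sub>R (N *v e2)"
  "geod_line N = line (g *v u) (g *v v)" "geod N 0 = mid (g *v u) (g *v v)"
  by(rule lift_frame[OF g]) blast
 \<comment> \<open>With this value \<open>R\<close> is the rotation whose entries satisfy
   \<open>R$2$1 * R$2$2 = 1/2\<close>, the sign for which the perpendicular enters the negative
   side, where \<open>y\<close> lies.\<close>
 define c where "c = 1 / sqrt 2"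
 have c: "c * c = 1/2" by(simp add: c_def)
 define R where "R = mat2 c (- c) c c"
 define M where "M = N ** R"
 have R: "R \<in> SL2" by(simp add: R_def SL2_iff c)
 have Ri: "moeb R \<i> = \<i>"
 proof -
  have "moeb R \<i> = (of_real c * (\<i> - 1)) / (of_real c * (\<i> + 1))" by(simp add: moeb_def R_def algebra_simps)
  also have "\<dots> = (\<i> - 1) / (\<i> + 1)" by(rule mult_divide_mult_cancel_left) (use c in auto)
  also have "\<dots> = \<i>"
  proof -
   have "\<i> + 1 \<noteq> (0::complex)" by(simp add: complex_eq_iff)
   thus ?thesis by(simp add: divide_eq_eq algebra_simps)
  qed
  finally show ?thesis .
 qed
 have R2: "R$2$1 * R$2$2 = 1/2" "(R$2$1)\<^sup>2 = (R$2$2)\<^sup>2" using c by(simp_all add: R_def)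
 have M: "M \<in> SL2" using N(1) R by(simp add: M_def)
 have d: "dt (g *v u) (g *v v) > 0" "dt (g *v u) (g *v v) = dt u v" using dt_G[OF g] pos by auto
 note p = perpendicular_geod[OF d(1) N(1) N(2,3)[folded d(2)] R Ri R2(2) M_def]
 have m0: "geod M 0 = mid (g *v u) (g *v v)"
  using N(5) moeb_mult[OF N(1) R, of \<i>] Ri by(simp add: geod_def M_def)
 let ?m = "geod M 0"
 have mI: "Im ?m > 0" unfolding geod_def using moeb_half_plane[OF M] Im_iexp half_plane_iff by blast
 have mL: "?m \<in> line (g *v u) (g *v v)" unfolding m0 by(rule mid_line) (use d in simp)
 have cl: "line (g *v u) (g *v v) \<subseteq> closure (tile z)" if z: "z \<in> region"
  and nz: "\<And>h. h \<in> \<Gamma> ==> sd h m \<noteq> 0 ==> sgn (sd h z) = sgn (sd h m)"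
  and sz: "sgn (sd g z) = 1 \<or> sgn (sd g z) = - 1" for z
 proof
  fix m' assume m': "m' \<in> line (g *v u) (g *v v)"
  hence I': "Im m' > 0" by(simp add: line_def)
  obtain r where r: "r > 0" "\<And>h x. h \<in> \<Gamma> ==> sd h m' \<noteq> 0 ==> x \<in> ball m' r ==> sgn (sd h x) = sgn (sd h m')"
   by(rule cell_near[OF I']) blast
  show "m' \<in> closure (tile z)" unfolding closure_approachable
  proof (intro allI impI)
   fix e :: real assume e: "e > 0"
   obtain p where p: "p \<in> ball m' (min r e)" "Im p > 0" "sgn (sd g p) = sgn (sd g z)"
    by(rule side_point[OF g m' _ sz, of "min r e"]) (use r e in auto)
   have "p \<in> tile z" by(rule cell_point[OF g m m' z nz p(2) r(2) p(3)]) (use p(1) in auto)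
   thus "\<exists>y\<in>tile z. dist y m' < e" using p(1) by(auto simp: dist_commute)
  qed
 qed
 have "strip_jump q (q ` line u v) (q (mid u v)) (tile x) (tile y) M"
  unfolding strip_jump_def
 proof (intro conjI tile_in x y M bexI[OF _ N(1)] exI[of _ 0])
  have "\<not> same_cell x y" using s g by force
  thus "tile x \<noteq> tile y" using tile_eq_iff[OF x y] by blast
  show "q ` geod_line N = q ` line u v" unfolding N(4) by(rule line_G_image[OF g])
  show "geod_line N \<subseteq> closure (tile x) \<inter> closure (tile y)"
   unfolding N(4) using cl[OF x nx] cl[OF y ny] s by simp
  show "geod M 0 = geod N 0" unfolding m0 N(5) ..
  show "q (geod M 0) = q (mid u v)" unfolding m0 mid_G(1)[OF g] by(rule q_moeb[OF g mid_G(2)])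
  show "orthogonal (vector_derivative (geod M) (at 0)) (vector_derivative (geod N) (at 0))"
   unfolding M_def using orthogonal_rotation[OF R N(1) Ri] R2(2) by blast
  obtain r where r: "r > 0" "\<And>h x. h \<in> \<Gamma> ==> sd h ?m \<noteq> 0 ==> x \<in> ball ?m r ==> sgn (sd h x) = sgn (sd h ?m)"
   by(rule cell_near[OF mI]) blast
  have "isCont (geod M) 0" using geod_deriv[OF M] has_vector_derivative_continuous by blast
  hence "(geod M \<longlongrightarrow> ?m) (at_right 0)" unfolding isCont_def by(rule tendsto_mono[OF at_le, rotated]) simp
  hence "eventually (\<lambda>t. dist (geod M t) ?m < r) (at_right 0)" using r(1) by(rule tendstoD)
  thus "\<forall>\<^sub>F t in at_right 0. geod M t \<in> tile y"
   using eventually_at_right_less[of "0::real"]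
  proof eventually_elim
   case (elim t)
   have "Im (geod M t) > 0" unfolding geod_def using moeb_half_plane[OF M] Im_iexp half_plane_iff by blast
   moreover have "sgn (sd g (geod M t)) = sgn (sd g y)" using p(3)[OF elim(2)] R2(1) s(2) by simp
   ultimately show ?case
    by(intro cell_point[OF g m mL y ny _ r(2)]) (use elim(1) in \<open>auto simp: dist_commute\<close>)
  qed
 qed
 thus ?thesis by blast
qed

lemma locally_constant_on_tiles:
 assumes D: "\<And>e e' M. strip_jump q (q ` line u v) (q (mid u v)) e e' M ==> D e = D e'"
  and m: "Im m > 0"
 shows "\<exists>T. openin (top_of_set half_plane) T \<and> m \<in> T \<and> (\<forall>x\<in>T. \<forall>y\<in>T. x \<in> region \<and> y \<in> region --> D (tile x) = D (tile y))"
proof -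
 obtain r where r: "r > 0" "ball m r \<subseteq> half_plane"
  "\<And>h x. h \<in> \<Gamma> ==> sd h m \<noteq> 0 ==> x \<in> ball m r ==> sgn (sd h x) = sgn (sd h m)"
  by(rule cell_near[OF m]) blast
 have const: "D (tile x) = D (tile y)" if x: "x \<in> ball m r" "x \<in> region" and y: "y \<in> ball m r" "y \<in> region" for x y
 proof (cases "same_cell x y")
  case True
  thus ?thesis using tile_eq_iff[OF x(2) y(2)] by simp
 next
  case False
  then obtain g where g: "g \<in> \<Gamma>" "sgn (sd g x) \<noteq> sgn (sd g y)" by blast
  have "sd g m = 0"
  proof (rule ccontr)
   assume n: "sd g m \<noteq> 0"
   show False using g(2) r(3)[OF g(1) n x(1)] r(3)[OF g(1) n y(1)] by simp
  qed
  hence mg: "m \<in> line (g *v u) (g *v v)" using m by(simp add: line_def)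
  have nx: "sgn (sd h x) = sgn (sd h m)" and ny: "sgn (sd h y) = sgn (sd h m)" if "h \<in> \<Gamma>" "sd h m \<noteq> 0" for h
   using r(3)[OF that x(1)] r(3)[OF that y(1)] .
  have s: "sgn (sd g x) = 1 \<or> sgn (sd g x) = -1" "sgn (sd g y) = 1 \<or> sgn (sd g y) = -1"
   using regionD(1)[OF x(2) g(1)] regionD(1)[OF y(2) g(1)] by(auto simp: sgn_if)
  have "sgn (sd g x) = 1 \<and> sgn (sd g y) = -1 \<or> sgn (sd g y) = 1 \<and> sgn (sd g x) = -1"
   using s g(2) by(elim disjE) simp_all
  then consider "sgn (sd g x) = 1" "sgn (sd g y) = -1" | "sgn (sd g y) = 1" "sgn (sd g x) = -1" by(elim disjE conjE)
  thus ?thesis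
  proof cases
   case 1
   then obtain M where "strip_jump q (q ` line u v) (q (mid u v)) (tile x) (tile y) M"
    using adjacent_jump[OF g(1) mg x(2) y(2) nx ny 1] by blast
   thus ?thesis by(rule D)
  next
   case 2
   then obtain M where "strip_jump q (q ` line u v) (q (mid u v)) (tile y) (tile x) M"
    using adjacent_jump[OF g(1) mg y(2) x(2) ny nx 2] by blast
   thus ?thesis by(rule D[symmetric])
  qed
 qed
 show ?thesis
 proof (intro exI[of _ "ball m r"] conjI ballI impI; (elim conjE)?)
  show "openin (top_of_set half_plane) (ball m r)"
  using r(2) by(simp add: openin_open_eq[OF open_half_plane])
  show "m \<in> ball m r" using r(1) by simp
 qed (rule const)
qed

lemma region_dense:
 assumes "open T" "m \<in> T" "Im m > 0"
 shows "\<exists>z. z \<in> T \<and> z \<in> region"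
proof (cases "m \<in> region")
 case False
 then obtain g where g: "g \<in> \<Gamma>" "sd g m = 0" using region_iff[OF assms(3)] by blast
 hence mg: "m \<in> line (g *v u) (g *v v)" using assms(3) by(simp add: line_def)
 obtain r where r: "r > 0" "\<And>h x. h \<in> \<Gamma> ==> sd h m \<noteq> 0 ==> x \<in> ball m r ==> sgn (sd h x) = sgn (sd h m)"
  by(rule cell_near[OF assms(3)]) blast
 obtain e where e: "e > 0" "ball m e \<subseteq> T" using assms(1,2) open_contains_ball by blast
 obtain p where p: "p \<in> ball m (min r e)" "Im p > 0" "sgn (sd g p) = 1"
  by(rule side_point[OF g(1) mg, of "min r e" 1]) (use r e in auto)
 have "sd h p \<noteq> 0" if h: "h \<in> \<Gamma>" for h
 proof (cases "sd h m = 0")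
  case True
  hence "h = g \<or> h = - g" using sd_unique[OF g(1) h assms(3) g(2)] by blast
  hence "sgn (sd h p) = 1" using p(3) by auto
  thus ?thesis by auto
 next
  case False
  hence "sgn (sd h p) = sgn (sd h m)" using r(2)[OF h] p(1) by simp
  thus ?thesis using False by(metis sgn_zero_iff)
 qed
 hence "p \<in> region" using region_iff[OF p(2)] by blast
 thus ?thesis using p(1) e(2) by auto
qed (use assms in blast)

text \<open>Instead of chaining jumps between two tiles, the connectedness of the half-plane is
  used: the function is locally constant on the dense region, also across each lift.\<close>

lemma constant_on_tiles:
 assumes D: "\<And>e e' M. strip_jump q (q ` line u v) (q (mid u v)) e e' M ==> D e = D e'"
  and e: "e \<in> tiles q (q ` line u v)" "e' \<in> tiles q (q ` line u v)"
 shows "D e = D e'"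
proof -
 obtain x y where xy: "x \<in> e" "y \<in> e'" using tile_nonempty e by blast
 hence r: "x \<in> region" "y \<in> region" using tile_subset e by blast+
 have "D (tile x) = D (tile y)"
 proof (rule connected_equivalence_relation_gen[where S = half_plane and P = "\<lambda>z. z \<in> region" and R = "\<lambda>x y. D (tile x) = D (tile y)"])
  show "connected half_plane" by(rule convex_connected[OF convex_half_plane])
  show "x \<in> half_plane" "y \<in> half_plane" "x \<in> region" "y \<in> region" using r by auto
  show "\<exists>z. z \<in> T \<and> z \<in> region" if "openin (top_of_set half_plane) T" "a \<in> T" for T a
  proof (rule region_dense)
   show "open T" using that(1) by(simp add: openin_open_eq[OF open_half_plane])
   show "a \<in> T" by(rule that(2))
   show "Im a > 0" using that openin_imp_subset half_plane_iff by blast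
  qed
  show "\<exists>T. openin (top_of_set half_plane) T \<and> a \<in> T \<and>
    (\<forall>x\<in>T. \<forall>y\<in>T. x \<in> region \<and> y \<in> region --> D (tile x) = D (tile y))" if "a \<in> half_plane" for a
   using locally_constant_on_tiles[OF D] that by(simp add: half_plane_iff)
 qed simp
 thus ?thesis using tile_eq[OF e(1) xy(1)] tile_eq[OF e(2) xy(2)] by simp
qed

lemma region_nonempty: "\<exists>e. e \<in> tiles q (q ` line u v)"
proof -
 have "\<i> \<in> half_plane" by(simp add: half_plane_iff)
 then obtain z where "z \<in> region" using region_dense[of half_plane \<i>] open_half_plane by auto
 thus ?thesis using tile_in(1) by blast
qed

text \<open>Two admissible fields have the same jumps, so their difference is one matrix
  \<open>X\<close> on all tiles, and the two cocycles differ by its coboundary.\<close>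

lemma strip_cocycle_unique:
 assumes u': "strip_cocycle \<Gamma> q (q ` line u v) (q (mid u v)) f" and z0: "Im z0 > 0"
 shows "H1_eq \<Gamma> f (\<lambda>g. strip z0 (moeb g z0))"
proof -
 let ?G = "q ` line u v" and ?f = "\<lambda>g. strip z0 (moeb g z0)"
 obtain \<psi> where a: "\<And>e. e \<in> tiles q ?G ==> trace (\<psi> e) = 0"
  "\<And>e e' M. strip_jump q ?G (q (mid u v)) e e' M ==> \<psi> e' - \<psi> e = unit_translation M"
  "\<And>M e. M \<in> \<Gamma> ==> e \<in> tiles q ?G ==> \<psi> (moeb M ` e) = Ad M (\<psi> e) + f M"
  using u' unfolding strip_cocycle_def by blast
 obtain \<phi> where b: "\<And>e. e \<in> tiles q ?G ==> trace (\<phi> e) = 0"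
  "\<And>e e' M. strip_jump q ?G (q (mid u v)) e e' M ==> \<phi> e' - \<phi> e = unit_translation M"
  "\<And>M e. M \<in> \<Gamma> ==> e \<in> tiles q ?G ==> \<phi> (moeb M ` e) = Ad M (\<phi> e) + ?f M"
  using strip_cocycle_strip[OF z0] unfolding strip_cocycle_def by blast
 obtain e where e: "e \<in> tiles q ?G" using region_nonempty by blast
 define X where "X = \<psi> e - \<phi> e"
 have D: "\<psi> e' - \<phi> e' = X" if "e' \<in> tiles q ?G" for e'
  unfolding X_def
 proof (rule constant_on_tiles[where D = "\<lambda>e. \<psi> e - \<phi> e", OF _ that e])
  fix e e' M assume sj: "strip_jump q ?G (q (mid u v)) e e' M"
  have "\<psi> e' - \<psi> e = \<phi> e' - \<phi> e" using a(2)[OF sj] b(2)[OF sj] by simp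
  thus "\<psi> e - \<phi> e = \<psi> e' - \<phi> e'" by(simp add: algebra_simps)
 qed
 have "f M - ?f M = X - Ad M X" if M: "M \<in> \<Gamma>" for M
 proof -
  have e1: "Ad M X = Ad M (\<psi> e) - Ad M (\<phi> e)" unfolding X_def by(rule Ad_lin(3)[OF G_SL2[OF M]])
  have e2: "X = (Ad M (\<psi> e) + f M) - (Ad M (\<phi> e) + ?f M)"
   unfolding a(3)[OF M e, symmetric] b(3)[OF M e, symmetric] by(rule D[OF tile_moeb[OF M e], symmetric])
  have "X - Ad M X = ((Ad M (\<psi> e) + f M) - (Ad M (\<phi> e) + ?f M)) - (Ad M (\<psi> e) - Ad M (\<phi> e))"
   by(simp only: e1 e2[symmetric])
  also have "\<dots> = f M - ?f M" by(simp add: algebra_simps)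
  finally show ?thesis by simp
 qed
 moreover have "trace X = 0" unfolding X_def using a(1)[OF e] b(1)[OF e] by(simp add: trace_lin)
 ultimately show ?thesis unfolding H1_eq_def coboundary_def by blast
qed

lemma strip_map_strip:
 assumes G: "geodesic_of q \<alpha> = q ` line u v" "p \<alpha> = q (mid u v)" and z0: "Im z0 > 0"
 shows "H1_eq \<Gamma> (strip_map \<Gamma> q p \<alpha>) (\<lambda>g. strip z0 (moeb g z0))"
proof (rule strip_cocycle_unique[OF _ z0])
 show "strip_cocycle \<Gamma> q (q ` line u v) (q (mid u v)) (strip_map \<Gamma> q p \<alpha>)"
  unfolding strip_map_def G
  by(rule someI[where P = "strip_cocycle \<Gamma> q (q ` line u v) (q (mid u v))", OF strip_cocycle_strip[OF z0]])
qed

end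

context cusped_torus
begin

section \<open>The four arcs of a flip\<close>

text \<open>A matrix with square minus the identity has no real eigenvector, so \<open>v\<close> and
  \<open>J *v v\<close> form a basis and determine it.\<close>

lemma involution_Jm:
 assumes J: "J ** J = - mat 1" and v: "v \<noteq> 0"
 shows "dt v (J *v v) \<noteq> 0" "Jm v (J *v v) = J"
proof -
 have JJ: "J *v (J *v w) = - w" for w by(simp add: mat_vec_assoc J)
 show d: "dt v (J *v v) \<noteq> 0"
 proof
  assume "dt v (J *v v) = 0"
  then obtain x where x: "J *v v = x *\<^sub>R v" using dt_zero_parallel v by blast
  have e: "(x * x) *\<^sub>R v = - v" using JJ[of v] unfolding x mat_vec_scale by simp
  have "(x * x + 1) *\<^sub>R v = 0" by(simp add: scaleR_add_left e)
  moreover have "x * x + 1 \<noteq> 0" using zero_le_square[of x] by linarith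
  ultimately show False using v by simp
 qed
 show "Jm v (J *v v) = J"
  by(rule mat_basis_eq[OF d]) (simp_all only: Jm_left[OF d] Jm_right[OF d] JJ)
qed

text \<open>The half turns \<open>hyp\<close>, \<open>hyp ** A\<close> and \<open>B ** hyp\<close>
  generate \<Gamma>, and their product in a suitable order is \<open>half_par\<close>, which fixes
  \<open>v0\<close> up to sign. Following \<open>v0\<close> through them closes up to a triangle
  whose sides they fold.\<close>

lemma tri_exists: "\<exists>a b c. tri a b c"
proof -
 let ?s1 = "hyp" and ?s2 = "hyp ** A" and ?s3 = "B ** hyp"
 have s: "?s1 ** ?s1 = - mat 1" "?s2 ** ?s2 = - mat 1" "?s3 ** ?s3 = - mat 1"
 proof -
  have "?s2 ** ?s2 = (hyp ** A) ** hyp ** A" by(simp only: matrix_mul_assoc)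
  also have "\<dots> = adj A ** (hyp ** hyp) ** A" unfolding hyp_A by(simp only: matrix_mul_assoc)
  also have "\<dots> = - mat 1" unfolding hyp_square by(simp add: mat_uminus_left mat_uminus_right adj_mult A_SL2)
  finally show "?s2 ** ?s2 = - mat 1" .
  have "?s3 ** ?s3 = B ** (hyp ** B) ** hyp" by(simp only: matrix_mul_assoc)
  also have "\<dots> = (B ** adj B) ** (hyp ** hyp)" unfolding hyp_B by(simp only: matrix_mul_assoc)
  also have "\<dots> = - mat 1" by(simp add: hyp_square adj_mult B_SL2)
  finally show "?s3 ** ?s3 = - mat 1" .
 qed (rule hyp_square)
 have sD: "?s1 \<in> \<Delta>" "?s2 \<in> \<Delta>" "?s3 \<in> \<Delta>"
  using hyp_odd odd_even[OF hyp_odd A_G] even_odd[OF B_G hyp_odd] by auto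
 have prod: "half_par = ?s3 ** (?s1 ** ?s2)"
  by(simp add: half_par_def hyp_square2 mat_uminus_right matrix_mul_assoc[symmetric])
 have gen: "\<Gamma> \<subseteq> H" if H: "\<And>g h. g \<in> H ==> h \<in> H ==> g ** h \<in> H" "\<And>g. g \<in> H ==> - g \<in> H" "?s1 \<in> H" "?s2 \<in> H" "?s3 \<in> H" for H
 proof (rule G_minimal)
  have e: "- (?s1 ** ?s2) = A" by(simp add: hyp_square2)
  have "- (?s1 ** ?s2) \<in> H" by(rule H(2)[OF H(1)[OF H(3) H(4)]])
  thus "A \<in> H" unfolding e .
  have "?s3 ** ?s1 = B ** (hyp ** hyp)" by(simp only: matrix_mul_assoc)
  hence e: "- (?s3 ** ?s1) = B" by(simp add: hyp_square mat_uminus_right)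
  have "- (?s3 ** ?s1) \<in> H" by(rule H(2)[OF H(1)[OF H(5) H(3)]])
  thus "B \<in> H" unfolding e .
  have "?s2 ** ?s1 = adj A ** (hyp ** hyp)" unfolding hyp_A by(simp only: matrix_mul_assoc)
  hence e: "- (?s2 ** ?s1) = adj A" by(simp add: hyp_square mat_uminus_right)
  have "- (?s2 ** ?s1) \<in> H" by(rule H(2)[OF H(1)[OF H(4) H(3)]])
  thus "adj A \<in> H" unfolding e .
  have "?s1 ** ?s3 = (hyp ** B) ** hyp" by(simp only: matrix_mul_assoc)
  also have "\<dots> = adj B ** (hyp ** hyp)" unfolding hyp_B by(simp only: matrix_mul_assoc)
  finally have e: "- (?s1 ** ?s3) = adj B" by(simp add: hyp_square mat_uminus_right)
  have "- (?s1 ** ?s3) \<in> H" by(rule H(2)[OF H(1)[OF H(3) H(5)]])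
  thus "adj B \<in> H" unfolding e .
  have e: "- (?s1 ** ?s1) = mat 1" by(simp add: hyp_square)
  have "- (?s1 ** ?s1) \<in> H" by(rule H(2)[OF H(1)[OF H(3) H(3)]])
  thus "mat 1 \<in> H" unfolding e .
 qed (fact H(1,2))+
 have mk: "tri x y z" if d: "dt x y > 0" "dt y z > 0" "dt z x > 0" and J: "Jm x y \<in> {r1, - r1}" "Jm y z \<in> {r2, - r2}" "Jm z x \<in> {r3, - r3}"
   and r: "{r1, r2, r3} = {?s1, ?s2, ?s3}" and c: "x \<in> cusps" "y \<in> cusps" "z \<in> cusps" for x y z r1 r2 r3
 proof -
  have "{r1, r2, r3} \<subseteq> \<Delta>" unfolding r using sD by blast
  hence D: "Jm x y \<in> \<Delta>" "Jm y z \<in> \<Delta>" "Jm z x \<in> \<Delta>" using J by auto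
  have "generating x y z" unfolding generating_def
  proof (intro allI impI)
   fix H assume H: "(\<forall>g\<in>H. \<forall>h\<in>H. g ** h \<in> H) \<and> (\<forall>g\<in>H. - g \<in> H) \<and> Jm x y \<in> H \<and> Jm y z \<in> H \<and> Jm z x \<in> H"
   have "w \<in> H" if "v \<in> {w, - w}" "v \<in> H" for v w :: "real^2^2"
   proof -
    have "- v \<in> H" using H that(2) by blast
    thus ?thesis using that by auto
   qed
   hence "{r1, r2, r3} \<subseteq> H" using J H by blast
   hence "{?s1, ?s2, ?s3} \<subseteq> H" unfolding r .
   thus "\<Gamma> \<subseteq> H" using H by(intro gen) blast+
  qed
  thus ?thesis unfolding tri_def using d D c by blast
 qed
 define a b c where "a = v0" and "b = ?s2 *v a" and "c = ?s1 *v b"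
 have cu: "a \<in> cusps" "b \<in> cusps" "c \<in> cusps"
  unfolding a_def b_def c_def using v0_cusp cusps_ext[OF odd_ext] sD by blast+
 note nz = cu[THEN cusp_nonzero]
 have ab: "dt a b \<noteq> 0" "Jm a b = ?s2" unfolding b_def using involution_Jm[OF s(2) nz(1)] by auto
 have bc: "dt b c \<noteq> 0" "Jm b c = ?s1" unfolding c_def using involution_Jm[OF s(1) nz(2)] by auto
 have "?s3 *v c = half_par *v a" unfolding c_def b_def prod by(simp only: mat_vec_assoc)
 hence e: "?s3 *v c = a \<or> ?s3 *v c = - a" using half_par_v0 by(simp add: a_def)
 have ca: "dt c a \<noteq> 0" "Jm c a = ?s3 \<or> Jm c a = - ?s3"
 proof -
  note i = involution_Jm[OF s(3) nz(3)]
  show d: "dt c a \<noteq> 0" using i(1) e by(auto simp: dt_lin)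
  show "Jm c a = ?s3 \<or> Jm c a = - ?s3"
   using e
  proof
   assume "?s3 *v c = - a"
   hence "Jm c (- a) = ?s3" using i(2) by simp
   thus ?thesis unfolding Jm_flips(3)[OF d] by(metis add.inverse_inverse)
  qed (use i(2) in simp)
 qed
 \<comment> \<open>Signs of \<open>b\<close> and \<open>c\<close> make the first two determinants
   positive. If the third one is then negative, the triangle is traversed in the opposite order,
   with \<open>b'\<close> negated.\<close>
 define b' where "b' = (if dt a b > 0 then b else - b)"
 define c' where "c' = (if dt b' c > 0 then c else - c)"
 have b': "b' = b \<or> b' = - b" by(simp add: b'_def)
 have c': "c' = c \<or> c' = - c" by(simp add: c'_def)
 have 1: "dt a b' > 0" unfolding b'_def using ab(1) by(auto simp: dt_lin)
 have "dt b' c \<noteq> 0" using bc(1) b' by(auto simp: dt_lin)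
 hence 2: "dt b' c' > 0" unfolding c'_def by(auto simp: dt_lin)
 have 3: "dt c' a \<noteq> 0" using ca(1) c' by(auto simp: dt_lin)
 have J1: "Jm a b' \<in> {?s2, - ?s2}" using b' ab(2) Jm_flips(3)[OF ab(1)] by auto
 have J2: "Jm b' c' \<in> {?s1, - ?s1}"
 proof -
  have "Jm b' c = Jm b c \<or> Jm b' c = - Jm b c" using b' Jm_flips(2)[OF bc(1)] by auto
  moreover have "Jm b' c' = Jm b' c \<or> Jm b' c' = - Jm b' c" using c' Jm_flips(3)[OF \<open>dt b' c \<noteq> 0\<close>] by auto
  ultimately show ?thesis using bc(2) by auto
 qed
 have J3: "Jm c' a \<in> {?s3, - ?s3}" using c' ca(2) Jm_flips(2)[OF ca(1)] by auto
 have cu': "a \<in> cusps" "b' \<in> cusps" "c' \<in> cusps" "- b' \<in> cusps" using cu b' c' by auto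
 show ?thesis
 proof (cases "dt c' a > 0")
  case True
  have "tri a b' c'" by(rule mk[OF 1 2 True J1 J2 J3]) (use cu' in auto)
  thus ?thesis by blast
 next
  case False
  hence n: "dt a c' > 0" using 3 dt_swap[of a c'] by linarith
  have "Jm a c' = - Jm c' a" using Jm_flips(4)[OF 3] .
  hence K1: "Jm a c' \<in> {?s3, - ?s3}" using J3 by auto
  have K2: "Jm c' (- b') \<in> {?s1, - ?s1}" using J2 Jm_flips(1)[of b' c'] 2 by simp
  have "dt b' a \<noteq> 0" using 1 dt_swap[of b' a] by simp
  hence "Jm (- b') a = Jm a b'" using Jm_flips(2)[of b' a] Jm_flips(4)[of a b'] 1 by simp
  hence K3: "Jm (- b') a \<in> {?s2, - ?s2}" using J1 by simp
  have d: "dt c' (- b') > 0" "dt (- b') a > 0" using 1 2 dt_swap[of c' b'] dt_swap[of b' a] by(simp_all add: dt_lin)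
  have "tri a c' (- b')" by(rule mk[OF n d K1 K2 K3]) (use cu' in auto)
  thus ?thesis by blast
 qed
qed

text \<open>Collects the data of a pair that ignore order and sign, so that the eight cases of
  \<open>is_edge\<close> are treated once.\<close>

lemma is_edge_cases:
 assumes "is_edge b c p r"
 shows "\<exists>g\<in>\<Gamma>. line b c = line (g *v p) (g *v r) \<and> mid b c = mid (g *v p) (g *v r) \<and>
  (\<forall>h. line (h *v b) (h *v c) = line ((h ** g) *v p) ((h ** g) *v r)) \<and>
  (dt b c = dt p r \<or> dt b c = - dt p r) \<and> (p \<in> cusps \<and> r \<in> cusps --> b \<in> cusps \<and> c \<in> cusps)"
proof -
 obtain g where g: "g \<in> \<Gamma>" and e: "(b = g *v p \<or> b = - (g *v p)) \<and> (c = g *v r \<or> c = - (g *v r)) \<or>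
  (c = g *v p \<or> c = - (g *v p)) \<and> (b = g *v r \<or> b = - (g *v r))" using assms unfolding is_edge_def by blast
 have 1: "line b c = line (g *v p) (g *v r)"
  using e by(elim disjE conjE; simp only: line_uminus line_swap[of "g *v r" "g *v p"])
 have 2: "mid b c = mid (g *v p) (g *v r)"
  using e by(elim disjE conjE; simp only: mid_uminus mid_swap[of "g *v r" "g *v p"])
 have 3: "line (h *v b) (h *v c) = line ((h ** g) *v p) ((h ** g) *v r)" for h
  using e by(elim disjE conjE; simp only: line_uminus mat_vec_uminus_right mat_vec_assoc line_swap[of "(h ** g) *v r" "(h ** g) *v p"])
 have d: "dt (g *v p) (g *v r) = dt p r" "dt (g *v r) (g *v p) = - dt p r"
  using dt_mat[OF G_SL2[OF g]] dt_swap[of r p] by simp_all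
 have 4: "dt b c = dt p r \<or> dt b c = - dt p r"
  using e by(elim disjE conjE; simp only: dt_lin d minus_minus simp_thms)
 have 5: "b \<in> cusps \<and> c \<in> cusps" if "p \<in> cusps" "r \<in> cusps"
  using e by(elim disjE conjE; simp only: cusps_uminus cusps_even[OF g that(1)] cusps_even[OF g that(2)] simp_thms)
 show ?thesis
 proof (rule bexI[OF _ g], intro conjI allI impI)
  show "b \<in> cusps" "c \<in> cusps" if "p \<in> cusps \<and> r \<in> cusps" using 5 that by blast+
 qed (rule 1 2 3 4)+
qed

lemma is_edge_line: "is_edge b c p r ==> q ` line b c = q ` line p r"
proof -
 assume e: "is_edge b c p r"
 obtain g where g: "g \<in> \<Gamma>" "line b c = line (g *v p) (g *v r)" using is_edge_cases[OF e] by(elim bexE conjE) (rule that)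
 show ?thesis unfolding g(2) by(rule line_G_image[OF g(1)])
qed

lemma is_edge_mid:
 assumes "is_edge b c p r" "dt p r \<noteq> 0"
 shows "q (mid b c) = q (mid p r)"
proof -
 obtain g where g: "g \<in> \<Gamma>" "mid b c = mid (g *v p) (g *v r)"
  using is_edge_cases[OF assms(1)] by(elim bexE conjE) (rule that)
 have "Im (mid p r) > 0" using mid_line[OF assms(2)] by(simp add: line_def)
 thus ?thesis unfolding g(2) mid_moeb[OF assms(2) G_SL2[OF g(1)]] by(rule q_moeb[OF g(1)])
qed

lemma is_edge_simple:
 assumes e: "is_edge b c p r" and s: "simple_pair p r"
 shows "simple_pair b c"
proof -
 obtain g where g: "g \<in> \<Gamma>" and l: "line b c = line (g *v p) (g *v r)"
  and lh: "\<And>h. line (h *v b) (h *v c) = line ((h ** g) *v p) ((h ** g) *v r)"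
  and d: "dt b c = dt p r \<or> dt b c = - dt p r" and cu: "p \<in> cusps \<and> r \<in> cusps --> b \<in> cusps \<and> c \<in> cusps"
  using is_edge_cases[OF e] by(elim bexE conjE) (rule that, assumption, assumption, erule spec, assumption, assumption)
 have gS: "g \<in> SL2" using G_SL2 g by blast
 note s' = s[unfolded simple_pair_def]
 show ?thesis unfolding simple_pair_def
 proof (intro conjI allI impI)
  show "b \<in> cusps" "c \<in> cusps" using cu s' by blast+
  show "dt b c \<noteq> 0" using d s' by auto
  have li: "line b c = moeb g ` line p r" unfolding l line_moeb[OF gS] ..
  show "inj_on q (line b c)"
  proof (rule inj_onI)
   fix x y assume xy: "x \<in> line b c" "y \<in> line b c" "q x = q y"
   then obtain x' y' where x': "x' \<in> line p r" "x = moeb g x'" "y' \<in> line p r" "y = moeb g y'" unfolding li by blast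
   hence "q x' = q y'" using xy(3) q_moeb[OF g] by(simp add: line_def)
   hence "x' = y'" using s' x'(1,3) by(meson inj_onD)
   thus "x = y" using x' by simp
  qed
  show "closedin (top_of_set punctured_torus) (q ` line b c)" unfolding is_edge_line[OF e] using s' by blast
  fix K :: "complex set" assume K: "compact K \<and> K \<subseteq> half_plane"
  hence fin: "finite {h \<in> \<Gamma>. line (h *v p) (h *v r) \<inter> K \<noteq> {}}" using s' by blast
  have inj: "inj_on (\<lambda>h. h ** g) {h \<in> \<Gamma>. line (h *v b) (h *v c) \<inter> K \<noteq> {}}"
  proof (rule inj_onI)
   fix h k assume "h ** g = k ** g"
   hence "(h ** g) ** adj g = (k ** g) ** adj g" by simp
   thus "h = k" by(simp add: matrix_mul_assoc[symmetric] adj_mult[OF gS])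
  qed
  show "finite {h \<in> \<Gamma>. line (h *v b) (h *v c) \<inter> K \<noteq> {}}"
  proof (rule finite_imageD[OF finite_subset[OF _ fin] inj], rule image_subsetI)
   fix h assume "h \<in> {h \<in> \<Gamma>. line (h *v b) (h *v c) \<inter> K \<noteq> {}}"
   thus "h ** g \<in> {h \<in> \<Gamma>. line (h *v p) (h *v r) \<inter> K \<noteq> {}}" unfolding lh using G_mult[OF _ g] by blast
  qed
 qed
qed

lemma unlinked_pairsI:
 assumes "\<And>g. g \<in> \<Gamma> ==> \<not> linked (g *v p) (g *v r) p' r'"
 shows "unlinked_pairs p r p' r'"
 unfolding unlinked_pairs_def
proof (intro ballI)
 fix g h assume g: "g \<in> \<Gamma>" and h: "h \<in> \<Gamma>"
 have hS: "h \<in> SL2" using G_SL2 h by blast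
 have "adj h ** g \<in> \<Gamma>" using g h G_mult by simp
 hence "\<not> linked ((adj h ** g) *v p) ((adj h ** g) *v r) p' r'" by(rule assms)
 moreover have "linked (h *v ((adj h ** g) *v p)) (h *v ((adj h ** g) *v r)) (h *v p') (h *v r') =
   linked ((adj h ** g) *v p) ((adj h ** g) *v r) p' r'" by(rule linked_mat[OF hS])
 ultimately show "\<not> linked (g *v p) (g *v r) (h *v p') (h *v r')"
  by(simp only: mat_vec_assoc adj_cancel_left(2)[OF hS] not_False_eq_True)
qed

lemma unlinked_pairs_edges:
 assumes u: "unlinked_pairs p r p' r'" and e: "is_edge b c p r" "is_edge b' c' p' r'" and g: "g \<in> \<Gamma>"
 shows "\<not> linked (g *v b) (g *v c) b' c'"
proof -
 obtain h where h: "h \<in> \<Gamma>" "(b = h *v p \<or> b = - (h *v p)) \<and> (c = h *v r \<or> c = - (h *v r)) \<or>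
  (c = h *v p \<or> c = - (h *v p)) \<and> (b = h *v r \<or> b = - (h *v r))" using e(1) unfolding is_edge_def by blast
 have gh: "g ** h \<in> \<Gamma>" by(rule G_mult[OF g h(1)])
 have n: "\<not> linked ((g ** h) *v p) ((g ** h) *v r) b' c'" by(rule edge_linked[OF e(2) u gh])
 have n': "\<not> linked ((g ** h) *v r) ((g ** h) *v p) b' c'"
  using n unfolding linked_swap(1)[of "(g ** h) *v r" "(g ** h) *v p"] .
 have v: "g *v (h *v x) = (g ** h) *v x" "g *v (- (h *v x)) = - ((g ** h) *v x)" for x
  by(simp_all add: mat_vec_assoc)
 show ?thesis using h(2) n n' by(elim disjE conjE) (simp_all only: v linked_uminus not_False_eq_True)
qed

text \<open>The three arcs are made edges one after the other; \<open>descent\<close> keeps those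
  already obtained because they are disjoint from the next one.\<close>

lemma common_triangulation:
 assumes s: "simple_pair p0 r0" "simple_pair p1 r1" "simple_pair p2 r2"
  and u: "unlinked_pairs p2 r2 p1 r1" "unlinked_pairs p0 r0 p1 r1" "unlinked_pairs p0 r0 p2 r2"
 shows "\<exists>a b c. tri a b c \<and> tedge a b c p0 r0 \<and> tedge a b c p1 r1 \<and> tedge a b c p2 r2"
proof -
 obtain a b c where t: "tri a b c" using tri_exists by blast
 obtain a1 b1 c1 where t1: "tri a1 b1 c1" "tedge a1 b1 c1 p1 r1" using descent[OF s(2) t] by blast
 obtain a2 b2 c2 where t2: "tri a2 b2 c2" "tedge a2 b2 c2 p2 r2" "tedge a2 b2 c2 p1 r1"
  using descent[OF s(3) t1(1)] u(1) t1(2) by blast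
 obtain a3 b3 c3 where t3: "tri a3 b3 c3" "tedge a3 b3 c3 p0 r0" "tedge a3 b3 c3 p1 r1" "tedge a3 b3 c3 p2 r2"
  using descent[OF s(1) t2(1)] u(2,3) t2(2,3) by blast
 show ?thesis using t3 by blast
qed

lemma cell_unlinked:
 assumes \<sigma>: "\<sigma> \<in> arc_complex q" and x: "x \<in> \<sigma>" "arc_pair x u v" and y: "y \<in> \<sigma>" "arc_pair y u' v'" and ne: "x \<noteq> y"
 shows "unlinked_pairs u v u' v'"
proof (rule unlinked_pairsI)
 fix g assume g: "g \<in> \<Gamma>"
 obtain f where f: "\<forall>\<alpha>\<in>\<sigma>. f \<alpha> \<in> \<alpha>" "pairwise (\<lambda>\<alpha> \<beta>. path_image (f \<alpha>) \<inter> path_image (f \<beta>) = {puncture}) \<sigma>"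
  using \<sigma> unfolding arc_complex_def by blast
 have "path_image (f x) \<inter> path_image (f y) = {puncture}" using f(2) x(1) y(1) ne unfolding pairwise_def by blast
 moreover have "f x \<in> x" "f y \<in> y" using f(1) x(1) y(1) by blast+
 ultimately show "\<not> linked (g *v u) (g *v v) u' v'" using arc_pair_unlinked[OF x(2) y(2) _ _ _ g] by blast
qed

lemma distinct_edges:
 assumes "arc_pair \<alpha> u v" "arc_pair \<beta> u' v'" "\<alpha> \<noteq> \<beta>" "\<alpha> \<in> arc_vertices q" "\<beta> \<in> arc_vertices q"
 shows "\<not> (is_edge x y u v \<and> is_edge x y u' v')"
proof
 assume "is_edge x y u v \<and> is_edge x y u' v'"
 hence "q ` line u v = q ` line u' v'" using is_edge_line[of x y u v] is_edge_line[of x y u' v'] by simp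
 thus False using same_geodesic_eq[OF assms(4,1,5,2)] assms(3) by blast
qed

text \<open>Distinct classes have distinct geodesics, so the fourth arc is not a side of the common
  triangulation, and \<open>flip_unique\<close> applies.\<close>

lemma flip_configuration:
 assumes \<sigma>: "{\<alpha>, \<beta>1, \<beta>2} \<in> arc_complex q" "card {\<alpha>, \<beta>1, \<beta>2} = 3"
  and \<tau>: "{\<alpha>', \<beta>1, \<beta>2} \<in> arc_complex q" "card {\<alpha>', \<beta>1, \<beta>2} = 3" and ne: "\<alpha> \<noteq> \<alpha>'"
  and p: "arc_pair \<alpha> p0 r0" "arc_pair \<beta>1 p1 r1" "arc_pair \<beta>2 p2 r2" "arc_pair \<alpha>' p r"
 shows "\<exists>a b c. tri a b c \<and> is_edge b c p0 r0 \<and> is_edge a (Jm b c *v a) p r \<and>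
  (is_edge c a p1 r1 \<and> is_edge a b p2 r2 \<or> is_edge c a p2 r2 \<and> is_edge a b p1 r1) \<and>
  unlinked_pairs p0 r0 p1 r1 \<and> unlinked_pairs p0 r0 p2 r2 \<and> unlinked_pairs p1 r1 p2 r2 \<and>
  unlinked_pairs p r p1 r1 \<and> unlinked_pairs p r p2 r2"
proof -
 have V: "\<alpha> \<in> arc_vertices q" "\<beta>1 \<in> arc_vertices q" "\<beta>2 \<in> arc_vertices q" "\<alpha>' \<in> arc_vertices q"
  using \<sigma>(1) \<tau>(1) by(auto simp: arc_complex_def)
 have distinct: "\<alpha> \<noteq> \<beta>1" "\<alpha> \<noteq> \<beta>2" "\<beta>1 \<noteq> \<beta>2" "\<alpha>' \<noteq> \<beta>1" "\<alpha>' \<noteq> \<beta>2"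
  using \<sigma>(2) \<tau>(2) by(auto simp: card_insert_if split: if_splits)
 have s: "simple_pair p0 r0" "simple_pair p1 r1" "simple_pair p2 r2" "simple_pair p r"
  using p by(simp_all add: arc_pair_def)
 have u: "unlinked_pairs p0 r0 p1 r1" "unlinked_pairs p0 r0 p2 r2" "unlinked_pairs p1 r1 p2 r2" "unlinked_pairs p2 r2 p1 r1"
  by(rule cell_unlinked[OF \<sigma>(1) _ p(1) _ p(2) distinct(1)] cell_unlinked[OF \<sigma>(1) _ p(1) _ p(3) distinct(2)]
    cell_unlinked[OF \<sigma>(1) _ p(2) _ p(3) distinct(3)] cell_unlinked[OF \<sigma>(1) _ p(3) _ p(2) distinct(3)[symmetric]]; simp)+
 have u': "unlinked_pairs p r p1 r1" "unlinked_pairs p r p2 r2"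
  by(rule cell_unlinked[OF \<tau>(1) _ p(4) _ p(2) distinct(4)] cell_unlinked[OF \<tau>(1) _ p(4) _ p(3) distinct(5)]; simp)+
 note D = distinct_edges
 note d = D[OF p(1,2) distinct(1) V(1,2)] D[OF p(1,3) distinct(2) V(1,3)] D[OF p(2,3) distinct(3) V(2,3)]
 note d' = D[OF p(1,4) ne V(1,4)] D[OF p(4,2) distinct(4) V(4,2)] D[OF p(4,3) distinct(5) V(4,3)]
 obtain a b c where t: "tri a b c" "tedge a b c p0 r0" "tedge a b c p1 r1" "tedge a b c p2 r2"
  using common_triangulation[OF s(1-3) u(4,1,2)] by blast
 have "\<not> tedge a b c p r"
  using t(2-4) d[of a b] d[of b c] d[of c a] d'[of a b] d'[of b c] d'[of c a] unfolding tedge_def by argo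
 from flip_unique[OF t(1) s(4) t(2-4) d u' this] obtain a' b' c' where
  "tri a' b' c' \<and> is_edge b' c' p0 r0 \<and> is_edge a' (Jm b' c' *v a') p r \<and>
  (is_edge c' a' p1 r1 \<and> is_edge a' b' p2 r2 \<or> is_edge c' a' p2 r2 \<and> is_edge a' b' p1 r1)" by blast
 thus ?thesis using u u' by blast
qed

end

context cusped_torus
begin

section \<open>Strip cocycles of the sides of a triangle\<close>

abbreviation strp :: "real^2 => real^2 => complex => complex => real^2^2" where
 "strp u v \<equiv> simple_geodesic.strip A B u v"

text \<open>The base point is the centre of the triangle: its inner product is the sum of the squares of
 the vertices.\<close>

lemma base_point:
 assumes "dt a b \<noteq> 0"
 obtains z K where "Im z > 0" "K > 0" "\<And>p r. side p r z = K * (sg p r a + sg p r b + sg p r c)"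
proof -
 \<comment> \<open>These are the entries of the symmetric matrix of the inner product. Its
   determinant is the sum of the three squared \<open>dt\<close>, hence positive, and the point of
   the form has real part \<open>?M / ?S2\<close> and imaginary part the root of the determinant
   divided by \<open>?S2\<close>.\<close>
 let ?S2 = "(a$2)\<^sup>2 + (b$2)\<^sup>2 + (c$2)\<^sup>2" and ?S1 = "(a$1)\<^sup>2 + (b$1)\<^sup>2 + (c$1)\<^sup>2" and ?M = "a$1 * a$2 + b$1 * b$2 + c$1 * c$2"
 have S2: "?S2 > 0"
 proof -
  have "a$2 \<noteq> 0 \<or> b$2 \<noteq> 0" using assms by(auto simp: dt_def)
  hence "(a$2)\<^sup>2 + (b$2)\<^sup>2 > 0" by(simp add: sum_power2_gt_zero_iff)
  thus ?thesis by(simp add: add_pos_nonneg)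
 qed
 have D: "?S1 * ?S2 - ?M\<^sup>2 > 0"
 proof -
  have "?S1 * ?S2 - ?M\<^sup>2 = (dt a b)\<^sup>2 + (dt b c)\<^sup>2 + (dt c a)\<^sup>2" by(simp add: dt_def power2_eq_square algebra_simps)
  moreover have "(dt a b)\<^sup>2 > 0" using assms by simp
  ultimately show ?thesis by(simp add: add_pos_nonneg)
 qed
 define z where "z = Complex (?M / ?S2) (sqrt (?S1 * ?S2 - ?M\<^sup>2) / ?S2)"
 have R: "Re z = ?M / ?S2" by(simp add: z_def)
 have "(Im z)\<^sup>2 = (?S1 * ?S2 - ?M\<^sup>2) / ?S2\<^sup>2" using D by(simp add: z_def power_divide)
 hence I: "(Im z)\<^sup>2 = (?S1 * ?S2 - ?M\<^sup>2) / ?S2\<^sup>2" .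
 have n: "?S2 \<noteq> 0" using S2 by linarith
 have gen: "(m / s)\<^sup>2 + (n * s - m\<^sup>2) / s\<^sup>2 = n / s" if "s \<noteq> 0" for m n s :: real
  using that by(simp add: power_divide field_simps power2_eq_square)
 have gen2: "x - y * (m / s) + w * (n / s) = 1 / s * (x * s - y * m + w * n)" if "s \<noteq> 0" for m n s x y w :: real
  using that by(simp add: field_simps)
 have N: "(Re z)\<^sup>2 + (Im z)\<^sup>2 = ?S1 / ?S2" unfolding R I by(rule gen[OF n])
 show thesis
 proof (rule that[of z "1 / ?S2"])
  show "Im z > 0" using D S2 by(simp add: z_def)
  show "1 / ?S2 > 0" using S2 by simp
  fix p r :: "real^2"
  have e: "sg p r a + sg p r b + sg p r c = p$1 * r$1 * ?S2 - (p$1 * r$2 + p$2 * r$1) * ?M + p$2 * r$2 * ?S1"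
   by(simp add: sg_def dt_def power2_eq_square algebra_simps)
  show "side p r z = 1 / ?S2 * (sg p r a + sg p r b + sg p r c)"
   unfolding side_explicit N e unfolding R by(rule gen2[OF n])
 qed
qed

text \<open>For odd \<open>h\<close>, composing with \<open>Jm p r\<close> returns to \<Gamma> and
  only exchanges the ends of the lift.\<close>

lemma unlinked_ext:
 assumes J: "Jm p r \<in> \<Delta>" "dt p r \<noteq> 0" and u: "\<And>g. g \<in> \<Gamma> ==> \<not> linked (g *v p) (g *v r) x y"
  and h: "h \<in> \<Lambda>" and g: "g \<in> \<Gamma>"
 shows "\<not> linked (g *v p) (g *v r) (h *v x) (h *v y)"
proof
 assume l: "linked (g *v p) (g *v r) (h *v x) (h *v y)"
 have hS: "h \<in> SL2" "adj h \<in> SL2" using ext_SL2 h by auto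
 let ?k = "adj h ** g"
 have "linked (adj h *v (g *v p)) (adj h *v (g *v r)) (adj h *v (h *v x)) (adj h *v (h *v y))"
  unfolding linked_mat[OF hS(2)] by(rule l)
 hence l': "linked (?k *v p) (?k *v r) x y" unfolding adj_cancel_vec(1)[OF hS(1)] unfolding mat_vec_assoc .
 show False
 proof (cases "h \<in> \<Gamma>")
  case True
  hence "?k \<in> \<Gamma>" using g G_mult by simp
  thus False using u l' by blast
 next
  case False
  hence "h \<in> \<Delta>" using h by(simp add: ext_group_def)
  hence k: "?k ** Jm p r \<in> \<Gamma>" using odd_odd[OF odd_even[OF odd_adj g] J(1)] by blast
  have "(?k ** Jm p r) *v p = ?k *v r" "(?k ** Jm p r) *v r = - (?k *v p)"
   unfolding mat_vec_assoc[symmetric, of ?k "Jm p r"] Jm_left[OF J(2)] Jm_right[OF J(2)] by(rule refl, rule mat_vec_uminus_right)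
  hence "\<not> linked (?k *v r) (- (?k *v p)) x y" using u[OF k] by simp
  thus False using l' by(simp add: linked_swap(1)[of "?k *v r" "?k *v p"])
 qed
qed

lemma sum_same_sign:
 fixes a b c d :: real
 assumes "\<not> a * b < 0" "\<not> b * c < 0" "\<not> c * a < 0" "\<not> c * d < 0" "\<not> d * b < 0" "b \<noteq> 0 \<or> c \<noteq> 0"
 shows "sgn (a + b + c) = sgn (d + b + c)"
 using assms unfolding neg_prod_iff sgn_if by(smt (verit))

text \<open>At the centre, \<open>side\<close> is a positive multiple of the sum of the values
  \<open>sg\<close> at the vertices; at its image under the half turn, \<open>a\<close> is replaced
  by the opposite vertex. Being unlinked with all sides, the lift has weakly constant sign on either
  triangle, and a nonzero value at \<open>b\<close> or \<open>c\<close> makes the two signs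
  agree.\<close>

lemma side_across:
 assumes t: "tri a b c" and J: "Jm p r \<in> \<Delta>" "dt p r \<noteq> 0"
  and u: "\<And>g. g \<in> \<Gamma> ==> \<not> linked (g *v p) (g *v r) a b" "\<And>g. g \<in> \<Gamma> ==> \<not> linked (g *v p) (g *v r) b c"
   "\<And>g. g \<in> \<Gamma> ==> \<not> linked (g *v p) (g *v r) c a"
  and z: "Im z > 0" "K > 0" "\<And>p r. side p r z = K * (sg p r a + sg p r b + sg p r c)"
  and g: "g \<in> \<Gamma>" and ne: "sg (g *v p) (g *v r) b \<noteq> 0 \<or> sg (g *v p) (g *v r) c \<noteq> 0"
 shows "sgn (side (g *v p) (g *v r) z) = sgn (side (g *v p) (g *v r) (moeb (Jm b c) z))"
proof -
 note t' = triD[OF t]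
 let ?J = "Jm b c" and ?p = "g *v p" and ?r = "g *v r"
 have JS: "?J \<in> SL2" by(rule Jm_SL2[OF t'(12)])
 have h: "?J \<in> \<Lambda>" by(rule odd_ext[OF t'(5)])
 have e: "?J *v b = c" "?J *v c = - b" using Jm_left[OF t'(12)] Jm_right[OF t'(12)] by auto
 have n: "\<not> sg ?p ?r a * sg ?p ?r b < 0" "\<not> sg ?p ?r b * sg ?p ?r c < 0" "\<not> sg ?p ?r c * sg ?p ?r a < 0"
  using u(1)[OF g] u(2)[OF g] u(3)[OF g] unfolding linked_sg .
 have "\<not> linked ?p ?r (?J *v a) (?J *v b)" "\<not> linked ?p ?r (?J *v c) (?J *v a)"
  by(rule unlinked_ext[OF J u(1) h g], assumption) (rule unlinked_ext[OF J u(3) h g], assumption)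
 hence n': "\<not> sg ?p ?r c * sg ?p ?r (?J *v a) < 0" "\<not> sg ?p ?r (?J *v a) * sg ?p ?r b < 0"
  unfolding e linked_uminus unfolding linked_sg by(simp_all only: mult.commute not_False_eq_True)
 have "side ?p ?r (moeb ?J z) = side (?J *v (adj ?J *v ?p)) (?J *v (adj ?J *v ?r)) (moeb ?J z)"
  unfolding adj_cancel_vec(2)[OF JS] ..
 hence 1: "sgn (side ?p ?r (moeb ?J z)) = sgn (side (adj ?J *v ?p) (adj ?J *v ?r) z)"
  by(simp only: sgn_side_moeb[OF JS z(1)])
 have d: "dt (adj ?J *v w) x = dt w (?J *v x)" for w x
  using dt_mat[OF JS, of "adj ?J *v w" x] unfolding adj_cancel_vec(2)[OF JS] by simp
 have s: "sg (adj ?J *v ?p) (adj ?J *v ?r) x = sg ?p ?r (?J *v x)" for x unfolding sg_def d ..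
 have m: "sg ?p ?r (- b) = sg ?p ?r b" by(simp add: sg_def dt_lin)
 have 2: "sgn (side (adj ?J *v ?p) (adj ?J *v ?r) z) = sgn (sg ?p ?r (?J *v a) + sg ?p ?r b + sg ?p ?r c)"
  unfolding z(3) s e m sgn_mult using z(2) by(simp add: add_ac)
 have 3: "sgn (side ?p ?r z) = sgn (sg ?p ?r a + sg ?p ?r b + sg ?p ?r c)"
  unfolding z(3) sgn_mult using z(2) by simp
 show ?thesis unfolding 1 2 3 by(rule sum_same_sign[OF n n' ne])
qed

lemma sg_zero_both:
 assumes p: "p \<in> cusps" "r \<in> cusps" "dt p r \<noteq> 0" and b: "b \<in> cusps" "c \<in> cusps" "dt b c \<noteq> 0"
  and z: "sg p r b = 0" "sg p r c = 0"
 shows "(b = p \<or> b = - p) \<and> (c = r \<or> c = - r) \<or> (c = p \<or> c = - p) \<and> (b = r \<or> b = - r)"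
proof -
 have P: "w = x \<or> w = - x" if "dt x w = 0" "x \<in> cusps" "w \<in> cusps" for x w
  using cusp_parallel[OF that(2,3,1)] .
 have "dt p b = 0 \<or> dt r b = 0" "dt p c = 0 \<or> dt r c = 0" using z by(auto simp: sg_def)
 moreover have "\<not> (dt p b = 0 \<and> dt p c = 0)" using P[OF _ p(1) b(1)] P[OF _ p(1) b(2)] b(3) by(auto simp: dt_lin)
 moreover have "\<not> (dt r b = 0 \<and> dt r c = 0)" using P[OF _ p(2) b(1)] P[OF _ p(2) b(2)] b(3) by(auto simp: dt_lin)
 ultimately consider "dt p b = 0" "dt r c = 0" | "dt p c = 0" "dt r b = 0" by blast
 thus ?thesis
 proof cases
  case 1
  thus ?thesis using P[OF _ p(1) b(1)] P[OF _ p(2) b(2)] by blast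
 next
  case 2
  thus ?thesis using P[OF _ p(1) b(2)] P[OF _ p(2) b(1)] by blast
 qed
qed

text \<open>By \<open>sg_zero_both\<close> only a lift joining \<open>b\<close> and \<open>c\<close>
  could separate the centre from its image, and \<open>b c\<close> is not an edge of this
  arc.\<close>

lemma strip_other_side:
 assumes t: "tri a b c" and s: "simple_pair p r" "dt p r > 0" and J: "Jm p r \<in> \<Delta>"
  and u: "\<And>g. g \<in> \<Gamma> ==> \<not> linked (g *v p) (g *v r) a b" "\<And>g. g \<in> \<Gamma> ==> \<not> linked (g *v p) (g *v r) b c"
   "\<And>g. g \<in> \<Gamma> ==> \<not> linked (g *v p) (g *v r) c a"
  and z: "Im z > 0" "K > 0" "\<And>p r. side p r z = K * (sg p r a + sg p r b + sg p r c)"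
  and ne: "\<not> is_edge b c p r"
 shows "strp p r z (moeb (Jm b c) z) = 0"
proof -
 note t' = triD[OF t]
 interpret simple_geodesic A B q p r using s by unfold_locales
 have d: "dt p r \<noteq> 0" using s(2) by simp
 have pr: "p \<in> cusps" "r \<in> cusps" using s(1) by(simp_all add: simple_pair_def)
 have "same_cell z (moeb (Jm b c) z)"
 proof
  fix g assume g: "g \<in> \<Gamma>"
  have dg: "dt (g *v p) (g *v r) \<noteq> 0" using dt_mat[OF G_SL2[OF g]] d by simp
  have ne': "sg (g *v p) (g *v r) b \<noteq> 0 \<or> sg (g *v p) (g *v r) c \<noteq> 0"
   using sg_zero_both[OF cusps_even[OF g pr(1)] cusps_even[OF g pr(2)] dg t'(8,9,12)] ne g unfolding is_edge_def by blast
  show "sgn (side (g *v p) (g *v r) z) = sgn (side (g *v p) (g *v r) (moeb (Jm b c) z))"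
   by(rule side_across[OF t J d u z g]; (assumption | rule ne'))
 qed
 thus ?thesis by(rule strip_same_cell)
qed

text \<open>The side \<open>b c\<close> is the only lift between the centre and its image. The
  centre lies on its negative side, whence the sign.\<close>

lemma strip_own_side:
 assumes t: "tri a b c" and s: "simple_pair b c"
  and u: "\<And>g. g \<in> \<Gamma> ==> \<not> linked (g *v b) (g *v c) a b" "\<And>g. g \<in> \<Gamma> ==> \<not> linked (g *v b) (g *v c) c a"
  and z: "Im z > 0" "K > 0" "\<And>p r. side p r z = K * (sg p r a + sg p r b + sg p r c)"
 shows "strp b c z (moeb (Jm b c) z) = - tv b c"
proof -
 note t' = triD[OF t]
 interpret simple_geodesic A B q b c using s t'(2) by unfold_locales
 let ?J = "Jm b c"
 have JS: "?J \<in> SL2" by(rule Jm_SL2[OF t'(12)])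
 have ubc: "\<not> linked (g *v b) (g *v c) b c" if "g \<in> \<Gamma>" for g
  using family_unlinked[OF s that G_one] by simp
 have e: "?J *v b = c" "?J *v c = - b" using Jm_left[OF t'(12)] Jm_right[OF t'(12)] by auto
 have s0: "side b c z < 0"
 proof -
  have "sg b c a + sg b c b + sg b c c = dt b a * dt c a" by(simp add: sg_def)
  also have "\<dots> < 0" using t'(1,3) dt_swap[of b a] by(simp add: mult_neg_pos)
  finally show ?thesis unfolding z(3) using z(2) by(simp add: mult_pos_neg)
 qed
 have s1: "side b c (moeb ?J z) = - side b c z / (norm (jac ?J z))\<^sup>2"
  using side_moeb[OF JS z(1), of b c] unfolding e by(simp add: side_swap[of c b])
 have jn: "(norm (jac ?J z))\<^sup>2 > 0" using jac_nonzero[OF JS z(1)] by simp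
 have s2: "side b c (moeb ?J z) > 0" unfolding s1 using divide_neg_pos[OF s0 jn] by simp
 have other: "sgn (side (g *v b) (g *v c) z) = sgn (side (g *v b) (g *v c) (moeb ?J z))"
  if g: "g \<in> \<Gamma>" "g \<noteq> mat 1" "g \<noteq> - mat 1" for g
 proof (rule side_across[OF t t'(5,12) u(1) ubc u(2) z g(1)])
  have dg: "dt (g *v b) (g *v c) \<noteq> 0" using dt_mat[OF G_SL2[OF g(1)]] t'(12) by simp
  show "sg (g *v b) (g *v c) b \<noteq> 0 \<or> sg (g *v b) (g *v c) c \<noteq> 0"
  proof (rule ccontr)
   assume "\<not> ?thesis"
   hence "(b = g *v b \<or> b = - (g *v b)) \<and> (c = g *v c \<or> c = - (g *v c)) \<or>
     (c = g *v b \<or> c = - (g *v b)) \<and> (b = g *v c \<or> b = - (g *v c))"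
    using sg_zero_both[OF cusps_even[OF g(1) t'(8)] cusps_even[OF g(1) t'(9)] dg t'(8,9,12)] by blast
   hence "line b c = line (g *v b) (g *v c)"
    using line_swap[of "g *v c" "g *v b"] by(elim disjE conjE) (metis line_uminus)+
   hence "mid b c \<in> line (g *v b) (g *v c)" using mid_line[OF t'(12)] by simp
   thus False using simple_pair_inj[OF s g(1) mid_line[OF t'(12)]] g(2,3) by blast
  qed
 qed assumption+
 have "cut z (moeb ?J z) = {mat 1, - mat 1}" using other s0 s2 by(auto simp: cut_def)
 hence "strip z (moeb ?J z) = jump (mat 1 *v b) (mat 1 *v c) z (moeb ?J z)" by(rule cut_single[OF G_one])
 also have "\<dots> = - tv b c" using s0 s2 by(simp add: jump_def)
 finally show ?thesis .
qed

end

section \<open>Cohomology of the holonomy\<close>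

lemma cocycle_add:
 assumes "S \<subseteq> SL2" "cocycle S u" "cocycle S v"
 shows "cocycle S (\<lambda>M. u M + v M)"
 unfolding cocycle_def
proof (intro conjI ballI)
 show "trace (u M + v M) = 0" if "M \<in> S" for M using assms(2,3) that by(simp add: cocycle_def trace_lin)
 show "u (M ** N) + v (M ** N) = u M + v M + Ad M (u N + v N)" if "M \<in> S" "N \<in> S" for M N
 proof -
  have "M \<in> SL2" using assms(1) that by blast
  thus ?thesis using assms(2,3) that by(simp add: cocycle_def Ad_lin)
 qed
qed

lemma cocycle_scale:
 assumes "S \<subseteq> SL2" "cocycle S u"
 shows "cocycle S (\<lambda>M. x *\<^sub>R u M)"
 unfolding cocycle_def
proof (intro conjI ballI)
 show "trace (x *\<^sub>R u M) = 0" if "M \<in> S" for M using assms(2) that by(simp add: cocycle_def trace_lin)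
 show "x *\<^sub>R u (M ** N) = x *\<^sub>R u M + Ad M (x *\<^sub>R u N)" if "M \<in> S" "N \<in> S" for M N
 proof -
  have "M \<in> SL2" using assms(1) that by blast
  thus ?thesis using assms(2) that by(simp add: cocycle_def Ad_lin scaleR_add_right)
 qed
qed

lemma cocycle_coboundary:
 assumes "S \<subseteq> SL2" "trace X = 0"
 shows "cocycle S (\<lambda>M. X - Ad M X)"
 unfolding cocycle_def
proof (intro conjI ballI)
 show "trace (X - Ad M X) = 0" if "M \<in> S" for M using assms that by(auto simp: trace_lin trace_Ad)
 show "X - Ad (M ** N) X = X - Ad M X + Ad M (X - Ad N X)" if "M \<in> S" "N \<in> S" for M N
 proof -
  have "M \<in> SL2" "N \<in> SL2" using assms(1) that by blast+
  thus ?thesis by(simp add: Ad_lin Ad_mult)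
 qed
qed

lemma coboundary_lin:
 assumes S: "S \<subseteq> SL2" and u: "coboundary S u" and v: "coboundary S v"
 shows "coboundary S (\<lambda>M. x *\<^sub>R u M + y *\<^sub>R v M)"
proof -
 obtain X where X: "trace X = 0" "\<And>M. M \<in> S ==> u M = X - Ad M X" using u unfolding coboundary_def by blast
 obtain Y where Y: "trace Y = 0" "\<And>M. M \<in> S ==> v M = Y - Ad M Y" using v unfolding coboundary_def by blast
 have "x *\<^sub>R u M + y *\<^sub>R v M = (x *\<^sub>R X + y *\<^sub>R Y) - Ad M (x *\<^sub>R X + y *\<^sub>R Y)" if M: "M \<in> S" for M
 proof -
  have "M \<in> SL2" using S M by blast
  thus ?thesis unfolding X(2)[OF M] Y(2)[OF M] by(simp add: Ad_lin scaleR_diff_right)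
 qed
 moreover have "trace (x *\<^sub>R X + y *\<^sub>R Y) = 0" using X(1) Y(1) by(simp add: trace_lin)
 ultimately show ?thesis unfolding coboundary_def by blast
qed

lemma coboundary_cong: "coboundary S u ==> (\<And>M. u M = v M) ==> coboundary S v"
 by(simp add: coboundary_def)

lemma H1_eq_lin:
 assumes S: "S \<subseteq> SL2" and u: "H1_eq S u u'" and v: "H1_eq S v v'"
 shows "H1_eq S (\<lambda>M. x *\<^sub>R u M + y *\<^sub>R v M) (\<lambda>M. x *\<^sub>R u' M + y *\<^sub>R v' M)"
 unfolding H1_eq_def
 by(rule coboundary_cong[OF coboundary_lin[OF S u[unfolded H1_eq_def] v[unfolded H1_eq_def], of x y]])
  (simp add: algebra_simps)

lemma H1_eq_sym:
 assumes "S \<subseteq> SL2" "H1_eq S u v"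
 shows "H1_eq S v u"
 unfolding H1_eq_def
 by(rule coboundary_cong[OF coboundary_lin[OF assms(1) assms(2)[unfolded H1_eq_def] assms(2)[unfolded H1_eq_def], of "-1" 0]]) simp

lemma H1_eq_trans:
 assumes "S \<subseteq> SL2" "H1_eq S u v" "H1_eq S v w"
 shows "H1_eq S u w"
 unfolding H1_eq_def
 by(rule coboundary_cong[OF coboundary_lin[OF assms(1) assms(2)[unfolded H1_eq_def] assms(3)[unfolded H1_eq_def], of 1 1]]) simp

lemma H1_eq_lin3:
 assumes S: "S \<subseteq> SL2" and e: "H1_eq S u u'" "H1_eq S v v'" "H1_eq S w w'"
 shows "H1_eq S (\<lambda>M. x *\<^sub>R u M + y *\<^sub>R v M + z *\<^sub>R w M) (\<lambda>M. x *\<^sub>R u' M + y *\<^sub>R v' M + z *\<^sub>R w' M)"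
 using H1_eq_lin[OF S H1_eq_lin[OF S e(1,2), of x y] e(3), of 1 z] by simp

lemma H1_eq_cocycle:
 assumes S: "S \<subseteq> SL2" "\<And>M N. M \<in> S ==> N \<in> S ==> M ** N \<in> S" and e: "H1_eq S u v" and v: "cocycle S v"
 shows "cocycle S u"
proof -
 obtain X where X: "trace X = 0" "\<And>M. M \<in> S ==> u M - v M = X - Ad M X"
  using e unfolding H1_eq_def coboundary_def by blast
 have c: "cocycle S (\<lambda>M. v M + (X - Ad M X))"
  by(rule cocycle_add[OF S(1) v cocycle_coboundary[OF S(1) X(1)]])
 have uM: "u M = v M + (X - Ad M X)" if "M \<in> S" for M using X(2)[OF that] by(simp add: algebra_simps)
 show ?thesis unfolding cocycle_def
 proof (intro conjI ballI)
  show "trace (u M) = 0" if "M \<in> S" for M using c that unfolding cocycle_def uM[OF that] by blast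
  show "u (M ** N) = u M + Ad M (u N)" if "M \<in> S" "N \<in> S" for M N
   using c that unfolding cocycle_def uM[OF that(1)] uM[OF that(2)] uM[OF S(2)[OF that]] by blast
 qed
qed

lemma H1_basis_swap: "H1_basis S u v w ==> H1_basis S u w v"
proof -
 assume b: "H1_basis S u v w"
 have e: "a *\<^sub>R u M + x *\<^sub>R w M + y *\<^sub>R v M = a *\<^sub>R u M + y *\<^sub>R v M + x *\<^sub>R w M" for a x y M by(simp add: add_ac)
 show "H1_basis S u w v" using b unfolding H1_basis_def e by blast
qed

text \<open>Any relation is a multiple of the given one: subtracting the multiple that removes
  \<open>f1'\<close> leaves a relation among the three basis vectors.\<close>

lemma flip_coefficients:
 assumes S: "S \<subseteq> SL2" and b: "H1_basis S f1 f2 f3"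
  and r: "H1_eq S (\<lambda>M. l *\<^sub>R f1 M + l *\<^sub>R f1' M) (\<lambda>M. m2 *\<^sub>R f2 M + m3 *\<^sub>R f3 M)" and l: "l > 0" and m: "2 * l < m2 + m3"
 shows "\<exists>a a' b1 b2. flip_relation S f1 f1' f2 f3 a a' b1 b2"
  "\<forall>a a' b1 b2 c c' d1 d2. flip_relation S f1 f1' f2 f3 a a' b1 b2 \<and> flip_relation S f1 f1' f2 f3 c c' d1 d2 -->
   (\<exists>k>0. c = k * a \<and> c' = k * a' \<and> d1 = k * b1 \<and> d2 = k * b2)"
  "\<forall>a a' b1 b2. flip_relation S f1 f1' f2 f3 a a' b1 b2 --> a + a' < b1 + b2"
proof -
 show "\<exists>a a' b1 b2. flip_relation S f1 f1' f2 f3 a a' b1 b2"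
  unfolding flip_relation_def using r l m by(intro exI[of _ l] exI[of _ m2] exI[of _ m3]) simp
 have mult: "\<exists>t>0. a = t * l \<and> a' = t * l \<and> b1 = t * m2 \<and> b2 = t * m3" if R: "flip_relation S f1 f1' f2 f3 a a' b1 b2" for a a' b1 b2
 proof -
  \<comment> \<open>The factor for which the coefficient of \<open>f1'\<close> cancels.\<close>
  let ?t = "a' / l"
  have a: "a > 0" "a' > 0" and e: "H1_eq S (\<lambda>M. a *\<^sub>R f1 M + a' *\<^sub>R f1' M) (\<lambda>M. b1 *\<^sub>R f2 M + b2 *\<^sub>R f3 M)"
   using R by(simp_all add: flip_relation_def)
  have "coboundary S (\<lambda>M. 1 *\<^sub>R ((a *\<^sub>R f1 M + a' *\<^sub>R f1' M) - (b1 *\<^sub>R f2 M + b2 *\<^sub>R f3 M)) +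
    (- ?t) *\<^sub>R ((l *\<^sub>R f1 M + l *\<^sub>R f1' M) - (m2 *\<^sub>R f2 M + m3 *\<^sub>R f3 M)))"
   by(rule coboundary_lin[OF S e[unfolded H1_eq_def] r[unfolded H1_eq_def]])
  hence "H1_eq S (\<lambda>M. (a - a') *\<^sub>R f1 M + (?t * m2 - b1) *\<^sub>R f2 M + (?t * m3 - b2) *\<^sub>R f3 M) (\<lambda>M. 0)"
   unfolding H1_eq_def by(rule coboundary_cong) (use l in \<open>simp add: algebra_simps\<close>)
  hence "a - a' = 0 \<and> ?t * m2 - b1 = 0 \<and> ?t * m3 - b2 = 0" using b unfolding H1_basis_def by blast
  thus ?thesis using a l by(intro exI[of _ ?t]) auto
 qed
 show "\<forall>a a' b1 b2 c c' d1 d2. flip_relation S f1 f1' f2 f3 a a' b1 b2 \<and> flip_relation S f1 f1' f2 f3 c c' d1 d2 -->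
   (\<exists>k>0. c = k * a \<and> c' = k * a' \<and> d1 = k * b1 \<and> d2 = k * b2)"
 proof (intro allI impI, elim conjE)
  fix a a' b1 b2 c c' d1 d2
  assume R: "flip_relation S f1 f1' f2 f3 a a' b1 b2" "flip_relation S f1 f1' f2 f3 c c' d1 d2"
  obtain t where t: "t > 0" "a = t * l" "a' = t * l" "b1 = t * m2" "b2 = t * m3" using mult[OF R(1)] by blast
  obtain s where s: "s > 0" "c = s * l" "c' = s * l" "d1 = s * m2" "d2 = s * m3" using mult[OF R(2)] by blast
  show "\<exists>k>0. c = k * a \<and> c' = k * a' \<and> d1 = k * b1 \<and> d2 = k * b2"
   unfolding t(2-5) s(2-5) using t(1) s(1) by(intro exI[of _ "s / t"]) simp
 qed
 show "\<forall>a a' b1 b2. flip_relation S f1 f1' f2 f3 a a' b1 b2 --> a + a' < b1 + b2"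
 proof (intro allI impI)
  fix a a' b1 b2 assume "flip_relation S f1 f1' f2 f3 a a' b1 b2"
  then obtain t where t: "t > 0" "a = t * l" "a' = t * l" "b1 = t * m2" "b2 = t * m3" using mult by blast
  have "t * (2 * l) < t * (m2 + m3)" using m t(1) by simp
  thus "a + a' < b1 + b2" unfolding t(2-5) by(simp add: algebra_simps)
 qed
qed

text \<open>The equations say that a vector in space has zero cross product with two others, and
  \<open>h\<close> that those two are not parallel. Commutation of trace zero parts of 2 by 2
  matrices has this form.\<close>

lemma cross_zero:
 fixes p q r :: real
 assumes a: "q * a21 = a12 * r" "2 * p * a12 = q * dA" "2 * p * a21 = r * dA"
  and b: "q * b21 = b12 * r" "2 * p * b12 = q * dB" "2 * p * b21 = r * dB"
  and h: "a12 * b21 - a21 * b12 \<noteq> 0 \<or> b12 * dA - a12 * dB \<noteq> 0 \<or> a21 * dB - b21 * dA \<noteq> 0"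
 shows "p = 0 \<and> q = 0 \<and> r = 0"
proof -
 let ?h1 = "a12 * b21 - a21 * b12" and ?h2 = "b12 * dA - a12 * dB" and ?h3 = "a21 * dB - b21 * dA"
 have "q * ?h1 = a12 * (q * b21) - b12 * (q * a21)" by(simp add: algebra_simps)
 hence q1: "q * ?h1 = 0" unfolding a(1) b(1) by simp
 have "r * ?h1 = b21 * (a12 * r) - a21 * (b12 * r)" by(simp add: algebra_simps)
 hence r1: "r * ?h1 = 0" unfolding a(1)[symmetric] b(1)[symmetric] by simp
 have "2 * p * ?h1 = b21 * (2 * p * a12) - b12 * (2 * p * a21)" by(simp add: algebra_simps)
 also have "\<dots> = dA * (q * b21 - b12 * r)" unfolding a(2,3) by(simp add: algebra_simps)
 finally have p1: "2 * p * ?h1 = 0" unfolding b(1) by simp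
 have "q * ?h2 = b12 * (q * dA) - a12 * (q * dB)" by(simp add: algebra_simps)
 hence q2: "q * ?h2 = 0" unfolding a(2)[symmetric] b(2)[symmetric] by simp
 have "r * ?h3 = a21 * (r * dB) - b21 * (r * dA)" by(simp add: algebra_simps)
 hence r3: "r * ?h3 = 0" unfolding a(3)[symmetric] b(3)[symmetric] by simp
 have "r * ?h2 = b12 * (r * dA) - a12 * (r * dB)" by(simp add: algebra_simps)
 also have "\<dots> = - (2 * p * ?h1)" unfolding a(3)[symmetric] b(3)[symmetric] by(simp add: algebra_simps)
 finally have r2: "r * ?h2 = 0" unfolding p1 by simp
 have "q * ?h3 = a21 * (q * dB) - b21 * (q * dA)" by(simp add: algebra_simps)
 also have "\<dots> = - (2 * p * ?h1)" unfolding a(2)[symmetric] b(2)[symmetric] by(simp add: algebra_simps)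
 finally have q3: "q * ?h3 = 0" unfolding p1 by simp
 have "2 * p * ?h2 = dA * (2 * p * b12) - dB * (2 * p * a12)" by(simp add: algebra_simps)
 hence p2: "2 * p * ?h2 = 0" unfolding a(2) b(2) by simp
 have "2 * p * ?h3 = dB * (2 * p * a21) - dA * (2 * p * b21)" by(simp add: algebra_simps)
 hence p3: "2 * p * ?h3 = 0" unfolding a(3) b(3) by simp
 have k: "p = 0 \<and> q = 0 \<and> r = 0" if "x \<noteq> 0" "2 * p * x = 0" "q * x = 0" "r * x = 0" for x
  using that by simp
 from h show ?thesis using k[OF _ p1 q1 r1] k[OF _ p2 q2 r2] k[OF _ p3 q3 r3] by blast
qed

lemma commute_both_zero:
 fixes X :: "real^2^2"
 assumes t: "trace X = 0" and c: "X ** A = A ** X" "X ** B = B ** X" and n: "A ** B \<noteq> B ** A"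
 shows "X = 0"
proof -
 have X22: "X$2$2 = - X$1$1" using t by(simp add: trace2)
 have k: "X$1$2 * C$2$1 = C$1$2 * X$2$1" "2 * X$1$1 * C$1$2 = X$1$2 * (C$1$1 - C$2$2)"
  "2 * X$1$1 * C$2$1 = X$2$1 * (C$1$1 - C$2$2)" if "X ** C = C ** X" for C
 proof -
  have e: "(X ** C)$i$j = (C ** X)$i$j" for i j unfolding that ..
  have "X$1$1 * C$1$1 + X$1$2 * C$2$1 = C$1$1 * X$1$1 + C$1$2 * X$2$1" using e[of 1 1] unfolding mat_mult2 .
  thus "X$1$2 * C$2$1 = C$1$2 * X$2$1" by(simp only: mult.commute[of "C$1$1"] add_left_cancel)
  have "X$1$1 * C$1$2 + X$1$2 * C$2$2 = X$1$2 * C$1$1 - X$1$1 * C$1$2"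
   using e[of 1 2] unfolding mat_mult2 X22 by(simp add: mult.commute)
  thus "2 * X$1$1 * C$1$2 = X$1$2 * (C$1$1 - C$2$2)" unfolding right_diff_distrib by linarith
  have "X$2$1 * C$1$1 - X$1$1 * C$2$1 = X$1$1 * C$2$1 + X$2$1 * C$2$2"
   using e[of 2 1] unfolding mat_mult2 X22 by(simp add: mult.commute)
  thus "2 * X$1$1 * C$2$1 = X$2$1 * (C$1$1 - C$2$2)" unfolding right_diff_distrib by linarith
 qed
 have h: "A$1$2 * B$2$1 - A$2$1 * B$1$2 \<noteq> 0 \<or> B$1$2 * (A$1$1 - A$2$2) - A$1$2 * (B$1$1 - B$2$2) \<noteq> 0 \<or>
  A$2$1 * (B$1$1 - B$2$2) - B$2$1 * (A$1$1 - A$2$2) \<noteq> 0"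
 proof (rule ccontr)
  assume "\<not> ?thesis"
  hence z: "A$1$2 * B$2$1 - A$2$1 * B$1$2 = 0" "B$1$2 * (A$1$1 - A$2$2) - A$1$2 * (B$1$1 - B$2$2) = 0"
   "A$2$1 * (B$1$1 - B$2$2) - B$2$1 * (A$1$1 - A$2$2) = 0" by blast+
  have d: "x = y \<longleftrightarrow> x - y = 0" for x y :: real by simp
  have "(A ** B)$1$1 - (B ** A)$1$1 = A$1$2 * B$2$1 - A$2$1 * B$1$2"
   "(A ** B)$1$2 - (B ** A)$1$2 = B$1$2 * (A$1$1 - A$2$2) - A$1$2 * (B$1$1 - B$2$2)"
   "(A ** B)$2$1 - (B ** A)$2$1 = - (A$2$1 * (B$2$2 - B$1$1) + B$2$1 * (A$1$1 - A$2$2))"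
   "(A ** B)$2$2 - (B ** A)$2$2 = - (A$1$2 * B$2$1 - A$2$1 * B$1$2)"
   unfolding mat_mult2 by(simp_all add: algebra_simps)
  hence "A ** B = B ** A" unfolding mat_eq2 d[of "(A ** B)$_$_"] using z by(simp add: algebra_simps)
  thus False using n by simp
 qed
 from cross_zero[OF k[OF c(1)] k[OF c(2)] h] show ?thesis using X22 by(simp add: mat_eq2)
qed

section \<open>Cocycles on the extended group and the dimension count\<close>

context cusped_torus
begin

lemma G_sub: "\<Gamma> \<subseteq> SL2" and L_sub: "\<Lambda> \<subseteq> SL2" and G_L: "\<Gamma> \<subseteq> \<Lambda>"
 using G_SL2 ext_SL2 by(auto simp: ext_group_def)

lemma cocycle_one:
 assumes "cocycle S W" "mat 1 \<in> S"
 shows "W (mat 1) = 0"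
proof -
 have "W (mat 1 ** mat 1) = W (mat 1) + Ad (mat 1) (W (mat 1))" using assms unfolding cocycle_def by blast
 thus ?thesis by simp
qed

lemma cocycle_uminus:
 assumes c: "cocycle S W" and S: "S \<subseteq> SL2" "mat 1 \<in> S" "- mat 1 \<in> S" and g: "g \<in> S"
 shows "W (- g) = W g"
proof -
 have 1: "Ad (- mat 1) X = X" for X by(simp add: Ad_uminus)
 have "W (- mat 1 ** - mat 1) = W (- mat 1) + Ad (- mat 1) (W (- mat 1))" using c S(3) unfolding cocycle_def by blast
 hence "W (- mat 1) + W (- mat 1) = 0" using cocycle_one[OF c S(2)] by(simp add: 1 mat_uminus_left)
 hence "W (- mat 1) = 0" by(simp flip: scaleR_2)
 moreover have "W (- mat 1 ** g) = W (- mat 1) + Ad (- mat 1) (W g)" using c S(3) g unfolding cocycle_def by blast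
 ultimately show ?thesis by(simp add: 1 mat_uminus_left)
qed

lemma cocycle_zero_gens:
 assumes c: "cocycle \<Lambda> W" and t: "tri a b c" and z: "W (Jm a b) = 0" "W (Jm b c) = 0" "W (Jm c a) = 0" and g: "g \<in> \<Gamma>"
 shows "W g = 0"
proof -
 note t' = triD[OF t]
 have one: "mat 1 \<in> \<Lambda>" "- mat 1 \<in> \<Lambda>" by(simp_all add: ext_group_def)
 let ?H = "{M \<in> \<Lambda>. W M = 0}"
 have "\<Gamma> \<subseteq> ?H"
 proof (rule t'(10)[unfolded generating_def, THEN spec, THEN mp], intro conjI ballI)
  fix g h assume gh: "g \<in> ?H" "h \<in> ?H"
  hence "W (g ** h) = W g + Ad g (W h)" using c unfolding cocycle_def by blast
  thus "g ** h \<in> ?H" using gh ext_mult Ad_lin(5)[OF ext_SL2] by simp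
 next
  fix g assume "g \<in> ?H"
  thus "- g \<in> ?H" using cocycle_uminus[OF c L_sub one, of g] ext_uminus by simp
 qed (use z t'(4-6) odd_ext in simp_all)
 thus ?thesis using g by blast
qed

lemma commute_AB_zero:
 assumes "trace X = 0" "\<And>g. g \<in> \<Gamma> ==> Ad g X = X"
 shows "X = 0"
proof (rule commute_both_zero[OF assms(1), of A B])
 have "X ** g = g ** X" if g: "g \<in> \<Gamma>" for g
 proof -
  have gS: "g \<in> SL2" using G_SL2 g by blast
  have "X ** g = (g ** X ** adj g) ** g" using assms(2)[OF g] by(simp add: Ad_SL2[OF gS])
  also have "\<dots> = g ** X" by(simp add: matrix_mul_assoc[symmetric] adj_mult[OF gS])
  finally show ?thesis .
 qed
 thus "X ** A = A ** X" "X ** B = B ** X" using A_G B_G by blast+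
 show "A ** B \<noteq> B ** A"
 proof
  assume "A ** B = B ** A"
  hence "hyp = 0" by(simp add: hyp_def)
  thus False using hyp_SL2 by(simp add: SL2_iff)
 qed
qed

text \<open>Evaluating at \<open>g ** J = J ** (adj J ** g ** J)\<close> in both ways shows that
  \<open>W J\<close> is invariant under \<Gamma>, hence zero by \<open>commute_AB_zero\<close>. So a
  relation on \<Gamma> may be tested at half turns.\<close>

lemma cocycle_zero_ext:
 assumes c: "cocycle \<Lambda> W" and z: "\<And>g. g \<in> \<Gamma> ==> W g = 0" and J: "J \<in> \<Delta>"
 shows "W J = 0"
proof (rule commute_AB_zero)
 have JL: "J \<in> \<Lambda>" by(rule odd_ext[OF J])
 have JS: "J \<in> SL2" by(rule odd_SL2[OF J])
 show "trace (W J) = 0" using c JL unfolding cocycle_def by blast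
 fix g assume g: "g \<in> \<Gamma>"
 have gL: "g \<in> \<Lambda>" using g G_L by blast
 let ?k = "adj J ** g ** J"
 have k: "?k \<in> \<Gamma>" using odd_odd[OF odd_even[OF odd_adj[OF J] g] J] .
 have kL: "?k \<in> \<Lambda>" using k G_L by blast
 have "g ** J = J ** ?k" by(simp add: matrix_mul_assoc[symmetric] adj_cancel_left[OF JS])
 moreover have "W (g ** J) = W g + Ad g (W J)" "W (J ** ?k) = W J + Ad J (W ?k)"
  using c gL JL kL unfolding cocycle_def by blast+
 ultimately show "Ad g (W J) = W J" using z[OF g] z[OF k] Ad_lin(5)[OF JS] by simp
qed

lemma cocycle_zero_AB:
 assumes c: "cocycle \<Gamma> W" and z: "W A = 0" "W B = 0" and g: "g \<in> \<Gamma>"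
 shows "W g = 0"
proof -
 have one: "mat 1 \<in> \<Gamma>" "- mat 1 \<in> \<Gamma>" by simp_all
 have mul: "W (M ** N) = W M + Ad M (W N)" if "M \<in> \<Gamma>" "N \<in> \<Gamma>" for M N using c that unfolding cocycle_def by blast
 have inv: "W (adj M) = 0" if M: "M \<in> \<Gamma>" "W M = 0" for M
 proof -
  have MS: "M \<in> SL2" using G_SL2 M by blast
  have "W (adj M ** M) = W (adj M) + Ad (adj M) (W M)" by(rule mul) (use M in simp_all)
  thus ?thesis using cocycle_one[OF c one(1)] M(2) MS by(simp add: adj_mult Ad_lin)
 qed
 have "\<Gamma> \<subseteq> {M \<in> \<Gamma>. W M = 0}"
 proof (rule G_minimal)
  show "M ** N \<in> {M \<in> \<Gamma>. W M = 0}" if "M \<in> {M \<in> \<Gamma>. W M = 0}" "N \<in> {M \<in> \<Gamma>. W M = 0}" for M N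
   using that mul G_mult Ad_lin(5)[OF G_SL2] by simp
  show "- M \<in> {M \<in> \<Gamma>. W M = 0}" if "M \<in> {M \<in> \<Gamma>. W M = 0}" for M
   using that cocycle_uminus[OF c G_sub one, of M] by simp
 qed (use z inv A_G B_G cocycle_one[OF c one(1)] in simp_all)
 thus ?thesis using g by blast
qed

text \<open>The condition also asks for \<open>X = 0\<close>: it is the injectivity of a linear map
  from a space of dimension six, three coefficients and a trace zero matrix, which is the input of
  the dimension count.\<close>

definition independent_cocycles :: "(real^2^2 => real^2^2) => (real^2^2 => real^2^2) => (real^2^2 => real^2^2) => bool" where
 "independent_cocycles u v w \<longleftrightarrow> cocycle \<Gamma> u \<and> cocycle \<Gamma> v \<and> cocycle \<Gamma> w \<and>
  (\<forall>x y z X. trace X = 0 \<and> (\<forall>M\<in>\<Gamma>. x *\<^sub>R u M + y *\<^sub>R v M + z *\<^sub>R w M + (X - Ad M X) = 0) -->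
    x = 0 \<and> y = 0 \<and> z = 0 \<and> X = 0)"

text \<open>Cocycles are determined by their values at the two generators, so the space of cocycles has
 dimension at most six; three independent classes and the coboundaries already span it.\<close>

lemma independent_spanning:
 assumes i: "independent_cocycles u v w" and h: "cocycle \<Gamma> h"
 shows "\<exists>x y z X. trace X = 0 \<and> (\<forall>M\<in>\<Gamma>. h M = x *\<^sub>R u M + y *\<^sub>R v M + z *\<^sub>R w M + (X - Ad M X))"
proof -
 have c: "cocycle \<Gamma> u" "cocycle \<Gamma> v" "cocycle \<Gamma> w" using i by(simp_all add: independent_cocycles_def)
 \<comment> \<open>\<open>mt\<close> and \<open>pr\<close> identify trace zero matrices with triples
   of reals, so that \<open>L\<close> is an endomorphism of a space of dimension six, where
   injective implies surjective.\<close>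
 define mt where "mt = (\<lambda>t :: real \<times> real \<times> real. mat2 (fst t) (fst (snd t)) (snd (snd t)) (- fst t))"
 define pr where "pr = (\<lambda>M :: real^2^2. (M$1$1, M$1$2, M$2$1))"
 have mt_lin: "mt (s + t) = mt s + mt t" "mt (r *\<^sub>R t) = r *\<^sub>R mt t" and mt_trace: "trace (mt t) = 0" for s t r
  by(simp_all add: mt_def mat_eq2 trace2)
 have pr_lin: "pr (M + N) = pr M + pr N" "pr (r *\<^sub>R M) = r *\<^sub>R pr M" for M N r by(simp_all add: pr_def)
 have pr_zero: "M = N" if "trace M = 0" "trace N = 0" "pr M = pr N" for M N
  using that by(simp add: pr_def trace2 mat_eq2)
 define W where "W = (\<lambda>p :: (real \<times> real \<times> real) \<times> (real \<times> real \<times> real). \<lambda>M.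
  fst (fst p) *\<^sub>R u M + fst (snd (fst p)) *\<^sub>R v M + snd (snd (fst p)) *\<^sub>R w M + (mt (snd p) - Ad M (mt (snd p))))"
 have W_lin: "W (p + p') M = W p M + W p' M" "W (r *\<^sub>R p) M = r *\<^sub>R W p M" if "M \<in> SL2" for p p' r M
  using that by(simp_all add: W_def mt_lin Ad_lin algebra_simps)
 have W_coc: "cocycle \<Gamma> (W p)" for p unfolding W_def
  by(intro cocycle_add[OF G_sub] cocycle_scale[OF G_sub] cocycle_coboundary[OF G_sub] c mt_trace)
 define L where "L = (\<lambda>p. (pr (W p A), pr (W p B)))"
 have lin: "linear L"
  by(rule linearI) (simp_all add: L_def W_lin[OF A_SL2] W_lin[OF B_SL2] pr_lin)
 have tr: "trace (f A) = 0" "trace (f B) = 0" if "cocycle \<Gamma> f" for f using that A_G B_G by(auto simp: cocycle_def)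
 have "p = 0" if "L p = 0" for p
 proof -
  have "pr (W p A) = pr 0" "pr (W p B) = pr 0" using that by(simp_all add: L_def pr_def zero_prod_def)
  hence "W p A = 0" "W p B = 0" using pr_zero tr[OF W_coc, of p] by(simp_all add: trace_lin)
  hence "\<forall>M\<in>\<Gamma>. W p M = 0" using cocycle_zero_AB[OF W_coc] by blast
  hence "fst (fst p) = 0 \<and> fst (snd (fst p)) = 0 \<and> snd (snd (fst p)) = 0 \<and> mt (snd p) = 0"
   using i mt_trace unfolding independent_cocycles_def W_def by blast
  thus ?thesis by(simp add: prod_eq_iff mt_def mat_eq2)
 qed
 hence "inj L" using linear_injective_0[OF lin] by blast
 hence "surj L" using linear_injective_imp_surjective[OF lin] by blast
 then obtain p where p: "L p = (pr (h A), pr (h B))" by(metis surjD)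
 have c': "cocycle \<Gamma> (\<lambda>M. 1 *\<^sub>R W p M + (-1) *\<^sub>R h M)"
  by(intro cocycle_add[OF G_sub] cocycle_scale[OF G_sub] W_coc h)
 have "W p A = h A" "W p B = h B" using p pr_zero tr[OF W_coc, of p] tr[OF h] by(simp_all add: L_def)
 hence "h M = W p M" if "M \<in> \<Gamma>" for M using cocycle_zero_AB[OF c' _ _ that] by simp
 thus ?thesis unfolding W_def using mt_trace by blast
qed

lemma independent_H1_basis:
 assumes i: "independent_cocycles u v w" and e: "H1_eq \<Gamma> f u" "H1_eq \<Gamma> g v" "H1_eq \<Gamma> h w"
 shows "H1_basis \<Gamma> f g h"
 unfolding H1_basis_def
proof (intro conjI allI impI)
 have c: "cocycle \<Gamma> u" "cocycle \<Gamma> v" "cocycle \<Gamma> w" using i by(simp_all add: independent_cocycles_def)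
 show "cocycle \<Gamma> f" by(rule H1_eq_cocycle[OF G_sub G_mult e(1) c(1)])
 show "cocycle \<Gamma> g" by(rule H1_eq_cocycle[OF G_sub G_mult e(2) c(2)])
 show "cocycle \<Gamma> h" by(rule H1_eq_cocycle[OF G_sub G_mult e(3) c(3)])
 have E: "H1_eq \<Gamma> (\<lambda>M. x *\<^sub>R f M + y *\<^sub>R g M + z *\<^sub>R h M) (\<lambda>M. x *\<^sub>R u M + y *\<^sub>R v M + z *\<^sub>R w M)" for x y z
  by(rule H1_eq_lin3[OF G_sub e])
 have "x = 0 \<and> y = 0 \<and> z = 0" if a: "H1_eq \<Gamma> (\<lambda>M. x *\<^sub>R f M + y *\<^sub>R g M + z *\<^sub>R h M) (\<lambda>M. 0)" for x y z
 proof -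
  have "H1_eq \<Gamma> (\<lambda>M. x *\<^sub>R u M + y *\<^sub>R v M + z *\<^sub>R w M) (\<lambda>M. 0)"
   by(rule H1_eq_trans[OF G_sub H1_eq_sym[OF G_sub E] a])
  then obtain X where X: "trace X = 0" "\<And>M. M \<in> \<Gamma> ==> x *\<^sub>R u M + y *\<^sub>R v M + z *\<^sub>R w M = X - Ad M X"
   unfolding H1_eq_def coboundary_def by auto
  have "x *\<^sub>R u M + y *\<^sub>R v M + z *\<^sub>R w M + (- X - Ad M (- X)) = 0" if "M \<in> \<Gamma>" for M
   unfolding X(2)[OF that] Ad_lin(4)[OF G_SL2[OF that]] by simp
  moreover have "trace (- X) = 0" using X(1) by(simp add: trace_lin)
  ultimately show ?thesis using i unfolding independent_cocycles_def by blast
 qed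
 thus "x = 0" "y = 0" "z = 0" if "H1_eq \<Gamma> (\<lambda>M. x *\<^sub>R f M + y *\<^sub>R g M + z *\<^sub>R h M) (\<lambda>M. 0)" for x y z
  using that by blast+
 fix k assume "cocycle \<Gamma> k"
 then obtain x y z X where X: "trace X = 0" "\<And>M. M \<in> \<Gamma> ==> k M = x *\<^sub>R u M + y *\<^sub>R v M + z *\<^sub>R w M + (X - Ad M X)"
  using independent_spanning[OF i] by blast
 have "H1_eq \<Gamma> k (\<lambda>M. x *\<^sub>R u M + y *\<^sub>R v M + z *\<^sub>R w M)"
  unfolding H1_eq_def coboundary_def using X by(intro exI[of _ X]) auto
 hence "H1_eq \<Gamma> k (\<lambda>M. x *\<^sub>R f M + y *\<^sub>R g M + z *\<^sub>R h M)"
  by(rule H1_eq_trans[OF G_sub _ H1_eq_sym[OF G_sub E]])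
 thus "\<exists>a b c. H1_eq \<Gamma> k (\<lambda>M. a *\<^sub>R f M + b *\<^sub>R g M + c *\<^sub>R h M)" by blast
qed

end

context simple_geodesic
begin

lemma strip_cocycle_ext:
 assumes J: "Jm u v \<in> \<Delta>" and z0: "Im z0 > 0"
 shows "cocycle \<Lambda> (\<lambda>g. strip z0 (moeb g z0))"
 unfolding cocycle_def
proof (intro conjI ballI)
 fix M N assume M: "M \<in> \<Lambda>" and N: "N \<in> \<Lambda>"
 have I: "Im (moeb g z) > 0" if "g \<in> \<Lambda>" "Im z > 0" for g z
  using moeb_half_plane[OF ext_SL2[OF that(1)], of z] that(2) by(simp add: half_plane_iff)
 have "strip z0 (moeb (M ** N) z0) = strip z0 (moeb M z0) + strip (moeb M z0) (moeb M (moeb N z0))"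
  unfolding moeb_mult[OF ext_SL2[OF M] ext_SL2[OF N] z0]
  by(rule strip_add[OF z0 I[OF M z0] I[OF M I[OF N z0]]])
 thus "strip z0 (moeb (M ** N) z0) = strip z0 (moeb M z0) + Ad M (strip z0 (moeb N z0))"
  unfolding strip_ext[OF J M z0 I[OF N z0]] .
qed simp

end

section \<open>The relation of a flip and its inequality\<close>

context cusped_torus
begin

text \<open>The conditions on the sides make each strip cocycle nonzero at exactly one of the three
  half turns.\<close>

definition good :: "real^2 => real^2 => real^2 => bool" where
 "good a b c \<longleftrightarrow> tri a b c \<and> simple_pair a b \<and> simple_pair b c \<and> simple_pair c a \<and>
  unlinked_pairs a b b c \<and> unlinked_pairs b c c a \<and> unlinked_pairs c a a b \<and>
  q ` line a b \<noteq> q ` line b c \<and> q ` line b c \<noteq> q ` line c a \<and> q ` line c a \<noteq> q ` line a b"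

lemma unlinked_pairs_sym: "unlinked_pairs p r p' r' ==> unlinked_pairs p' r' p r"
proof -
 assume u: "unlinked_pairs p r p' r'"
 show ?thesis unfolding unlinked_pairs_def
 proof (intro ballI)
  fix g h assume "g \<in> \<Gamma>" "h \<in> \<Gamma>"
  hence "\<not> linked (h *v p) (h *v r) (g *v p') (g *v r')" using u unfolding unlinked_pairs_def by blast
  thus "\<not> linked (g *v p') (g *v r') (h *v p) (h *v r)"
   unfolding linked_sym[of "g *v p'" "g *v r'" "h *v p" "h *v r"] .
 qed
qed

lemma unlinked_pairsD: "unlinked_pairs p r p' r' ==> g \<in> \<Gamma> ==> \<not> linked (g *v p) (g *v r) p' r'"
proof -
 assume "unlinked_pairs p r p' r'" "g \<in> \<Gamma>"
 hence "\<not> linked (g *v p) (g *v r) (mat 1 *v p') (mat 1 *v r')" using G_one unfolding unlinked_pairs_def by blast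
 thus ?thesis by simp
qed

lemma good_rot:
 assumes "good a b c"
 shows "good b c a"
 using assms tri_rot[of a b c] unfolding good_def by(elim conjE) (intro conjI; assumption | erule not_sym)

lemma goodI:
 assumes t: "tri a b c" and e: "is_edge b c p0 r0" "is_edge c a p1 r1" "is_edge a b p2 r2"
  and s: "simple_pair p0 r0" "simple_pair p1 r1" "simple_pair p2 r2"
  and u: "unlinked_pairs p0 r0 p1 r1" "unlinked_pairs p1 r1 p2 r2" "unlinked_pairs p2 r2 p0 r0"
  and d: "q ` line p0 r0 \<noteq> q ` line p1 r1" "q ` line p1 r1 \<noteq> q ` line p2 r2" "q ` line p2 r2 \<noteq> q ` line p0 r0"
 shows "good a b c"
 unfolding good_def
proof (intro conjI t is_edge_simple[OF e(1) s(1)] is_edge_simple[OF e(2) s(2)] is_edge_simple[OF e(3) s(3)])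
 show "unlinked_pairs a b b c" by(rule unlinked_pairsI[OF unlinked_pairs_edges[OF u(3) e(3,1)]])
 show "unlinked_pairs b c c a" by(rule unlinked_pairsI[OF unlinked_pairs_edges[OF u(1) e(1,2)]])
 show "unlinked_pairs c a a b" by(rule unlinked_pairsI[OF unlinked_pairs_edges[OF u(2) e(2,3)]])
 show "q ` line a b \<noteq> q ` line b c" "q ` line b c \<noteq> q ` line c a" "q ` line c a \<noteq> q ` line a b"
  unfolding is_edge_line[OF e(1)] is_edge_line[OF e(2)] is_edge_line[OF e(3)] by(rule d)+
qed

text \<open>The values of the other two strip cocycles follow by \<open>good_rot\<close>, since the
  base point is symmetric in the three vertices.\<close>

lemma good_values:
 assumes g: "good a b c"
  and z: "Im z > 0" "K > 0" "\<And>p r. side p r z = K * (sg p r a + sg p r b + sg p r c)"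
 shows "strp b c z (moeb (Jm b c) z) = - tv b c" "strp b c z (moeb (Jm c a) z) = 0" "strp b c z (moeb (Jm a b) z) = 0"
proof -
 have t: "tri a b c" and s: "simple_pair b c" and U: "unlinked_pairs a b b c" "unlinked_pairs b c c a"
  and d: "q ` line a b \<noteq> q ` line b c" "q ` line b c \<noteq> q ` line c a"
  using g by(simp_all add: good_def)
 note t' = triD[OF t]
 have u1: "\<not> linked (g *v b) (g *v c) a b" if "g \<in> \<Gamma>" for g by(rule unlinked_pairsD[OF unlinked_pairs_sym[OF U(1)] that])
 have u2: "\<not> linked (g *v b) (g *v c) c a" if "g \<in> \<Gamma>" for g by(rule unlinked_pairsD[OF U(2) that])
 have u3: "\<not> linked (g *v b) (g *v c) b c" if "g \<in> \<Gamma>" for g using family_unlinked[OF s that G_one] by simp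
 have z2: "side p r z = K * (sg p r b + sg p r c + sg p r a)" for p r unfolding z(3) by(simp add: add_ac)
 have z3: "side p r z = K * (sg p r c + sg p r a + sg p r b)" for p r unfolding z(3) by(simp add: add_ac)
 show "strp b c z (moeb (Jm b c) z) = - tv b c" by(rule strip_own_side[OF t s u1 u2 z])
 have n2: "\<not> is_edge c a b c" using is_edge_line[of c a b c] d(2) by auto
 show "strp b c z (moeb (Jm c a) z) = 0"
  by(rule strip_other_side[OF tri_rot[OF t] s t'(2,5) u3 u2 u1 z(1,2) z2 n2])
 have n3: "\<not> is_edge a b b c" using is_edge_line[of a b b c] d(1) by auto
 show "strp b c z (moeb (Jm a b) z) = 0"
  by(rule strip_other_side[OF tri_rot[OF tri_rot[OF t]] s t'(2,5) u2 u1 u3 z(1,2) z3 n3])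
qed

lemma strp_cocycle:
 assumes "simple_pair b c" "dt b c > 0" "Jm b c \<in> \<Delta>" "Im z > 0"
 shows "cocycle \<Lambda> (\<lambda>g. strp b c z (moeb g z))" "cocycle \<Gamma> (\<lambda>g. strp b c z (moeb g z))"
proof -
 interpret simple_geodesic A B q b c using assms(1,2) by unfold_locales
 show "cocycle \<Lambda> (\<lambda>g. strp b c z (moeb g z))" by(rule strip_cocycle_ext[OF assms(3,4)])
 show "cocycle \<Gamma> (\<lambda>g. strp b c z (moeb g z))" by(rule strip_cocycle_value[OF assms(4)])
qed

text \<open>Trace zero matrices correspond to symmetric bilinear forms through
  \<open>dt\<close>.\<close>

lemma dt_trace0_sym: "trace X = 0 ==> dt (X *v v) w = dt (X *v w) v"
 by(simp add: trace2 dt_def algebra_simps) (simp add: add_eq_0_iff algebra_simps)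

text \<open>Consider the symmetric form of \<open>X\<close> at the pair \<open>b\<close>,
  \<open>c\<close>. The half turn changes its sign there, and the form of \<open>tv b c\<close>
  vanishes there; so twice the value is zero.\<close>

lemma side_equation:
 assumes d: "dt b c \<noteq> 0" and t: "trace X = 0" and e: "x *\<^sub>R tv b c = X - Ad (Jm b c) X"
 shows "dt (X *v b) c = 0"
proof -
 let ?J = "Jm b c"
 have J: "?J \<in> SL2" by(rule Jm_SL2[OF d])
 have aJ: "adj ?J *v b = - c" "adj ?J *v c = b" unfolding adj_Jm using Jm_left[OF d] Jm_right[OF d] by simp_all
 have "dt (Ad ?J X *v b) c = dt (?J *v (X *v (adj ?J *v b))) (?J *v (adj ?J *v c))"
  unfolding Ad_SL2[OF J] adj_cancel_vec(2)[OF J] by(simp only: mat_vec_assoc matrix_mul_assoc)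
 also have "\<dots> = - dt (X *v c) b" unfolding dt_mat[OF J] aJ by(simp add: dt_lin)
 also have "\<dots> = - dt (X *v b) c" using dt_trace0_sym[OF t, of c b] by simp
 finally have 1: "dt (Ad ?J X *v b) c = - dt (X *v b) c" .
 have "dt (tv b c *v b) c = 0"
  unfolding tv_def by(simp add: mat_add_vec matrix_vector_mult_diff_rdistrib nil_vec dt_lin)
 hence "dt ((x *\<^sub>R tv b c) *v b) c = 0" by(simp add: mat_add_vec dt_lin)
 hence "dt (X *v b) c - dt (Ad ?J X *v b) c = 0"
  unfolding e by(simp add: matrix_vector_mult_diff_rdistrib dt_lin)
 thus ?thesis unfolding 1 by simp
qed

lemma tv_nonzero: "dt b c \<noteq> 0 ==> tv b c \<noteq> 0"
 using nil_eq_imp[of b c] by(auto simp: tv_def)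

text \<open>A relation on \<Gamma> extends to the half turns by \<open>cocycle_zero_ext\<close>.
  There it reads as three equations of the kind of \<open>side_equation\<close>, which make the form
  of \<open>X\<close> vanish on all pairs of distinct vertices, hence \<open>X = 0\<close>; then
  each coefficient multiplies a single nonzero translation.\<close>

lemma good_independent:
 assumes g: "good a b c"
  and z: "Im z > 0" "K > 0" "\<And>p r. side p r z = K * (sg p r a + sg p r b + sg p r c)"
 shows "independent_cocycles (\<lambda>g. strp b c z (moeb g z)) (\<lambda>g. strp c a z (moeb g z)) (\<lambda>g. strp a b z (moeb g z))"
  (is "independent_cocycles ?u ?v ?w")
proof -
 have t: "tri a b c" and s: "simple_pair a b" "simple_pair b c" "simple_pair c a" using g by(simp_all add: good_def)
 note t' = triD[OF t]
 have z2: "side p r z = K * (sg p r b + sg p r c + sg p r a)" for p r unfolding z(3) by(simp add: add_ac)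
 have z3: "side p r z = K * (sg p r c + sg p r a + sg p r b)" for p r unfolding z(3) by(simp add: add_ac)
 note v1 = good_values[OF g z]
 note v2 = good_values[OF good_rot[OF g] z(1,2) z2]
 note v3 = good_values[OF good_rot[OF good_rot[OF g]] z(1,2) z3]
 note c1 = strp_cocycle[OF s(2) t'(2,5) z(1)]
 note c2 = strp_cocycle[OF s(3) t'(3,6) z(1)]
 note c3 = strp_cocycle[OF s(1) t'(1,4) z(1)]
 have key: "x = 0 \<and> y = 0 \<and> w = 0 \<and> X = 0"
  if X: "trace X = 0" and e: "\<forall>M\<in>\<Gamma>. x *\<^sub>R ?u M + y *\<^sub>R ?v M + w *\<^sub>R ?w M + (X - Ad M X) = 0" for x y w X
 proof -
  let ?W = "\<lambda>M. x *\<^sub>R ?u M + y *\<^sub>R ?v M + w *\<^sub>R ?w M + (X - Ad M X)"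
  have cW: "cocycle \<Lambda> ?W"
   by(intro cocycle_add[OF L_sub] cocycle_scale[OF L_sub] cocycle_coboundary[OF L_sub] c1(1) c2(1) c3(1) X)
  have W0: "?W J = 0" if "J \<in> \<Delta>" for J by(rule cocycle_zero_ext[OF cW _ that]) (rule e[THEN bspec])
  have E1: "x *\<^sub>R tv b c = X - Ad (Jm b c) X" using W0[OF t'(5)] unfolding v1 v2 v3 by simp
  have E2: "y *\<^sub>R tv c a = X - Ad (Jm c a) X" using W0[OF t'(6)] unfolding v1 v2 v3 by simp
  have E3: "w *\<^sub>R tv a b = X - Ad (Jm a b) X" using W0[OF t'(4)] unfolding v1 v2 v3 by simp
  have P: "dt (X *v b) c = 0" "dt (X *v c) a = 0" "dt (X *v a) b = 0"
   using side_equation[OF t'(12) X E1] side_equation[OF t'(13) X E2] side_equation[OF t'(11) X E3] .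
  have P': "dt (X *v c) b = 0" "dt (X *v a) c = 0" "dt (X *v b) a = 0"
   using P dt_trace0_sym[OF X, of b c] dt_trace0_sym[OF X, of c a] dt_trace0_sym[OF X, of a b] by simp_all
  have Xa: "X *v a = 0"
   by(rule dt_basis_eq[OF t'(12)]) (use P(3) P'(2) dt_swap[of b "X *v a"] dt_swap[of c "X *v a"] in \<open>simp_all add: dt_lin\<close>)
  have Xb: "X *v b = 0"
   by(rule dt_basis_eq[OF t'(13)]) (use P(1) P'(3) dt_swap[of a "X *v b"] dt_swap[of c "X *v b"] in \<open>simp_all add: dt_lin\<close>)
  have X0: "X = 0" by(rule mat_basis_eq[OF t'(11)]) (use Xa Xb in simp_all)
  show ?thesis
   using E1 E2 E3 tv_nonzero[OF t'(12)] tv_nonzero[OF t'(13)] tv_nonzero[OF t'(11)]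
    Ad_lin(5)[OF Jm_SL2[OF t'(12)]] Ad_lin(5)[OF Jm_SL2[OF t'(13)]] Ad_lin(5)[OF Jm_SL2[OF t'(11)]]
   unfolding X0 by simp
 qed
 show ?thesis unfolding independent_cocycles_def
  by(rule conjI[OF c1(2) conjI[OF c2(2) conjI[OF c3(2)]]], intro allI impI, elim conjE, rule key; assumption)
qed

text \<open>In the basis \<open>b\<close>, \<open>c\<close> the coordinates of \<open>a'\<close> are
  (x, -y) and those of \<open>a\<close> are (-y, -x): orthogonal vectors of equal length, whose
  squares add up to x^2 + y^2 times those of the basis. The number \<open>n\<close> is the inverse
  of x^2 + y^2, and the second identity is Ptolemy's relation, so \<open>n\<close> is the ratio of
  the lambda lengths of the two diagonals.\<close>

lemma tri_nil_relation:
 assumes t: "tri a b c"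
 defines "a' \<equiv> Jm b c *v a" and "n \<equiv> (dt b c)\<^sup>2 / ((dt c a)\<^sup>2 + (dt a b)\<^sup>2)"
 shows "n *\<^sub>R (nil a' + nil a) = nil b + nil c" "n * dt a' a = - dt b c" "n > 0"
proof -
 note t' = triD[OF t]
 let ?l1 = "dt b c" and ?l2 = "dt c a" and ?l3 = "dt a b"
 have ac: "dt a c = - ?l2" and ba: "dt b a = - ?l3" and cb: "dt c b = - ?l1"
  by(simp_all only: dt_swap[of a c] dt_swap[of b a] dt_swap[of c b])
 have l: "?l1 > 0" "?l2 > 0" "?l3 > 0" using t' by auto
 define x y where "x = ?l3 / ?l1" and "y = ?l2 / ?l1"
 have a': "a' = x *\<^sub>R b - y *\<^sub>R c"
  unfolding a'_def Jm_vec[OF t'(12)] x_def y_def by(simp add: ac ba scaleR_diff_right scaleR_add_right)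
 have a: "a = (- y) *\<^sub>R b + (- x) *\<^sub>R c"
 proof -
  have "?l1 *\<^sub>R a = (- ?l2) *\<^sub>R b + (- ?l3) *\<^sub>R c" using dt_expand[of b c a] unfolding ac ba .
  hence "(1 / ?l1) *\<^sub>R (?l1 *\<^sub>R a) = (1 / ?l1) *\<^sub>R ((- ?l2) *\<^sub>R b + (- ?l3) *\<^sub>R c)" by simp
  thus ?thesis using l by(simp add: x_def y_def scaleR_add_right scaleR_diff_right)
 qed
 have s: "x\<^sup>2 + y\<^sup>2 > 0" using l by(simp add: x_def y_def add_pos_pos)
 have n: "n * (x\<^sup>2 + y\<^sup>2) = 1"
 proof -
  have p: "?l2\<^sup>2 + ?l3\<^sup>2 \<noteq> 0" using l by(simp add: sum_power2_eq_zero_iff)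
  have e: "x\<^sup>2 + y\<^sup>2 = (?l2\<^sup>2 + ?l3\<^sup>2) / ?l1\<^sup>2" by(simp add: x_def y_def power_divide add_divide_distrib)
  have gen: "u / v * (v / u) = 1" if "u \<noteq> 0" "v \<noteq> 0" for u v :: real using that by simp
  show ?thesis unfolding n_def e by(rule gen[OF _ p]) (use l in simp)
 qed
 have 1: "nil (x *\<^sub>R b - y *\<^sub>R c) + nil ((- y) *\<^sub>R b + (- x) *\<^sub>R c) = (x\<^sup>2 + y\<^sup>2) *\<^sub>R (nil b + nil c)"
  by(simp add: mat_eq2 nil_def power2_eq_square algebra_simps)
 hence "nil a' + nil a = (x\<^sup>2 + y\<^sup>2) *\<^sub>R (nil b + nil c)" unfolding a[symmetric] a'[symmetric] .
 thus "n *\<^sub>R (nil a' + nil a) = nil b + nil c" using n by(simp only: scaleR_scaleR scaleR_one)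
 have "dt (x *\<^sub>R b - y *\<^sub>R c) ((- y) *\<^sub>R b + (- x) *\<^sub>R c) = - ((x\<^sup>2 + y\<^sup>2) * ?l1)"
  by(simp add: dt_lin cb power2_eq_square algebra_simps)
 hence d: "dt a' a = - ((x\<^sup>2 + y\<^sup>2) * ?l1)" unfolding a[symmetric] a'[symmetric] .
 have "n * dt a' a = - (n * (x\<^sup>2 + y\<^sup>2)) * ?l1" unfolding d by(simp add: algebra_simps)
 thus "n * dt a' a = - ?l1" using n by simp
 have "(?l2\<^sup>2 + ?l3\<^sup>2) > 0" using l by(simp add: add_pos_pos)
 thus "n > 0" unfolding n_def using l by simp
qed

lemma flip_length_inequality:
 fixes l1 l2 l3 :: real
 assumes l: "0 < l1" "0 < l2" "0 < l3"
 shows "2 * l1 < (l2 + l3) * (1 + l1\<^sup>2 / (l2\<^sup>2 + l3\<^sup>2))"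
proof -
 define r where "r = sqrt (l2\<^sup>2 + l3\<^sup>2)"
 have p: "l2\<^sup>2 + l3\<^sup>2 > 0" using l by(simp add: add_pos_pos)
 have r: "r > 0" "r\<^sup>2 = l2\<^sup>2 + l3\<^sup>2" using p by(simp_all add: r_def)
 have "(l2 + l3)\<^sup>2 = l2\<^sup>2 + l3\<^sup>2 + 2 * (l2 * l3)" by(simp add: power2_sum)
 moreover have "l2 * l3 > 0" using l by simp
 ultimately have sq: "r\<^sup>2 < (l2 + l3)\<^sup>2" unfolding r(2) by linarith
 have lt: "r < l2 + l3" by(rule power2_less_imp_less[OF sq]) (use l in simp)
 have "(r - l1)\<^sup>2 = r\<^sup>2 + l1\<^sup>2 - 2 * l1 * r" by(simp add: power2_diff)
 hence "2 * l1 * r \<le> r\<^sup>2 + l1\<^sup>2" using zero_le_power2[of "r - l1"] by linarith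
 hence "2 * l1 \<le> (r\<^sup>2 + l1\<^sup>2) / r" by(simp only: pos_le_divide_eq[OF r(1)])
 also have "\<dots> = r * (1 + l1\<^sup>2 / r\<^sup>2)"
  using r(1) by(simp only: power2_eq_square add_divide_distrib distrib_left) simp
 also have "\<dots> < (l2 + l3) * (1 + l1\<^sup>2 / r\<^sup>2)"
  by(rule mult_strict_right_mono[OF lt add_pos_nonneg]) simp_all
 finally show ?thesis unfolding r(2) .
qed

text \<open>The linear content of the relation at the three half turns, with the squares of the
  vectors as abstract letters, so that the entries of the matrices need not be expanded.\<close>

lemma flip_matrix_identities:
 fixes na nb nc na' nb2 tbc tca tab V X :: "real^2^2"
 assumes r: "n *\<^sub>R (na' + na) = nb + nc" and l: "l1 \<noteq> 0" "l2 \<noteq> 0" "l3 \<noteq> 0"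
  and t: "tbc = (1 / (2 * l1)) *\<^sub>R (nb - nc)" "tca = (1 / (2 * l2)) *\<^sub>R (nc - na)" "tab = (1 / (2 * l3)) *\<^sub>R (na - nb)"
  and V: "l1 *\<^sub>R V = (- n / 2) *\<^sub>R (na' - na)" "l1 *\<^sub>R V2 = (- n / 2) *\<^sub>R (na2' - nc)"
  and r2: "n *\<^sub>R (na2' + nc) = nb2 + na"
 shows "l1 *\<^sub>R (- tbc + V) = ((n/2) *\<^sub>R na - (1/2) *\<^sub>R nb) - ((n/2) *\<^sub>R na' - (1/2) *\<^sub>R nc)"
  "l1 *\<^sub>R (V - V2) + (l2 * (1 + n)) *\<^sub>R tca = ((n/2) *\<^sub>R na - (1/2) *\<^sub>R nb) - ((n/2) *\<^sub>R nc - (1/2) *\<^sub>R nb2)"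
  "(l3 * (1 + n)) *\<^sub>R tab = ((n/2) *\<^sub>R na - (1/2) *\<^sub>R nb) - ((n/2) *\<^sub>R nb - (1/2) *\<^sub>R na)"
proof -
 have V': "l1 *\<^sub>R V = n *\<^sub>R na - (1/2) *\<^sub>R (nb + nc)" unfolding V(1) r[symmetric] by(simp add: vec_eq_iff algebra_simps)
 have V2': "l1 *\<^sub>R V2 = n *\<^sub>R nc - (1/2) *\<^sub>R (nb2 + na)" unfolding V(2) r2[symmetric] by(simp add: vec_eq_iff algebra_simps)
 have T: "l1 *\<^sub>R tbc = (1/2) *\<^sub>R (nb - nc)" "l2 *\<^sub>R tca = (1/2) *\<^sub>R (nc - na)" "l3 *\<^sub>R tab = (1/2) *\<^sub>R (na - nb)"
  unfolding t using l by simp_all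
 have na': "n *\<^sub>R na' = nb + nc - n *\<^sub>R na" unfolding r[symmetric] by(simp add: scaleR_add_right)
 have "l1 *\<^sub>R (- tbc + V) = l1 *\<^sub>R V - l1 *\<^sub>R tbc" by(simp add: scaleR_diff_right scaleR_add_right)
 also have "\<dots> = ((n/2) *\<^sub>R na - (1/2) *\<^sub>R nb) - ((1/2) *\<^sub>R (n *\<^sub>R na') - (1/2) *\<^sub>R nc)"
  unfolding V' T na' by(simp add: vec_eq_iff field_simps)
 finally show "l1 *\<^sub>R (- tbc + V) = ((n/2) *\<^sub>R na - (1/2) *\<^sub>R nb) - ((n/2) *\<^sub>R na' - (1/2) *\<^sub>R nc)" by simp
 have "l1 *\<^sub>R (V - V2) + (l2 * (1 + n)) *\<^sub>R tca = l1 *\<^sub>R V - l1 *\<^sub>R V2 + (1 + n) *\<^sub>R (l2 *\<^sub>R tca)"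
  by(simp add: scaleR_diff_right mult.commute)
 also have "\<dots> = ((n/2) *\<^sub>R na - (1/2) *\<^sub>R nb) - ((n/2) *\<^sub>R nc - (1/2) *\<^sub>R nb2)"
  unfolding V' V2' T by(simp add: vec_eq_iff field_simps)
 finally show "l1 *\<^sub>R (V - V2) + (l2 * (1 + n)) *\<^sub>R tca = ((n/2) *\<^sub>R na - (1/2) *\<^sub>R nb) - ((n/2) *\<^sub>R nc - (1/2) *\<^sub>R nb2)" .
 have "(l3 * (1 + n)) *\<^sub>R tab = (1 + n) *\<^sub>R (l3 *\<^sub>R tab)" by(simp add: mult.commute)
 also have "\<dots> = ((n/2) *\<^sub>R na - (1/2) *\<^sub>R nb) - ((n/2) *\<^sub>R nb - (1/2) *\<^sub>R na)"
  unfolding T by(simp add: vec_eq_iff field_simps)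
 finally show "(l3 * (1 + n)) *\<^sub>R tab = ((n/2) *\<^sub>R na - (1/2) *\<^sub>R nb) - ((n/2) *\<^sub>R nb - (1/2) *\<^sub>R na)" .
qed

text \<open>The difference of the two sides, corrected by the coboundary of \<open>- X\<close>, is a
  cocycle on \<Lambda> that vanishes at the three half turns of \<open>a b c\<close>, hence on
  \<Gamma>. The strip of the new diagonal is known only at the half turns of the flipped triangle
  and has to be carried over.\<close>

lemma flip_cocycle_relation:
 assumes g: "good a b c" and g': "good a b (- (Jm b c *v a))"
  and z: "Im z > 0" "K > 0" "\<And>p r. side p r z = K * (sg p r a + sg p r b + sg p r c)"
  and z': "Im z' > 0" "K' > 0" "\<And>p r. side p r z' = K' * (sg p r a + sg p r b + sg p r (- (Jm b c *v a)))"
 defines "n \<equiv> (dt b c)\<^sup>2 / ((dt c a)\<^sup>2 + (dt a b)\<^sup>2)"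
 shows "H1_eq \<Gamma> (\<lambda>M. dt b c *\<^sub>R strp b c z (moeb M z) + dt b c *\<^sub>R strp (- (Jm b c *v a)) a z' (moeb M z'))
  (\<lambda>M. (dt c a * (1 + n)) *\<^sub>R strp c a z (moeb M z) + (dt a b * (1 + n)) *\<^sub>R strp a b z (moeb M z))"
proof -
 let ?a = "- (Jm b c *v a)" and ?J1 = "Jm b c" and ?J2 = "Jm c a" and ?J3 = "Jm a b"
 let ?u = "\<lambda>M. strp b c z (moeb M z)" and ?v = "\<lambda>M. strp c a z (moeb M z)" and ?w = "\<lambda>M. strp a b z (moeb M z)"
  and ?u' = "\<lambda>M. strp ?a a z' (moeb M z')"
 have t: "tri a b c" and s: "simple_pair a b" "simple_pair b c" "simple_pair c a" using g by(simp_all add: good_def)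
 have tt: "tri a b ?a" and ss: "simple_pair ?a a" using g' by(simp_all add: good_def)
 note t' = triD[OF t] and tt' = triD[OF tt]
 have J1S: "?J1 \<in> SL2" and J2S: "?J2 \<in> SL2" and J3S: "?J3 \<in> SL2"
  by(rule Jm_SL2[OF t'(12)], rule Jm_SL2[OF t'(13)], rule Jm_SL2[OF t'(11)])
 have e: "?J1 *v b = c" "?J1 *v c = - b" "?J2 *v c = a" "?J2 *v a = - c" "?J3 *v a = b" "?J3 *v b = - a"
  using Jm_left[OF t'(12)] Jm_right[OF t'(12)] Jm_left[OF t'(13)] Jm_right[OF t'(13)] Jm_left[OF t'(11)] Jm_right[OF t'(11)] by auto
 have z2: "side p r z = K * (sg p r b + sg p r c + sg p r a)" for p r unfolding z(3) by(simp add: add_ac)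
 have z3: "side p r z = K * (sg p r c + sg p r a + sg p r b)" for p r unfolding z(3) by(simp add: add_ac)
 have z2': "side p r z' = K' * (sg p r b + sg p r ?a + sg p r a)" for p r unfolding z'(3) by(simp add: add_ac)
 note v1 = good_values[OF g z]
 note v2 = good_values[OF good_rot[OF g] z(1,2) z2]
 note v3 = good_values[OF good_rot[OF good_rot[OF g]] z(1,2) z3]
 note v' = good_values[OF good_rot[OF g'] z'(1,2) z2']
 note c1 = strp_cocycle[OF s(2) t'(2,5) z(1)]
 note c2 = strp_cocycle[OF s(3) t'(3,6) z(1)]
 note c3 = strp_cocycle[OF s(1) t'(1,4) z(1)]
 note c' = strp_cocycle[OF ss tt'(3,6) z'(1)]
 have JJ: "Jm ?a a = ?J1"
 proof (rule mat_basis_eq[OF tt'(13)])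
  have "?J1 *v (?J1 *v a) = - a" by(simp add: mat_vec_assoc Jm_square[OF t'(12)])
  thus "Jm ?a a *v ?a = ?J1 *v ?a" unfolding Jm_left[OF tt'(13)] by(simp only: mat_vec_uminus_right minus_minus)
  show "Jm ?a a *v a = ?J1 *v a" unfolding Jm_right[OF tt'(13)] by simp
 qed
 have Jb: "Jm b ?a = ?J1 ** ?J2 ** adj ?J1"
 proof -
  have "?J1 ** ?J2 ** adj ?J1 = Jm (- b) (?J1 *v a)" using Jm_conj[OF t'(13) J1S] unfolding e .
  moreover have "Jm (- b) ?a = - Jm b ?a" by(rule Jm_flips(2)[OF tt'(12)])
  moreover have "Jm (- b) (- ?a) = - Jm (- b) ?a" by(rule Jm_flips(3)) (use tt'(12) in \<open>simp add: dt_lin\<close>)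
  ultimately show ?thesis by simp
 qed
 define V where "V = - tv ?a a"
 have V1: "?u' ?J1 = V" using v'(1) unfolding JJ V_def .
 have V3: "?u' ?J3 = 0" using v'(2) .
 have V4: "?u' (?J1 ** ?J2 ** adj ?J1) = 0" using v'(3) unfolding Jb .
 have AV: "Ad ?J1 V = - V"
 proof -
  have "?J1 *v ?a = a" using Jm_left[OF tt'(13)] unfolding JJ .
  moreover have "?J1 *v a = - ?a" by simp
  ultimately have "Ad ?J1 (tv ?a a) = tv a (- ?a)" unfolding Ad_tv[OF J1S] by(simp only:)
  also have "\<dots> = - tv a ?a" by(rule tv_uminus(2))
  also have "tv a ?a = tv ?a a" by(rule tv_sym)
  finally show ?thesis unfolding V_def Ad_lin(4)[OF J1S] by simp
 qed
 \<comment> \<open>The cocycle \<open>?u'\<close> vanishes at the conjugate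
   \<open>?J1 ** ?J2 ** adj ?J1\<close>, a half turn of the flipped triangle; expanding by the
   cocycle rule and using \<open>AV\<close> isolates its value at \<open>?J2\<close>.\<close>
 have V2: "?u' ?J2 = V - Ad ?J2 V"
 proof -
  have L: "?J1 \<in> \<Lambda>" "?J2 \<in> \<Lambda>" "adj ?J1 \<in> \<Lambda>" "?J1 ** ?J2 \<in> \<Lambda>" using odd_ext[OF t'(5)] odd_ext[OF t'(6)] ext_adj ext_mult by auto
  have cc: "?u' (M ** N) = ?u' M + Ad M (?u' N)" if "M \<in> \<Lambda>" "N \<in> \<Lambda>" for M N
   using c'(1) that unfolding cocycle_def by blast
  have one: "mat 1 \<in> \<Lambda>" "- mat 1 \<in> \<Lambda>" by(simp_all add: ext_group_def)
  have "?u' (adj ?J1) = V" unfolding adj_Jm using cocycle_uminus[OF c'(1) L_sub one L(1)] V1 by simp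
  hence "0 = V + Ad ?J1 (?u' ?J2) + Ad (?J1 ** ?J2) V" using cc[OF L(4,3)] cc[OF L(1,2)] V4 V1 by simp
  hence "0 = V + Ad ?J1 (?u' ?J2 + Ad ?J2 V)" by(simp add: Ad_lin[OF J1S] Ad_mult[OF J1S J2S] add.assoc)
  hence "Ad ?J1 (?u' ?J2 + Ad ?J2 V) = - V" by(simp add: eq_neg_iff_add_eq_0 add.commute)
  hence "Ad ?J1 (Ad ?J1 (?u' ?J2 + Ad ?J2 V)) = V" using AV Ad_lin(4)[OF J1S, of V] by simp
  hence "?u' ?J2 + Ad ?J2 V = V"
   unfolding Ad_mult[OF J1S J1S, symmetric] Jm_square[OF t'(12)] by(simp add: Ad_uminus)
  thus ?thesis by(simp add: algebra_simps)
 qed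
 note nr = tri_nil_relation[OF t, folded n_def]
 \<comment> \<open>At \<open>?J3\<close>, which exchanges \<open>nil a\<close> and
   \<open>nil b\<close>, the coefficients must differ by \<open>(1 + n) / 2\<close>; at
   \<open>?J1\<close>, which sends \<open>nil b\<close> to \<open>nil c\<close>, the coefficient of
   \<open>nil b\<close> must be -1/2.\<close>
 define X where "X = (n/2) *\<^sub>R nil a - (1/2) *\<^sub>R nil b"
 let ?l1 = "dt b c" and ?l2 = "dt c a" and ?l3 = "dt a b"
 have dn: "dt (?J1 *v a) a \<noteq> 0" using nr(2) t'(12) by auto
 have lV: "?l1 *\<^sub>R V = (- n / 2) *\<^sub>R (nil (?J1 *v a) - nil a)"
 proof -
  have "?l1 = - (n * dt (?J1 *v a) a)" using nr(2) by simp
  hence "?l1 * (1 / (2 * dt (?J1 *v a) a)) = - n / 2" using dn by simp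
  thus ?thesis unfolding V_def tv_uminus(1) tv_def[of "?J1 *v a" a] by(simp add: scaleR_scaleR)
 qed
 have lV2: "?l1 *\<^sub>R Ad ?J2 V = (- n / 2) *\<^sub>R (nil (?J2 *v (?J1 *v a)) - nil c)"
  unfolding Ad_lin(1)[OF J2S, symmetric] lV unfolding Ad_lin(1)[OF J2S] Ad_lin(3)[OF J2S] Ad_nil[OF J2S] e by simp
 have r2: "n *\<^sub>R (nil (?J2 *v (?J1 *v a)) + nil c) = nil (?J2 *v b) + nil a"
 proof -
  have "Ad ?J2 (n *\<^sub>R (nil (?J1 *v a) + nil a)) = Ad ?J2 (nil b + nil c)" unfolding nr(1) ..
  thus ?thesis unfolding Ad_lin(1)[OF J2S] Ad_lin(2)[OF J2S] Ad_nil[OF J2S] e by simp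
 qed
 note id = flip_matrix_identities[OF nr(1) t'(12,13,11) tv_def[of b c] tv_def[of c a] tv_def[of a b] lV lV2 r2]
 have AX: "Ad ?J1 X = (n/2) *\<^sub>R nil (?J1 *v a) - (1/2) *\<^sub>R nil c" "Ad ?J2 X = (n/2) *\<^sub>R nil c - (1/2) *\<^sub>R nil (?J2 *v b)"
  "Ad ?J3 X = (n/2) *\<^sub>R nil b - (1/2) *\<^sub>R nil a"
  unfolding X_def by(simp_all add: Ad_lin[OF J1S] Ad_lin[OF J2S] Ad_lin[OF J3S] Ad_nil[OF J1S] Ad_nil[OF J2S] Ad_nil[OF J3S] e)
 have trX: "trace (- X) = 0" unfolding X_def by(simp add: trace_lin)
 let ?W = "\<lambda>M. (?l1 *\<^sub>R ?u M + ?l1 *\<^sub>R ?u' M) + (- (?l2 * (1 + n))) *\<^sub>R ?v M + (- (?l3 * (1 + n))) *\<^sub>R ?w M + (- X - Ad M (- X))"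
 have cW: "cocycle \<Lambda> ?W"
  by(intro cocycle_add[OF L_sub] cocycle_scale[OF L_sub] cocycle_coboundary[OF L_sub] c1(1) c2(1) c3(1) c'(1) trX)
 have i1: "?l1 *\<^sub>R (- tv b c) + ?l1 *\<^sub>R V = X - Ad ?J1 X"
  unfolding AX unfolding X_def scaleR_add_right[symmetric] by(rule id(1))
 have W1: "?W ?J1 = 0" unfolding V1 v1 v2 v3 Ad_lin(4)[OF J1S] i1 by simp
 have i2: "?l1 *\<^sub>R (V - Ad ?J2 V) + (?l2 * (1 + n)) *\<^sub>R tv c a = X - Ad ?J2 X"
  unfolding AX unfolding X_def by(rule id(2))
 have "(?l1 *\<^sub>R 0 + ?l1 *\<^sub>R (V - Ad ?J2 V)) + (- (?l2 * (1 + n))) *\<^sub>R (- tv c a) =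
   ?l1 *\<^sub>R (V - Ad ?J2 V) + (?l2 * (1 + n)) *\<^sub>R tv c a" by simp
 note i2' = this[unfolded i2]
 have W2: "?W ?J2 = 0" unfolding V2 v1 v2 v3 Ad_lin(4)[OF J2S] i2' by simp
 have i3: "(?l3 * (1 + n)) *\<^sub>R tv a b = X - Ad ?J3 X"
  unfolding AX unfolding X_def by(rule id(3))
 have "(- (?l3 * (1 + n))) *\<^sub>R (- tv a b) = (?l3 * (1 + n)) *\<^sub>R tv a b" by simp
 note i3' = this[unfolded i3]
 have W3: "?W ?J3 = 0" unfolding V3 v1 v2 v3 Ad_lin(4)[OF J3S] i3' by simp
 have "?W M = 0" if "M \<in> \<Gamma>" for M by(rule cocycle_zero_gens[OF cW t W3 W1 W2 that])
 hence "(?l1 *\<^sub>R ?u M + ?l1 *\<^sub>R ?u' M) - ((?l2 * (1 + n)) *\<^sub>R ?v M + (?l3 * (1 + n)) *\<^sub>R ?w M) = X - Ad M X" if "M \<in> \<Gamma>" for M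
  using that by(simp add: Ad_lin(4)[OF G_SL2[OF that]] algebra_simps)
 moreover have "trace X = 0" using trX by(simp add: trace_lin)
 ultimately show ?thesis unfolding H1_eq_def coboundary_def by blast
qed

lemma strip_map_edge:
 assumes p: "arc_pair \<alpha> u v" "p \<alpha> = q (mid u v)" and e: "is_edge b c u v" and d: "dt b c > 0" and z: "Im z > 0"
 shows "H1_eq \<Gamma> (strip_map \<Gamma> q p \<alpha>) (\<lambda>M. strp b c z (moeb M z))"
proof -
 have s: "simple_pair u v" and G: "geodesic_of q \<alpha> = q ` line u v" using p(1) by(simp_all add: arc_pair_def)
 interpret simple_geodesic A B q b c using is_edge_simple[OF e s] d by unfold_locales
 have "dt u v \<noteq> 0" using s by(simp add: simple_pair_def)
 thus ?thesis
  by(intro strip_map_strip z) (simp_all add: G p(2) is_edge_line[OF e] is_edge_mid[OF e])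
qed

text \<open>\<open>flip_configuration\<close> does not tell which of \<beta>1, \<beta>2 is the side
  \<open>c a\<close>. The local fact \<open>main\<close> treats one order and is used for both, with
  a swap of basis and summands in the second.\<close>

lemma flip_inequality:
 assumes w: "\<And>\<alpha>. \<alpha> \<in> arc_vertices q ==> arc_pair \<alpha> (P \<alpha>) (R \<alpha>)" "\<And>\<alpha>. p \<alpha> = q (mid (P \<alpha>) (R \<alpha>))"
  and \<sigma>: "{\<alpha>, \<beta>1, \<beta>2} \<in> arc_complex q" "card {\<alpha>, \<beta>1, \<beta>2} = 3"
  and \<tau>: "{\<alpha>', \<beta>1, \<beta>2} \<in> arc_complex q" "card {\<alpha>', \<beta>1, \<beta>2} = 3" and ne: "\<alpha> \<noteq> \<alpha>'"
 shows "\<exists>l m2 m3. l > 0 \<and> 2 * l < m2 + m3 \<and>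
   H1_basis \<Gamma> (strip_map \<Gamma> q p \<alpha>) (strip_map \<Gamma> q p \<beta>1) (strip_map \<Gamma> q p \<beta>2) \<and>
   H1_eq \<Gamma> (\<lambda>M. l *\<^sub>R strip_map \<Gamma> q p \<alpha> M + l *\<^sub>R strip_map \<Gamma> q p \<alpha>' M)
    (\<lambda>M. m2 *\<^sub>R strip_map \<Gamma> q p \<beta>1 M + m3 *\<^sub>R strip_map \<Gamma> q p \<beta>2 M)"
proof -
 have V: "\<alpha> \<in> arc_vertices q" "\<beta>1 \<in> arc_vertices q" "\<beta>2 \<in> arc_vertices q" "\<alpha>' \<in> arc_vertices q"
  using \<sigma>(1) \<tau>(1) by(auto simp: arc_complex_def)
 have distinct: "\<alpha> \<noteq> \<beta>1" "\<alpha> \<noteq> \<beta>2" "\<beta>1 \<noteq> \<beta>2" "\<alpha>' \<noteq> \<beta>1" "\<alpha>' \<noteq> \<beta>2"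
  using \<sigma>(2) \<tau>(2) by(auto simp: card_insert_if split: if_splits)
 note p0 = w(1)[OF V(1)] and p1 = w(1)[OF V(2)] and p2 = w(1)[OF V(3)] and p' = w(1)[OF V(4)]
 have s: "simple_pair (P x) (R x)" if "x \<in> arc_vertices q" for x using w(1)[OF that] by(simp add: arc_pair_def)
 have D: "q ` line (P x) (R x) \<noteq> q ` line (P y) (R y)" if "x \<in> arc_vertices q" "y \<in> arc_vertices q" "x \<noteq> y" for x y
  using same_geodesic_eq[OF that(1) w(1)[OF that(1)] that(2) w(1)[OF that(2)]] that(3) by blast
 obtain a b c where t: "tri a b c" and e0: "is_edge b c (P \<alpha>) (R \<alpha>)" and e': "is_edge a (Jm b c *v a) (P \<alpha>') (R \<alpha>')"
  and e12: "is_edge c a (P \<beta>1) (R \<beta>1) \<and> is_edge a b (P \<beta>2) (R \<beta>2) \<or> is_edge c a (P \<beta>2) (R \<beta>2) \<and> is_edge a b (P \<beta>1) (R \<beta>1)"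
  and u: "unlinked_pairs (P \<alpha>) (R \<alpha>) (P \<beta>1) (R \<beta>1)" "unlinked_pairs (P \<alpha>) (R \<alpha>) (P \<beta>2) (R \<beta>2)"
   "unlinked_pairs (P \<beta>1) (R \<beta>1) (P \<beta>2) (R \<beta>2)" "unlinked_pairs (P \<alpha>') (R \<alpha>') (P \<beta>1) (R \<beta>1)"
   "unlinked_pairs (P \<alpha>') (R \<alpha>') (P \<beta>2) (R \<beta>2)"
  using flip_configuration[OF \<sigma> \<tau> ne p0 p1 p2 p'] by(elim exE conjE) (rule that; assumption)
 note t' = triD[OF t]
 let ?a = "- (Jm b c *v a)" and ?f = "strip_map \<Gamma> q p" and ?n = "(dt b c)\<^sup>2 / ((dt c a)\<^sup>2 + (dt a b)\<^sup>2)"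
 have tt: "tri a b ?a" by(rule tri_flip[OF t])
 have ea: "is_edge ?a a (P \<alpha>') (R \<alpha>')" using e' by(simp add: is_edge_swap)
 have main: "H1_basis \<Gamma> (?f \<alpha>) (?f \<beta>) (?f \<beta>') \<and>
   H1_eq \<Gamma> (\<lambda>M. dt b c *\<^sub>R ?f \<alpha> M + dt b c *\<^sub>R ?f \<alpha>' M)
    (\<lambda>M. (dt c a * (1 + ?n)) *\<^sub>R ?f \<beta> M + (dt a b * (1 + ?n)) *\<^sub>R ?f \<beta>' M)"
  if B: "\<beta> \<in> arc_vertices q" "\<beta>' \<in> arc_vertices q" "\<alpha> \<noteq> \<beta>" "\<alpha> \<noteq> \<beta>'" "\<beta> \<noteq> \<beta>'" "\<alpha>' \<noteq> \<beta>" "\<alpha>' \<noteq> \<beta>'"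
   and E: "is_edge c a (P \<beta>) (R \<beta>)" "is_edge a b (P \<beta>') (R \<beta>')"
   and U: "unlinked_pairs (P \<alpha>) (R \<alpha>) (P \<beta>) (R \<beta>)" "unlinked_pairs (P \<alpha>) (R \<alpha>) (P \<beta>') (R \<beta>')"
    "unlinked_pairs (P \<beta>) (R \<beta>) (P \<beta>') (R \<beta>')" "unlinked_pairs (P \<alpha>') (R \<alpha>') (P \<beta>) (R \<beta>)"
    "unlinked_pairs (P \<alpha>') (R \<alpha>') (P \<beta>') (R \<beta>')" for \<beta> \<beta>'
 proof -
  have g: "good a b c"
   by(rule goodI[OF t e0 E s[OF V(1)] s[OF B(1)] s[OF B(2)] U(1,3) unlinked_pairs_sym[OF U(2)]
    D[OF V(1) B(1,3)] D[OF B(1,2,5)] D[OF B(2) V(1) B(4)[symmetric]]])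
  have eb: "is_edge b ?a (P \<beta>) (R \<beta>)"
  proof -
   have "Jm b c *v c = - b" by(rule Jm_right[OF t'(12)])
   hence "is_edge (- b) (Jm b c *v a) (P \<beta>) (R \<beta>)"
    using is_edge_ext[OF odd_ext[OF t'(5)] t'(6,13), of "P \<beta>" "R \<beta>"] E(1) by simp
   thus ?thesis by simp
  qed
  have g': "good a b ?a"
   by(rule goodI[OF tt eb ea E(2) s[OF B(1)] s[OF V(4)] s[OF B(2)] unlinked_pairs_sym[OF U(4)] U(5) unlinked_pairs_sym[OF U(3)]
    D[OF B(1) V(4) B(6)[symmetric]] D[OF V(4) B(2,7)] D[OF B(2,1) B(5)[symmetric]]])
  obtain z K where z: "Im z > 0" "K > 0" "\<And>p r. side p r z = K * (sg p r a + sg p r b + sg p r c)"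
   using base_point[OF t'(11), of c] by blast
  obtain z' K' where z': "Im z' > 0" "K' > 0" "\<And>p r. side p r z' = K' * (sg p r a + sg p r b + sg p r ?a)"
   using base_point[OF t'(11), of ?a] by blast
  note f0 = strip_map_edge[where p = p, OF p0 w(2) e0 t'(2) z(1)]
  note f1 = strip_map_edge[where p = p, OF w(1)[OF B(1)] w(2) E(1) t'(3) z(1)]
  note f2 = strip_map_edge[where p = p, OF w(1)[OF B(2)] w(2) E(2) t'(1) z(1)]
  note f' = strip_map_edge[where p = p, OF p' w(2) ea triD(3)[OF tt] z'(1)]
  show ?thesis
  proof
   show "H1_basis \<Gamma> (?f \<alpha>) (?f \<beta>) (?f \<beta>')"
    by(rule independent_H1_basis[OF good_independent[OF g z] f0 f1 f2])
   show "H1_eq \<Gamma> (\<lambda>M. dt b c *\<^sub>R ?f \<alpha> M + dt b c *\<^sub>R ?f \<alpha>' M)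
    (\<lambda>M. (dt c a * (1 + ?n)) *\<^sub>R ?f \<beta> M + (dt a b * (1 + ?n)) *\<^sub>R ?f \<beta>' M)"
    by(rule H1_eq_trans[OF G_sub H1_eq_lin[OF G_sub f0 f']
     H1_eq_trans[OF G_sub flip_cocycle_relation[OF g g' z z'] H1_eq_sym[OF G_sub H1_eq_lin[OF G_sub f1 f2]]]])
  qed
 qed
 have less: "2 * dt b c < dt c a * (1 + ?n) + dt a b * (1 + ?n)"
  using flip_length_inequality[OF t'(2,3,1)] by(simp only: distrib_right)
 from e12 show ?thesis
 proof
  assume "is_edge c a (P \<beta>1) (R \<beta>1) \<and> is_edge a b (P \<beta>2) (R \<beta>2)"
  hence "H1_basis \<Gamma> (?f \<alpha>) (?f \<beta>1) (?f \<beta>2) \<and>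
   H1_eq \<Gamma> (\<lambda>M. dt b c *\<^sub>R ?f \<alpha> M + dt b c *\<^sub>R ?f \<alpha>' M)
    (\<lambda>M. (dt c a * (1 + ?n)) *\<^sub>R ?f \<beta>1 M + (dt a b * (1 + ?n)) *\<^sub>R ?f \<beta>2 M)"
   by(elim conjE) (rule main[OF V(2,3) distinct(1,2,3,4,5) _ _ u])
  thus ?thesis
   by(intro exI[of _ "dt b c"] exI[of _ "dt c a * (1 + ?n)"] exI[of _ "dt a b * (1 + ?n)"] conjI[OF t'(2)] conjI[OF less])
 next
  assume "is_edge c a (P \<beta>2) (R \<beta>2) \<and> is_edge a b (P \<beta>1) (R \<beta>1)"
  hence m: "H1_basis \<Gamma> (?f \<alpha>) (?f \<beta>2) (?f \<beta>1) \<and>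
   H1_eq \<Gamma> (\<lambda>M. dt b c *\<^sub>R ?f \<alpha> M + dt b c *\<^sub>R ?f \<alpha>' M)
    (\<lambda>M. (dt c a * (1 + ?n)) *\<^sub>R ?f \<beta>2 M + (dt a b * (1 + ?n)) *\<^sub>R ?f \<beta>1 M)"
   by(elim conjE) (rule main[OF V(3,2) distinct(2,1) distinct(3)[symmetric] distinct(5,4) _ _ u(2,1) unlinked_pairs_sym[OF u(3)] u(5,4)])
  have "H1_eq \<Gamma> (\<lambda>M. dt b c *\<^sub>R ?f \<alpha> M + dt b c *\<^sub>R ?f \<alpha>' M)
    (\<lambda>M. (dt a b * (1 + ?n)) *\<^sub>R ?f \<beta>1 M + (dt c a * (1 + ?n)) *\<^sub>R ?f \<beta>2 M)"
   using m by(simp only: add.commute[of "(dt a b * (1 + ?n)) *\<^sub>R _"])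
  moreover have "2 * dt b c < dt a b * (1 + ?n) + dt c a * (1 + ?n)" using less by linarith
  ultimately show ?thesis
   by(intro exI[of _ "dt b c"] exI[of _ "dt a b * (1 + ?n)"] exI[of _ "dt c a * (1 + ?n)"] conjI t'(2)
    H1_basis_swap[OF m[THEN conjunct1]])
 qed
qed

end

section \<open>Choice of the waists and conclusion\<close>

theorem theorem4p2:
  fixes A B :: "real^2^2" and q :: "complex \<Rightarrow> complex \<times> complex"
  assumes "one_cusped_torus A B q"
  shows "\<exists>p. waist_choice q p \<and>
    (\<forall>\<alpha> \<alpha>' \<beta>1 \<beta>2.
       {\<alpha>, \<beta>1, \<beta>2} \<in> arc_complex q \<and> card {\<alpha>, \<beta>1, \<beta>2} = 3 \<and>
       {\<alpha>', \<beta>1, \<beta>2} \<in> arc_complex q \<and> card {\<alpha>', \<beta>1, \<beta>2} = 3 \<and> \<alpha> \<noteq> \<alpha>' \<longrightarrow>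
       (let \<Gamma> = holonomy_group A B; f = strip_map \<Gamma> q p;
            R = flip_relation \<Gamma> (f \<alpha>) (f \<alpha>') (f \<beta>1) (f \<beta>2)
        in H1_basis \<Gamma> (f \<alpha>) (f \<beta>1) (f \<beta>2) \<and>
           (\<exists>a a' b1 b2. R a a' b1 b2) \<and>
           (\<forall>a a' b1 b2 c c' d1 d2. R a a' b1 b2 \<and> R c c' d1 d2 \<longrightarrow>
              (\<exists>k>0. c = k * a \<and> c' = k * a' \<and> d1 = k * b1 \<and> d2 = k * b2)) \<and>
           (\<forall>a a' b1 b2. R a a' b1 b2 \<longrightarrow> a + a' < b1 + b2)))"
proof -
 interpret cusped_torus A B q using assms by unfold_locales
 define S where "S = (\<lambda>\<alpha>. SOME w. arc_pair \<alpha> (fst w) (snd w))"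
 \<comment> \<open>The midpoints of all translates of the pair project to one point, so the ends
   chosen by \<open>S\<close> give the equidistant waist of the arc.\<close>
 define p where "p = (\<lambda>\<alpha>. q (mid (fst (S \<alpha>)) (snd (S \<alpha>))))"
 have S: "arc_pair \<alpha> (fst (S \<alpha>)) (snd (S \<alpha>))" if a: "\<alpha> \<in> arc_vertices q" for \<alpha>
 proof -
  obtain u v where "arc_pair \<alpha> u v" by(rule arc_vertex_pair[OF a])
  hence "arc_pair \<alpha> (fst (u, v)) (snd (u, v))" by simp
  thus ?thesis unfolding S_def by(rule someI)
 qed
 have w: "waist_choice q p" unfolding waist_choice_def
 proof
  fix \<alpha> assume "\<alpha> \<in> arc_vertices q"
  from S[OF this] have "geodesic_of q \<alpha> = q ` line (fst (S \<alpha>)) (snd (S \<alpha>))" "dt (fst (S \<alpha>)) (snd (S \<alpha>)) \<noteq> 0"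
   by(simp_all add: arc_pair_def simple_pair_def)
  thus "p \<alpha> \<in> geodesic_of q \<alpha>" unfolding p_def using mid_line by simp
 qed
 have main: "H1_basis \<Gamma> (strip_map \<Gamma> q p \<alpha>) (strip_map \<Gamma> q p \<beta>1) (strip_map \<Gamma> q p \<beta>2) \<and>
  (\<exists>a a' b1 b2. flip_relation \<Gamma> (strip_map \<Gamma> q p \<alpha>) (strip_map \<Gamma> q p \<alpha>') (strip_map \<Gamma> q p \<beta>1) (strip_map \<Gamma> q p \<beta>2) a a' b1 b2) \<and>
  (\<forall>a a' b1 b2 c c' d1 d2.
    flip_relation \<Gamma> (strip_map \<Gamma> q p \<alpha>) (strip_map \<Gamma> q p \<alpha>') (strip_map \<Gamma> q p \<beta>1) (strip_map \<Gamma> q p \<beta>2) a a' b1 b2 \<and>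
    flip_relation \<Gamma> (strip_map \<Gamma> q p \<alpha>) (strip_map \<Gamma> q p \<alpha>') (strip_map \<Gamma> q p \<beta>1) (strip_map \<Gamma> q p \<beta>2) c c' d1 d2 -->
    (\<exists>k>0. c = k * a \<and> c' = k * a' \<and> d1 = k * b1 \<and> d2 = k * b2)) \<and>
  (\<forall>a a' b1 b2. flip_relation \<Gamma> (strip_map \<Gamma> q p \<alpha>) (strip_map \<Gamma> q p \<alpha>') (strip_map \<Gamma> q p \<beta>1) (strip_map \<Gamma> q p \<beta>2) a a' b1 b2 -->
    a + a' < b1 + b2)"
  if h: "{\<alpha>, \<beta>1, \<beta>2} \<in> arc_complex q" "card {\<alpha>, \<beta>1, \<beta>2} = 3"
   "{\<alpha>', \<beta>1, \<beta>2} \<in> arc_complex q" "card {\<alpha>', \<beta>1, \<beta>2} = 3" "\<alpha> \<noteq> \<alpha>'" for \<alpha> \<alpha>' \<beta>1 \<beta>2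
 proof -
  obtain l m2 m3 where l: "l > 0" "2 * l < m2 + m3"
   and b: "H1_basis \<Gamma> (strip_map \<Gamma> q p \<alpha>) (strip_map \<Gamma> q p \<beta>1) (strip_map \<Gamma> q p \<beta>2)"
   and r: "H1_eq \<Gamma> (\<lambda>M. l *\<^sub>R strip_map \<Gamma> q p \<alpha> M + l *\<^sub>R strip_map \<Gamma> q p \<alpha>' M)
    (\<lambda>M. m2 *\<^sub>R strip_map \<Gamma> q p \<beta>1 M + m3 *\<^sub>R strip_map \<Gamma> q p \<beta>2 M)"
  proof -
   have e: "p \<alpha> = q (mid (fst (S \<alpha>)) (snd (S \<alpha>)))" for \<alpha> by(simp add: p_def)
   show thesis
    by(rule flip_inequality[where P = "\<lambda>\<alpha>. fst (S \<alpha>)" and R = "\<lambda>\<alpha>. snd (S \<alpha>)", OF S e h, THEN exE], assumption)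
     (elim exE conjE, rule that; assumption)
  qed
  note F = flip_coefficients[OF G_sub b r l]
  show ?thesis by(intro conjI b F)
 qed
 show ?thesis unfolding Let_def
  by(rule exI[of _ p], rule conjI[OF w], intro allI impI, elim conjE, rule main; assumption)
qed

end
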